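(* Consider the equation $$\dot x=Ax+f(t,x)+\varepsilon g(t,x,\varepsilon),\qquad( * )$$ and assume that one of the following two sets of hypotheses is satisfied. Analytic compact case: $A$ is a generator of an analytic compact semigroup $e^{At}$ in $E$. The operators $f,g$ are subordinated to some $A^{-\alpha}$, $0<\alpha<1$ (so $f(t,A^{-\alpha}\xi)$ and $g(t,A^{-\alpha}\xi,\varepsilon)$ are considered as functions of $\xi\in E$), the operator $f(\cdot,A^{-\alpha}\cdot)$ is differentiable in the second variable, and the operators $f'_{(2)}(\cdot,A^{-\alpha}\cdot)$ (derivative in the second variable) and $g(\cdot,A^{-\alpha}\cdot,\cdot)$ are continuous and satisfy a Lipschitz condition in the second variable uniformly with respect to the other variables. Contractive case: $A$ is a generator of a $C_0$-semigroup $e^{At}$ which is contractive, namely $\|e^{At}\|\le e^{-\gamma t}$ with $\gamma>0$. The operators $f$ and $g$ are continuous and verify $\chi(f(t,\Omega))\le k'\chi(\Omega)$, $\chi(g(t,\Omega,\varepsilon))\le k'\chi(\Omega)$ for bounded $\Omega\subset E$, where $k'\ge0$, $q=k'/\gamma<1$, and $\chi$ is the Hausdorff measure of noncompactness. The operator $f$ is differentiable in the second variable and the operators $f'_{(2)}$ and $g$ are continuous and satisfy a Lipschitz condition in the second variable uniformly with respect to the other variables. Let $\xi_0\in E$ and assume that the solution $x(\cdot,\xi_0,0)$ of $( * )$ with $\varepsilon=0$ satisfying $x(0)=\xi_0$ is defined on $[0,T]$. Assume that there exists a function $S\in C^1(V,E)$ defined on some open neighborhood $V\subset\mathbb{R}^k$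 of a point $h_0$ such that $S(h_0)=\xi_0$ and $\mathcal{P}_0(\xi)=\xi$ for any $\xi\in\bigcup_{h\in V}\{S(h)\}$, and that $\dim S'(h_0)\mathbb{R}^k=k$. Let $E_{1,h}=S'(h)\mathbb{R}^k$, let $E_{2,h}$ be any subspace of $E$ such that $E=E_{1,h}\oplus E_{2,h}$, and assume that both the projectors $\pi_{1,h}$ of $E$ onto $E_{1,h}$ along $E_{2,h}$ and $\pi_{2,h}$ of $E$ onto $E_{2,h}$ along $E_{1,h}$ are continuous in $h\in V$, and that $\pi_{2,h_0}((\mathcal{P}_0)'(\xi_0)-I)\pi_{2,h_0}$ is invertible on $E_{2,h_0}$. Let $M$ be the bifurcation function defined in the context, and assume that $h_0$ is an isolated zero of $M$ with $\mathrm{ind}(h_0,M)\neq0$. Then, for any $\varepsilon>0$ sufficiently small, $( * )$ has a $T$-periodic solution $x_\varepsilon\in C^0([0,T],E)$, and $$x_\varepsilon(0)\to\xi_0\quad\text{as }\varepsilon\to0.$$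
   Context: Setting: $E$ is a Banach space, $T>0$, $A:D(A)\to E$, $D(A)\subset E$, is the infinitesimal generator of a semigroup $e^{At}$ of linear operators in $E$, and $f\in C^1(\mathbb{R}\times E,E)$, $g\in C^0(\mathbb{R}\times E\times[0,1],E)$ are $T$-periodic in the first variable. $I$ is the identity operator. The equation under study is $\dot x=Ax+f(t,x)+\varepsilon g(t,x,\varepsilon)$, denoted $( * )$. Two alternative sets of hypotheses, called the analytic compact case and the contractive case, are written out in the claim. In the analytic compact case, $A^{\alpha}$, $A^{-\alpha}$ denote the fractional powers in the usual sense of analytic semigroup theory (i.e. the fractional powers of $-A$), which are assumed to be defined, $A^{-\alpha}$ being bounded. In the contractive case, $\chi(\Omega)=\inf\{r>0:\text{there exist finitely many } y_1,\dots,y_m \text{ such that }\Omega\subset\bigcup_{i=1}^mB(y_i,r)\}$ is the Hausdorff measure of noncompactness of a bounded set $\Omega\subset E$, where $B(y,r)$ is the ball in $E$ centered at $y$ with radius $r$. Solutions and Poincaré map: put $\alpha=0$ (so $A^{\pm\alpha}=I$) in the contractive case. Solutions of $( * )$ are understood as continuous solutions of $$x(t)=e^{At}\xi+\int_0^tA^\alpha e^{A(t-s)}\left[f(s,A^{-\alpha}x(s))+\varepsilon g(s,A^{-\alpha}x(s),\varepsilon)\right]ds,\qquad \xi=x(0).$$ For $\xi\in E$, $\varepsilon\in[0,1]$ this has a unique solution, denoted $x(t,\xi,\varepsilon)$, on some interval $[0,d]$; when it is defined on $[0,T]$ the Poincaré map is $\mathcal{P}_\varepsilon(\xi)=x(T,\xi,\varepsilon)$.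 A solution on $[0,T]$ is $T$-periodic if $x(0)=x(T)$. If $\mathcal{P}_0$ is defined at $\xi_0$, then it is defined and differentiable near $\xi_0$. Bifurcation function: for $\xi$ near $\xi_0$ let $\eta(\xi)=y(T)$, where $y$ is the solution of $$\dot y=Ay+f'_x(t,x(t,\xi,0))y+g(t,x(t,\xi,0),0),\qquad y(0)=0,$$ understood as $y(t)=\int_0^tA^\alpha e^{A(t-s)}\left[D_2\hat f(s,x(s,\xi,0))y(s)+g(s,A^{-\alpha}x(s,\xi,0),0)\right]ds$, where $\hat f(s,z)=f(s,A^{-\alpha}z)$ and $D_2$ is the derivative in the second variable. For $h$ in a small neighborhood of $h_0$ define $M(h)\in\mathbb{R}^k$ by $$M(h)=\left(S'(h)\right)^{-1}\pi_{1,h}\left[\eta(S(h))-\left((\mathcal{P}_0)'(S(h))-I\right)\left(\pi_{2,h}((\mathcal{P}_0)'(S(h))-I)\pi_{2,h}\right)^{-1}\pi_{2,h}\eta(S(h))\right],$$ where $(S'(h))^{-1}$ is the inverse of $S'(h):\mathbb{R}^k\to E_{1,h}$ and $\left(\pi_{2,h}((\mathcal{P}_0)'(S(h))-I)\pi_{2,h}\right)^{-1}$ is the inverse on $E_{2,h}$; both exist for $h$ close to $h_0$. For an isolated zero $h_0$ of $M$, $\mathrm{ind}(h_0,M)$ is the topological index of $h_0$, i.e. the Brouwer degree (with respect to $0$) of $M$ on a ball centered at $h_0$ so small that $h_0$ is the only zero of $M$ in it. *)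

theory Defs
  imports "HOL-Analysis.Analysis" "HOL-Homology.Homology"
begin

definition c0_semigroup :: "(real \<Rightarrow> 'a::real_normed_vector \<Rightarrow>\<^sub>L 'a) \<Rightarrow> bool" where
  "c0_semigroup U \<longleftrightarrow>
     U 0 = id_blinfun \<and>
     (\<forall>s\<ge>0. \<forall>t\<ge>0. U (s + t) = U s o\<^sub>L U t) \<and>
     (\<forall>x. ((\<lambda>t. U t x) \<longlongrightarrow> x) (at_right 0))"

definition infinitesimal_generator ::
    "(real \<Rightarrow> 'a::real_normed_vector \<Rightarrow>\<^sub>L 'a) \<Rightarrow> 'a set \<Rightarrow> ('a \<Rightarrow> 'a) \<Rightarrow> bool" where
  "infinitesimal_generator U D A \<longleftrightarrow>
     D = {x. \<exists>l. ((\<lambda>h. (U h x - x) /\<^sub>R h) \<longlongrightarrow> l) (at_right 0)} \<and>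
     (\<forall>x\<in>D. ((\<lambda>h. (U h x - x) /\<^sub>R h) \<longlongrightarrow> A x) (at_right 0))"

definition compact_semigroup :: "(real \<Rightarrow> 'a::real_normed_vector \<Rightarrow>\<^sub>L 'a) \<Rightarrow> bool" where
  "compact_semigroup U \<longleftrightarrow> (\<forall>t>0. \<forall>B. bounded B \<longrightarrow> compact (closure (blinfun_apply (U t) ` B)))"

text \<open>
  The Banach spaces here are real. An analytic semigroup is therefore one whose complexification
  extends holomorphically to a sector around the positive half-line. The complexification of
  the space is the product with itself, \<open>(x, y)\<close> standing for \<open>x + i y\<close>.
\<close>

definition complex_scale :: "complex \<Rightarrow> 'a::real_vector \<times> 'a \<Rightarrow> 'a \<times> 'a" where
  "complex_scale c v =
     (Re c *\<^sub>R fst v - Im c *\<^sub>R snd v, Im c *\<^sub>R fst v + Re c *\<^sub>R snd v)"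

definition sector :: "real \<Rightarrow> complex set" where
  "sector \<theta> = {z. z \<noteq> 0 \<and> \<bar>Arg z\<bar> < \<theta>}"

definition holomorphic_semigroup_on_sector ::
    "real \<Rightarrow> (complex \<Rightarrow> ('a::real_normed_vector \<times> 'a) \<Rightarrow>\<^sub>L ('a \<times> 'a)) \<Rightarrow> bool" where
  "holomorphic_semigroup_on_sector \<theta> W \<longleftrightarrow>
     (\<forall>z\<in>sector \<theta>. \<forall>c v. W z (complex_scale c v) = complex_scale c (W z v)) \<and>
     (\<forall>z\<in>sector \<theta>. \<forall>w\<in>sector \<theta>. W (z + w) = W z o\<^sub>L W w) \<and>
     (\<forall>v. \<forall>z\<in>sector \<theta>. \<exists>d.
        ((\<lambda>w. W w v) has_derivative (\<lambda>c. complex_scale c d)) (at z)) \<and>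
     (\<forall>v. ((\<lambda>z. W z v) \<longlongrightarrow> v) (at 0 within sector \<theta>))"

definition analytic_semigroup :: "(real \<Rightarrow> 'a::real_normed_vector \<Rightarrow>\<^sub>L 'a) \<Rightarrow> bool" where
  "analytic_semigroup U \<longleftrightarrow>
     (\<exists>\<theta> W. 0 < \<theta> \<and> \<theta> \<le> pi / 2 \<and> holomorphic_semigroup_on_sector \<theta> W \<and>
        (\<forall>t>0. \<forall>x y. blinfun_apply (W (complex_of_real t)) (x, y) = (U t x, U t y)))"

text \<open>
  \<open>neg_frac_power U \<alpha>\<close> is the power of exponent \<open>- \<alpha>\<close> of minus the generator of \<open>U\<close>, given by
  the Gamma-integral of the semigroup, and \<open>frac_power U \<alpha>\<close> is its inverse. The latter is a
  total function, meaningful only on its domain, the range of \<open>neg_frac_power U \<alpha>\<close>. Both are the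
  identity for \<open>\<alpha> = 0\<close>. Integrals are Henstock-Kurzweil integrals, which
  include improper ones and need no separability of the space.
\<close>

definition neg_frac_power :: "(real \<Rightarrow> 'a::banach \<Rightarrow>\<^sub>L 'a) \<Rightarrow> real \<Rightarrow> 'a \<Rightarrow> 'a" where
  "neg_frac_power U \<alpha> x =
     (if \<alpha> = 0 then x
      else (1 / Gamma \<alpha>) *\<^sub>R integral {0..} (\<lambda>t. t powr (\<alpha> - 1) *\<^sub>R U t x))"

definition frac_power :: "(real \<Rightarrow> 'a::banach \<Rightarrow>\<^sub>L 'a) \<Rightarrow> real \<Rightarrow> 'a \<Rightarrow> 'a" where
  "frac_power U \<alpha> = inv_into UNIV (neg_frac_power U \<alpha>)"

definition frac_powers_defined :: "(real \<Rightarrow> 'a::banach \<Rightarrow>\<^sub>L 'a) \<Rightarrow> real \<Rightarrow> bool" where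
  "frac_powers_defined U \<alpha> \<longleftrightarrow>
     (\<forall>x. (\<lambda>t. t powr (\<alpha> - 1) *\<^sub>R U t x) integrable_on {0..} \<and>
          (\<lambda>t. norm (t powr (\<alpha> - 1) *\<^sub>R U t x)) integrable_on {0..}) \<and>
     inj (neg_frac_power U \<alpha>)"

text \<open>Meaningful for bounded sets only, where the infimum is over a nonempty set.\<close>

definition hausdorff_mnc :: "'a::metric_space set \<Rightarrow> real" where
  "hausdorff_mnc \<Omega> = Inf {r. 0 < r \<and> (\<exists>Y. finite Y \<and> \<Omega> \<subseteq> (\<Union>y\<in>Y. ball y r))}"

definition C1_on ::
    "('a::real_normed_vector \<Rightarrow> 'b::real_normed_vector) \<Rightarrow> 'a set \<Rightarrow> bool" where
  "C1_on F V \<longleftrightarrow>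
     (\<exists>F' :: 'a \<Rightarrow> 'a \<Rightarrow>\<^sub>L 'b. continuous_on V F' \<and> (\<forall>x\<in>V. (F has_derivative F' x) (at x)))"

definition D2 ::
    "('c \<Rightarrow> 'a::real_normed_vector \<Rightarrow> 'b::real_normed_vector) \<Rightarrow> 'c \<Rightarrow> 'a \<Rightarrow> 'a \<Rightarrow>\<^sub>L 'b" where
  "D2 F t z = Blinfun (frechet_derivative (F t) (at z))"

definition regular_pair ::
    "(real \<Rightarrow> 'a::real_normed_vector \<Rightarrow> 'a) \<Rightarrow> (real \<Rightarrow> 'a \<Rightarrow> real \<Rightarrow> 'a) \<Rightarrow> bool" where
  "regular_pair F G \<longleftrightarrow>
     (\<forall>t z. F t differentiable at z) \<and>
     continuous_on UNIV (\<lambda>(t, z). D2 F t z) \<and>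
     (\<exists>L. \<forall>t. L-lipschitz_on UNIV (D2 F t)) \<and>
     continuous_on (UNIV \<times> UNIV \<times> {0..1}) (\<lambda>(t, z, \<epsilon>). G t z \<epsilon>) \<and>
     (\<exists>L. \<forall>t. \<forall>\<epsilon>\<in>{0..1}. L-lipschitz_on UNIV (\<lambda>z. G t z \<epsilon>))"

definition analytic_compact_case ::
    "(real \<Rightarrow> 'a::banach \<Rightarrow>\<^sub>L 'a) \<Rightarrow> real \<Rightarrow> (real \<Rightarrow> 'a \<Rightarrow> 'a) \<Rightarrow> (real \<Rightarrow> 'a \<Rightarrow> real \<Rightarrow> 'a) \<Rightarrow> bool"
  where
  "analytic_compact_case U \<alpha> f g \<longleftrightarrow>
     c0_semigroup U \<and> analytic_semigroup U \<and> compact_semigroup U \<and>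
     0 < \<alpha> \<and> \<alpha> < 1 \<and>
     frac_powers_defined U \<alpha> \<and> bounded_linear (neg_frac_power U \<alpha>) \<and>
     regular_pair (\<lambda>t z. f t (neg_frac_power U \<alpha> z)) (\<lambda>t z \<epsilon>. g t (neg_frac_power U \<alpha> z) \<epsilon>)"

definition contractive_case ::
    "(real \<Rightarrow> 'a::banach \<Rightarrow>\<^sub>L 'a) \<Rightarrow> real \<Rightarrow> (real \<Rightarrow> 'a \<Rightarrow> 'a) \<Rightarrow> (real \<Rightarrow> 'a \<Rightarrow> real \<Rightarrow> 'a) \<Rightarrow> bool"
  where
  "contractive_case U \<alpha> f g \<longleftrightarrow>
     \<alpha> = 0 \<and> c0_semigroup U \<and>
     (\<exists>\<gamma>>0. \<exists>k'\<ge>0. k' / \<gamma> < 1 \<and>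
        (\<forall>t\<ge>0. norm (U t) \<le> exp (- \<gamma> * t)) \<and>
        (\<forall>t \<Omega>. bounded \<Omega> \<longrightarrow> hausdorff_mnc (f t ` \<Omega>) \<le> k' * hausdorff_mnc \<Omega>) \<and>
        (\<forall>t. \<forall>\<epsilon>\<in>{0..1}. \<forall>\<Omega>. bounded \<Omega> \<longrightarrow>
           hausdorff_mnc ((\<lambda>x. g t x \<epsilon>) ` \<Omega>) \<le> k' * hausdorff_mnc \<Omega>)) \<and>
     continuous_on UNIV (\<lambda>(t, x). f t x) \<and>
     regular_pair f g"

definition mild_solution ::
    "(real \<Rightarrow> 'a::banach \<Rightarrow>\<^sub>L 'a) \<Rightarrow> real \<Rightarrow> (real \<Rightarrow> 'a \<Rightarrow> 'a) \<Rightarrow> (real \<Rightarrow> 'a \<Rightarrow> real \<Rightarrow> 'a) \<Rightarrow>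
     real \<Rightarrow> 'a \<Rightarrow> real \<Rightarrow> (real \<Rightarrow> 'a) \<Rightarrow> bool" where
  "mild_solution U \<alpha> f g \<epsilon> \<xi> d x \<longleftrightarrow>
     continuous_on {0..d} x \<and>
     (\<forall>t\<in>{0..d}.
        ((\<lambda>s. frac_power U \<alpha> (U (t - s)
                (f s (neg_frac_power U \<alpha> (x s)) + \<epsilon> *\<^sub>R g s (neg_frac_power U \<alpha> (x s)) \<epsilon>)))
          has_integral (x t - U t \<xi>)) {0..t})"

text \<open>
  A solution on an interval restricts to a solution on every shorter one, and solutions are unique,
  so the value at \<open>t\<close> can be read off the solution on \<open>{0..t}\<close>. It is meaningful only if there is one.
\<close>

definition sol ::
    "(real \<Rightarrow> 'a::banach \<Rightarrow>\<^sub>L 'a) \<Rightarrow> real \<Rightarrow> (real \<Rightarrow> 'a \<Rightarrow> 'a) \<Rightarrow> (real \<Rightarrow> 'a \<Rightarrow> real \<Rightarrow> 'a) \<Rightarrow>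
     real \<Rightarrow> 'a \<Rightarrow> real \<Rightarrow> 'a" where
  "sol U \<alpha> f g \<epsilon> \<xi> t = (THE v. \<exists>x. mild_solution U \<alpha> f g \<epsilon> \<xi> t x \<and> x t = v)"

definition sol_exists ::
    "(real \<Rightarrow> 'a::banach \<Rightarrow>\<^sub>L 'a) \<Rightarrow> real \<Rightarrow> (real \<Rightarrow> 'a \<Rightarrow> 'a) \<Rightarrow> (real \<Rightarrow> 'a \<Rightarrow> real \<Rightarrow> 'a) \<Rightarrow>
     real \<Rightarrow> 'a \<Rightarrow> real \<Rightarrow> bool" where
  "sol_exists U \<alpha> f g \<epsilon> \<xi> d \<longleftrightarrow> (\<exists>x. mild_solution U \<alpha> f g \<epsilon> \<xi> d x)"

text \<open>Meaningful only where \<open>sol_exists U \<alpha> f g \<epsilon> \<xi> T\<close> holds.\<close>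

definition poincare ::
    "(real \<Rightarrow> 'a::banach \<Rightarrow>\<^sub>L 'a) \<Rightarrow> real \<Rightarrow> (real \<Rightarrow> 'a \<Rightarrow> 'a) \<Rightarrow> (real \<Rightarrow> 'a \<Rightarrow> real \<Rightarrow> 'a) \<Rightarrow>
     real \<Rightarrow> real \<Rightarrow> 'a \<Rightarrow> 'a" where
  "poincare U \<alpha> f g T \<epsilon> \<xi> = sol U \<alpha> f g \<epsilon> \<xi> T"

definition eta ::
    "(real \<Rightarrow> 'a::banach \<Rightarrow>\<^sub>L 'a) \<Rightarrow> real \<Rightarrow> (real \<Rightarrow> 'a \<Rightarrow> 'a) \<Rightarrow> (real \<Rightarrow> 'a \<Rightarrow> real \<Rightarrow> 'a) \<Rightarrow>
     real \<Rightarrow> 'a \<Rightarrow> 'a" where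
  "eta U \<alpha> f g T \<xi> =
     (THE v. \<exists>y. continuous_on {0..T} y \<and>
        (\<forall>t\<in>{0..T}.
           ((\<lambda>s. frac_power U \<alpha> (U (t - s)
                   (D2 (\<lambda>r z. f r (neg_frac_power U \<alpha> z)) s (sol U \<alpha> f g 0 \<xi> s) (y s)
                    + g s (neg_frac_power U \<alpha> (sol U \<alpha> f g 0 \<xi> s)) 0)))
             has_integral y t) {0..t}) \<and>
        y T = v)"

definition poincare_deriv_minus_id ::
    "(real \<Rightarrow> 'a::banach \<Rightarrow>\<^sub>L 'a) \<Rightarrow> real \<Rightarrow> (real \<Rightarrow> 'a \<Rightarrow> 'a) \<Rightarrow> (real \<Rightarrow> 'a \<Rightarrow> real \<Rightarrow> 'a) \<Rightarrow>
     real \<Rightarrow> 'a \<Rightarrow> 'a \<Rightarrow> 'a" where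
  "poincare_deriv_minus_id U \<alpha> f g T \<xi> v =
     frechet_derivative (poincare U \<alpha> f g T 0) (at \<xi>) v - v"

definition tangent_space ::
    "('k::real_normed_vector \<Rightarrow> 'a::real_normed_vector) \<Rightarrow> 'k \<Rightarrow> 'a set" where
  "tangent_space S h = range (frechet_derivative S (at h))"

definition direct_sum_decomposition :: "'a::real_vector set \<Rightarrow> 'a set \<Rightarrow> bool" where
  "direct_sum_decomposition X Y \<longleftrightarrow>
     subspace X \<and> subspace Y \<and> X \<inter> Y = {0} \<and> (\<forall>v. \<exists>x\<in>X. \<exists>y\<in>Y. v = x + y)"

definition projector_onto_along ::
    "('a::real_normed_vector \<Rightarrow>\<^sub>L 'a) \<Rightarrow> 'a set \<Rightarrow> 'a set \<Rightarrow> bool" where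
  "projector_onto_along P X Y \<longleftrightarrow> (\<forall>x\<in>X. \<forall>y\<in>Y. P (x + y) = x)"

definition invertible_operator_on :: "('a::real_normed_vector \<Rightarrow> 'a) \<Rightarrow> 'a set \<Rightarrow> bool" where
  "invertible_operator_on L X \<longleftrightarrow> bij_betw L X X \<and> continuous_on X (inv_into X L)"

definition bifurcation_map ::
    "(real \<Rightarrow> 'a::banach \<Rightarrow>\<^sub>L 'a) \<Rightarrow> real \<Rightarrow> (real \<Rightarrow> 'a \<Rightarrow> 'a) \<Rightarrow> (real \<Rightarrow> 'a \<Rightarrow> real \<Rightarrow> 'a) \<Rightarrow>
     real \<Rightarrow> ('k::real_normed_vector \<Rightarrow> 'a) \<Rightarrow> ('k \<Rightarrow> 'a set) \<Rightarrow> ('k \<Rightarrow> 'a \<Rightarrow>\<^sub>L 'a) \<Rightarrow>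
     ('k \<Rightarrow> 'a \<Rightarrow>\<^sub>L 'a) \<Rightarrow> 'k \<Rightarrow> 'k" where
  "bifurcation_map U \<alpha> f g T S E2 \<pi>1 \<pi>2 h =
     (let Q = poincare_deriv_minus_id U \<alpha> f g T (S h);
          e = eta U \<alpha> f g T (S h)
      in inv_into UNIV (frechet_derivative S (at h))
           (\<pi>1 h (e - Q (inv_into (E2 h) (\<lambda>v. \<pi>2 h (Q (\<pi>2 h v))) (\<pi>2 h e)))))"

text \<open>
  The library has the Brouwer degree of self-maps of the standard sphere, realised inside
  \<open>nat \<Rightarrow> real\<close>. The degree, with respect to \<open>0\<close>, of \<open>F\<close> on the ball of centre \<open>a\<close> and radius
  \<open>r\<close>, for \<open>F\<close> continuous on the closed ball and without zeros on its boundary, is the degree of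
  the normalised boundary map \<open>u \<mapsto> F (a + r u) / \<bar>F (a + r u)\<bar>\<close> of the unit sphere. The
  identification of \<open>real ^ 'k\<close> with the first \<open>CARD('k)\<close> coordinates uses an arbitrary enumeration
  of the index type; the degree does not depend on it, as source and target are identified in
  the same way.
\<close>

definition to_coords :: "real ^ 'k::finite \<Rightarrow> nat \<Rightarrow> real" where
  "to_coords v i = (if i < CARD('k) then v $ from_nat_into UNIV i else 0)"

definition of_coords :: "(nat \<Rightarrow> real) \<Rightarrow> real ^ 'k::finite" where
  "of_coords x = (\<chi> j. x (to_nat_on UNIV j))"

definition brouwer_degree_ball ::
    "(real ^ 'k::finite \<Rightarrow> real ^ 'k) \<Rightarrow> real ^ 'k \<Rightarrow> real \<Rightarrow> int" where
  "brouwer_degree_ball F a r =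
     Brouwer_degree2 (CARD('k) - 1) (\<lambda>x. to_coords (sgn (F (a + r *\<^sub>R of_coords x))))"

definition isolated_zero :: "'k::real_normed_vector \<Rightarrow> ('k \<Rightarrow> 'k) \<Rightarrow> bool" where
  "isolated_zero a F \<longleftrightarrow> F a = 0 \<and> (\<forall>\<^sub>F x in at a. F x \<noteq> 0)"

text \<open>The degree is the same on all sufficiently small balls.\<close>

definition zero_index :: "real ^ 'k::finite \<Rightarrow> (real ^ 'k \<Rightarrow> real ^ 'k) \<Rightarrow> int" where
  "zero_index a F = (THE d. \<forall>\<^sub>F r in at_right 0. brouwer_degree_ball F a r = d)"

lemma to_of_coords:
  assumes "x \<in> topspace (nsphere (CARD('k::finite) - 1))"
  shows "to_coords (of_coords x :: real ^ 'k) = x"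
proof
  fix i
  have zero: "x i = 0" if "i \<ge> CARD('k)" for i
  proof -
    have "\<forall>j>CARD('k) - 1. x j = 0"
      using assms by (simp add: nsphere)
    moreover have "i > CARD('k) - 1"
      using that zero_less_card_finite[where 'a='k] by linarith
    ultimately show ?thesis
      by blast
  qed
  show "to_coords (of_coords x :: real ^ 'k) i = x i"
  proof (cases "i < CARD('k)")
    case True
    then have "i \<in> to_nat_on (UNIV :: 'k set) ` UNIV"
      using to_nat_on_finite[of "UNIV :: 'k set"] by (simp add: bij_betw_def)
    then show ?thesis
      using True by (simp add: to_coords_def of_coords_def to_nat_on_from_nat_into)
  qed (simp add: to_coords_def zero)
qed

lemma norm_of_coords:
  assumes "x \<in> topspace (nsphere (CARD('k::finite) - 1))"
  shows "norm (of_coords x :: real ^ 'k) = 1"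
proof -
  have set: "{..<CARD('k)} = {..CARD('k) - 1}"
    using lessThan_Suc_atMost[of "CARD('k) - 1"] zero_less_card_finite[where 'a='k]
    by (metis Suc_diff_1)
  have "(\<Sum>j\<in>UNIV. (x (to_nat_on (UNIV :: 'k set) j))\<^sup>2) = (\<Sum>i<CARD('k). (x i)\<^sup>2)"
    using sum.reindex_bij_betw[OF to_nat_on_finite[of "UNIV :: 'k set"], of "\<lambda>i. (x i)\<^sup>2"] by simp
  also have "\<dots> = 1"
    using assms unfolding set by (auto simp: nsphere)
  finally show ?thesis
    by (simp add: norm_vec_def L2_set_def of_coords_def)
qed

lemma brouwer_degree_ball_translation:
  assumes "r > 0"
  shows "brouwer_degree_ball (\<lambda>v. v - a) a r = 1"
proof -
  have "Brouwer_degree2 (CARD('a) - 1) (\<lambda>x. to_coords (sgn (a + r *\<^sub>R of_coords x - a)))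
      = Brouwer_degree2 (CARD('a) - 1) id"
    by (rule Brouwer_degree2_eq)
       (use assms in \<open>simp add: sgn_div_norm norm_of_coords to_of_coords\<close>)
  then show ?thesis
    by (simp add: brouwer_degree_ball_def)
qed

end

theory Submission
  imports Defs "HOL-Complex_Analysis.Cauchy_Integral_Formula"
begin

text \<open>
  Near \<open>\<xi>0\<close> the perturbed Poincare map is \<open>P0 + \<epsilon> R\<close> with \<open>R\<close> jointly continuous, Lipschitz in
  the initial value, and \<open>R 0 = \<eta>\<close>. Writing a fixed point as \<open>S h + \<epsilon> w\<close> with \<open>w\<close> in the complement
  \<open>E2 h\<close> and dividing the fixed point equation by \<open>\<epsilon>\<close> leaves two equations. The one in the complement
  is solved for \<open>w\<close> by a contraction, because the compressed operator \<open>P0' - I\<close> is invertible there. The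
  one in the tangent space becomes \<open>N \<epsilon> h = 0\<close> with \<open>N\<close> continuous on \<open>[0, e] \<times> V\<close> and \<open>N 0 = M\<close>, so
  homotopy invariance of the Brouwer degree provides a zero close to \<open>h0\<close>. As \<open>g\<close> is Lipschitz, no
  degree theory for condensing maps is involved.

  The mild equation is solved by contractions in the space of bounded continuous functions with weight
  \<open>exp (- \<mu> t)\<close>; all that enters about the semigroup is a strongly continuous kernel
  \<open>K t = A\<^sup>\<alpha> (U t)\<close> with an integrable singularity at \<open>0\<close>. In the analytic case this kernel is
  \<open>- \<integral> s\<^sup>-\<^sup>\<alpha> U' (t + s) ds / \<Gamma> (1 - \<alpha>)\<close>, the bound on \<open>U'\<close> coming from Cauchy's inequality.
\<close>

section \<open>Weakly singular integrals\<close>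

text \<open>The complement \<open>E2 h\<close> moves with \<open>h\<close>, so its equation does not
  live in a fixed space. It is therefore posed in the whole space: the complementary component of
  the residual plus the tangential component of the unknown has to vanish. The linearisation at
  \<open>h0\<close> is the compressed operator on \<open>E2 h0\<close> together with the identity on
  the tangent space. Its inverse \<open>J\<close>, frozen at \<open>h0\<close>, serves as
  approximate inverse for all nearby \<open>h\<close> and small \<open>\<epsilon>\<close>, and the
  two components of the solution separate afterwards. The weight makes the convolution with
  \<open>K\<close> as small as desired on the whole of \<open>[0, T]\<close>, so one contraction
  covers the entire interval. Dividing by \<open>\<epsilon>\<close> is harmless because the
  difference quotient is itself the unknown, and its equation has constants that do not depend on
  \<open>\<epsilon>\<close>. The integral for the kernel runs over a half-line, whereas analyticity
  controls \<open>U'\<close> only near 0. The missing decay is extracted from the convergence of the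
  Gamma-integral in \<open>frac_powers_defined\<close>. Cauchy's inequality and Fubini's theorem are
  applied to scalar functions, obtained by norming functionals.\<close>

lemma integrable_singular_at_0:
  fixes h :: "real \<Rightarrow> 'a::banach"
  assumes cont: "continuous_on {0<..b} h" and b: "0 \<le> b" and \<beta>: "\<beta> < 1" and c: "0 \<le> c"
    and bd: "\<And>s. s \<in> {0<..b} \<Longrightarrow> norm (h s) \<le> c * s powr (- \<beta>)"
  shows "h integrable_on {0..b}" "norm (integral {0..b} h) \<le> c * (b powr (1 - \<beta>) / (1 - \<beta>))"
proof -
  define \<kappa> where "\<kappa> s = c * (s powr (1 - \<beta>) / (1 - \<beta>))" for s
  have pw: "((\<lambda>x. c * x powr (- \<beta>)) has_integral \<kappa> s) {0..s}" if "0 \<le> s" for s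
    using has_integral_mult_right[OF has_integral_powr_from_0[of "- \<beta>" s], of c] that \<beta> by (simp add: \<kappa>_def)
  show *: "h integrable_on {0..b}"
  proof (cases "b = 0")
    case False
    then have b: "b > 0" using b by simp
    \<comment> \<open>Increments of the tail integrals \<open>\<Phi>\<close> are dominated by those
      of \<open>\<kappa>\<close>, so \<open>\<Phi>\<close> extends continuously to 0. The
      fundamental theorem of calculus, with derivatives required only in the interior, then gives
      integrability up to 0.\<close>
    define \<Phi> where "\<Phi> s = - integral {s..b} h" for s
    have sub: "continuous_on {s..s'} h" if "0 < s" "s' \<le> b" for s s'
      using that by (intro continuous_on_subset[OF cont]) auto
    have diff: "norm (\<Phi> s' - \<Phi> s) \<le> \<kappa> s' - \<kappa> s" if "0 < s" "s \<le> s'" "s' \<le> b" for s s'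
    proof -
      have "integral {s..s'} h + integral {s'..b} h = integral {s..b} h"
        using that by (intro Henstock_Kurzweil_Integration.integral_combine integrable_continuous_interval sub) auto
      then have "\<Phi> s' - \<Phi> s = integral {s..s'} h" by (simp add: \<Phi>_def algebra_simps)
      also have "norm \<dots> \<le> integral {s..s'} (\<lambda>x. c * x powr (- \<beta>))"
        using that by (intro integral_norm_bound_integral integrable_continuous_interval sub bd continuous_intros) auto
      also have "\<dots> = \<kappa> s' - \<kappa> s"
      proof -
        have "integral {0..s} (\<lambda>x. c * x powr (- \<beta>)) + integral {s..s'} (\<lambda>x. c * x powr (- \<beta>))
            = integral {0..s'} (\<lambda>x. c * x powr (- \<beta>))"
          using that pw[of s'] by (intro Henstock_Kurzweil_Integration.integral_combine) auto
        then show ?thesis using integral_unique[OF pw[of s]] integral_unique[OF pw[of s']] that by linarith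
      qed
      finally show ?thesis .
    qed
    have "continuous_on {0..b} \<kappa>"
      unfolding \<kappa>_def using \<beta> by (intro continuous_intros continuous_on_powr') auto
    then have "uniformly_continuous_on {0..b} \<kappa>"
      by (simp add: compact_uniformly_continuous)
    then have "uniformly_continuous_on {0<..b} \<kappa>"
      unfolding uniformly_continuous_on_def by (meson atLeastAtMost_iff greaterThanAtMost_iff less_imp_le)
    moreover have "dist (\<Phi> s) (\<Phi> s') \<le> dist (\<kappa> s) (\<kappa> s')" if "s \<in> {0<..b}" "s' \<in> {0<..b}" for s s'
      using diff[of s s'] diff[of s' s] that by (cases "s \<le> s'") (auto simp: dist_norm norm_minus_commute)
    ultimately have "uniformly_continuous_on {0<..b} \<Phi>"
      unfolding uniformly_continuous_on_def by (meson order_le_less_trans)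
    then obtain g where g: "uniformly_continuous_on (closure {0<..b}) g" "\<And>x. x \<in> {0<..b} \<Longrightarrow> \<Phi> x = g x"
      by (rule uniformly_continuous_on_extension_on_closure) blast
    have "(h has_integral g b - g 0) {0..b}"
    proof (rule fundamental_theorem_of_calculus_interior)
      show "continuous_on {0..b} g" using g(1) b uniformly_continuous_imp_continuous by fastforce
      fix x assume x: "x \<in> {0<..<b}"
      have "((\<lambda>u. integral {x/2..u} h) has_vector_derivative h x) (at x within {x/2..b})"
        using x by (intro integral_has_vector_derivative sub) auto
      then have "((\<lambda>u. integral {x/2..u} h) has_vector_derivative h x) (at x)"
        using x at_within_interior[of x "{x/2..b}"] by simp
      then have "((\<lambda>u. integral {x/2..u} h + \<Phi> (x/2)) has_vector_derivative h x) (at x)"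
        by (auto intro!: derivative_eq_intros)
      then show "(g has_vector_derivative h x) (at x)"
      proof (rule has_vector_derivative_transform_within_open[of _ _ _ "{x/2<..<b}"])
        fix u assume u: "u \<in> {x/2<..<b}"
        have "integral {x/2..u} h + integral {u..b} h = integral {x/2..b} h"
          using u x by (intro Henstock_Kurzweil_Integration.integral_combine integrable_continuous_interval sub) auto
        then have "integral {x/2..u} h = integral {x/2..b} h - integral {u..b} h"
          by (simp add: eq_diff_eq)
        then show "integral {x/2..u} h + \<Phi> (x/2) = g u"
          using g(2)[of u] u x by (simp add: \<Phi>_def)
      qed (use x in auto)
    qed (use b in auto)
    then show ?thesis by blast
  qed (use integrable_on_refl[of h 0] in simp)
  \<comment> \<open>The bound says nothing about \<open>h 0\<close>. The value there is replaced by
    0, which fits the majorant because \<open>0 powr _ = 0\<close>.\<close>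
  have "integral {0..b} h = integral {0..b} (\<lambda>s. if s = 0 then 0 else h s)"
    by (rule integral_spike[of "{0}"]) auto
  moreover have "norm (integral {0..b} (\<lambda>s. if s = 0 then 0 else h s)) \<le> integral {0..b} (\<lambda>x. c * x powr (- \<beta>))"
  proof (rule integral_norm_bound_integral)
    show "(\<lambda>s. if s = 0 then 0 else h s) integrable_on {0..b}"
      using integrable_spike[OF *, of "{0}"] by simp
  qed (use pw[OF b] bd c in auto)
  ultimately show "norm (integral {0..b} h) \<le> c * (b powr (1 - \<beta>) / (1 - \<beta>))"
    using integral_unique[OF pw[OF b]] unfolding \<kappa>_def by metis
qed

text \<open>Bridge to the Lebesgue integral: for a nonnegative function convergence is automatically
  absolute. It is used where Fubini's theorem or domination is applied to an integral known in the
  Henstock-Kurzweil sense.\<close>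

lemma has_bochner_integral_nonneg_HK:
  fixes f :: "real \<Rightarrow> real"
  assumes [measurable]: "f \<in> borel_measurable borel" "S \<in> sets borel"
    and "\<And>x. x \<in> S \<Longrightarrow> 0 \<le> f x" and I: "(f has_integral I) S"
  shows "has_bochner_integral lborel (\<lambda>x. indicator S x * f x) I"
proof (rule has_bochner_integral_nn_integral)
  have eq: "(\<lambda>x. if x \<in> S then f x else 0) = (\<lambda>x. indicator S x * f x)"
    by (auto simp: indicator_def)
  have "((\<lambda>x. indicator S x * f x) has_integral I) UNIV"
    using I has_integral_restrict_UNIV[of S f I] unfolding eq by blast
  then show "(\<integral>\<^sup>+x. ennreal (indicator S x * f x) \<partial>lborel) = ennreal I"
    by (intro nn_integral_has_integral_lborel) (auto simp: indicator_def assms)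
  show "0 \<le> I" using has_integral_nonneg[OF I] assms by blast
qed (auto simp: indicator_def assms)

text \<open>The substitution \<open>s = u * t\<close> reduces this to the Beta integral with
  parameters \<open>1 - \<alpha>\<close> and \<open>\<alpha>\<close>. The powers of \<open>u\<close>
  cancel, so the value does not depend on \<open>u\<close>.\<close>

lemma beta_kernel_integral:
  fixes \<alpha> u :: real
  assumes \<alpha>: "0 < \<alpha>" "\<alpha> < 1" and u: "0 < u"
  shows "has_bochner_integral lborel (\<lambda>s. indicator {0..u} s * (s powr (- \<alpha>) * (u - s) powr (\<alpha> - 1)))
           (Gamma (1 - \<alpha>) * Gamma \<alpha>)"
proof (rule has_bochner_integral_nonneg_HK)
  have "((\<lambda>t. t powr (- \<alpha>) * (1 - t) powr (\<alpha> - 1)) has_integral Gamma (1 - \<alpha>) * Gamma \<alpha>) (cbox 0 1)"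
    using has_integral_Beta_real[of "1 - \<alpha>" \<alpha>] \<alpha> by (simp add: Beta_def)
  from has_integral_affinity'[OF this, of "1 / u" 0]
  have "((\<lambda>s. (s / u) powr (- \<alpha>) * (1 - s / u) powr (\<alpha> - 1)) has_integral u * (Gamma (1 - \<alpha>) * Gamma \<alpha>)) {0..u}"
    using u by simp
  from has_integral_mult_right[OF this, of "1 / u"]
  have "((\<lambda>s. 1 / u * ((s / u) powr (- \<alpha>) * (1 - s / u) powr (\<alpha> - 1))) has_integral Gamma (1 - \<alpha>) * Gamma \<alpha>) {0..u}"
    using u by simp
  then show "((\<lambda>s. s powr (- \<alpha>) * (u - s) powr (\<alpha> - 1)) has_integral Gamma (1 - \<alpha>) * Gamma \<alpha>) {0..u}"
  proof (rule has_integral_eq[rotated])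
    fix s assume s: "s \<in> {0..u}"
    have "1 - s / u = (u - s) / u" using u by (simp add: field_simps)
    then have "1 / u * ((s / u) powr (- \<alpha>) * (1 - s / u) powr (\<alpha> - 1))
       = s powr (- \<alpha>) * (u - s) powr (\<alpha> - 1) * (1 / (u * (u powr (- \<alpha>) * u powr (\<alpha> - 1))))"
      using s u by (simp add: powr_divide)
    also have "u powr (- \<alpha>) * u powr (\<alpha> - 1) = u powr (- \<alpha> + (\<alpha> - 1))"
      by (simp only: powr_add)
    also have "\<dots> = 1 / u" using u by (simp add: powr_minus_divide)
    finally show "1 / u * ((s / u) powr (- \<alpha>) * (1 - s / u) powr (\<alpha> - 1)) = s powr (- \<alpha>) * (u - s) powr (\<alpha> - 1)"
      using u by simp
  qed
qed auto

text \<open>Up to Gamma factors, \<open>\<Psi>\<close> is the Weyl fractional integral of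
  \<open>g\<close> of order \<open>\<alpha>\<close>, and the outer integral is the one of order
  \<open>1 - \<alpha>\<close> evaluated at 0. The orders add up to 1, so the plain integral of
  \<open>g\<close> results. With \<open>u = s + r\<close> as variable, Fubini leaves
  \<open>beta_kernel_integral\<close> inside.\<close>

lemma weyl_integral_composition:
  fixes g :: "real \<Rightarrow> real"
  assumes \<alpha>: "0 < \<alpha>" "\<alpha> < 1" and g: "set_integrable lborel {0<..} g"
    and [measurable]: "g \<in> borel_measurable borel"
  defines "\<Psi> \<equiv> \<lambda>s. LBINT r:{0<..}. r powr (\<alpha> - 1) * g (s + r)"
  shows "set_integrable lborel {0<..} (\<lambda>s. s powr (- \<alpha>) * \<Psi> s)"
    "(LBINT s:{0<..}. s powr (- \<alpha>) * \<Psi> s) = Gamma (1 - \<alpha>) * Gamma \<alpha> * (LBINT u:{0<..}. g u)"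
proof -
  define g0 where "g0 u = indicator {0<..} u * g u" for u :: real
  define B where "B = Gamma (1 - \<alpha>) * Gamma \<alpha>"
  define k where "k u s = indicator {0<..} s * indicator {0<..} (u - s) * (s powr (- \<alpha>) * (u - s) powr (\<alpha> - 1)) * g0 u"
    for u s :: real
  have [measurable]: "g0 \<in> borel_measurable borel" unfolding g0_def by measurable
  have g0: "integrable lborel g0" using g by (simp add: set_integrable_def g0_def[abs_def])
  have k_eq: "k u = (\<lambda>s. indicator {0..u} s * (s powr (- \<alpha>) * (u - s) powr (\<alpha> - 1)) * g0 u)" for u
    by (auto simp: k_def indicator_def fun_eq_iff)
  have hk: "has_bochner_integral lborel (k u) (B * g0 u)" for u
  proof (cases "u > 0")
    case True
    show ?thesis
      unfolding k_eq B_def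
      by (intro has_bochner_integral_mult_left beta_kernel_integral \<alpha> True)
  next
    case False
    then have "k u = (\<lambda>s. 0)" by (simp add: k_def g0_def fun_eq_iff)
    then show ?thesis using False by (simp add: g0_def has_bochner_integral_zero)
  qed
  \<comment> \<open>The weight in \<open>k\<close> is nonnegative and \<open>g0 u\<close> does not
    depend on \<open>s\<close>, so taking absolute values amounts to the constant factor
    \<open>sgn (g0 u)\<close>.\<close>
  have hkn: "(\<integral>s. norm (k u s) \<partial>lborel) = B * norm (g0 u)" for u
  proof -
    have "(\<integral>s. norm (k u s) \<partial>lborel) = (\<integral>s. k u s * sgn (g0 u) \<partial>lborel)"
    proof (rule Bochner_Integration.integral_cong)
      fix s
      have *: "norm (A * g0 u) = A * g0 u * sgn (g0 u)" if "0 \<le> A" for A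
      proof -
        have "norm (A * g0 u) = A * \<bar>g0 u\<bar>" using that by (simp add: abs_mult)
        then show ?thesis by (simp add: abs_sgn)
      qed
      show "norm (k u s) = k u s * sgn (g0 u)" unfolding k_def by (rule *) simp
    qed simp
    also have "\<dots> = B * g0 u * sgn (g0 u)"
      using hk[of u] by (simp add: has_bochner_integral_iff)
    finally show ?thesis by (simp add: abs_sgn mult.assoc)
  qed
  have int: "integrable (lborel \<Otimes>\<^sub>M lborel) (\<lambda>(u, s). k u s)"
  proof (rule lborel_pair.Fubini_integrable)
    show "(\<lambda>(u, s). k u s) \<in> borel_measurable (lborel \<Otimes>\<^sub>M lborel)"
      unfolding k_def by measurable
    show "integrable lborel (\<lambda>u. \<integral>s. norm (case (u, s) of (u, s) \<Rightarrow> k u s) \<partial>lborel)"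
      using g0 by (simp add: hkn[unfolded real_norm_def])
    show "AE u in lborel. integrable lborel (\<lambda>s. case (u, s) of (u, s) \<Rightarrow> k u s)"
      using hk by (auto simp: has_bochner_integral_iff)
  qed
  have inner: "(\<integral>u. k u s \<partial>lborel) = indicator {0<..} s * (s powr (- \<alpha>) * \<Psi> s)" for s
  proof (cases "s > 0")
    case True
    have "(\<integral>u. k u s \<partial>lborel) = \<bar>1\<bar> *\<^sub>R (\<integral>r. k (s + 1 * r) s \<partial>lborel)"
      by (rule lborel_integral_real_affine) simp
    also have "\<dots> = (\<integral>r. s powr (- \<alpha>) * (indicator {0<..} r * (r powr (\<alpha> - 1) * g (s + r))) \<partial>lborel)"
      unfolding real_scaleR_def abs_one mult_1
      by (rule Bochner_Integration.integral_cong) (use True in \<open>auto simp: k_def g0_def indicator_def\<close>)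
    finally show ?thesis
      using True by (simp add: \<Psi>_def set_lebesgue_integral_def)
  qed (simp add: k_def)
  have "integrable lborel (\<lambda>s. \<integral>u. k u s \<partial>lborel)"
    using lborel_pair.integrable_snd[OF int] by simp
  then show "set_integrable lborel {0<..} (\<lambda>s. s powr (- \<alpha>) * \<Psi> s)"
    by (simp add: inner set_integrable_def)
  have "(\<integral>s. (\<integral>u. k u s \<partial>lborel) \<partial>lborel) = (\<integral>u. (\<integral>s. k u s \<partial>lborel) \<partial>lborel)"
    by (rule lborel_pair.Fubini_integral[OF int])
  also have "\<dots> = B * (\<integral>u. g0 u \<partial>lborel)"
    using hk by (simp add: has_bochner_integral_iff)
  finally show "(LBINT s:{0<..}. s powr (- \<alpha>) * \<Psi> s) = Gamma (1 - \<alpha>) * Gamma \<alpha> * (LBINT u:{0<..}. g u)"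
    by (simp add: inner set_lebesgue_integral_def B_def g0_def)
qed

section \<open>Lyapunov--Schmidt reduction\<close>

text \<open>Besides the fixed points the a posteriori estimate is recorded, with factor 2 = 1 / (1 -
  1/2). Continuity and Lipschitz dependence of the fixed point on the parameter are derived from
  it.\<close>

lemma contraction_family:
  fixes F :: "'p \<Rightarrow> 'w::banach \<Rightarrow> 'w"
  assumes "0 \<le> \<rho>"
    and self: "\<And>p w. p \<in> P \<Longrightarrow> norm w \<le> \<rho> \<Longrightarrow> norm (F p w) \<le> \<rho>"
    and contr: "\<And>p w w'. p \<in> P \<Longrightarrow> norm w \<le> \<rho> \<Longrightarrow> norm w' \<le> \<rho> \<Longrightarrow>
                  norm (F p w - F p w') \<le> norm (w - w') / 2"
  obtains \<omega> where "\<And>p. p \<in> P \<Longrightarrow> norm (\<omega> p) \<le> \<rho>" "\<And>p. p \<in> P \<Longrightarrow> F p (\<omega> p) = \<omega> p"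
    "\<And>p w. p \<in> P \<Longrightarrow> norm w \<le> \<rho> \<Longrightarrow> norm (w - \<omega> p) \<le> 2 * norm (F p w - w)"
proof -
  have "\<exists>w. norm w \<le> \<rho> \<and> F p w = w" if "p \<in> P" for p
  proof -
    have "\<exists>!w\<in>cball 0 \<rho>. F p w = w"
    proof (rule Banach_fix[where c = "1/2"])
      show "complete (cball (0::'w) \<rho>)" by (simp add: complete_eq_closed)
      show "cball (0::'w) \<rho> \<noteq> {}" using assms(1) by auto
      show "F p ` cball 0 \<rho> \<subseteq> cball 0 \<rho>" using self that by auto
    qed (use contr that in \<open>auto simp: dist_norm\<close>)
    then show ?thesis by auto
  qed
  then obtain \<omega> where \<omega>: "\<And>p. p \<in> P \<Longrightarrow> norm (\<omega> p) \<le> \<rho> \<and> F p (\<omega> p) = \<omega> p"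
    by metis
  show ?thesis
  proof
    fix p and w :: 'w assume p: "p \<in> P" "norm w \<le> \<rho>"
    have "norm (F p w - F p (\<omega> p)) \<le> norm (w - \<omega> p) / 2"
      using contr[OF p] \<omega>[OF p(1)] by blast
    moreover have "norm (w - \<omega> p) \<le> norm (F p w - F p (\<omega> p)) + norm (F p w - w)"
      using norm_triangle_ineq4[of "F p w - F p (\<omega> p)" "F p w - w"] \<omega>[OF p(1)] by simp
    ultimately show "norm (w - \<omega> p) \<le> 2 * norm (F p w - w)"
      by linarith
  qed (use \<omega> in auto)
qed

lemma contraction_family_continuous:
  fixes F :: "'p::topological_space \<Rightarrow> 'w::real_normed_vector \<Rightarrow> 'w"
  assumes \<omega>: "\<And>p. p \<in> P \<Longrightarrow> norm (\<omega> p) \<le> \<rho>" "\<And>p. p \<in> P \<Longrightarrow> F p (\<omega> p) = \<omega> p"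
    "\<And>p w. p \<in> P \<Longrightarrow> norm w \<le> \<rho> \<Longrightarrow> norm (w - \<omega> p) \<le> 2 * norm (F p w - w)"
    and cont: "\<And>w. norm w \<le> \<rho> \<Longrightarrow> continuous_on P (\<lambda>p. F p w)"
  shows "continuous_on P \<omega>"
  unfolding continuous_on_def
proof
  fix q assume q: "q \<in> P"
  have "((\<lambda>p. F p (\<omega> q)) \<longlongrightarrow> F q (\<omega> q)) (at q within P)"
    using cont[OF \<omega>(1)[OF q]] q by (auto simp: continuous_on_def)
  then have "((\<lambda>p. 2 * norm (F p (\<omega> q) - \<omega> q)) \<longlongrightarrow> 2 * norm (\<omega> q - \<omega> q)) (at q within P)"
    using \<omega>(2)[OF q] by (intro tendsto_intros) auto
  then have lim: "((\<lambda>p. 2 * norm (F p (\<omega> q) - \<omega> q)) \<longlongrightarrow> 0) (at q within P)"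
    by simp
  have "((\<lambda>p. \<omega> p - \<omega> q) \<longlongrightarrow> 0) (at q within P)"
  proof (rule Lim_null_comparison[OF _ lim])
    show "\<forall>\<^sub>F p in at q within P. norm (\<omega> p - \<omega> q) \<le> 2 * norm (F p (\<omega> q) - \<omega> q)"
      unfolding eventually_at_filter using \<omega>(3)[OF _ \<omega>(1)[OF q]]
      by (intro always_eventually) (auto simp: norm_minus_commute)
  qed
  then show "(\<omega> \<longlongrightarrow> \<omega> q) (at q within P)"
    using Lim_null by blast
qed

text \<open>Mean value inequality for \<open>P - L\<close>. With \<open>L = 0\<close> it turns a
  bound of the derivative into a Lipschitz bound.\<close>

lemma derivative_near_linear_bound:
  fixes P :: "'a::real_normed_vector \<Rightarrow> 'b::real_normed_vector" and P' :: "'a \<Rightarrow> 'a \<Rightarrow>\<^sub>L 'b"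
    and L :: "'a \<Rightarrow>\<^sub>L 'b"
  assumes "convex B" and "\<And>x. x \<in> B \<Longrightarrow> (P has_derivative P' x) (at x within B)"
    and "\<And>x. x \<in> B \<Longrightarrow> norm (P' x - L) \<le> e" and "x \<in> B" "y \<in> B"
  shows "norm (P x - P y - L (x - y)) \<le> e * norm (x - y)"
proof -
  have "norm ((\<lambda>x. P x - L x) x - (\<lambda>x. P x - L x) y) \<le> e * norm (x - y)"
  proof (rule differentiable_bound[OF assms(1)])
    fix z assume z: "z \<in> B"
    show "((\<lambda>x. P x - L x) has_derivative blinfun_apply (P' z - L)) (at z within B)"
      unfolding minus_blinfun.rep_eq
      using assms(2)[OF z] bounded_linear_imp_has_derivative[OF blinfun.bounded_linear_right, of L]
      by (auto intro!: derivative_eq_intros)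
    show "onorm (blinfun_apply (P' z - L)) \<le> e"
      using assms(3)[OF z] by (simp add: norm_blinfun.rep_eq)
  qed (use assms in auto)
  then show ?thesis by (simp add: blinfun.diff_right algebra_simps)
qed

text \<open>The value at \<open>\<epsilon> = 0\<close> makes the difference quotient jointly continuous.\<close>

definition dquot ::
    "('a::real_normed_vector \<Rightarrow> 'b::real_normed_vector) \<Rightarrow> ('a \<Rightarrow> 'a \<Rightarrow>\<^sub>L 'b) \<Rightarrow> real \<Rightarrow> 'a \<Rightarrow> 'a \<Rightarrow> 'b" where
  "dquot P P' \<epsilon> a y = (if \<epsilon> = 0 then P' a y else (P (a + \<epsilon> *\<^sub>R y) - P a) /\<^sub>R \<epsilon>)"

text \<open>The two arguments of \<open>P\<close> differ by
  \<open>\<epsilon> *\<^sub>R (y - y')\<close>, so the factor \<open>\<epsilon>\<close> cancels and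
  the constant is uniform in \<open>\<epsilon>\<close>, the limit case 0 included.\<close>

lemma dquot_near_linear_bound:
  fixes P :: "'a::real_normed_vector \<Rightarrow> 'b::real_normed_vector" and P' :: "'a \<Rightarrow> 'a \<Rightarrow>\<^sub>L 'b"
    and L :: "'a \<Rightarrow>\<^sub>L 'b"
  assumes "convex B" and "\<And>x. x \<in> B \<Longrightarrow> (P has_derivative P' x) (at x within B)"
    and L: "\<And>x. x \<in> B \<Longrightarrow> norm (P' x - L) \<le> e"
    and a: "a \<in> B" "a + \<epsilon> *\<^sub>R y \<in> B" "a + \<epsilon> *\<^sub>R y' \<in> B"
  shows "norm (dquot P P' \<epsilon> a y - dquot P P' \<epsilon> a y' - L (y - y')) \<le> e * norm (y - y')"
proof (cases "\<epsilon> = 0")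
  case True
  have "norm ((P' a - L) (y - y')) \<le> e * norm (y - y')"
    using L[OF a(1)] by (meson mult_right_mono norm_blinfun norm_ge_zero order_trans)
  then show ?thesis
    using True by (simp add: dquot_def blinfun.diff_left blinfun.diff_right algebra_simps)
next
  case False
  let ?D = "P (a + \<epsilon> *\<^sub>R y) - P (a + \<epsilon> *\<^sub>R y') - L ((a + \<epsilon> *\<^sub>R y) - (a + \<epsilon> *\<^sub>R y'))"
  have "dquot P P' \<epsilon> a y - dquot P P' \<epsilon> a y' - L (y - y') = ?D /\<^sub>R \<epsilon>"
    using False by (simp add: dquot_def blinfun.diff_right blinfun.scaleR_right blinfun.add_right
        scaleR_diff_right)
  moreover have "norm ?D \<le> e * norm ((a + \<epsilon> *\<^sub>R y) - (a + \<epsilon> *\<^sub>R y'))"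
    by (rule derivative_near_linear_bound[OF assms(1-3) a(2,3)])
  moreover have "(a + \<epsilon> *\<^sub>R y) - (a + \<epsilon> *\<^sub>R y') = \<epsilon> *\<^sub>R (y - y')"
    by (simp add: scaleR_diff_right)
  ultimately have "norm (dquot P P' \<epsilon> a y - dquot P P' \<epsilon> a y' - L (y - y'))
      \<le> e * (\<bar>\<epsilon>\<bar> * norm (y - y')) / \<bar>\<epsilon>\<bar>"
    using False by (simp add: divide_right_mono divide_inverse_commute)
  then show ?thesis
    using False by simp
qed

lemma dquot_0 [simp]: "dquot P P' \<epsilon> a 0 = 0"
  by (simp add: dquot_def)

text \<open>At \<open>\<epsilon>0 = 0\<close> continuity of the quotient's ingredients does not
  help. There the mean value bound compares the quotient with the single operator
  \<open>P' a0\<close>, on a ball where \<open>P'\<close> is close to it.\<close>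

lemma tendsto_dquot:
  fixes P :: "'a::real_normed_vector \<Rightarrow> 'b::real_normed_vector" and P' :: "'a \<Rightarrow> 'a \<Rightarrow>\<^sub>L 'b"
  assumes B: "open B" and der: "\<And>x. x \<in> B \<Longrightarrow> (P has_derivative P' x) (at x)"
    and cont: "continuous_on B P'"
    and \<epsilon>: "(\<epsilon> \<longlongrightarrow> \<epsilon>0) F" and a: "(a \<longlongrightarrow> a0) F" and y: "(y \<longlongrightarrow> y0) F"
    and in_B: "a0 \<in> B" "a0 + \<epsilon>0 *\<^sub>R y0 \<in> B"
  shows "((\<lambda>p. dquot P P' (\<epsilon> p) (a p) (y p)) \<longlongrightarrow> dquot P P' \<epsilon>0 a0 y0) F"
proof (cases "\<epsilon>0 = 0")
  case False
  have contP: "isCont P x" if "x \<in> B" for x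
    using der[OF that] has_derivative_continuous by blast
  have ev: "\<forall>\<^sub>F p in F. \<epsilon> p \<noteq> 0"
    using \<epsilon> False by (rule tendsto_imp_eventually_ne)
  have "((\<lambda>p. (P (a p + \<epsilon> p *\<^sub>R y p) - P (a p)) /\<^sub>R \<epsilon> p) \<longlongrightarrow> (P (a0 + \<epsilon>0 *\<^sub>R y0) - P a0) /\<^sub>R \<epsilon>0) F"
    using False in_B
    by (intro tendsto_intros isCont_tendsto_compose[OF contP] \<epsilon> a y) auto
  then show ?thesis
    using False ev by (auto simp: dquot_def elim!: Lim_transform_eventually eventually_mono)
next
  case True
  show ?thesis
  proof (rule tendstoI)
    fix e :: real assume e: "e > 0"
    define d where "d = e / (2 * (norm y0 + 1))"
    have np: "norm y0 + 1 > 0" by (simp add: add_nonneg_pos)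
    have d: "d > 0" using e np by (simp add: d_def)
    have "isCont P' a0"
      using cont B in_B(1) continuous_on_eq_continuous_at by blast
    then have "\<forall>\<^sub>F x in nhds a0. dist (P' x) (P' a0) < d"
      using d by (metis isCont_def tendstoD tendsto_at_iff_tendsto_nhds)
    moreover have "\<forall>\<^sub>F x in nhds a0. x \<in> B"
      using B in_B(1) by (rule eventually_nhds_in_open)
    ultimately have "\<forall>\<^sub>F x in nhds a0. dist (P' x) (P' a0) < d \<and> x \<in> B"
      by (rule eventually_conj)
    then obtain s where s: "s > 0" "\<And>x. dist x a0 < s \<Longrightarrow> dist (P' x) (P' a0) < d \<and> x \<in> B"
      unfolding eventually_nhds_metric by blast
    have lim: "((\<lambda>p. a p + \<epsilon> p *\<^sub>R y p) \<longlongrightarrow> a0) F"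
      using tendsto_add[OF a tendsto_scaleR[OF \<epsilon> y]] True by simp
    have "((\<lambda>p. P' a0 (y p)) \<longlongrightarrow> P' a0 y0) F"
      by (intro tendsto_intros y)
    then have 1: "\<forall>\<^sub>F p in F. dist (P' a0 (y p)) (P' a0 y0) < e/2"
      using e tendstoD half_gt_zero by blast
    have 2: "\<forall>\<^sub>F p in F. dist (a p) a0 < s" "\<forall>\<^sub>F p in F. dist (a p + \<epsilon> p *\<^sub>R y p) a0 < s"
      using a lim s(1) tendstoD by blast+
    have 3: "\<forall>\<^sub>F p in F. dist (y p) y0 < 1"
      using y tendstoD zero_less_one by blast
    show "\<forall>\<^sub>F p in F. dist (dquot P P' (\<epsilon> p) (a p) (y p)) (dquot P P' \<epsilon>0 a0 y0) < e"
      using 1 2 3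
    proof eventually_elim
      case (elim p)
      have "norm (dquot P P' (\<epsilon> p) (a p) (y p) - dquot P P' (\<epsilon> p) (a p) 0 - P' a0 (y p - 0)) \<le> d * norm (y p - 0)"
      proof (rule dquot_near_linear_bound[where B = "ball a0 s"])
        show "(P has_derivative blinfun_apply (P' x)) (at x within ball a0 s)" if "x \<in> ball a0 s" for x
          using der s(2)[of x] that by (auto intro: has_derivative_at_withinI simp: dist_commute)
        show "norm (P' x - P' a0) \<le> d" if "x \<in> ball a0 s" for x
          using s(2)[of x] that by (auto simp: dist_commute dist_norm norm_minus_commute intro: less_imp_le)
      qed (use elim in \<open>auto simp: dist_commute s\<close>)
      then have "norm (dquot P P' (\<epsilon> p) (a p) (y p) - P' a0 (y p)) \<le> d * norm (y p)"
        by simp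
      also have "\<dots> \<le> d * (norm y0 + 1)"
        using elim(4) d norm_triangle_ineq2[of "y p" y0] by (auto simp: dist_norm)
      also have "\<dots> = e / 2" using np unfolding d_def by (metis less_irrefl mult.commute nonzero_mult_divide_mult_cancel_right times_divide_eq_left)
      finally show ?case
        using elim(1) True
          dist_triangle[of "dquot P P' (\<epsilon> p) (a p) (y p)" "P' a0 y0" "P' a0 (y p)"]
        by (simp add: dist_norm dquot_def)
    qed
  qed
qed

lemma continuous_on_dquot:
  fixes P :: "'a::real_normed_vector \<Rightarrow> 'b::real_normed_vector" and P' :: "'a \<Rightarrow> 'a \<Rightarrow>\<^sub>L 'b"
  assumes "open B" and "\<And>x. x \<in> B \<Longrightarrow> (P has_derivative P' x) (at x)" and "continuous_on B P'"
    and "continuous_on D \<epsilon>" "continuous_on D a" "continuous_on D y"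
    and "\<And>p. p \<in> D \<Longrightarrow> a p \<in> B" "\<And>p. p \<in> D \<Longrightarrow> a p + \<epsilon> p *\<^sub>R y p \<in> B"
  shows "continuous_on D (\<lambda>p. dquot P P' (\<epsilon> p) (a p) (y p))"
  using assms(4-) unfolding continuous_on_def
  by (auto intro!: tendsto_dquot[OF assms(1-3)])

lemma bounded_below_perturb:
  fixes L L' :: "'a::real_normed_vector \<Rightarrow>\<^sub>L 'b::real_normed_vector"
  assumes "\<And>v. c * norm v \<le> norm (L v)" "norm (L' - L) \<le> c / 2"
  shows "c / 2 * norm v \<le> norm (L' v)"
proof -
  have "norm ((L' - L) v) \<le> c / 2 * norm v"
    using assms(2) by (meson mult_right_mono norm_blinfun norm_ge_zero order_trans)
  moreover have "norm (L v) \<le> norm (L' v) + norm ((L' - L) v)"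
    using norm_triangle_ineq4[of "L' v" "(L' - L) v"] by (simp add: blinfun.diff_left)
  ultimately show ?thesis using assms(1)[of v] by (simp add: field_simps)
qed

text \<open>\<open>J\<close> is a left inverse, at \<open>h0\<close>, of the compressed operator
  extended by the tangential projector. Kept fixed, it drives the iteration for all nearby
  \<open>h\<close>. The two injectivity claims allow the caller to evaluate the inverses in the
  bifurcation function and so to recognise it as \<open>N 0\<close>.\<close>

theorem lyapunov_schmidt:
  fixes P0 :: "'a::banach \<Rightarrow> 'a" and P0' :: "'a \<Rightarrow> 'a \<Rightarrow>\<^sub>L 'a" and R :: "real \<Rightarrow> 'a \<Rightarrow> 'a"
    and S :: "'k::real_normed_vector \<Rightarrow> 'a" and S' :: "'k \<Rightarrow> 'k \<Rightarrow>\<^sub>L 'a"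
    and p1 p2 :: "'k \<Rightarrow> 'a \<Rightarrow>\<^sub>L 'a" and J :: "'a \<Rightarrow>\<^sub>L 'a"
  assumes pos: "\<rho> > 0" "e0 > 0" "c > 0"
    and der: "\<And>x. x \<in> ball \<xi>0 \<rho> \<Longrightarrow> (P0 has_derivative P0' x) (at x)"
    and cont': "continuous_on (ball \<xi>0 \<rho>) P0'"
    and contR: "continuous_on ({0..e0} \<times> ball \<xi>0 \<rho>) (\<lambda>(\<epsilon>, x). R \<epsilon> x)"
    and lipR: "\<And>\<epsilon> x x'. \<epsilon> \<in> {0..e0} \<Longrightarrow> x \<in> ball \<xi>0 \<rho> \<Longrightarrow> x' \<in> ball \<xi>0 \<rho> \<Longrightarrow>
                 norm (R \<epsilon> x - R \<epsilon> x') \<le> \<Lambda> * norm (x - x')"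
    and V: "open V" "h0 \<in> V" and contS: "continuous_on V S" and contS': "continuous_on V S'"
    and S0: "S h0 = \<xi>0" and fixS: "\<And>h. h \<in> V \<Longrightarrow> P0 (S h) = S h"
    and injS: "\<And>v. c * norm v \<le> norm (S' h0 v)"
    and p_sum: "\<And>h v. h \<in> V \<Longrightarrow> p1 h v + p2 h v = v"
    and p_idem: "\<And>h v. h \<in> V \<Longrightarrow> p1 h (p1 h v) = p1 h v"
    and p_range: "\<And>h v. h \<in> V \<Longrightarrow> p1 h v \<in> range (S' h)"
    and contp: "continuous_on V p1" "continuous_on V p2"
    and J: "\<And>v. J (p2 h0 (P0' \<xi>0 (p2 h0 v) - p2 h0 v) + p1 h0 v) = v"
    and Jinj: "\<And>v. J v = 0 \<Longrightarrow> v = 0"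
  obtains r0 e1 C N w where "r0 > 0" "e1 > 0" "e1 \<le> e0" "cball h0 r0 \<subseteq> V"
    "continuous_on ({0..e1} \<times> cball h0 r0) (\<lambda>(\<epsilon>, h). N \<epsilon> h)"
    "\<And>h. h \<in> cball h0 r0 \<Longrightarrow> p1 h (w h) = 0"
    "\<And>h. h \<in> cball h0 r0 \<Longrightarrow> p2 h (P0' (S h) (w h) - w h + R 0 (S h)) = 0"
    "\<And>h. h \<in> cball h0 r0 \<Longrightarrow> S' h (N 0 h) = p1 h (P0' (S h) (w h) - w h + R 0 (S h))"
    "\<And>h v. h \<in> cball h0 r0 \<Longrightarrow> p1 h v = 0 \<Longrightarrow> p2 h (P0' (S h) v - v) = 0 \<Longrightarrow> v = 0"
    "\<And>h v. h \<in> cball h0 r0 \<Longrightarrow> S' h v = 0 \<Longrightarrow> v = 0"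
    "\<And>\<epsilon> h. \<epsilon> \<in> {0<..e1} \<Longrightarrow> h \<in> cball h0 r0 \<Longrightarrow> N \<epsilon> h = 0 \<Longrightarrow>
       \<exists>x\<in>ball \<xi>0 \<rho>. P0 x + \<epsilon> *\<^sub>R R \<epsilon> x = x \<and> norm (x - S h) \<le> \<epsilon> * C"
proof -
  define a where "a = norm J + 1"
  define b where "b = norm (p2 h0) + 1"
  \<comment> \<open>Twice the bound found in \<open>self0\<close> for \<open>F p 0\<close>: a map
    with Lipschitz constant 1/2 then keeps the ball of radius \<open>\<rho>w\<close>
    invariant.\<close>
  define \<rho>w where "\<rho>w = 2 * (a * b * (norm (R 0 \<xi>0) + 1))"
  have a: "a > 0" "norm J \<le> a" and b: "b > 0" by (simp_all add: a_def b_def add_nonneg_pos)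
  have \<rho>w: "\<rho>w > 0" using a b by (simp add: \<rho>w_def add_nonneg_pos)
  \<comment> \<open>The summand \<open>p1 h\<close> extends the compressed operator by the identity
    on the tangent space, so that it acts on the whole space although the complement varies. The
    hypothesis on \<open>J\<close> says that it is a left inverse of \<open>L h0\<close>.\<close>
  define L where "L h = (p2 h o\<^sub>L (P0' \<xi>0 - id_blinfun) o\<^sub>L p2 h) + p1 h" for h
  have L_apply: "L h v = p2 h (P0' \<xi>0 (p2 h v) - p2 h v) + p1 h v" for h v
    by (simp add: L_def plus_blinfun.rep_eq minus_blinfun.rep_eq)
  have contL: "continuous_on V L"
    unfolding L_def by (intro continuous_intros contp)
  have p21: "p2 h (p1 h v) = 0" and p22: "p2 h (p2 h v) = p2 h v" and p12: "p1 h (p2 h v) = 0" 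
    if "h \<in> V" for h v
  proof -
    show "p2 h (p1 h v) = 0"
      using p_sum[OF that, of "p1 h v"] p_idem[OF that] by simp
    then show "p2 h (p2 h v) = p2 h v"
      using arg_cong[OF p_sum[OF that, of v], of "p2 h"] by (simp add: blinfun.add_right)
    then show "p1 h (p2 h v) = 0"
      using p_sum[OF that, of "p2 h v"] by simp
  qed
  \<comment> \<open>Chosen so that
    \<open>a * (1 / (4 * a) + 2 * b\<^sup>2 * \<omega>) = 1 / 2\<close>, the Lipschitz constant of
    \<open>F\<close> below.\<close>
  define \<omega> where "\<omega> = 1 / (8 * a * b * b)"
  have \<omega>: "\<omega> > 0" using a b by (simp add: \<omega>_def)
  have nhd: "\<forall>\<^sub>F h in nhds h0. dist (\<phi> h) (\<phi> h0) < d" if "continuous_on V \<phi>" "d > 0"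
    for \<phi> :: "'k \<Rightarrow> 'z::metric_space" and d
  proof -
    have "isCont \<phi> h0"
      using that(1) V continuous_on_eq_continuous_at by blast
    then show ?thesis
      using that(2) by (metis isCont_def tendstoD tendsto_at_iff_tendsto_nhds)
  qed

  \<comment> \<open>Choice of the neighbourhoods and of the range of
    \<open>\<epsilon>\<close>\<close>
  have "isCont P0' \<xi>0"
    using cont' pos(1) continuous_on_eq_continuous_at by (metis centre_in_ball open_ball)
  then have "\<forall>\<^sub>F x in nhds \<xi>0. dist (P0' x) (P0' \<xi>0) < \<omega>"
    using \<omega> by (metis isCont_def tendstoD tendsto_at_iff_tendsto_nhds)
  then obtain s where s: "s > 0" "\<And>x. dist x \<xi>0 < s \<Longrightarrow> dist (P0' x) (P0' \<xi>0) < \<omega>"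
    unfolding eventually_nhds_metric by blast
  define \<rho>1 where "\<rho>1 = min s \<rho>"
  have \<rho>1: "\<rho>1 > 0" "\<rho>1 \<le> \<rho>" "\<rho>1 \<le> s" using s pos by (auto simp: \<rho>1_def)
  have sub\<rho>: "ball \<xi>0 \<rho>1 \<subseteq> ball \<xi>0 \<rho>" using \<rho>1 by (simp add: subset_ball)
  have nearL: "norm (P0' x - P0' \<xi>0) \<le> \<omega>" if "x \<in> ball \<xi>0 \<rho>1" for x
    using s(2)[of x] that \<rho>1 by (auto simp: dist_norm norm_minus_commute)
  have derw: "(P0 has_derivative P0' x) (at x within ball \<xi>0 \<rho>1)" if "x \<in> ball \<xi>0 \<rho>1" for x
    using der[of x] that \<rho>1 by (auto intro: has_derivative_at_withinI)
  have "(0, \<xi>0) \<in> {0..e0} \<times> ball \<xi>0 \<rho>" using pos by auto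
  from contR[unfolded continuous_on_iff, rule_format, OF this zero_less_one]
  obtain s2 where s2: "s2 > 0"
    "\<And>\<epsilon> x. \<epsilon> \<in> {0..e0} \<Longrightarrow> x \<in> ball \<xi>0 \<rho> \<Longrightarrow> dist (\<epsilon>, x) (0, \<xi>0) < s2 \<Longrightarrow> dist (R \<epsilon> x) (R 0 \<xi>0) < 1"
    by fastforce
  define \<sigma> where "\<sigma> = min (\<rho>1 / 2) (s2 / 2)"
  have \<sigma>: "\<sigma> > 0" using \<rho>1 s2 by (simp add: \<sigma>_def)
  have "\<forall>\<^sub>F h in nhds h0. h \<in> V \<and> dist (L h) (L h0) < 1 / (4 * a) \<and> dist (p2 h) (p2 h0) < 1 \<and>
     dist (S h) (S h0) < \<sigma> \<and> dist (S' h) (S' h0) < c / 2"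
    using a \<sigma> pos
    by (intro eventually_conj nhd contL contp contS contS' eventually_nhds_in_open V) auto
  then obtain s3 where s3: "s3 > 0" "\<And>h. dist h h0 < s3 \<Longrightarrow> h \<in> V \<and> dist (L h) (L h0) < 1 / (4 * a) \<and>
     dist (p2 h) (p2 h0) < 1 \<and> dist (S h) (S h0) < \<sigma> \<and> dist (S' h) (S' h0) < c / 2"
    unfolding eventually_nhds_metric by blast
  define r0 where "r0 = s3 / 2"
  have r0: "r0 > 0" using s3 by (simp add: r0_def)
  have near: "h \<in> V" "dist (L h) (L h0) < 1 / (4 * a)" "dist (p2 h) (p2 h0) < 1" "dist (S h) (S h0) < \<sigma>"
     "dist (S' h) (S' h0) < c / 2" if "h \<in> cball h0 r0" for h
    using s3(2)[of h] that s3(1) by (auto simp: r0_def dist_commute)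
  \<comment> \<open>Apart from \<open>e0\<close>, the bounds serve in turn to keep
    \<open>R \<epsilon> (S h)\<close> within 1 of \<open>R 0 \<xi>0\<close>, to keep
    \<open>S h + \<epsilon> *\<^sub>R p2 h v\<close> in the ball of radius \<open>\<rho>1\<close>,
    and to make \<open>R\<close> at that point \<open>\<omega>\<close>-Lipschitz in
    \<open>p2 h v\<close>.\<close>
  define e1 where "e1 = min (min e0 (s2 / 2)) (min (\<rho>1 / (4 * b * \<rho>w)) (\<omega> / (\<bar>\<Lambda>\<bar> + 1)))"
  have "\<omega> / (\<bar>\<Lambda>\<bar> + 1) > 0" using \<omega> by (simp add: add_nonneg_pos)
  then have e1: "e1 > 0" "e1 \<le> e0" "e1 \<le> s2/2" "e1 \<le> \<rho>1 / (4 * b * \<rho>w)" "e1 \<le> \<omega> / (\<bar>\<Lambda>\<bar> + 1)"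
    using pos s2(1) \<rho>1 b \<rho>w unfolding e1_def by (simp, linarith+)
  have p2b: "norm (p2 h) \<le> b" if "h \<in> cball h0 r0" for h
    using near(3)[OF that] norm_triangle_ineq2[of "p2 h" "p2 h0"] by (auto simp: b_def dist_norm)
  have p2v: "norm (p2 h v) \<le> b * norm v" if "h \<in> cball h0 r0" for h v
    using norm_blinfun[of "p2 h" v] p2b[OF that] mult_right_mono[OF p2b[OF that], of "norm v"] by simp
  have Sin: "S h \<in> ball \<xi>0 \<rho>1" if "h \<in> cball h0 r0" for h
    using near(4)[OF that] S0 \<rho>1 by (auto simp: \<sigma>_def dist_commute)
  have Sin2: "S h + \<epsilon> *\<^sub>R p2 h v \<in> ball \<xi>0 \<rho>1"
    if "h \<in> cball h0 r0" "norm v \<le> \<rho>w" "\<epsilon> \<in> {0..e1}" for h v \<epsilon>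
  proof -
    have "norm (\<epsilon> *\<^sub>R p2 h v) \<le> e1 * (b * \<rho>w)"
      using p2v[OF that(1), of v] that b \<rho>w
      by (auto intro!: mult_mono order_trans[OF p2v])
    also have "\<dots> \<le> \<rho>1 / (4 * b * \<rho>w) * (b * \<rho>w)"
      using e1 b \<rho>w by (intro mult_right_mono) auto
    also have "\<dots> < \<rho>1 / 2" using b \<rho>w \<rho>1 by (simp add: field_simps)
    finally have "norm (\<epsilon> *\<^sub>R p2 h v) < \<rho>1 / 2" .
    moreover have "norm (S h - \<xi>0) < \<rho>1 / 2"
      using near(4)[OF that(1)] S0 by (auto simp: \<sigma>_def dist_norm)
    ultimately have "norm (S h - \<xi>0 + \<epsilon> *\<^sub>R p2 h v) < \<rho>1"
      using norm_triangle_ineq[of "S h - \<xi>0" "\<epsilon> *\<^sub>R p2 h v"] by linarith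
    then show ?thesis
      by (simp add: dist_norm norm_minus_commute algebra_simps)
  qed
  \<comment> \<open>For \<open>\<epsilon> > 0\<close> this is the residual of the fixed point
    equation at \<open>S h + \<epsilon> *\<^sub>R p2 h v\<close> divided by
    \<open>\<epsilon>\<close>, since \<open>P0 (S h) = S h\<close>.\<close>
  define z where "z \<epsilon> h v = dquot P0 P0' \<epsilon> (S h) (p2 h v) - p2 h v + R \<epsilon> (S h + \<epsilon> *\<^sub>R p2 h v)" for \<epsilon> h v
  define F where "F = (\<lambda>(\<epsilon>, h) v. v - J (p2 h (z \<epsilon> h v) + p1 h v))"
  let ?D = "{0..e1} \<times> cball h0 r0"

  \<comment> \<open>Contraction estimate and fixed point in the complement\<close>
  have Lbound: "norm (L h0 v - L h v) \<le> 1 / (4 * a) * norm v" if "h \<in> cball h0 r0" for h v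
  proof -
    have "norm ((L h0 - L h) v) \<le> norm (L h0 - L h) * norm v" by (rule norm_blinfun)
    also have "\<dots> \<le> 1 / (4 * a) * norm v"
      using near(2)[OF that] by (intro mult_right_mono) (auto simp: dist_norm norm_minus_commute)
    finally show ?thesis by (simp add: blinfun.diff_left)
  qed
  have contr: "norm (F p v - F p v') \<le> norm (v - v') / 2"
    if "p \<in> ?D" "norm v \<le> \<rho>w" "norm v' \<le> \<rho>w" for p v v'
  proof -
    obtain \<epsilon> h where p: "p = (\<epsilon>, h)" "\<epsilon> \<in> {0..e1}" "h \<in> cball h0 r0" using \<open>p \<in> ?D\<close> by auto
    define d where "d = v - v'"
    define err where "err = dquot P0 P0' \<epsilon> (S h) (p2 h v) - dquot P0 P0' \<epsilon> (S h) (p2 h v') - P0' \<xi>0 (p2 h v - p2 h v')"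
    define rr where "rr = R \<epsilon> (S h + \<epsilon> *\<^sub>R p2 h v) - R \<epsilon> (S h + \<epsilon> *\<^sub>R p2 h v')"
    have err: "norm err \<le> \<omega> * norm (p2 h v - p2 h v')"
      unfolding err_def
      by (rule dquot_near_linear_bound[where B = "ball \<xi>0 \<rho>1"])
         (use derw nearL Sin Sin2 p that in auto)
    have "norm rr \<le> \<Lambda> * norm ((S h + \<epsilon> *\<^sub>R p2 h v) - (S h + \<epsilon> *\<^sub>R p2 h v'))"
      unfolding rr_def using subsetD[OF sub\<rho> Sin2[OF p(3) _ p(2)]] that(2,3) p(2) e1(2) by (intro lipR) auto
    also have "\<dots> = \<Lambda> * \<epsilon> * norm (p2 h v - p2 h v')"
      using p(2) by (simp flip: scaleR_diff_right)
    also have "\<dots> \<le> \<omega> * norm (p2 h v - p2 h v')"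
    proof (rule mult_right_mono)
      have "\<Lambda> * \<epsilon> \<le> (\<bar>\<Lambda>\<bar> + 1) * e1" using p(2) by (intro mult_mono) auto
      also have "\<dots> \<le> \<omega>" using e1(5) by (simp add: field_simps add_nonneg_pos)
      finally show "\<Lambda> * \<epsilon> \<le> \<omega>" .
    qed simp
    finally have rr: "norm rr \<le> \<omega> * norm (p2 h v - p2 h v')" .
    have pd: "norm (p2 h v - p2 h v') \<le> b * norm d"
      using p2v[OF p(3), of d] by (simp add: d_def blinfun.diff_right)
    have split: "z \<epsilon> h v - z \<epsilon> h v' = P0' \<xi>0 (p2 h d) - p2 h d + (err + rr)"
      by (simp add: z_def err_def rr_def d_def blinfun.diff_right algebra_simps)
    have "F p v - F p v' = d - J (p2 h (z \<epsilon> h v - z \<epsilon> h v') + p1 h d)"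
      by (simp add: F_def p(1) d_def blinfun.diff_right blinfun.add_right algebra_simps)
    \<comment> \<open>As \<open>J (L h0 d) = d\<close>, what remains is the change of
      \<open>L\<close> between \<open>h0\<close> and \<open>h\<close> and the two nonlinear errors,
      each with its share of the constant 1/2.\<close>
    also have "\<dots> = J (L h0 d) - J (L h d + p2 h (err + rr))"
      unfolding L_apply J split by (simp add: blinfun.add_right blinfun.diff_right algebra_simps)
    also have "\<dots> = J ((L h0 d - L h d) - p2 h (err + rr))"
      by (simp add: blinfun.add_right blinfun.diff_right algebra_simps)
    finally have "norm (F p v - F p v') \<le> a * norm ((L h0 d - L h d) - p2 h (err + rr))"
      using norm_blinfun[of J "(L h0 d - L h d) - p2 h (err + rr)"]
        mult_right_mono[OF a(2), of "norm ((L h0 d - L h d) - p2 h (err + rr))"] by simp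
    also have "\<dots> \<le> a * (1 / (4 * a) * norm d + b * (\<omega> * (b * norm d) + \<omega> * (b * norm d)))"
    proof (rule mult_left_mono)
      have nn: "norm (err + rr) \<le> \<omega> * (b * norm d) + \<omega> * (b * norm d)"
        using err rr mult_left_mono[OF pd, of \<omega>] \<omega> norm_triangle_ineq[of err rr] by linarith
      show "norm ((L h0 d - L h d) - p2 h (err + rr))
          \<le> 1 / (4 * a) * norm d + b * (\<omega> * (b * norm d) + \<omega> * (b * norm d))"
        using norm_triangle_ineq4[of "L h0 d - L h d" "p2 h (err + rr)"] Lbound[OF p(3), of d]
          p2v[OF p(3), of "err + rr"] mult_left_mono[OF nn less_imp_le[OF b]] by linarith
    qed (use a in auto)
    also have "\<dots> = norm d / 2"
      using a b by (simp add: \<omega>_def field_simps)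
    finally show ?thesis by (simp add: d_def)
  qed
  have self0: "norm (F p 0) \<le> \<rho>w / 2" if "p \<in> ?D" for p
  proof -
    obtain \<epsilon> h where p: "p = (\<epsilon>, h)" "\<epsilon> \<in> {0..e1}" "h \<in> cball h0 r0" using \<open>p \<in> ?D\<close> by auto
    have "dist (\<epsilon>, S h) (0, \<xi>0) \<le> \<bar>\<epsilon>\<bar> + dist (S h) \<xi>0"
      using sqrt_sum_squares_le_sum_abs[of \<epsilon> "dist (S h) \<xi>0"] by (simp add: dist_Pair_Pair dist_real_def)
    also have "\<dots> < s2"
      using p(2) e1(3) near(4)[OF p(3)] S0 by (auto simp: \<sigma>_def)
    finally have "dist (R \<epsilon> (S h)) (R 0 \<xi>0) < 1"
      using p e1(2) subsetD[OF sub\<rho> Sin[OF p(3)]] by (intro s2(2)) auto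
    then have "norm (R \<epsilon> (S h)) \<le> norm (R 0 \<xi>0) + 1"
      using norm_triangle_ineq2[of "R \<epsilon> (S h)" "R 0 \<xi>0"] by (simp add: dist_norm)
    then have "norm (p2 h (R \<epsilon> (S h))) \<le> b * (norm (R 0 \<xi>0) + 1)"
      using mult_left_mono[OF _ less_imp_le[OF b]] p2v[OF p(3)] order_trans by blast
    then have "norm J * norm (p2 h (R \<epsilon> (S h))) \<le> a * (b * (norm (R 0 \<xi>0) + 1))"
      using a by (intro mult_mono) auto
    then have "norm (J (p2 h (R \<epsilon> (S h)))) \<le> a * (b * (norm (R 0 \<xi>0) + 1))"
      using norm_blinfun order_trans by blast
    then show ?thesis
      by (simp add: F_def p(1) z_def \<rho>w_def mult.assoc)
  qed
  have self: "norm (F p v) \<le> \<rho>w" if "p \<in> ?D" "norm v \<le> \<rho>w" for p v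
    using contr[OF that, of 0] self0[OF that(1)] that(2) \<rho>w norm_triangle_sub[of "F p v" "F p 0"] by simp
  from contraction_family[of \<rho>w ?D F, OF less_imp_le[OF \<rho>w] self contr]
  obtain W where W: "\<And>p. p \<in> ?D \<Longrightarrow> norm (W p) \<le> \<rho>w" "\<And>p. p \<in> ?D \<Longrightarrow> F p (W p) = W p"
    "\<And>p w. p \<in> ?D \<Longrightarrow> norm w \<le> \<rho>w \<Longrightarrow> norm (w - W p) \<le> 2 * norm (F p w - w)"
    by blast

  \<comment> \<open>Continuity of the fixed point and of the tangential component\<close>
  have sub: "cball h0 r0 \<subseteq> V" using near(1) by auto
  have cS: "continuous_on ?D (\<lambda>p. S (snd p))" and cp1: "continuous_on ?D (\<lambda>p. p1 (snd p))"
    and cp2: "continuous_on ?D (\<lambda>p. p2 (snd p))" and cS': "continuous_on ?D (\<lambda>p. S' (snd p))"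
    by (rule continuous_on_compose2[OF _ continuous_on_snd[OF continuous_on_id]], rule contS contp contS',
        use sub in auto)+
  have contz: "continuous_on ?D (\<lambda>p. z (fst p) (snd p) (v p))"
    if "continuous_on ?D v" "\<And>p. p \<in> ?D \<Longrightarrow> norm (v p) \<le> \<rho>w" for v
    unfolding z_def
  proof (intro continuous_on_add continuous_on_diff)
    show cy: "continuous_on ?D (\<lambda>p. p2 (snd p) (v p))"
      by (intro continuous_intros cp2 that)
    show "continuous_on ?D (\<lambda>p. dquot P0 P0' (fst p) (S (snd p)) (p2 (snd p) (v p)))"
      by (rule continuous_on_dquot[OF open_ball der cont'])
         (use cS cy subsetD[OF sub\<rho> Sin] subsetD[OF sub\<rho> Sin2] that(2) in \<open>auto intro!: continuous_intros\<close>)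
    have "continuous_on ?D (\<lambda>p. (\<lambda>(\<epsilon>, x). R \<epsilon> x) (fst p, S (snd p) + fst p *\<^sub>R p2 (snd p) (v p)))"
    proof (rule continuous_on_compose2[OF contR])
      show "continuous_on ?D (\<lambda>p. (fst p, S (snd p) + fst p *\<^sub>R p2 (snd p) (v p)))"
        by (intro continuous_intros cS cy)
      show "(\<lambda>p. (fst p, S (snd p) + fst p *\<^sub>R p2 (snd p) (v p))) ` ?D \<subseteq> {0..e0} \<times> ball \<xi>0 \<rho>"
        using subsetD[OF sub\<rho> Sin2] that(2) e1(2) by auto
    qed
    then show "continuous_on ?D (\<lambda>p. R (fst p) (S (snd p) + fst p *\<^sub>R p2 (snd p) (v p)))"
      by simp
  qed
  have contW: "continuous_on ?D W"
  proof (rule contraction_family_continuous[OF W])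
    fix v :: 'a assume v: "norm v \<le> \<rho>w"
    have "continuous_on ?D (\<lambda>p. v - J (p2 (snd p) (z (fst p) (snd p) v) + p1 (snd p) v))"
      by (intro continuous_intros cp1 cp2 contz v)
    then show "continuous_on ?D (\<lambda>p. F p v)" by (simp add: F_def case_prod_unfold)
  qed
  define Z where "Z p = z (fst p) (snd p) (W p)" for p
  have contZ: "continuous_on ?D Z"
    unfolding Z_def by (intro contz contW W)
  have "\<forall>p\<in>?D. \<exists>n. S' (snd p) n = p1 (snd p) (Z p)"
  proof
    fix p assume "p \<in> ?D"
    then have "p1 (snd p) (Z p) \<in> range (S' (snd p))" using sub by (intro p_range) auto
    then show "\<exists>n. S' (snd p) n = p1 (snd p) (Z p)" by (metis image_iff)
  qed
  then obtain n where n: "\<And>p. p \<in> ?D \<Longrightarrow> S' (snd p) (n p) = p1 (snd p) (Z p)"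
    by metis
  have low: "c / 2 * norm v \<le> norm (S' h v)" if "h \<in> cball h0 r0" for h v
    by (rule bounded_below_perturb[OF injS]) (use near(5)[OF that] in \<open>auto simp: dist_norm\<close>)
  have contn: "continuous_on ?D n"
    unfolding continuous_on_def
  proof
    fix q assume q: "q \<in> ?D"
    \<comment> \<open>The preimages \<open>n\<close> were picked by choice. They vary continuously
      because \<open>S' (snd p)\<close> is bounded below uniformly near \<open>h0\<close>; the term
      with \<open>n q\<close> accounts for the change of \<open>S'\<close> itself.\<close>
    let ?e = "\<lambda>p. 2 / c * norm (p1 (snd p) (Z p) - p1 (snd q) (Z q) + (S' (snd q) - S' (snd p)) (n q))"
    have "continuous_on ?D ?e"
      by (intro continuous_intros cp1 contZ cS')
    then have "(?e \<longlongrightarrow> ?e q) (at q within ?D)"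
      using q unfolding continuous_on_def by blast
    then have lim: "(?e \<longlongrightarrow> 0) (at q within ?D)" by simp
    have "((\<lambda>p. n p - n q) \<longlongrightarrow> 0) (at q within ?D)"
    proof (rule Lim_null_comparison[OF _ lim])
      have "norm (n p - n q) \<le> ?e p" if "p \<in> ?D" for p
      proof -
        have eq: "S' (snd p) (n p - n q) = p1 (snd p) (Z p) - p1 (snd q) (Z q) + (S' (snd q) - S' (snd p)) (n q)"
          using n[OF q] n[OF that] by (simp add: blinfun.diff_left blinfun.diff_right)
        have "c / 2 * norm (n p - n q) \<le> norm (S' (snd p) (n p - n q))"
          using that by (intro low) auto
        then show ?thesis
          unfolding eq using pos(3) by (simp add: field_simps)
      qed
      then show "\<forall>\<^sub>F p in at q within ?D. norm (n p - n q) \<le> ?e p"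
        unfolding eventually_at_filter by (intro always_eventually) auto
    qed
    then show "(n \<longlongrightarrow> n q) (at q within ?D)"
      using Lim_null by blast
  qed
  \<comment> \<open>Injectivity of \<open>J\<close> turns the fixed point equation into
    \<open>p2 h Z + p1 h W = 0\<close>. Applying \<open>p1 h\<close>, which annihilates the range of
    \<open>p2 h\<close>, separates the two summands.\<close>
  have fixed: "p1 h (W (\<epsilon>, h)) = 0" "p2 h (W (\<epsilon>, h)) = W (\<epsilon>, h)" "p2 h (Z (\<epsilon>, h)) = 0"
    if "\<epsilon> \<in> {0..e1}" "h \<in> cball h0 r0" for \<epsilon> h
  proof -
    have h: "h \<in> V" using sub that by auto
    have "J (p2 h (Z (\<epsilon>, h)) + p1 h (W (\<epsilon>, h))) = 0"
      using W(2)[of "(\<epsilon>, h)"] that by (simp add: F_def Z_def)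
    then have eq: "p2 h (Z (\<epsilon>, h)) + p1 h (W (\<epsilon>, h)) = 0"
      by (rule Jinj)
    then have "p1 h (p2 h (Z (\<epsilon>, h)) + p1 h (W (\<epsilon>, h))) = 0" by (simp add: blinfun.zero_right)
    then show *: "p1 h (W (\<epsilon>, h)) = 0"
      by (simp add: blinfun.add_right p12[OF h] p_idem[OF h])
    then show "p2 h (Z (\<epsilon>, h)) = 0" using eq by simp
    show "p2 h (W (\<epsilon>, h)) = W (\<epsilon>, h)" using * p_sum[OF h, of "W (\<epsilon>, h)"] by simp
  qed
  have Z0: "Z (0, h) = P0' (S h) (W (0, h)) - W (0, h) + R 0 (S h)" if "h \<in> cball h0 r0" for h
    using fixed(2)[OF _ that, of 0] e1 by (simp add: Z_def z_def dquot_def)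
  show ?thesis
  proof (rule that[of r0 e1 "\<lambda>\<epsilon> h. n (\<epsilon>, h)" "\<lambda>h. W (0, h)" \<rho>w])
    show "continuous_on ?D (\<lambda>(\<epsilon>, h). n (\<epsilon>, h))" using contn by simp
    show "S' h (n (0, h)) = p1 h (P0' (S h) (W (0, h)) - W (0, h) + R 0 (S h))" if "h \<in> cball h0 r0" for h
      using n[of "(0, h)"] that e1 Z0[OF that] by simp
    show "p2 h (P0' (S h) (W (0, h)) - W (0, h) + R 0 (S h)) = 0" if "h \<in> cball h0 r0" for h
      using fixed(3)[of 0 h] that e1 Z0[OF that] by simp
    show "v = 0" if h: "h \<in> cball h0 r0" and v: "p1 h v = 0" "p2 h (P0' (S h) v - v) = 0" for h v
    proof -
      have p2: "p2 h v = v" using p_sum[of h v] v h sub by auto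
      have "L h v = L h v - p2 h (P0' (S h) v - v)" using v by simp
      also have "\<dots> = p2 h ((P0' \<xi>0 - P0' (S h)) v)"
        using p2 v by (simp add: L_apply blinfun.diff_right blinfun.diff_left)
      finally have "norm (L h v) \<le> b * norm ((P0' \<xi>0 - P0' (S h)) v)"
        using p2v[OF h] by simp
      moreover have "norm (P0' \<xi>0 - P0' (S h)) * norm v \<le> \<omega> * norm v"
        using nearL[OF Sin[OF h]] by (intro mult_right_mono) (auto simp: norm_minus_commute)
      then have "norm ((P0' \<xi>0 - P0' (S h)) v) \<le> \<omega> * norm v"
        using norm_blinfun order_trans by blast
      then have "b * norm ((P0' \<xi>0 - P0' (S h)) v) \<le> b * (\<omega> * norm v)"
        using b by simp
      moreover have "norm v \<le> a * norm (L h0 v)"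
        using order_trans[OF norm_blinfun mult_right_mono[OF a(2)], of "L h0 v"] J[of v] by (simp add: L_apply)
      moreover have "norm (L h0 v) \<le> norm (L h v) + 1 / (4 * a) * norm v"
        using Lbound[OF h, of v] norm_triangle_sub[of "L h0 v" "L h v"] by linarith
      ultimately have "norm v \<le> a * norm (L h0 v)" "norm (L h0 v) \<le> b * (\<omega> * norm v) + 1 / (4 * a) * norm v"
        by linarith+
      \<comment> \<open>Both bounds together multiply \<open>norm v\<close> by at most 1/8 + 1/4,
        which forces \<open>v = 0\<close>.\<close>
      then have "norm v \<le> a * (b * (\<omega> * norm v) + 1 / (4 * a) * norm v)"
        using mult_left_mono[OF _ less_imp_le[OF a(1)]] order_trans by blast
      also have "\<dots> = (1 / (8 * b) + 1 / 4) * norm v" 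
        using a b by (simp add: \<omega>_def field_simps)
      also have "\<dots> \<le> (1 / 8 + 1 / 4) * norm v"
      proof (intro mult_right_mono add_right_mono)
        have "1 \<le> b" by (simp add: b_def)
        then show "1 / (8 * b) \<le> 1 / 8" by (simp add: field_simps)
      qed simp
      finally show "v = 0" by simp
    qed
    show "v = 0" if "h \<in> cball h0 r0" "S' h v = 0" for h v
      using low[OF that(1), of v] that(2) pos(3) by (simp add: mult_le_0_iff)
    show "\<exists>x\<in>ball \<xi>0 \<rho>. P0 x + \<epsilon> *\<^sub>R R \<epsilon> x = x \<and> norm (x - S h) \<le> \<epsilon> * \<rho>w"
      if \<epsilon>: "\<epsilon> \<in> {0<..e1}" and h: "h \<in> cball h0 r0" and n0: "n (\<epsilon>, h) = 0" for \<epsilon> h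
    proof -
      have D: "(\<epsilon>, h) \<in> ?D" using \<epsilon> h by auto
      have hV: "h \<in> V" using h sub by auto
      have "p1 h (Z (\<epsilon>, h)) = 0" using n[OF D] n0 by (simp add: blinfun.zero_right)
      then have "Z (\<epsilon>, h) = 0" using fixed(3)[of \<epsilon> h] \<epsilon> h p_sum[OF hV, of "Z (\<epsilon>, h)"] by simp
      then have "dquot P0 P0' \<epsilon> (S h) (W (\<epsilon>, h)) - W (\<epsilon>, h) + R \<epsilon> (S h + \<epsilon> *\<^sub>R W (\<epsilon>, h)) = 0"
        using fixed(2)[of \<epsilon> h] \<epsilon> h by (simp add: Z_def z_def)
      then have "\<epsilon> *\<^sub>R (dquot P0 P0' \<epsilon> (S h) (W (\<epsilon>, h)) - W (\<epsilon>, h) + R \<epsilon> (S h + \<epsilon> *\<^sub>R W (\<epsilon>, h))) = 0"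
        by simp
      then have "P0 (S h + \<epsilon> *\<^sub>R W (\<epsilon>, h)) + \<epsilon> *\<^sub>R R \<epsilon> (S h + \<epsilon> *\<^sub>R W (\<epsilon>, h)) = S h + \<epsilon> *\<^sub>R W (\<epsilon>, h)"
        using \<epsilon> fixS[OF hV] by (simp add: dquot_def scaleR_add_right scaleR_diff_right algebra_simps)
      moreover have "S h + \<epsilon> *\<^sub>R W (\<epsilon>, h) \<in> ball \<xi>0 \<rho>"
        using subsetD[OF sub\<rho> Sin2[OF h W(1)[OF D], of \<epsilon>]] fixed(2)[of \<epsilon> h] \<epsilon> h by auto
      moreover have "norm (S h + \<epsilon> *\<^sub>R W (\<epsilon>, h) - S h) \<le> \<epsilon> * \<rho>w"
        using W(1)[OF D] \<epsilon> by simp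
      ultimately show ?thesis by blast
    qed
  qed (use r0 e1 sub fixed(1)[of 0] in auto)
qed

section \<open>Abstract integral equations depending on parameters\<close>

lemma has_derivative_quadratic:
  fixes f :: "'a::real_normed_vector \<Rightarrow> 'b::real_normed_vector" and A :: "'a \<Rightarrow>\<^sub>L 'b"
  assumes "s > 0" and q: "\<And>y. dist y x < s \<Longrightarrow> norm (f y - f x - A (y - x)) \<le> C * (norm (y - x))\<^sup>2"
  shows "(f has_derivative A) (at x)"
proof (rule has_derivativeI_sandwich[where H = "\<lambda>y. C * norm (y - x)" and e = s])
  have "((\<lambda>y. C * norm (y - x)) \<longlongrightarrow> C * norm (x - x)) (at x)" by (intro tendsto_intros)
  then show "((\<lambda>y. C * norm (y - x)) \<longlongrightarrow> 0) (at x within UNIV)" by simp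
  fix y assume "y \<noteq> x" "dist y x < s"
  then show "norm (f y - f x - A (y - x)) / norm (y - x) \<le> C * norm (y - x)"
    using q[of y] by (simp add: divide_le_eq power2_eq_square mult.assoc)
qed (use assms in \<open>auto intro: blinfun.bounded_linear_right\<close>)

text \<open>Mean value inequality for
  \<open>a \<mapsto> N (a + \<epsilon> *\<^sub>R y) - N a\<close>, whose derivative has size at most
  \<open>L * \<bar>\<epsilon>\<bar> * norm y\<close>. Dividing by \<open>\<epsilon>\<close> leaves a
  constant that is uniform down to 0; it yields the Lipschitz dependence of the difference quotient
  of solutions on the initial value.\<close>

lemma dquot_lipschitz_base:
  fixes N :: "'x::real_normed_vector \<Rightarrow> 'y::real_normed_vector" and N' :: "'x \<Rightarrow> 'x \<Rightarrow>\<^sub>L 'y"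
  assumes der: "\<And>u. (N has_derivative N' u) (at u)" and lip: "\<And>u v. norm (N' u - N' v) \<le> L * norm (u - v)"
  shows "norm (dquot N N' \<epsilon> a y - dquot N N' \<epsilon> b y) \<le> L * norm y * norm (a - b)"
proof (cases "\<epsilon> = 0")
  case True
  have "norm ((N' a - N' b) y) \<le> L * norm (a - b) * norm y"
    using lip[of a b] by (meson mult_right_mono norm_blinfun norm_ge_zero order_trans)
  then show ?thesis using True by (simp add: dquot_def blinfun.diff_left algebra_simps)
next
  case False
  let ?\<Phi> = "\<lambda>a. N (a + \<epsilon> *\<^sub>R y) - N a"
  have "norm (?\<Phi> a - ?\<Phi> b - (0 :: 'x \<Rightarrow>\<^sub>L 'y) (a - b)) \<le> L * norm (\<epsilon> *\<^sub>R y) * norm (a - b)"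
  proof (rule derivative_near_linear_bound[where B = UNIV and P' = "\<lambda>a. N' (a + \<epsilon> *\<^sub>R y) - N' a"])
    fix x :: 'x
    have "((\<lambda>a. a + \<epsilon> *\<^sub>R y) has_derivative (\<lambda>h. h)) (at x)"
      by (auto intro!: derivative_eq_intros)
    from has_derivative_compose[OF this der]
    have "((\<lambda>a. N (a + \<epsilon> *\<^sub>R y)) has_derivative N' (x + \<epsilon> *\<^sub>R y)) (at x)" .
    then show "(?\<Phi> has_derivative (N' (x + \<epsilon> *\<^sub>R y) - N' x)) (at x within UNIV)"
      unfolding minus_blinfun.rep_eq by (intro has_derivative_diff der) auto
    show "norm (N' (x + \<epsilon> *\<^sub>R y) - N' x - 0) \<le> L * norm (\<epsilon> *\<^sub>R y)"
      using lip[of "x + \<epsilon> *\<^sub>R y" x] by simp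
  qed auto
  then have "norm (?\<Phi> a - ?\<Phi> b) / \<bar>\<epsilon>\<bar> \<le> L * norm (\<epsilon> *\<^sub>R y) * norm (a - b) / \<bar>\<epsilon>\<bar>"
    by (intro divide_right_mono) (auto simp: zero_blinfun.rep_eq)
  also have "\<dots> = L * norm y * norm (a - b)" using False by simp
  also have "norm (?\<Phi> a - ?\<Phi> b) / \<bar>\<epsilon>\<bar> = norm ((?\<Phi> a - ?\<Phi> b) /\<^sub>R \<epsilon>)"
    by (simp add: divide_inverse_commute)
  also have "(?\<Phi> a - ?\<Phi> b) /\<^sub>R \<epsilon> = dquot N N' \<epsilon> a y - dquot N N' \<epsilon> b y"
    using False by (simp add: dquot_def scaleR_diff_right)
  finally show ?thesis .
qed

text \<open>Continuity in the first variable alone becomes joint continuity once the second variable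
  enters with a uniform Lipschitz constant.\<close>

lemma continuous_on_lipschitz_second:
  fixes G :: "'p::topological_space \<Rightarrow> 'x::real_normed_vector \<Rightarrow> 'y::real_normed_vector"
  assumes cont: "\<And>u. continuous_on A (\<lambda>\<epsilon>. G \<epsilon> u)"
    and lip: "\<And>\<epsilon> u v. \<epsilon> \<in> A \<Longrightarrow> norm (G \<epsilon> u - G \<epsilon> v) \<le> L * norm (u - v)"
    and c: "continuous_on D e" "continuous_on D w" "\<And>p. p \<in> D \<Longrightarrow> e p \<in> A"
  shows "continuous_on D (\<lambda>p. G (e p) (w p))"
  unfolding continuous_on_def
proof
  fix q assume q: "q \<in> D"
  have "continuous_on D (\<lambda>p. G (e p) (w q))"
    by (rule continuous_on_compose2[OF cont c(1)]) (use c(3) in auto)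
  then have 1: "((\<lambda>p. G (e p) (w q)) \<longlongrightarrow> G (e q) (w q)) (at q within D)"
    using q by (auto simp: continuous_on_def)
  have "((\<lambda>p. L * norm (w p - w q)) \<longlongrightarrow> L * norm (w q - w q)) (at q within D)"
    using c(2) q by (intro tendsto_intros) (auto simp: continuous_on_def)
  then have lim: "((\<lambda>p. L * norm (w p - w q)) \<longlongrightarrow> 0) (at q within D)" by simp
  have "((\<lambda>p. G (e p) (w p) - G (e p) (w q)) \<longlongrightarrow> 0) (at q within D)"
    by (rule Lim_null_comparison[OF _ lim]) (use lip c(3) in \<open>auto simp: eventually_at_filter intro!: always_eventually\<close>)
  from tendsto_add[OF this 1] show "((\<lambda>p. G (e p) (w p)) \<longlongrightarrow> G (e q) (w q)) (at q within D)"
    by simp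
qed

text \<open>
  Here \<open>y \<epsilon> \<xi>\<close> is the difference quotient of the perturbed and the unperturbed solution. It is
  obtained as a fixed point itself, which yields its continuity up to \<open>\<epsilon> = 0\<close>.
\<close>

theorem perturbed_solution_family:
  fixes Uh :: "'e::banach \<Rightarrow>\<^sub>L 'x::banach" and V :: "'x \<Rightarrow>\<^sub>L 'x" and N :: "'x \<Rightarrow> 'x" and N' :: "'x \<Rightarrow> 'x \<Rightarrow>\<^sub>L 'x"
    and G :: "real \<Rightarrow> 'x \<Rightarrow> 'x" and ev :: "'x \<Rightarrow>\<^sub>L 'e"
  assumes \<rho>: "\<rho> > 0" and L: "L \<ge> 0" and LG: "LG \<ge> 0"
    and der: "\<And>u. (N has_derivative N' u) (at u)"
    and lip: "\<And>u v. norm (N' u - N' v) \<le> L * norm (u - v)"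
    and B: "\<And>u. u \<in> cball u0 \<rho> \<Longrightarrow> norm (N' u) \<le> B" and small: "norm V * B \<le> 1 / 4"
    and lipG: "\<And>\<epsilon> u v. \<epsilon> \<in> {0..1} \<Longrightarrow> norm (G \<epsilon> u - G \<epsilon> v) \<le> LG * norm (u - v)"
    and contG: "\<And>u. continuous_on {0..1} (\<lambda>\<epsilon>. G \<epsilon> u)"
    and u0: "u0 = Uh \<xi>0 + V (N u0)"
  obtains \<rho>' e0 \<Lambda> u y and P' :: "'e \<Rightarrow> 'e \<Rightarrow>\<^sub>L 'e" where "\<rho>' > 0" "0 < e0" "e0 \<le> 1"
    "\<And>\<xi>. \<xi> \<in> ball \<xi>0 \<rho>' \<Longrightarrow> u \<xi> = Uh \<xi> + V (N (u \<xi>))"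
    "\<And>\<xi>. \<xi> \<in> ball \<xi>0 \<rho>' \<Longrightarrow> ((\<lambda>\<xi>. ev (u \<xi>)) has_derivative P' \<xi>) (at \<xi>)"
    "continuous_on (ball \<xi>0 \<rho>') P'"
    "\<And>\<epsilon> \<xi>. \<epsilon> \<in> {0..e0} \<Longrightarrow> \<xi> \<in> ball \<xi>0 \<rho>' \<Longrightarrow>
       u \<xi> + \<epsilon> *\<^sub>R y \<epsilon> \<xi> = Uh \<xi> + V (N (u \<xi> + \<epsilon> *\<^sub>R y \<epsilon> \<xi>) + \<epsilon> *\<^sub>R G \<epsilon> (u \<xi> + \<epsilon> *\<^sub>R y \<epsilon> \<xi>))"
    "\<And>\<xi>. \<xi> \<in> ball \<xi>0 \<rho>' \<Longrightarrow> y 0 \<xi> = V (N' (u \<xi>) (y 0 \<xi>) + G 0 (u \<xi>))"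
    "continuous_on ({0..e0} \<times> ball \<xi>0 \<rho>') (\<lambda>(\<epsilon>, \<xi>). ev (y \<epsilon> \<xi>))"
    "\<And>\<epsilon> \<xi> \<xi>'. \<epsilon> \<in> {0..e0} \<Longrightarrow> \<xi> \<in> ball \<xi>0 \<rho>' \<Longrightarrow> \<xi>' \<in> ball \<xi>0 \<rho>' \<Longrightarrow>
       norm (ev (y \<epsilon> \<xi>) - ev (y \<epsilon> \<xi>')) \<le> \<Lambda> * norm (\<xi> - \<xi>')"
proof -
  define aU where "aU = norm Uh + 1"
  \<comment> \<open>Makes \<open>norm (F \<xi> 0) \<le> \<rho> / 4\<close>, so that
    \<open>F \<xi>\<close> maps the ball of radius \<open>\<rho> / 2\<close> into itself.\<close>
  define \<rho>' where "\<rho>' = \<rho> / (4 * aU)"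
  have Uh1: "aU > 0" by (simp add: aU_def add_nonneg_pos)
  have \<rho>': "\<rho>' > 0" using \<rho> Uh1 by (simp add: \<rho>'_def)
  let ?D = "ball \<xi>0 \<rho>'"

  \<comment> \<open>Contraction estimates for \<open>V\<close> composed with
    \<open>N\<close>\<close>
  have contrV: "norm (V (dquot N N' \<epsilon> a y) - V (dquot N N' \<epsilon> a y')) \<le> norm (y - y') / 4"
    if "a \<in> cball u0 \<rho>" "a + \<epsilon> *\<^sub>R y \<in> cball u0 \<rho>" "a + \<epsilon> *\<^sub>R y' \<in> cball u0 \<rho>" for a \<epsilon> y y'
  proof -
    have "norm (dquot N N' \<epsilon> a y - dquot N N' \<epsilon> a y' - (0 :: 'x \<Rightarrow>\<^sub>L 'x) (y - y')) \<le> B * norm (y - y')"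
      by (rule dquot_near_linear_bound[where B = "cball u0 \<rho>"])
         (use that B der in \<open>auto intro: has_derivative_at_withinI\<close>)
    then have "norm V * norm (dquot N N' \<epsilon> a y - dquot N N' \<epsilon> a y') \<le> norm V * (B * norm (y - y'))"
      by (intro mult_left_mono) auto
    also have "\<dots> \<le> 1 / 4 * norm (y - y')"
      using mult_right_mono[OF small, of "norm (y - y')"] by (simp add: mult.assoc)
    finally show ?thesis
      using norm_blinfun[of V "dquot N N' \<epsilon> a y - dquot N N' \<epsilon> a y'"] by (simp add: blinfun.diff_right)
  qed
  \<comment> \<open>With \<open>\<epsilon> = 1\<close> and base point \<open>u0\<close> the quotient
    is \<open>N a - N u0\<close>, so this is an instance of \<open>contrV\<close>.\<close>
  have contrN: "norm (V (N a) - V (N b)) \<le> norm (a - b) / 4" if "a \<in> cball u0 \<rho>" "b \<in> cball u0 \<rho>" for a b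
    using contrV[of u0 1 "a - u0" "b - u0"] that \<rho> by (simp add: dquot_def blinfun.diff_right)
  have N'V: "norm (V (N' a y)) \<le> norm y / 4" if "a \<in> cball u0 \<rho>" for a y
    using contrV[of a 0 y 0] that by (simp add: dquot_def)
  \<comment> \<open>Right-hand side of the equation for \<open>u0 + w\<close> minus that of the
    equation for \<open>u0\<close>.\<close>
  define F where "F \<xi> w = Uh (\<xi> - \<xi>0) + (V (N (u0 + w)) - V (N u0))" for \<xi> w
  have Fcontr: "norm (F \<xi> w - F \<xi> w') \<le> norm (w - w') / 2" if "norm w \<le> \<rho> / 2" "norm w' \<le> \<rho> / 2" for \<xi> w w'
    using contrN[of "u0 + w" "u0 + w'"] that \<rho> norm_ge_zero[of "w - w'"]
    by (simp add: F_def dist_norm del: norm_ge_zero)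
  have F0: "norm (F \<xi> 0) \<le> \<rho> / 4" if "\<xi> \<in> ?D" for \<xi>
  proof -
    have "norm (F \<xi> 0) \<le> norm Uh * norm (\<xi> - \<xi>0)" by (simp add: F_def norm_blinfun)
    also have "\<dots> \<le> aU * \<rho>'"
      using that by (intro mult_mono) (auto simp: aU_def dist_norm norm_minus_commute)
    also have "\<dots> = \<rho> / 4" using Uh1 by (simp add: \<rho>'_def)
    finally show ?thesis .
  qed
  have Fself: "norm (F \<xi> w) \<le> \<rho> / 2" if "\<xi> \<in> ?D" "norm w \<le> \<rho> / 2" for \<xi> w
    using F0[OF that(1)] Fcontr[OF that(2), of 0 \<xi>] that(2) \<rho> norm_triangle_sub[of "F \<xi> w" "F \<xi> 0"] by simp
  obtain \<omega> where \<omega>: "\<And>\<xi>. \<xi> \<in> ?D \<Longrightarrow> norm (\<omega> \<xi>) \<le> \<rho> / 2" "\<And>\<xi>. \<xi> \<in> ?D \<Longrightarrow> F \<xi> (\<omega> \<xi>) = \<omega> \<xi>"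
    "\<And>\<xi> w. \<xi> \<in> ?D \<Longrightarrow> norm w \<le> \<rho> / 2 \<Longrightarrow> norm (w - \<omega> \<xi>) \<le> 2 * norm (F \<xi> w - w)"
    using contraction_family[of "\<rho> / 2" ?D F, OF _ Fself Fcontr] \<rho> by (metis half_gt_zero less_imp_le)

  \<comment> \<open>The unperturbed solutions and their derivative in the initial value\<close>
  define u where "u \<xi> = u0 + \<omega> \<xi>" for \<xi>
  have u_in: "u \<xi> \<in> cball u0 (\<rho> / 2)" "u \<xi> \<in> cball u0 \<rho>" if "\<xi> \<in> ?D" for \<xi>
    using \<omega>(1)[OF that] \<rho> by (auto simp: u_def dist_norm)
  have u_eq: "u \<xi> = Uh \<xi> + V (N (u \<xi>))" if "\<xi> \<in> ?D" for \<xi>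
    using \<omega>(2)[OF that] u0 by (simp add: u_def F_def blinfun.diff_right algebra_simps)
  define b where "b = 2 * norm Uh"
  have b: "b \<ge> 0" by (simp add: b_def)
  have u_lip: "norm (u \<xi> - u \<xi>') \<le> b * norm (\<xi> - \<xi>')" if "\<xi> \<in> ?D" "\<xi>' \<in> ?D" for \<xi> \<xi>'
  proof -
    have "norm (\<omega> \<xi> - \<omega> \<xi>') \<le> 2 * norm (F \<xi>' (\<omega> \<xi>) - F \<xi> (\<omega> \<xi>))"
      using \<omega>(3)[OF that(2) \<omega>(1)[OF that(1)]] \<omega>(2)[OF that(1)] by simp
    also have "F \<xi>' (\<omega> \<xi>) - F \<xi> (\<omega> \<xi>) = Uh (\<xi>' - \<xi>)" by (simp add: F_def blinfun.diff_right)
    finally show ?thesis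
      using norm_blinfun[of Uh "\<xi>' - \<xi>"] by (simp add: u_def b_def norm_minus_commute)
  qed
  have u_cont: "continuous_on ?D u"
    by (rule lipschitz_on_continuous_on[of b]) (use u_lip b in \<open>auto simp: lipschitz_on_def dist_norm\<close>)
  have N'_cont: "continuous_on UNIV N'"
    by (rule lipschitz_on_continuous_on[of L]) (use lip L in \<open>auto simp: lipschitz_on_def dist_norm\<close>)
  have N'u_cont: "continuous_on ?D (\<lambda>\<xi>. N' (u \<xi>))"
    by (rule continuous_on_compose2[OF N'_cont u_cont]) auto
  \<comment> \<open>Formal differentiation of \<open>u = Uh \<xi> + V (N u)\<close> gives a linear
    equation for the derivative. Solving it as a fixed point in operator space makes the solution
    continuous in \<open>\<xi>\<close> with respect to the operator norm.\<close>
  define FY where "FY \<xi> Y = Uh + (V o\<^sub>L N' (u \<xi>) o\<^sub>L Y)" for \<xi> and Y :: "'e \<Rightarrow>\<^sub>L 'x"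
  have VN'Y: "norm (V o\<^sub>L N' (u \<xi>) o\<^sub>L Y) \<le> norm Y / 4" if "\<xi> \<in> ?D" for \<xi> and Y :: "'e \<Rightarrow>\<^sub>L 'x"
  proof (rule norm_blinfun_bound)
    fix x
    show "norm ((V o\<^sub>L N' (u \<xi>) o\<^sub>L Y) x) \<le> norm Y / 4 * norm x"
      using N'V[OF u_in(2)[OF that], of "Y x"] norm_blinfun[of Y x] by simp
  qed simp
  have FY_contr: "norm (FY \<xi> Y - FY \<xi> Y') \<le> norm (Y - Y') / 2" if "\<xi> \<in> ?D" for \<xi> Y Y'
  proof -
    have eq: "FY \<xi> Y - FY \<xi> Y' = (V o\<^sub>L N' (u \<xi>) o\<^sub>L (Y - Y'))"
      by (rule blinfun_eqI) (simp add: FY_def plus_blinfun.rep_eq minus_blinfun.rep_eq blinfun.diff_right)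
    show ?thesis unfolding eq using VN'Y[OF that, of "Y - Y'"] norm_ge_zero[of "Y - Y'"] by linarith
  qed
  have FY_self: "norm (FY \<xi> Y) \<le> b" if "\<xi> \<in> ?D" "norm Y \<le> b" for \<xi> Y
    using norm_triangle_ineq[of Uh "V o\<^sub>L N' (u \<xi>) o\<^sub>L Y"] VN'Y[OF that(1), of Y] that(2)
      norm_ge_zero[of Uh] unfolding FY_def b_def by linarith
  obtain Y where Y: "\<And>\<xi>. \<xi> \<in> ?D \<Longrightarrow> norm (Y \<xi>) \<le> b" "\<And>\<xi>. \<xi> \<in> ?D \<Longrightarrow> FY \<xi> (Y \<xi>) = Y \<xi>"
    "\<And>\<xi> w. \<xi> \<in> ?D \<Longrightarrow> norm w \<le> b \<Longrightarrow> norm (w - Y \<xi>) \<le> 2 * norm (FY \<xi> w - w)"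
    using contraction_family[of b ?D FY, OF b FY_self FY_contr] by metis
  have Y_cont: "continuous_on ?D Y"
    by (rule contraction_family_continuous[OF Y]) (auto simp: FY_def intro!: continuous_intros N'u_cont)
  have u_der: "(u has_derivative Y \<xi>) (at \<xi>)" if \<xi>: "\<xi> \<in> ?D" for \<xi>
  proof -
    obtain s where s: "s > 0" "ball \<xi> s \<subseteq> ?D" using \<xi> open_ball openE by blast
    show ?thesis
    proof (rule has_derivative_quadratic[OF s(1), where C = "2 * (norm V * L * b\<^sup>2)"])
      fix \<xi>' assume "dist \<xi>' \<xi> < s"
      then have \<xi>': "\<xi>' \<in> ?D" using s(2) by (auto simp: dist_commute subset_iff)
      \<comment> \<open>The remainder of the claimed derivative. It solves
        \<open>r = V n + V (N' (u \<xi>) r)\<close> with \<open>n\<close> quadratic in the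
        increment, and the last term is at most \<open>norm r / 4\<close>.\<close>
      define r where "r = u \<xi>' - u \<xi> - Y \<xi> (\<xi>' - \<xi>)"
      define n where "n = N (u \<xi>') - N (u \<xi>) - N' (u \<xi>) (u \<xi>' - u \<xi>)"
      have "norm (N (u \<xi>') - N (u \<xi>) - N' (u \<xi>) (u \<xi>' - u \<xi>)) \<le> (L * norm (u \<xi>' - u \<xi>)) * norm (u \<xi>' - u \<xi>)"
      proof (rule derivative_near_linear_bound[where B = "cball (u \<xi>) (norm (u \<xi>' - u \<xi>))"])
        fix v assume "v \<in> cball (u \<xi>) (norm (u \<xi>' - u \<xi>))"
        then have "L * norm (v - u \<xi>) \<le> L * norm (u \<xi>' - u \<xi>)"
          using L by (intro mult_left_mono) (auto simp: dist_norm norm_minus_commute)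
        then show "norm (N' v - N' (u \<xi>)) \<le> L * norm (u \<xi>' - u \<xi>)"
          using lip[of v "u \<xi>"] by linarith
      qed (use der in \<open>auto simp: dist_norm norm_minus_commute intro: has_derivative_at_withinI\<close>)
      also have "\<dots> \<le> L * (b * norm (\<xi>' - \<xi>)) * (b * norm (\<xi>' - \<xi>))"
        using u_lip[OF \<xi>' \<xi>] L b by (intro mult_mono) auto
      finally have n: "norm n \<le> L * b\<^sup>2 * (norm (\<xi>' - \<xi>))\<^sup>2" by (simp add: n_def power2_eq_square algebra_simps)
      have Yeq: "Y \<xi> h = Uh h + V (N' (u \<xi>) (Y \<xi> h))" for h
        using arg_cong[OF Y(2)[OF \<xi>], of "\<lambda>Y. blinfun_apply Y h"] by (simp add: FY_def plus_blinfun.rep_eq)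
      have "u \<xi>' - u \<xi> = (Uh \<xi>' + V (N (u \<xi>'))) - (Uh \<xi> + V (N (u \<xi>)))"
        by (rule arg_cong2[where f = "(-)", OF u_eq[OF \<xi>'] u_eq[OF \<xi>]])
      then have "r = ((Uh \<xi>' + V (N (u \<xi>'))) - (Uh \<xi> + V (N (u \<xi>)))) - (Uh (\<xi>' - \<xi>) + V (N' (u \<xi>) (Y \<xi> (\<xi>' - \<xi>))))"
        unfolding r_def by (rule arg_cong2[where f = "(-)", OF _ Yeq])
      also have "\<dots> = V (N (u \<xi>')) - V (N (u \<xi>)) - V (N' (u \<xi>) (Y \<xi> (\<xi>' - \<xi>)))"
        by (simp add: blinfun.diff_right)
      also have "\<dots> = V n + V (N' (u \<xi>) r)"
        by (simp add: n_def r_def blinfun.diff_right)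
      finally have "norm r \<le> norm (V n) + norm r / 4"
        using norm_triangle_ineq[of "V n" "V (N' (u \<xi>) r)"] N'V[OF u_in(2)[OF \<xi>], of r] by simp
      moreover have "norm (V n) \<le> norm V * (L * b\<^sup>2 * (norm (\<xi>' - \<xi>))\<^sup>2)"
        using n by (intro order_trans[OF norm_blinfun] mult_left_mono) auto
      ultimately have "norm r \<le> 2 * (norm V * (L * b\<^sup>2 * (norm (\<xi>' - \<xi>))\<^sup>2))"
        using norm_ge_zero[of r] by linarith
      then show "norm (u \<xi>' - u \<xi> - Y \<xi> (\<xi>' - \<xi>)) \<le> 2 * (norm V * L * b\<^sup>2) * (norm (\<xi>' - \<xi>))\<^sup>2"
        by (simp add: r_def algebra_simps)
    qed
  qed

  \<comment> \<open>The difference quotient as a fixed point\<close>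
  have "compact ((\<lambda>\<epsilon>. G \<epsilon> u0) ` {0..1})" using contG by (intro compact_continuous_image) auto
  then obtain \<Gamma>0 where \<Gamma>0: "\<And>\<epsilon>. \<epsilon> \<in> {0..1} \<Longrightarrow> norm (G \<epsilon> u0) \<le> \<Gamma>0"
    by (meson bounded_iff compact_imp_bounded image_eqI)
  define \<Gamma> where "\<Gamma> = \<Gamma>0 + LG * \<rho>"
  have \<Gamma>: "norm (G \<epsilon> (u \<xi>)) \<le> \<Gamma>" if "\<epsilon> \<in> {0..1}" "\<xi> \<in> ?D" for \<epsilon> \<xi>
  proof -
    have "norm (G \<epsilon> (u \<xi>) - G \<epsilon> u0) \<le> LG * norm (u \<xi> - u0)" by (rule lipG[OF that(1)])
    also have "\<dots> \<le> LG * \<rho>"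
      using u_in(2)[OF that(2)] LG by (intro mult_left_mono) (auto simp: dist_norm norm_minus_commute)
    finally show ?thesis
      using \<Gamma>0[OF that(1)] norm_triangle_sub[of "G \<epsilon> (u \<xi>)" "G \<epsilon> u0"] by (simp add: \<Gamma>_def)
  qed
  have "0 \<le> \<Gamma>0" using order_trans[OF norm_ge_zero \<Gamma>0[of 0]] by simp
  then have \<Gamma>pos: "\<Gamma> \<ge> 0" using LG \<rho> by (simp add: \<Gamma>_def)
  define \<rho>y where "\<rho>y = 2 * (norm V * \<Gamma>) + 1"
  have \<rho>y: "\<rho>y > 0" using \<Gamma>pos by (simp add: \<rho>y_def add_nonneg_pos)
  define vg where "vg = norm V * LG + 1"
  \<comment> \<open>Besides 1, the first bound keeps \<open>u \<xi> + \<epsilon> *\<^sub>R y\<close>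
    in the ball where \<open>N'\<close> is controlled, and the second makes the contribution of
    \<open>G\<close> contract by 1/4.\<close>
  define e0 where "e0 = min 1 (min (\<rho> / (2 * \<rho>y)) (1 / (4 * vg)))"
  have VLG: "vg > 0" "norm V * LG \<le> vg" using LG by (simp_all add: vg_def add_nonneg_pos)
  have e0: "e0 > 0" "e0 \<le> 1" "e0 \<le> \<rho> / (2 * \<rho>y)" "e0 \<le> 1 / (4 * vg)"
    using \<rho> \<rho>y VLG by (auto simp: e0_def)
  have e0LG: "\<epsilon> * (norm V * LG) \<le> 1 / 4" if "\<epsilon> \<in> {0..e0}" for \<epsilon>
  proof -
    have "\<epsilon> * (norm V * LG) \<le> 1 / (4 * vg) * vg"
      using that e0(4) LG VLG by (intro mult_mono) auto
    then show ?thesis using VLG by simp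
  qed
  have near: "u \<xi> + \<epsilon> *\<^sub>R y \<in> cball u0 \<rho>" if "\<xi> \<in> ?D" "\<epsilon> \<in> {0..e0}" "norm y \<le> \<rho>y" for \<xi> \<epsilon> y
  proof -
    have "\<epsilon> * norm y \<le> \<rho> / (2 * \<rho>y) * \<rho>y"
      using that e0(3) \<rho> \<rho>y by (intro mult_mono) auto
    then have "norm (\<epsilon> *\<^sub>R y) \<le> \<rho> / 2" using \<rho>y that(2) by simp
    moreover have "norm (u \<xi> - u0) \<le> \<rho> / 2" using u_in(1)[OF that(1)] by (simp add: dist_norm norm_minus_commute)
    ultimately have "norm (u \<xi> - u0 + \<epsilon> *\<^sub>R y) \<le> \<rho>"
      using norm_triangle_ineq[of "u \<xi> - u0" "\<epsilon> *\<^sub>R y"] by linarith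
    then show ?thesis by (simp add: dist_norm norm_minus_commute algebra_simps)
  qed
  \<comment> \<open>For \<open>\<epsilon> > 0\<close> a fixed point \<open>y\<close> means that
    \<open>u \<xi> + \<epsilon> *\<^sub>R y\<close> solves the perturbed equation. For
    \<open>\<epsilon> = 0\<close> it is the inhomogeneous linearised equation behind
    \<open>\<eta>\<close>.\<close>
  define H where "H = (\<lambda>(\<epsilon>, \<xi>) y. V (dquot N N' \<epsilon> (u \<xi>) y + G \<epsilon> (u \<xi> + \<epsilon> *\<^sub>R y)))"
  let ?E = "{0..e0} \<times> ?D"
  have VG: "norm (V (G \<epsilon> a) - V (G \<epsilon> b)) \<le> norm V * LG * norm (a - b)" if "\<epsilon> \<in> {0..e0}" for \<epsilon> a b
  proof -
    have "norm (V (G \<epsilon> a - G \<epsilon> b)) \<le> norm V * (LG * norm (a - b))"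
      using that e0(2) by (intro order_trans[OF norm_blinfun] mult_left_mono lipG) auto
    then show ?thesis by (simp add: blinfun.diff_right mult.assoc)
  qed
  have H_contr: "norm (H p y - H p y') \<le> norm (y - y') / 2"
    if "p \<in> ?E" "norm y \<le> \<rho>y" "norm y' \<le> \<rho>y" for p y y'
  proof -
    obtain \<epsilon> \<xi> where p: "p = (\<epsilon>, \<xi>)" "\<epsilon> \<in> {0..e0}" "\<xi> \<in> ?D" using \<open>p \<in> ?E\<close> by auto
    have "norm (V (G \<epsilon> (u \<xi> + \<epsilon> *\<^sub>R y)) - V (G \<epsilon> (u \<xi> + \<epsilon> *\<^sub>R y')))
        \<le> norm V * LG * norm ((u \<xi> + \<epsilon> *\<^sub>R y) - (u \<xi> + \<epsilon> *\<^sub>R y'))"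
      by (rule VG[OF p(2)])
    also have "\<dots> = \<epsilon> * (norm V * LG) * norm (y - y')" using p(2) by (simp flip: scaleR_diff_right)
    also have "\<dots> \<le> 1 / 4 * norm (y - y')" by (intro mult_right_mono e0LG p) simp
    finally have "norm (V (G \<epsilon> (u \<xi> + \<epsilon> *\<^sub>R y)) - V (G \<epsilon> (u \<xi> + \<epsilon> *\<^sub>R y'))) \<le> norm (y - y') / 4" by simp
    moreover have "norm (V (dquot N N' \<epsilon> (u \<xi>) y) - V (dquot N N' \<epsilon> (u \<xi>) y')) \<le> norm (y - y') / 4"
      using that p by (intro contrV u_in near) auto
    moreover have "H p y - H p y' = (V (dquot N N' \<epsilon> (u \<xi>) y) - V (dquot N N' \<epsilon> (u \<xi>) y'))
        + (V (G \<epsilon> (u \<xi> + \<epsilon> *\<^sub>R y)) - V (G \<epsilon> (u \<xi> + \<epsilon> *\<^sub>R y')))"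
      by (simp add: H_def p(1) blinfun.add_right)
    ultimately show ?thesis
      using norm_triangle_ineq[of "V (dquot N N' \<epsilon> (u \<xi>) y) - V (dquot N N' \<epsilon> (u \<xi>) y')"
          "V (G \<epsilon> (u \<xi> + \<epsilon> *\<^sub>R y)) - V (G \<epsilon> (u \<xi> + \<epsilon> *\<^sub>R y'))"] by simp
  qed
  have H_self: "norm (H p y) \<le> \<rho>y" if "p \<in> ?E" "norm y \<le> \<rho>y" for p y
  proof -
    obtain \<epsilon> \<xi> where p: "p = (\<epsilon>, \<xi>)" "\<epsilon> \<in> {0..e0}" "\<xi> \<in> ?D" using \<open>p \<in> ?E\<close> by auto
    have "norm (H p 0) \<le> norm V * \<Gamma>"
      using \<Gamma>[of \<epsilon> \<xi>] p e0(2) by (auto simp: H_def intro!: order_trans[OF norm_blinfun mult_left_mono])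
    then show ?thesis
      using H_contr[OF that, of 0] \<rho>y that(2) norm_triangle_sub[of "H p y" "H p 0"] by (simp add: \<rho>y_def)
  qed
  from contraction_family[of \<rho>y ?E H, OF less_imp_le[OF \<rho>y] H_self H_contr]
  obtain Z where Z: "\<And>p. p \<in> ?E \<Longrightarrow> norm (Z p) \<le> \<rho>y" "\<And>p. p \<in> ?E \<Longrightarrow> H p (Z p) = Z p"
    "\<And>p w. p \<in> ?E \<Longrightarrow> norm w \<le> \<rho>y \<Longrightarrow> norm (w - Z p) \<le> 2 * norm (H p w - w)"
    by blast
  have cu: "continuous_on ?E (\<lambda>p. u (snd p))"
    by (rule continuous_on_compose2[OF u_cont continuous_on_snd[OF continuous_on_id]]) auto
  have Z_cont: "continuous_on ?E Z"
  proof (rule contraction_family_continuous[OF Z])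
    fix w :: 'x
    have 1: "continuous_on ?E (\<lambda>p. dquot N N' (fst p) (u (snd p)) w)"
      by (rule continuous_on_dquot[OF open_UNIV der N'_cont]) (auto intro!: continuous_intros cu)
    have 2: "continuous_on ?E (\<lambda>p. G (fst p) (u (snd p) + fst p *\<^sub>R w))"
      by (rule continuous_on_lipschitz_second[OF contG lipG]) (use e0(2) in \<open>auto intro!: continuous_intros cu\<close>)
    have "continuous_on ?E (\<lambda>p. V (dquot N N' (fst p) (u (snd p)) w + G (fst p) (u (snd p) + fst p *\<^sub>R w)))"
      by (intro continuous_intros 1 2)
    then show "continuous_on ?E (\<lambda>p. H p w)" by (simp add: H_def case_prod_unfold)
  qed
  \<comment> \<open>Lipschitz constant of \<open>H\<close> in \<open>\<xi>\<close> at frozen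
    \<open>y\<close>: \<open>L * \<rho>y\<close> stems from the quotient, \<open>LG\<close> from the
    perturbation and \<open>b\<close> from \<open>u\<close>.\<close>
  define q where "q = norm V * (L * \<rho>y + LG) * b"
  have q: "q \<ge> 0" using L LG \<rho>y b by (simp add: q_def)
  have Z_lip: "norm (Z (\<epsilon>, \<xi>) - Z (\<epsilon>, \<xi>')) \<le> 2 * (q * norm (\<xi> - \<xi>'))"
    if "\<epsilon> \<in> {0..e0}" "\<xi> \<in> ?D" "\<xi>' \<in> ?D" for \<epsilon> \<xi> \<xi>'
  proof -
    have in_E: "(\<epsilon>, \<xi>) \<in> ?E" "(\<epsilon>, \<xi>') \<in> ?E" using that by auto
    define y where "y = Z (\<epsilon>, \<xi>)"
    have y: "norm y \<le> \<rho>y" "H (\<epsilon>, \<xi>) y = y" using Z(1,2)[OF in_E(1)] by (auto simp: y_def)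
    have "norm (y - Z (\<epsilon>, \<xi>')) \<le> 2 * norm (H (\<epsilon>, \<xi>') y - H (\<epsilon>, \<xi>) y)"
      using Z(3)[OF in_E(2) y(1)] y(2) by simp
    also have "norm (H (\<epsilon>, \<xi>') y - H (\<epsilon>, \<xi>) y) \<le> q * norm (\<xi> - \<xi>')"
    proof -
      have eq: "H (\<epsilon>, \<xi>') y - H (\<epsilon>, \<xi>) y = V (dquot N N' \<epsilon> (u \<xi>') y - dquot N N' \<epsilon> (u \<xi>) y)
          + (V (G \<epsilon> (u \<xi>' + \<epsilon> *\<^sub>R y)) - V (G \<epsilon> (u \<xi> + \<epsilon> *\<^sub>R y)))"
        by (simp add: H_def blinfun.add_right blinfun.diff_right)
      have "norm (H (\<epsilon>, \<xi>') y - H (\<epsilon>, \<xi>) y) \<le> norm (V (dquot N N' \<epsilon> (u \<xi>') y - dquot N N' \<epsilon> (u \<xi>) y))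
          + norm (V (G \<epsilon> (u \<xi>' + \<epsilon> *\<^sub>R y)) - V (G \<epsilon> (u \<xi> + \<epsilon> *\<^sub>R y)))"
        unfolding eq by (rule norm_triangle_ineq)
      moreover have "norm (V (G \<epsilon> (u \<xi>' + \<epsilon> *\<^sub>R y)) - V (G \<epsilon> (u \<xi> + \<epsilon> *\<^sub>R y))) \<le> norm V * LG * norm (u \<xi>' - u \<xi>)"
        using VG[OF that(1), of "u \<xi>' + \<epsilon> *\<^sub>R y" "u \<xi> + \<epsilon> *\<^sub>R y"] by simp
      moreover have "norm (V (dquot N N' \<epsilon> (u \<xi>') y - dquot N N' \<epsilon> (u \<xi>) y)) \<le> norm V * (L * \<rho>y * norm (u \<xi>' - u \<xi>))"
      proof -
        have "L * norm y * norm (u \<xi>' - u \<xi>) \<le> L * \<rho>y * norm (u \<xi>' - u \<xi>)"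
          using y(1) L by (intro mult_right_mono mult_left_mono) auto
        then have "norm (dquot N N' \<epsilon> (u \<xi>') y - dquot N N' \<epsilon> (u \<xi>) y) \<le> L * \<rho>y * norm (u \<xi>' - u \<xi>)"
          using dquot_lipschitz_base[OF der lip, of \<epsilon> "u \<xi>'" y "u \<xi>"] by linarith
        then show ?thesis by (rule order_trans[OF norm_blinfun mult_left_mono]) simp
      qed
      ultimately have "norm (H (\<epsilon>, \<xi>') y - H (\<epsilon>, \<xi>) y) \<le> norm V * (L * \<rho>y * norm (u \<xi>' - u \<xi>)) + norm V * LG * norm (u \<xi>' - u \<xi>)"
        by linarith
      also have "\<dots> = norm V * (L * \<rho>y + LG) * norm (u \<xi>' - u \<xi>)" by (simp add: algebra_simps)
      also have "\<dots> \<le> norm V * (L * \<rho>y + LG) * (b * norm (\<xi>' - \<xi>))"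
        using L LG \<rho>y by (intro mult_left_mono u_lip that) auto
      finally show ?thesis by (simp add: q_def norm_minus_commute mult.assoc)
    qed
    finally show ?thesis by (simp add: y_def)
  qed
  show ?thesis
  proof (rule that[of \<rho>' e0 u "\<lambda>\<xi>. ev o\<^sub>L Y \<xi>" "\<lambda>\<epsilon> \<xi>. Z (\<epsilon>, \<xi>)" "norm ev * (2 * q)"])
    show "((\<lambda>\<xi>. ev (u \<xi>)) has_derivative blinfun_apply (ev o\<^sub>L Y \<xi>)) (at \<xi>)" if "\<xi> \<in> ?D" for \<xi>
      using bounded_linear.has_derivative[OF blinfun.bounded_linear_right u_der[OF that], of ev]
      by (simp add: blinfun_compose.rep_eq comp_def)
    show "continuous_on ?D (\<lambda>\<xi>. ev o\<^sub>L Y \<xi>)" by (intro continuous_intros Y_cont)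
    show "u \<xi> + \<epsilon> *\<^sub>R Z (\<epsilon>, \<xi>) = Uh \<xi> + V (N (u \<xi> + \<epsilon> *\<^sub>R Z (\<epsilon>, \<xi>)) + \<epsilon> *\<^sub>R G \<epsilon> (u \<xi> + \<epsilon> *\<^sub>R Z (\<epsilon>, \<xi>)))"
      if "\<epsilon> \<in> {0..e0}" "\<xi> \<in> ?D" for \<epsilon> \<xi>
    proof (cases "\<epsilon> = 0")
      case True
      show ?thesis unfolding True scaleR_zero_left add_0_right by (rule u_eq[OF that(2)])
    next
      case False
      have "Z (\<epsilon>, \<xi>) = V (dquot N N' \<epsilon> (u \<xi>) (Z (\<epsilon>, \<xi>)) + G \<epsilon> (u \<xi> + \<epsilon> *\<^sub>R Z (\<epsilon>, \<xi>)))"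
        using Z(2)[of "(\<epsilon>, \<xi>)"] that by (simp add: H_def)
      then have "\<epsilon> *\<^sub>R Z (\<epsilon>, \<xi>) = V (\<epsilon> *\<^sub>R (dquot N N' \<epsilon> (u \<xi>) (Z (\<epsilon>, \<xi>)) + G \<epsilon> (u \<xi> + \<epsilon> *\<^sub>R Z (\<epsilon>, \<xi>))))"
        by (metis blinfun.scaleR_right)
      also have "\<epsilon> *\<^sub>R (dquot N N' \<epsilon> (u \<xi>) (Z (\<epsilon>, \<xi>)) + G \<epsilon> (u \<xi> + \<epsilon> *\<^sub>R Z (\<epsilon>, \<xi>)))
         = N (u \<xi> + \<epsilon> *\<^sub>R Z (\<epsilon>, \<xi>)) - N (u \<xi>) + \<epsilon> *\<^sub>R G \<epsilon> (u \<xi> + \<epsilon> *\<^sub>R Z (\<epsilon>, \<xi>))"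
        using False by (simp add: dquot_def scaleR_add_right)
      finally have "\<epsilon> *\<^sub>R Z (\<epsilon>, \<xi>) = V (N (u \<xi> + \<epsilon> *\<^sub>R Z (\<epsilon>, \<xi>)) - N (u \<xi>) + \<epsilon> *\<^sub>R G \<epsilon> (u \<xi> + \<epsilon> *\<^sub>R Z (\<epsilon>, \<xi>)))" .
      from arg_cong2[where f = "(+)", OF u_eq[OF that(2)] this]
      have "u \<xi> + \<epsilon> *\<^sub>R Z (\<epsilon>, \<xi>) = (Uh \<xi> + V (N (u \<xi>))) + V (N (u \<xi> + \<epsilon> *\<^sub>R Z (\<epsilon>, \<xi>)) - N (u \<xi>) + \<epsilon> *\<^sub>R G \<epsilon> (u \<xi> + \<epsilon> *\<^sub>R Z (\<epsilon>, \<xi>)))" .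
      then show ?thesis by (simp add: blinfun.add_right blinfun.diff_right)
    qed
    show "Z (0, \<xi>) = V (N' (u \<xi>) (Z (0, \<xi>)) + G 0 (u \<xi>))" if "\<xi> \<in> ?D" for \<xi>
      using Z(2)[of "(0, \<xi>)"] that e0(1) by (simp add: H_def dquot_def)
    have "continuous_on ?E (\<lambda>p. ev (Z p))" by (intro continuous_intros Z_cont)
    then show "continuous_on ?E (\<lambda>(\<epsilon>, \<xi>). ev (Z (\<epsilon>, \<xi>)))" by (simp add: case_prod_unfold)
    show "norm (ev (Z (\<epsilon>, \<xi>)) - ev (Z (\<epsilon>, \<xi>'))) \<le> norm ev * (2 * q) * norm (\<xi> - \<xi>')"
      if "\<epsilon> \<in> {0..e0}" "\<xi> \<in> ?D" "\<xi>' \<in> ?D" for \<epsilon> \<xi> \<xi>'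
    proof -
      have "norm (ev (Z (\<epsilon>, \<xi>) - Z (\<epsilon>, \<xi>'))) \<le> norm ev * (2 * (q * norm (\<xi> - \<xi>')))"
        using Z_lip[OF that] by (intro order_trans[OF norm_blinfun] mult_left_mono) auto
      then show ?thesis by (simp add: blinfun.diff_right mult.assoc)
    qed
  qed (use \<rho>' e0 u_eq in auto)
qed

section \<open>Volterra equations with a weakly singular kernel\<close>

text \<open>For \<open>0 \<le> T\<close> a retraction of the line onto \<open>[0, T]\<close>.
  Composing with it embeds the continuous functions on the interval into the Banach space of bounded
  continuous functions on the line.\<close>

definition clip :: "real \<Rightarrow> real \<Rightarrow> real" where
  "clip T t = max 0 (min T t)"

lemma clip_in: "0 \<le> T \<Longrightarrow> clip T t \<in> {0..T}"
  and clip_id: "t \<in> {0..T} \<Longrightarrow> clip T t = t"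
  by (auto simp: clip_def)

lemma continuous_on_clip [continuous_intros]:
  "continuous_on S f \<Longrightarrow> continuous_on S (\<lambda>x. clip T (f x))"
  unfolding clip_def by (intro continuous_intros)

lemma clip_bcontfun:
  fixes h :: "real \<Rightarrow> 'b::real_normed_vector"
  assumes "0 \<le> T" and cont: "continuous_on {0..T} h"
  shows "(\<lambda>t. h (clip T t)) \<in> bcontfun"
proof -
  have "bounded (h ` {0..T})" using cont by (intro compact_imp_bounded compact_continuous_image) auto
  then obtain C where "\<And>t. t \<in> {0..T} \<Longrightarrow> norm (h t) \<le> C" by (meson bounded_iff image_eqI)
  then show ?thesis
    using clip_in[OF assms(1)]
    by (intro bcontfun_normI[where b = C] continuous_on_compose2[OF cont] continuous_intros) auto
qed

lemma Bcontfun_clip_apply: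
  fixes h :: "real \<Rightarrow> 'b::real_normed_vector"
  assumes "0 \<le> T" "continuous_on {0..T} h"
  shows "apply_bcontfun (Bcontfun (\<lambda>t. h (clip T t))) t = h (clip T t)"
  using clip_bcontfun[OF assms] by (simp add: Bcontfun_inverse)

lemma continuous_on_superposition:
  assumes "continuous_on ({0..T} \<times> UNIV) (\<lambda>(t, z). F t z)"
  shows "continuous_on {0..T} (\<lambda>t. F t (apply_bcontfun u t))"
proof -
  have "continuous_on {0..T} (\<lambda>t. (\<lambda>(t, z). F t z) (t, apply_bcontfun u t))"
    by (rule continuous_on_compose2[OF assms]) (auto intro!: continuous_intros)
  then show ?thesis by simp
qed

text \<open>The Lipschitz constant of \<open>F' t\<close> is uniform in \<open>t\<close>, so the
  pointwise Taylor remainder is bounded by \<open>L * (norm (v - u))\<^sup>2\<close> in the supremum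
  norm. This gives Frechet differentiability of the superposition operator.\<close>

lemma superposition_C1:
  fixes F :: "real \<Rightarrow> 'a::real_normed_vector \<Rightarrow> 'b::real_normed_vector" and F' :: "real \<Rightarrow> 'a \<Rightarrow> 'a \<Rightarrow>\<^sub>L 'b"
  assumes T: "0 \<le> T" and L: "0 \<le> L"
    and contF: "continuous_on ({0..T} \<times> UNIV) (\<lambda>(t, z). F t z)"
    and contF': "continuous_on ({0..T} \<times> UNIV) (\<lambda>(t, z). F' t z)"
    and der: "\<And>t z. t \<in> {0..T} \<Longrightarrow> (F t has_derivative F' t z) (at z)"
    and lip: "\<And>t z w. t \<in> {0..T} \<Longrightarrow> norm (F' t z - F' t w) \<le> L * norm (z - w)"
  obtains N :: "(real \<Rightarrow>\<^sub>C 'a) \<Rightarrow> (real \<Rightarrow>\<^sub>C 'b)" and N' :: "(real \<Rightarrow>\<^sub>C 'a) \<Rightarrow> (real \<Rightarrow>\<^sub>C 'a) \<Rightarrow>\<^sub>L (real \<Rightarrow>\<^sub>C 'b)"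
  where "\<And>u t. apply_bcontfun (N u) t = F (clip T t) (u (clip T t))"
    "\<And>u v t. apply_bcontfun (N' u v) t = F' (clip T t) (u (clip T t)) (v (clip T t))"
    "\<And>u. (N has_derivative N' u) (at u)"
    "\<And>u v. norm (N' u - N' v) \<le> L * norm (u - v)"
    "\<And>u B. (\<And>t. t \<in> {0..T} \<Longrightarrow> norm (F' t (apply_bcontfun u t)) \<le> B) \<Longrightarrow> norm (N' u) \<le> B"
proof -
  define N where "N u = Bcontfun (\<lambda>t. F (clip T t) (apply_bcontfun u (clip T t)))" for u
  define n where "n u v = Bcontfun (\<lambda>t. F' (clip T t) (apply_bcontfun u (clip T t)) (apply_bcontfun v (clip T t)))" for u v
  have N: "apply_bcontfun (N u) t = F (clip T t) (u (clip T t))" for u t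
    unfolding N_def by (rule Bcontfun_clip_apply[OF T continuous_on_superposition[OF contF]])
  have cF'u: "continuous_on {0..T} (\<lambda>t. F' t (apply_bcontfun u t))" for u
    by (rule continuous_on_superposition[OF contF'])
  have n: "apply_bcontfun (n u v) t = F' (clip T t) (u (clip T t)) (v (clip T t))" for u v t
    unfolding n_def by (rule Bcontfun_clip_apply[OF T]) (intro continuous_intros cF'u continuous_on_apply_bcontfun)
  have nbound: "norm (n u v) \<le> B * norm v" if "\<And>t. t \<in> {0..T} \<Longrightarrow> norm (F' t (apply_bcontfun u t)) \<le> B" for u v B
  proof (rule norm_bound)
    fix t
    have "norm (F' (clip T t) (u (clip T t)) (v (clip T t))) \<le> norm (F' (clip T t) (u (clip T t))) * norm (v (clip T t))"
      by (rule norm_blinfun)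
    also have "\<dots> \<le> B * norm v"
      using that[OF clip_in[OF T, of t]] norm_bounded[of v "clip T t"] order_trans[OF norm_ge_zero that[OF clip_in[OF T, of t]]]
      by (intro mult_mono) auto
    finally show "norm (apply_bcontfun (n u v) t) \<le> B * norm v" by (simp add: n)
  qed
  have bl: "bounded_linear (n u)" for u
  proof -
    have "bounded ((\<lambda>t. F' t (apply_bcontfun u t)) ` {0..T})"
      using cF'u by (intro compact_imp_bounded compact_continuous_image) auto
    then obtain B where "\<And>t. t \<in> {0..T} \<Longrightarrow> norm (F' t (apply_bcontfun u t)) \<le> B" by (meson bounded_iff image_eqI)
    then have "norm (n u v) \<le> norm v * B" for v using nbound[of u B v] by (simp add: mult.commute)
    then show ?thesis
      by (rule bounded_linear_intro[rotated 2])
         (auto intro!: bcontfun_eqI simp: n blinfun.add_right blinfun.scaleR_right)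
  qed
  define N' where "N' u = Blinfun (n u)" for u
  have N': "blinfun_apply (N' u) v = n u v" for u v
    unfolding N'_def using bl[of u] by (simp add: bounded_linear_Blinfun_apply)
  show ?thesis
  proof (rule that[of N N'])
    show "apply_bcontfun (N u) t = F (clip T t) (u (clip T t))" for u t by (rule N)
    show "apply_bcontfun (N' u v) t = F' (clip T t) (u (clip T t)) (v (clip T t))" for u v t by (simp add: N' n)
    show "norm (N' u) \<le> B" if "\<And>t. t \<in> {0..T} \<Longrightarrow> norm (F' t (apply_bcontfun u t)) \<le> B" for u B
    proof (rule norm_blinfun_bound)
      show "0 \<le> B" using order_trans[OF norm_ge_zero that[of 0]] T by simp
      show "norm (N' u v) \<le> B * norm v" for v unfolding N' using that by (rule nbound)
    qed
    show "norm (N' u - N' v) \<le> L * norm (u - v)" for u v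
    proof (rule norm_blinfun_bound)
      fix w
      show "norm ((N' u - N' v) w) \<le> L * norm (u - v) * norm w"
      proof (rule norm_bound)
        fix t
        let ?t = "clip T t"
        have t: "?t \<in> {0..T}" using clip_in[OF T] .
        have "apply_bcontfun ((N' u - N' v) w) t = (F' ?t (u ?t) - F' ?t (v ?t)) (w ?t)"
          by (simp add: blinfun.diff_left N' n)
        also have "norm \<dots> \<le> norm (F' ?t (u ?t) - F' ?t (v ?t)) * norm (w ?t)" by (rule norm_blinfun)
        also have "\<dots> \<le> (L * norm (u - v)) * norm w"
        proof (rule mult_mono)
          have "norm (F' ?t (u ?t) - F' ?t (v ?t)) \<le> L * norm (u ?t - v ?t)" by (rule lip[OF t])
          also have "\<dots> \<le> L * norm (u - v)"
            using norm_bounded[of "u - v" ?t] L by (intro mult_left_mono) auto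
          finally show "norm (F' ?t (u ?t) - F' ?t (v ?t)) \<le> L * norm (u - v)" .
        qed (use L norm_bounded in auto)
        finally show "norm (apply_bcontfun ((N' u - N' v) w) t) \<le> L * norm (u - v) * norm w" .
      qed
    qed (use L in simp)
    show "(N has_derivative N' u) (at u)" for u
    proof (rule has_derivative_quadratic[of 1])
      fix v
      show "norm (N v - N u - N' u (v - u)) \<le> L * (norm (v - u))\<^sup>2"
      proof (rule norm_bound)
        fix t
        let ?t = "clip T t"
        have t: "?t \<in> {0..T}" using clip_in[OF T] .
        let ?r = "norm (v ?t - u ?t)"
        have "norm (F ?t (v ?t) - F ?t (u ?t) - F' ?t (u ?t) (v ?t - u ?t)) \<le> (L * ?r) * ?r"
        proof (rule derivative_near_linear_bound[where B = "cball (u ?t) ?r" and P' = "F' ?t"])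
          fix z assume "z \<in> cball (u ?t) ?r"
          then have "L * norm (z - u ?t) \<le> L * ?r"
            using L by (intro mult_left_mono) (auto simp: dist_norm norm_minus_commute)
          then show "norm (F' ?t z - F' ?t (u ?t)) \<le> L * ?r"
            using lip[OF t, of z "u ?t"] by linarith
        qed (use der[OF t] in \<open>auto simp: dist_norm norm_minus_commute intro: has_derivative_at_withinI\<close>)
        also have "\<dots> \<le> (L * norm (v - u)) * norm (v - u)"
          using norm_bounded[of "v - u" ?t] L by (intro mult_mono mult_left_mono) auto
        finally show "norm (apply_bcontfun (N v - N u - N' u (v - u)) t) \<le> L * (norm (v - u))\<^sup>2"
          by (simp add: N N' n power2_eq_square mult.assoc)
      qed
    qed simp
  qed
qed

text \<open>For a fixed \<open>u\<close> the superposition is uniformly continuous on the compact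
  set \<open>{0..T} \<times> {0..1}\<close>, which gives continuity in \<open>\<epsilon>\<close>
  with respect to the supremum norm.\<close>

lemma superposition_lipschitz:
  fixes G :: "real \<Rightarrow> 'a::real_normed_vector \<Rightarrow> real \<Rightarrow> 'b::real_normed_vector"
  assumes T: "0 \<le> T" and L: "0 \<le> L"
    and cont: "continuous_on ({0..T} \<times> UNIV \<times> {0..1}) (\<lambda>(t, z, \<epsilon>). G t z \<epsilon>)"
    and lip: "\<And>t z w \<epsilon>. t \<in> {0..T} \<Longrightarrow> \<epsilon> \<in> {0..1} \<Longrightarrow> norm (G t z \<epsilon> - G t w \<epsilon>) \<le> L * norm (z - w)"
  obtains Gn :: "real \<Rightarrow> (real \<Rightarrow>\<^sub>C 'a) \<Rightarrow> (real \<Rightarrow>\<^sub>C 'b)"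
  where "\<And>\<epsilon> u t. \<epsilon> \<in> {0..1} \<Longrightarrow> apply_bcontfun (Gn \<epsilon> u) t = G (clip T t) (u (clip T t)) \<epsilon>"
    "\<And>\<epsilon> u v. \<epsilon> \<in> {0..1} \<Longrightarrow> norm (Gn \<epsilon> u - Gn \<epsilon> v) \<le> L * norm (u - v)"
    "\<And>u. continuous_on {0..1} (\<lambda>\<epsilon>. Gn \<epsilon> u)"
proof -
  define Gn where "Gn \<epsilon> u = Bcontfun (\<lambda>t. G (clip T t) (apply_bcontfun u (clip T t)) \<epsilon>)" for \<epsilon> u
  have joint: "continuous_on ({0..T} \<times> {0..1}) (\<lambda>p. G (fst p) (apply_bcontfun u (fst p)) (snd p))" for u
  proof -
    have "continuous_on ({0..T} \<times> {0..1}) (\<lambda>p. (\<lambda>(t, z, \<epsilon>). G t z \<epsilon>) (fst p, apply_bcontfun u (fst p), snd p))"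
      by (rule continuous_on_compose2[OF cont])
         (auto intro!: continuous_intros continuous_on_compose2[OF continuous_on_apply_bcontfun])
    then show ?thesis by simp
  qed
  have Gn: "apply_bcontfun (Gn \<epsilon> u) t = G (clip T t) (u (clip T t)) \<epsilon>" if "\<epsilon> \<in> {0..1}" for \<epsilon> u t
  proof -
    have "continuous_on {0..T} (\<lambda>t. (\<lambda>p. G (fst p) (apply_bcontfun u (fst p)) (snd p)) (t, \<epsilon>))"
      by (rule continuous_on_compose2[OF joint]) (use that in \<open>auto intro!: continuous_intros\<close>)
    then have "continuous_on {0..T} (\<lambda>t. G t (apply_bcontfun u t) \<epsilon>)" by simp
    then show ?thesis unfolding Gn_def by (rule Bcontfun_clip_apply[OF T])
  qed
  show ?thesis
  proof (rule that[of Gn])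
    show "norm (Gn \<epsilon> u - Gn \<epsilon> v) \<le> L * norm (u - v)" if "\<epsilon> \<in> {0..1}" for \<epsilon> u v
    proof (rule norm_bound)
      fix t
      let ?t = "clip T t"
      have "norm (G ?t (u ?t) \<epsilon> - G ?t (v ?t) \<epsilon>) \<le> L * norm (u ?t - v ?t)"
        by (rule lip[OF clip_in[OF T] that])
      also have "\<dots> \<le> L * norm (u - v)"
        using norm_bounded[of "u - v" ?t] L by (intro mult_left_mono) auto
      finally show "norm (apply_bcontfun (Gn \<epsilon> u - Gn \<epsilon> v) t) \<le> L * norm (u - v)"
        by (simp add: Gn[OF that])
    qed
    show "continuous_on {0..1} (\<lambda>\<epsilon>. Gn \<epsilon> u)" for u
      unfolding continuous_on_iff
    proof (intro ballI allI impI)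
      fix \<epsilon> e :: real assume \<epsilon>: "\<epsilon> \<in> {0..1}" and e: "e > 0"
      have "uniformly_continuous_on ({0..T} \<times> {0..1}) (\<lambda>p. G (fst p) (apply_bcontfun u (fst p)) (snd p))"
        by (rule compact_uniformly_continuous[OF joint]) (intro compact_Times compact_Icc)
      then obtain d where d: "d > 0" "\<And>p q. p \<in> {0..T} \<times> {0..1} \<Longrightarrow> q \<in> {0..T} \<times> {0..1} \<Longrightarrow> dist q p < d \<Longrightarrow>
          dist (G (fst q) (apply_bcontfun u (fst q)) (snd q)) (G (fst p) (apply_bcontfun u (fst p)) (snd p)) < e / 2"
        unfolding uniformly_continuous_on_def using half_gt_zero[OF e] by blast
      show "\<exists>d>0. \<forall>\<epsilon>'\<in>{0..1}. dist \<epsilon>' \<epsilon> < d \<longrightarrow> dist (Gn \<epsilon>' u) (Gn \<epsilon> u) < e"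
      proof (intro exI[of _ d] conjI ballI impI d(1))
        fix \<epsilon>' assume \<epsilon>': "\<epsilon>' \<in> {0..1}" "dist \<epsilon>' \<epsilon> < d"
        have "norm (Gn \<epsilon>' u - Gn \<epsilon> u) \<le> e / 2"
        proof (rule norm_bound)
          fix t
          show "norm (apply_bcontfun (Gn \<epsilon>' u - Gn \<epsilon> u) t) \<le> e / 2"
            using d(2)[of "(clip T t, \<epsilon>)" "(clip T t, \<epsilon>')"] clip_in[OF T, of t] \<epsilon> \<epsilon>'
            by (simp add: Gn dist_Pair_Pair) (simp add: dist_norm)
        qed
        then show "dist (Gn \<epsilon>' u) (Gn \<epsilon> u) < e" using e by (simp add: dist_norm)
      qed
    qed
  qed (rule Gn)
qed

lemma has_integral_flip:
  fixes f :: "real \<Rightarrow> 'b::real_normed_vector"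
  assumes "(f has_integral i) {0..t}"
  shows "((\<lambda>s. f (t - s)) has_integral i) {0..t}"
proof -
  have "((\<lambda>x. f (- x)) has_integral i) {- t..- 0}"
    using assms by (simp only: has_integral_reflect_real)
  then have "((\<lambda>x. f (- x)) has_integral i) (cbox (- t) 0)"
    unfolding minus_zero interval_cbox .
  from has_integral_affinity'[OF this, of 1 "- t"] show ?thesis by simp
qed

text \<open>\<open>K\<close> is only strongly continuous. Away from 0 its norms are bounded, and
  this makes its application to a moving vector continuous.\<close>

lemma singular_kernel_continuous:
  fixes K :: "real \<Rightarrow> 'a::real_normed_vector \<Rightarrow>\<^sub>L 'b::real_normed_vector"
  assumes contK: "\<And>z. continuous_on {0<..T} (\<lambda>s. K s z)"
    and K: "\<And>s. s \<in> {0<..T} \<Longrightarrow> norm (K s) \<le> c * s powr (- \<beta>)" and \<beta>: "0 \<le> \<beta>" and c: "0 \<le> c"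
    and v: "continuous_on {0<..t} v" and t: "t \<le> T"
  shows "continuous_on {0<..t} (\<lambda>s. K s (v s))"
proof -
  have part: "continuous_on {a..t} (\<lambda>s. K s (v s))" if a: "0 < a" for a
  proof (rule continuous_on_lipschitz_second[where A = "{a..t}" and G = "\<lambda>s z. K s z" and e = "\<lambda>s. s"])
    fix s :: real and y z :: 'a assume s: "s \<in> {a..t}"
    have "norm (K s) \<le> c * s powr (- \<beta>)" using s a t by (intro K) auto
    also have "\<dots> \<le> c * a powr (- \<beta>)" using s a \<beta> c by (intro mult_left_mono powr_mono2') auto
    finally have "norm (K s) * norm (y - z) \<le> c * a powr (- \<beta>) * norm (y - z)" by (intro mult_right_mono) auto
    then show "norm (K s y - K s z) \<le> c * a powr (- \<beta>) * norm (y - z)"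
      using norm_blinfun[of "K s" "y - z"] by (simp add: blinfun.diff_right)
  next
    show "continuous_on {a..t} (\<lambda>s. K s z)" for z
      by (rule continuous_on_subset[OF contK]) (use a t in auto)
    show "continuous_on {a..t} v"
      by (rule continuous_on_subset[OF v]) (use a in auto)
  qed (auto intro: continuous_intros)
  show ?thesis
    unfolding continuous_on_eq_continuous_within
  proof
    fix x assume x: "x \<in> {0<..t}"
    have "continuous (at x within {x/2..t}) (\<lambda>s. K s (v s))"
      using part[of "x/2"] x by (auto simp: continuous_on_eq_continuous_within)
    moreover have "at x within {x/2..t} = at x within {0<..t}"
      by (rule at_within_nhd[of _ "{x/2<..}"]) (use x in auto)
    ultimately show "continuous (at x within {0<..t}) (\<lambda>s. K s (v s))" by simp
  qed
qed

lemma singular_kernel_integrable: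
  fixes K :: "real \<Rightarrow> 'a::real_normed_vector \<Rightarrow>\<^sub>L 'b::banach"
  assumes contK: "\<And>z. continuous_on {0<..T} (\<lambda>s. K s z)"
    and K: "\<And>s. s \<in> {0<..T} \<Longrightarrow> norm (K s) \<le> c * s powr (- \<beta>)" and \<beta>: "0 \<le> \<beta>" "\<beta> < 1" and c: "0 \<le> c"
    and v: "continuous_on {0..t} v" and t: "t \<in> {0..T}"
  shows "(\<lambda>s. K s (v s)) integrable_on {0..t}"
proof -
  have "bounded (v ` {0..t})" using v by (intro compact_imp_bounded compact_continuous_image) auto
  then obtain H where H: "\<And>s. s \<in> {0..t} \<Longrightarrow> norm (v s) \<le> H" by (meson bounded_iff image_eqI)
  have H0: "0 \<le> H" using order_trans[OF norm_ge_zero H[of 0]] t by simp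
  show ?thesis
  proof (rule integrable_singular_at_0(1)[where c = "c * H" and \<beta> = \<beta>])
    show "continuous_on {0<..t} (\<lambda>s. K s (v s))"
      by (rule singular_kernel_continuous[OF contK K \<beta>(1) c continuous_on_subset[OF v]]) (use t in auto)
    fix s assume s: "s \<in> {0<..t}"
    have "norm (K s (v s)) \<le> norm (K s) * norm (v s)" by (rule norm_blinfun)
    also have "\<dots> \<le> (c * s powr (- \<beta>)) * H"
      using s t H[of s] c by (intro mult_mono K) auto
    finally show "norm (K s (v s)) \<le> c * H * s powr (- \<beta>)" by (simp add: algebra_simps)
  qed (use t \<beta> c H0 in auto)
qed

lemma convolution_integrable:
  fixes K :: "real \<Rightarrow> 'a::real_normed_vector \<Rightarrow>\<^sub>L 'b::banach"
  assumes "\<And>z. continuous_on {0<..T} (\<lambda>s. K s z)"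
    and "\<And>s. s \<in> {0<..T} \<Longrightarrow> norm (K s) \<le> c * s powr (- \<beta>)" and "0 \<le> \<beta>" "\<beta> < 1" and "0 \<le> c"
    and v: "continuous_on {0..t} v" and t: "t \<in> {0..T}"
  shows "(\<lambda>s. K (t - s) (v s)) integrable_on {0..t}"
    "integral {0..t} (\<lambda>s. K (t - s) (v s)) = integral {0..t} (\<lambda>s. K s (v (t - s)))"
proof -
  have "continuous_on {0..t} (\<lambda>s. v (t - s))"
    by (rule continuous_on_compose2[OF v]) (auto intro!: continuous_intros)
  then have "(\<lambda>s. K s (v (t - s))) integrable_on {0..t}"
    using singular_kernel_integrable[OF assms(1-5) _ t] by blast
  from has_integral_flip[OF integrable_integral[OF this]]
  have "((\<lambda>s. K (t - s) (v s)) has_integral integral {0..t} (\<lambda>s. K s (v (t - s)))) {0..t}" by simp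
  then show "(\<lambda>s. K (t - s) (v s)) integrable_on {0..t}"
    "integral {0..t} (\<lambda>s. K (t - s) (v s)) = integral {0..t} (\<lambda>s. K s (v (t - s)))"
    by (auto simp: has_integral_integrable_integral)
qed

text \<open>Two majorants are kept apart: the power bound ensures that the integrals exist, while
  \<open>k\<close> determines the operator norm, so that an exponential weight in \<open>k\<close>
  can make that norm small.\<close>

lemma volterra_operator:
  fixes K :: "real \<Rightarrow> 'a::real_normed_vector \<Rightarrow>\<^sub>L 'b::banach" and k :: "real \<Rightarrow> real"
  assumes T: "0 \<le> T" and contK: "\<And>z. continuous_on {0<..T} (\<lambda>s. K s z)"
    and K: "\<And>s. s \<in> {0<..T} \<Longrightarrow> norm (K s) \<le> c * s powr (- \<beta>)" and \<beta>: "0 \<le> \<beta>" "\<beta> < 1" and c: "0 \<le> c"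
    and k: "k integrable_on {0..T}" and Kk: "\<And>s. s \<in> {0..T} \<Longrightarrow> norm (K s) \<le> k s"
  obtains V :: "(real \<Rightarrow>\<^sub>C 'a) \<Rightarrow>\<^sub>L (real \<Rightarrow>\<^sub>C 'b)"
  where "\<And>u t. apply_bcontfun (V u) t = integral {0..clip T t} (\<lambda>s. K (clip T t - s) (u s))"
    "norm V \<le> integral {0..T} k"
proof -
  \<comment> \<open>In this form the singularity of the kernel stays at \<open>s = 0\<close> when
    \<open>t\<close> varies.\<close>
  define W where "W u t = integral {0..t} (\<lambda>s. K s (apply_bcontfun u (t - s)))" for u t
  have cu: "continuous_on S (\<lambda>s. apply_bcontfun u (t - s))" for S u and t :: real
    by (rule continuous_on_compose2[OF continuous_on_apply_bcontfun]) (auto intro!: continuous_intros)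
  have intK: "(\<lambda>s. K s (v s)) integrable_on {0..t}" if "continuous_on {0..t} v" "t \<in> {0..T}" for t v
    by (rule singular_kernel_integrable[OF contK K \<beta> c that])
  have kpos: "0 \<le> k s" if "s \<in> {0..T}" for s using order_trans[OF norm_ge_zero Kk[OF that]] .
  have kint: "k integrable_on {a..b}" if "0 \<le> a" "b \<le> T" for a b
    using that by (intro integrable_on_subinterval[OF k]) auto
  define \<kappa> where "\<kappa> t = integral {0..t} k" for t
  have \<kappa>_mono: "\<kappa> s \<le> \<kappa> t" if "0 \<le> s" "s \<le> t" "t \<le> T" for s t
    unfolding \<kappa>_def using that kpos by (intro integral_subset_le kint) auto
  have \<kappa>0: "0 \<le> \<kappa> T" using \<kappa>_mono[of 0 T] T by (simp add: \<kappa>_def)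
  have bound: "norm (integral {a..b} (\<lambda>s. K s (v s))) \<le> H * integral {a..b} k"
    if "0 \<le> a" "b \<le> T" "0 \<le> H" and v: "\<And>s. s \<in> {a..b} \<Longrightarrow> norm (v s) \<le> H"
      and i: "(\<lambda>s. K s (v s)) integrable_on {a..b}" for a b H v
  proof -
    have "norm (integral {a..b} (\<lambda>s. K s (v s))) \<le> integral {a..b} (\<lambda>s. H * k s)"
    proof (rule integral_norm_bound_integral[OF i integrable_on_cmult_left[of k, simplified]])
      fix s assume s: "s \<in> {a..b}"
      have "norm (K s) * norm (v s) \<le> k s * H"
        using s that(1,2) v[OF s] kpos[of s] by (intro mult_mono Kk) auto
      then show "norm (K s (v s)) \<le> H * k s"
        using norm_blinfun[of "K s" "v s"] by (simp add: mult.commute)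
    qed (rule kint[OF that(1,2)])
    then show ?thesis by simp
  qed
  have W_cont: "continuous_on {0..T} (W u)" for u
  proof -
    have uc_u: "uniformly_continuous_on {0..T} (apply_bcontfun u)"
      by (rule compact_uniformly_continuous) auto
    have uc_k: "uniformly_continuous_on {0..T} \<kappa>"
      unfolding \<kappa>_def by (intro compact_uniformly_continuous indefinite_integral_continuous_1 k) auto
    have uc: "\<exists>d>0. \<forall>a\<in>{0..T}. \<forall>b\<in>{0..T}. dist b a < d \<longrightarrow> dist (u b) (u a) < e1 \<and> dist (\<kappa> b) (\<kappa> a) < e2"
      if e: "e1 > 0" "e2 > 0" for e1 e2
    proof -
      obtain d1 where d1: "d1 > 0" "\<forall>a\<in>{0..T}. \<forall>b\<in>{0..T}. dist b a < d1 \<longrightarrow> dist (u b) (u a) < e1"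
        using uc_u e(1) unfolding uniformly_continuous_on_def by blast
      obtain d2 where d2: "d2 > 0" "\<forall>a\<in>{0..T}. \<forall>b\<in>{0..T}. dist b a < d2 \<longrightarrow> dist (\<kappa> b) (\<kappa> a) < e2"
        using uc_k e(2) unfolding uniformly_continuous_on_def by blast
      show ?thesis using d1 d2 by (intro exI[of _ "min d1 d2"]) auto
    qed
    \<comment> \<open>On the common range \<open>{0..a}\<close> the modulus of continuity of
      \<open>u\<close> acts; on \<open>{a..b}\<close> the integral of \<open>k\<close> does, whose
      primitive \<open>\<kappa>\<close> is uniformly continuous.\<close>
    have step: "norm (W u b - W u a) \<le> e1 * \<kappa> T + norm u * (\<kappa> b - \<kappa> a)"
      if ab: "0 \<le> a" "a \<le> b" "b \<le> T" and e1: "0 \<le> e1"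
        and close: "\<And>s. s \<in> {0..a} \<Longrightarrow> norm (u (b - s) - u (a - s)) \<le> e1" for a b e1
    proof -
      have ib: "(\<lambda>s. K s (u (b - s))) integrable_on {0..b}" using ab by (intro intK cu) auto
      have ia: "(\<lambda>s. K s (u (b - s))) integrable_on {0..a}" "(\<lambda>s. K s (u (a - s))) integrable_on {0..a}"
        using ab by (intro intK cu; auto)+
      have iab: "(\<lambda>s. K s (u (b - s))) integrable_on {a..b}"
        using ab by (intro integrable_on_subinterval[OF ib]) auto
      have "W u b = integral {0..a} (\<lambda>s. K s (u (b - s))) + integral {a..b} (\<lambda>s. K s (u (b - s)))"
        unfolding W_def using ab ib by (simp add: Henstock_Kurzweil_Integration.integral_combine)
      moreover have "integral {0..a} (\<lambda>s. K s (u (b - s))) - W u a = integral {0..a} (\<lambda>s. K s (u (b - s) - u (a - s)))"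
        unfolding W_def using ia by (simp add: blinfun.diff_right Henstock_Kurzweil_Integration.integral_diff)
      ultimately have "W u b - W u a = integral {0..a} (\<lambda>s. K s (u (b - s) - u (a - s))) + integral {a..b} (\<lambda>s. K s (u (b - s)))"
        by (simp add: algebra_simps)
      moreover have "norm (integral {0..a} (\<lambda>s. K s (u (b - s) - u (a - s)))) \<le> e1 * integral {0..a} k"
        using ab e1 close integrable_diff[OF ia] by (intro bound) (auto simp: blinfun.diff_right)
      moreover have "e1 * integral {0..a} k \<le> e1 * \<kappa> T"
        using \<kappa>_mono[of a T] ab e1 by (intro mult_left_mono) (auto simp: \<kappa>_def)
      moreover have "norm (integral {a..b} (\<lambda>s. K s (u (b - s)))) \<le> norm u * integral {a..b} k"
        using ab iab by (intro bound) (auto simp: norm_bounded)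
      moreover have "integral {a..b} k = \<kappa> b - \<kappa> a"
        unfolding \<kappa>_def using ab Henstock_Kurzweil_Integration.integral_combine[of 0 a b k] kint by (simp add: algebra_simps)
      ultimately show ?thesis
        using norm_triangle_ineq[of "integral {0..a} (\<lambda>s. K s (u (b - s) - u (a - s)))" "integral {a..b} (\<lambda>s. K s (u (b - s)))"]
        by simp
    qed
    show ?thesis
      unfolding continuous_on_iff
    proof (intro ballI allI impI)
      fix t e :: real assume t: "t \<in> {0..T}" and e: "e > 0"
      define k1 where "k1 = \<kappa> T + 1"
      define n1 where "n1 = norm u + 1"
      define e1 where "e1 = e / (2 * k1)"
      define e2 where "e2 = e / (2 * n1)"
      have pos: "k1 > 0" "n1 > 0" using \<kappa>0 by (simp_all add: k1_def n1_def add_nonneg_pos)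
      have e12: "e1 > 0" "e2 > 0" using e pos by (simp_all add: e1_def e2_def)
      obtain d where d: "d > 0" "\<And>a b. a \<in> {0..T} \<Longrightarrow> b \<in> {0..T} \<Longrightarrow> dist b a < d \<Longrightarrow> dist (u b) (u a) < e1 \<and> dist (\<kappa> b) (\<kappa> a) < e2"
        using uc[OF e12] by blast
      have small: "e1 * \<kappa> T + norm u * e2 < e"
      proof -
        have "e1 * k1 = e / 2" "n1 * e2 = e / 2" using pos by (simp_all add: e1_def e2_def)
        then show ?thesis using e12 unfolding k1_def n1_def by (simp add: algebra_simps)
      qed
      have key: "dist (W u b) (W u a) < e" if "a \<in> {0..T}" "b \<in> {0..T}" "a \<le> b" "dist b a < d" for a b
      proof -
        have "norm (W u b - W u a) \<le> e1 * \<kappa> T + norm u * (\<kappa> b - \<kappa> a)"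
        proof (rule step)
          show "norm (u (b - s) - u (a - s)) \<le> e1" if "s \<in> {0..a}" for s
            using d(2)[of "a - s" "b - s"] that \<open>a \<in> {0..T}\<close> \<open>b \<in> {0..T}\<close> \<open>a \<le> b\<close> \<open>dist b a < d\<close>
            by (auto simp: dist_norm)
        qed (use that e12 in auto)
        also have "\<dots> \<le> e1 * \<kappa> T + norm u * e2"
          using d(2)[OF that(1,2,4)] by (intro add_left_mono mult_left_mono) (auto simp: dist_real_def)
        finally show ?thesis using small by (simp add: dist_norm)
      qed
      show "\<exists>d>0. \<forall>t'\<in>{0..T}. dist t' t < d \<longrightarrow> dist (W u t') (W u t) < e"
      proof (intro exI[of _ d] conjI ballI impI d(1))
        fix t' assume "t' \<in> {0..T}" "dist t' t < d"
        then show "dist (W u t') (W u t) < e"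
          using key[of t t'] key[of t' t] t by (cases "t \<le> t'") (auto simp: dist_commute)
      qed
    qed
  qed
  define w where "w u = Bcontfun (\<lambda>t. W u (clip T t))" for u
  have w: "apply_bcontfun (w u) t = W u (clip T t)" for u t
    unfolding w_def by (rule Bcontfun_clip_apply[OF T W_cont])
  have w_norm: "norm (w u) \<le> norm u * \<kappa> T" for u
  proof (rule norm_bound)
    fix t
    have t: "clip T t \<in> {0..T}" by (rule clip_in[OF T])
    have "norm (W u (clip T t)) \<le> norm u * integral {0..clip T t} k"
      unfolding W_def using t by (intro bound intK cu) (auto simp: norm_bounded)
    also have "\<dots> \<le> norm u * \<kappa> T"
      using \<kappa>_mono[of "clip T t" T] t by (intro mult_left_mono) (auto simp: \<kappa>_def)
    finally show "norm (apply_bcontfun (w u) t) \<le> norm u * \<kappa> T" by (simp add: w)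
  qed
  have "W (u + v) t = W u t + W v t" if "t \<in> {0..T}" for u v t
    unfolding W_def using intK[OF cu that] by (simp add: blinfun.add_right Henstock_Kurzweil_Integration.integral_add)
  moreover have "W (r *\<^sub>R u) t = r *\<^sub>R W u t" for r u t
    unfolding W_def by (simp add: blinfun.scaleR_right)
  ultimately have bl: "bounded_linear w"
    using w_norm clip_in[OF T] by (intro bounded_linear_intro[of w "\<kappa> T"]) (auto intro!: bcontfun_eqI simp: w)
  show ?thesis
  proof (rule that[of "Blinfun w"])
    show "apply_bcontfun (Blinfun w u) t = integral {0..clip T t} (\<lambda>s. K (clip T t - s) (u s))" for u t
      using convolution_integrable(2)[OF contK K \<beta> c _ clip_in[OF T, of t], where v = "apply_bcontfun u"]
      by (simp add: bounded_linear_Blinfun_apply[OF bl] w W_def)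
    show "norm (Blinfun w) \<le> integral {0..T} k"
      using w_norm \<kappa>0 by (intro norm_blinfun_bound) (auto simp: bounded_linear_Blinfun_apply[OF bl] \<kappa>_def mult.commute)
  qed
qed

text \<open>As the weight grows, the integrand tends to 0 pointwise and stays dominated by
  \<open>\<bar>c\<bar> * s powr (- \<beta>)\<close>. This smallness over all of
  \<open>{0..T}\<close> takes the place of a construction on short intervals.\<close>

lemma weighted_kernel_small:
  fixes c \<beta> T e :: real
  assumes "0 \<le> \<beta>" "\<beta> < 1" "0 \<le> T" "e > 0"
  obtains \<mu> where "\<mu> > 0" "(\<lambda>s. c * s powr (- \<beta>) * exp (- \<mu> * s)) integrable_on {0..T}"
    "integral {0..T} (\<lambda>s. c * s powr (- \<beta>) * exp (- \<mu> * s)) \<le> e"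
proof -
  define f where "f n s = c * s powr (- \<beta>) * exp (- real n * s)" for n s
  have "((\<lambda>s. \<bar>c\<bar> * s powr (- \<beta>)) has_integral \<bar>c\<bar> * (T powr (- \<beta> + 1) / (- \<beta> + 1))) {0..T}"
    using assms by (intro has_integral_mult_right has_integral_powr_from_0) auto
  then have pw: "(\<lambda>s. \<bar>c\<bar> * s powr (- \<beta>)) integrable_on {0..T}" by blast
  have int: "f n integrable_on {0..T}" for n
  proof (rule integrable_singular_at_0(1)[of T "f n" \<beta> "\<bar>c\<bar>"])
    show "continuous_on {0<..T} (f n)" unfolding f_def by (intro continuous_intros) auto
    fix s assume s: "s \<in> {0<..T}"
    have "\<bar>c\<bar> * s powr (- \<beta>) * exp (- real n * s) \<le> \<bar>c\<bar> * s powr (- \<beta>) * 1"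
      using s by (intro mult_left_mono) auto
    then show "norm (f n s) \<le> \<bar>c\<bar> * s powr (- \<beta>)" by (simp add: f_def abs_mult)
  qed (use assms in auto)
  have "(\<lambda>n. integral {0..T} (f n)) \<longlonglongrightarrow> integral {0..T} (\<lambda>s. 0)"
  proof (rule dominated_convergence(2)[OF int pw])
    show "norm (f n s) \<le> \<bar>c\<bar> * s powr (- \<beta>)" if "s \<in> {0..T}" for n s
    proof -
      have "\<bar>c\<bar> * s powr (- \<beta>) * exp (- real n * s) \<le> \<bar>c\<bar> * s powr (- \<beta>) * 1"
        using that by (intro mult_left_mono) auto
      then show ?thesis by (simp add: f_def abs_mult)
    qed
    show "(\<lambda>n. f n s) \<longlonglongrightarrow> 0" if s: "s \<in> {0..T}" for s
    proof (cases "s = 0")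
      case False
      then have "s > 0" using s by simp
      then have "exp (- s) < 1" by simp
      then have "(\<lambda>n. exp (- s) ^ n) \<longlonglongrightarrow> 0" by (intro LIMSEQ_realpow_zero) auto
      then have "(\<lambda>n. c * s powr (- \<beta>) * exp (- s) ^ n) \<longlonglongrightarrow> 0" by (rule tendsto_mult_right_zero)
      then show ?thesis by (simp add: f_def flip: exp_of_nat_mult)
    qed (simp add: f_def)
  qed
  then have "\<forall>\<^sub>F n in sequentially. integral {0..T} (f n) < e"
    using assms(4) by (auto intro: order_tendstoD)
  moreover have "\<forall>\<^sub>F n in sequentially. n > 0" by (rule eventually_gt_at_top)
  ultimately obtain n where "n > 0" "integral {0..T} (f n) < e"
    using eventually_happens'[OF sequentially_bot] eventually_conj by (metis (mono_tags, lifting))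
  then show ?thesis using int[of n] by (intro that[of "real n"]) (auto simp: f_def[abs_def])
qed

instance bcontfun :: (metric_space, banach) banach ..

text \<open>The free term \<open>\<phi>\<close> is \<open>U t \<xi>\<close> for the state equation
  and 0 for the linearised equation behind \<open>\<eta>\<close>.\<close>

definition kernel_solution ::
    "(real \<Rightarrow> 'a::real_normed_vector \<Rightarrow>\<^sub>L 'b::real_normed_vector) \<Rightarrow> (real \<Rightarrow> 'b) \<Rightarrow> (real \<Rightarrow> 'b \<Rightarrow> 'a) \<Rightarrow> real \<Rightarrow> (real \<Rightarrow> 'b) \<Rightarrow> bool" where
  "kernel_solution K \<phi> r d x \<longleftrightarrow> continuous_on {0..d} x \<and>
     (\<forall>t\<in>{0..d}. ((\<lambda>s. K (t - s) (r s (x s))) has_integral (x t - \<phi> t)) {0..t})"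

lemma kernel_solution_mono:
  assumes "kernel_solution K \<phi> r d x" "d' \<le> d"
  shows "kernel_solution K \<phi> r d' x"
  using assms by (auto simp: kernel_solution_def intro: continuous_on_subset)

text \<open>Evaluate the difference at a maximum point \<open>\<tau>\<close> of its weighted norm:
  the weight makes the integral operator contract by 1/2 there, hence the maximum is 0. A Lipschitz
  bound along the two given solutions is enough.\<close>

lemma kernel_solution_unique:
  fixes K :: "real \<Rightarrow> 'a::banach \<Rightarrow>\<^sub>L 'a"
  assumes K: "\<And>s. s \<in> {0..T} \<Longrightarrow> norm (K s) \<le> c * s powr (- \<beta>)" and \<beta>: "0 \<le> \<beta>" "\<beta> < 1" and c: "0 \<le> c"
    and d: "d \<in> {0..T}" and x: "kernel_solution K \<phi> r d x" and y: "kernel_solution K \<phi> r d y"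
    and B: "0 \<le> B" "\<And>s. s \<in> {0..d} \<Longrightarrow> norm (r s (x s) - r s (y s)) \<le> B * norm (x s - y s)"
    and t: "t \<in> {0..d}"
  shows "x t = y t"
proof -
  have "0 < 1 / (2 * (B + 1))" using B(1) by simp
  have T0: "0 \<le> T" using d by simp
  obtain \<mu> where \<mu>: "\<mu> > 0" "(\<lambda>s. c * s powr (- \<beta>) * exp (- \<mu> * s)) integrable_on {0..T}"
    "integral {0..T} (\<lambda>s. c * s powr (- \<beta>) * exp (- \<mu> * s)) \<le> 1 / (2 * (B + 1))"
    using weighted_kernel_small[OF \<beta> T0 \<open>0 < 1 / (2 * (B + 1))\<close>, of c] by blast
  let ?k = "\<lambda>s. c * s powr (- \<beta>) * exp (- \<mu> * s)"
  define w where "w t = x t - y t" for t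
  define n where "n t = exp (- \<mu> * t) * norm (w t)" for t
  have w_cont: "continuous_on {0..d} w"
    using x y by (auto simp: w_def kernel_solution_def intro!: continuous_intros)
  have "continuous_on {0..d} n" unfolding n_def by (intro continuous_intros w_cont)
  then obtain \<tau> where \<tau>: "\<tau> \<in> {0..d}" "\<And>s. s \<in> {0..d} \<Longrightarrow> n s \<le> n \<tau>"
    using continuous_attains_sup[of "{0..d}" n] d by auto
  have w_le: "norm (w s) \<le> n \<tau> * exp (\<mu> * s)" if "s \<in> {0..d}" for s
  proof -
    have "norm (w s) = n s * exp (\<mu> * s)" by (simp add: n_def flip: exp_add)
    also have "\<dots> \<le> n \<tau> * exp (\<mu> * s)" by (intro mult_right_mono \<tau>(2) that) auto
    finally show ?thesis .
  qed
  have n0: "0 \<le> n \<tau>" by (simp add: n_def)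
  have k_int: "?k integrable_on {0..\<tau>}" by (rule integrable_on_subinterval[OF \<mu>(2)]) (use \<tau>(1) d in auto)
  have kflip: "((\<lambda>s. ?k (\<tau> - s)) has_integral integral {0..\<tau>} ?k) {0..\<tau>}"
    by (rule has_integral_flip[OF integrable_integral[OF k_int]])
  have "((\<lambda>s. K (\<tau> - s) (r s (x s)) - K (\<tau> - s) (r s (y s))) has_integral ((x \<tau> - \<phi> \<tau>) - (y \<tau> - \<phi> \<tau>))) {0..\<tau>}"
    using x y \<tau>(1) by (intro has_integral_diff) (auto simp: kernel_solution_def)
  then have wi: "((\<lambda>s. K (\<tau> - s) (r s (x s) - r s (y s))) has_integral w \<tau>) {0..\<tau>}"
    by (simp add: w_def blinfun.diff_right)
  have "norm (w \<tau>) \<le> (B * n \<tau> * exp (\<mu> * \<tau>)) * integral {0..\<tau>} ?k"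
  proof -
    have "norm (integral {0..\<tau>} (\<lambda>s. K (\<tau> - s) (r s (x s) - r s (y s)))) \<le> integral {0..\<tau>} (\<lambda>s. (B * n \<tau> * exp (\<mu> * \<tau>)) * ?k (\<tau> - s))"
    proof (rule integral_norm_bound_integral)
      show "(\<lambda>s. K (\<tau> - s) (r s (x s) - r s (y s))) integrable_on {0..\<tau>}" using wi by blast
      show "(\<lambda>s. (B * n \<tau> * exp (\<mu> * \<tau>)) * ?k (\<tau> - s)) integrable_on {0..\<tau>}"
        using has_integral_mult_right[OF kflip] by blast
      fix s assume s: "s \<in> {0..\<tau>}"
      have sd: "s \<in> {0..d}" using s \<tau>(1) by auto
      have "norm (K (\<tau> - s) (r s (x s) - r s (y s))) \<le> norm (K (\<tau> - s)) * norm (r s (x s) - r s (y s))"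
        by (rule norm_blinfun)
      also have "\<dots> \<le> (c * (\<tau> - s) powr (- \<beta>)) * (B * (n \<tau> * exp (\<mu> * s)))"
      proof (rule mult_mono)
        show "norm (K (\<tau> - s)) \<le> c * (\<tau> - s) powr (- \<beta>)" using s \<tau>(1) d by (intro K) auto
        show "norm (r s (x s) - r s (y s)) \<le> B * (n \<tau> * exp (\<mu> * s))"
          using B(2)[OF sd] mult_left_mono[OF w_le[OF sd] B(1)] by (simp add: w_def)
      qed (use c in auto)
      also have "\<dots> = (B * n \<tau> * exp (\<mu> * \<tau>)) * ?k (\<tau> - s)"
      proof -
        have "exp (\<mu> * s) = exp (\<mu> * \<tau>) * exp (- \<mu> * (\<tau> - s))" by (simp add: algebra_simps flip: exp_add)
        then show ?thesis by (simp add: algebra_simps)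
      qed
      finally show "norm (K (\<tau> - s) (r s (x s) - r s (y s))) \<le> (B * n \<tau> * exp (\<mu> * \<tau>)) * ?k (\<tau> - s)" .
    qed
    moreover have "integral {0..\<tau>} (\<lambda>s. (B * n \<tau> * exp (\<mu> * \<tau>)) * ?k (\<tau> - s)) = (B * n \<tau> * exp (\<mu> * \<tau>)) * integral {0..\<tau>} ?k"
      by (rule integral_unique[OF has_integral_mult_right[OF kflip]])
    ultimately show ?thesis unfolding integral_unique[OF wi] by (rule ord_le_eq_trans)
  qed
  also have "\<dots> \<le> (B * n \<tau> * exp (\<mu> * \<tau>)) * (1 / (2 * (B + 1)))"
  proof (rule mult_left_mono)
    have "integral {0..\<tau>} ?k \<le> integral {0..T} ?k"
      using \<tau>(1) d c by (intro integral_subset_le k_int \<mu>(2)) auto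
    then show "integral {0..\<tau>} ?k \<le> 1 / (2 * (B + 1))" using \<mu>(3) by simp
  qed (use B n0 in auto)
  finally have "exp (- \<mu> * \<tau>) * norm (w \<tau>) \<le> exp (- \<mu> * \<tau>) * ((B * n \<tau> * exp (\<mu> * \<tau>)) * (1 / (2 * (B + 1))))"
    by (intro mult_left_mono) auto
  also have "\<dots> = B / (B + 1) * (n \<tau> / 2)" using B(1) by (simp add: exp_minus field_simps)
  also have "\<dots> \<le> 1 * (n \<tau> / 2)" using B(1) n0 by (intro mult_right_mono) auto
  finally have "n \<tau> \<le> n \<tau> / 2" by (simp add: n_def)
  then have "n \<tau> = 0" using n0 by linarith
  then show ?thesis using w_le[OF t] by (simp add: w_def)
qed

text \<open>
  A solution \<open>x\<close> on \<open>{0..T}\<close> is represented by \<open>\<lambda>t. exp (- \<mu> * t) *\<^sub>R x t\<close>, extended by constants to a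
  bounded continuous function on the line.
\<close>

theorem solution_family:
  fixes U K :: "real \<Rightarrow> 'a::banach \<Rightarrow>\<^sub>L 'a" and f :: "real \<Rightarrow> 'a \<Rightarrow> 'a" and f' :: "real \<Rightarrow> 'a \<Rightarrow> 'a \<Rightarrow>\<^sub>L 'a"
    and g :: "real \<Rightarrow> 'a \<Rightarrow> real \<Rightarrow> 'a"
  assumes T: "0 < T" and L: "0 \<le> L" and LG: "0 \<le> LG"
    and U: "\<And>x. continuous_on {0..T} (\<lambda>t. U t x)" "\<And>t. t \<in> {0..T} \<Longrightarrow> norm (U t) \<le> M"
    and contK: "\<And>z. continuous_on {0<..T} (\<lambda>s. K s z)"
    and K: "\<And>s. s \<in> {0..T} \<Longrightarrow> norm (K s) \<le> c * s powr (- \<beta>)" and \<beta>: "0 \<le> \<beta>" "\<beta> < 1" and c: "0 \<le> c"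
    and contf: "continuous_on ({0..T} \<times> UNIV) (\<lambda>(t, z). f t z)"
    and contf': "continuous_on ({0..T} \<times> UNIV) (\<lambda>(t, z). f' t z)"
    and der: "\<And>t z. t \<in> {0..T} \<Longrightarrow> (f t has_derivative f' t z) (at z)"
    and lip: "\<And>t z w. t \<in> {0..T} \<Longrightarrow> norm (f' t z - f' t w) \<le> L * norm (z - w)"
    and contg: "continuous_on ({0..T} \<times> UNIV \<times> {0..1}) (\<lambda>(t, z, \<epsilon>). g t z \<epsilon>)"
    and lipg: "\<And>t z w \<epsilon>. t \<in> {0..T} \<Longrightarrow> \<epsilon> \<in> {0..1} \<Longrightarrow> norm (g t z \<epsilon> - g t w \<epsilon>) \<le> LG * norm (z - w)"
    and x0: "kernel_solution K (\<lambda>t. U t \<xi>0) f T x0"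
  obtains \<rho> e0 \<Lambda> X R and P' :: "'a \<Rightarrow> 'a \<Rightarrow>\<^sub>L 'a" where "\<rho> > 0" "0 < e0" "e0 \<le> 1"
    "\<And>\<xi>. \<xi> \<in> ball \<xi>0 \<rho> \<Longrightarrow> kernel_solution K (\<lambda>t. U t \<xi>) f T (X \<xi>)"
    "\<And>\<xi>. \<xi> \<in> ball \<xi>0 \<rho> \<Longrightarrow> ((\<lambda>\<xi>. X \<xi> T) has_derivative P' \<xi>) (at \<xi>)"
    "continuous_on (ball \<xi>0 \<rho>) P'"
    "\<And>\<epsilon> \<xi>. \<epsilon> \<in> {0..e0} \<Longrightarrow> \<xi> \<in> ball \<xi>0 \<rho> \<Longrightarrow>
       \<exists>x. kernel_solution K (\<lambda>t. U t \<xi>) (\<lambda>s z. f s z + \<epsilon> *\<^sub>R g s z \<epsilon>) T x \<and> x T = X \<xi> T + \<epsilon> *\<^sub>R R \<epsilon> \<xi>"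
    "\<And>\<xi>. \<xi> \<in> ball \<xi>0 \<rho> \<Longrightarrow>
       \<exists>y. kernel_solution K (\<lambda>t. 0) (\<lambda>s z. f' s (X \<xi> s) z + g s (X \<xi> s) 0) T y \<and> y T = R 0 \<xi>"
    "continuous_on ({0..e0} \<times> ball \<xi>0 \<rho>) (\<lambda>(\<epsilon>, \<xi>). R \<epsilon> \<xi>)"
    "\<And>\<epsilon> \<xi> \<xi>'. \<epsilon> \<in> {0..e0} \<Longrightarrow> \<xi> \<in> ball \<xi>0 \<rho> \<Longrightarrow> \<xi>' \<in> ball \<xi>0 \<rho> \<Longrightarrow>
       norm (R \<epsilon> \<xi> - R \<epsilon> \<xi>') \<le> \<Lambda> * norm (\<xi> - \<xi>')"
proof -
  have T0: "0 \<le> T" using T by simp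
  have x0_cont: "continuous_on {0..T} x0" using x0 by (simp add: kernel_solution_def)
  have "continuous_on {0..T} (\<lambda>t. (\<lambda>(t, z). f' t z) (t, x0 t))"
    by (rule continuous_on_compose2[OF contf']) (auto intro!: continuous_intros x0_cont)
  then have "continuous_on {0..T} (\<lambda>t. f' t (x0 t))" by simp
  then have "bounded ((\<lambda>t. f' t (x0 t)) ` {0..T})" by (intro compact_imp_bounded compact_continuous_image) auto
  then obtain B0 where B0: "\<And>t. t \<in> {0..T} \<Longrightarrow> norm (f' t (x0 t)) \<le> B0" by (meson bounded_iff image_eqI)
  \<comment> \<open>Bound for \<open>f'\<close> in the tube of radius 1 around \<open>x0\<close>; on
    the whole space \<open>f'\<close> may be unbounded.\<close>
  define B where "B = B0 + L"
  have B: "norm (f' t z) \<le> B" if "t \<in> {0..T}" "norm (z - x0 t) \<le> 1" for t z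
  proof -
    have "norm (f' t z - f' t (x0 t)) \<le> L * 1" 
      using lip[OF that(1), of z "x0 t"] mult_left_mono[OF that(2) L] by linarith
    then show ?thesis
      using B0[OF that(1)] norm_triangle_sub[of "f' t z" "f' t (x0 t)"] by (simp add: B_def)
  qed
  have Bpos: "0 \<le> B" using order_trans[OF norm_ge_zero B[of 0 "x0 0"]] T by simp
  \<comment> \<open>Leads to \<open>norm V * B \<le> 1 / 4\<close>, as
    \<open>perturbed_solution_family\<close> demands; the summand 1 covers
    \<open>B = 0\<close>.\<close>
  have "0 < 1 / (4 * (B + 1))" using Bpos by simp
  from weighted_kernel_small[OF \<beta> T0 this, of c]
  obtain \<mu> where \<mu>: "\<mu> > 0" "(\<lambda>s. c * s powr (- \<beta>) * exp (- \<mu> * s)) integrable_on {0..T}"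
    "integral {0..T} (\<lambda>s. c * s powr (- \<beta>) * exp (- \<mu> * s)) \<le> 1 / (4 * (B + 1))" by blast
  define Km where "Km s = exp (- \<mu> * s) *\<^sub>R K s" for s
  have contKm: "continuous_on {0<..T} (\<lambda>s. Km s z)" for z
    unfolding Km_def by (simp add: scaleR_blinfun.rep_eq) (intro continuous_intros contK)
  have Km_k: "norm (Km s) \<le> c * s powr (- \<beta>) * exp (- \<mu> * s)" if "s \<in> {0..T}" for s
    using mult_right_mono[OF K[OF that], of "exp (- \<mu> * s)"] by (simp add: Km_def mult.commute)
  have Km: "norm (Km s) \<le> c * s powr (- \<beta>)" if "s \<in> {0<..T}" for s
  proof -
    have "norm (Km s) \<le> c * s powr (- \<beta>) * exp (- \<mu> * s)" using that by (intro Km_k) auto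
    also have "\<dots> \<le> c * s powr (- \<beta>) * 1" using that c \<mu>(1) by (intro mult_left_mono) auto
    finally show ?thesis by simp
  qed
  obtain V :: "(real \<Rightarrow>\<^sub>C 'a) \<Rightarrow>\<^sub>L (real \<Rightarrow>\<^sub>C 'a)"
    where V: "\<And>u t. apply_bcontfun (V u) t = integral {0..clip T t} (\<lambda>s. Km (clip T t - s) (u s))"
      "norm V \<le> integral {0..T} (\<lambda>s. c * s powr (- \<beta>) * exp (- \<mu> * s))"
    using volterra_operator[OF T0 contKm Km \<beta> c \<mu>(2) Km_k] by blast
  have small: "norm V * B \<le> 1 / 4"
  proof -
    have "norm V * B \<le> 1 / (4 * (B + 1)) * B" using V(2) \<mu>(3) Bpos by (intro mult_right_mono) auto
    also have "\<dots> \<le> 1 / 4" using Bpos by (simp add: field_simps)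
    finally show ?thesis .
  qed
  \<comment> \<open>The nonlinearities conjugated by the weight. In the derivative the two
    exponential factors cancel, so the bound \<open>B\<close> carries over to
    \<open>F'\<close>.\<close>
  define F where "F t z = exp (- \<mu> * t) *\<^sub>R f t (exp (\<mu> * t) *\<^sub>R z)" for t z
  define F' where "F' t z = f' t (exp (\<mu> * t) *\<^sub>R z)" for t z
  define G where "G t z \<epsilon> = exp (- \<mu> * t) *\<^sub>R g t (exp (\<mu> * t) *\<^sub>R z) \<epsilon>" for t z \<epsilon>
  have contF: "continuous_on ({0..T} \<times> UNIV) (\<lambda>(t, z). F t z)"
  proof -
    have "continuous_on ({0..T} \<times> UNIV) (\<lambda>p. (\<lambda>(t, z). f t z) (fst p, exp (\<mu> * fst p) *\<^sub>R snd p))"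
      by (rule continuous_on_compose2[OF contf]) (auto intro!: continuous_intros)
    then have "continuous_on ({0..T} \<times> UNIV) (\<lambda>p. exp (- \<mu> * fst p) *\<^sub>R f (fst p) (exp (\<mu> * fst p) *\<^sub>R snd p))"
      by (intro continuous_intros) simp
    then show ?thesis by (simp add: F_def case_prod_unfold)
  qed
  have contF': "continuous_on ({0..T} \<times> UNIV) (\<lambda>(t, z). F' t z)"
  proof -
    have "continuous_on ({0..T} \<times> UNIV) (\<lambda>p. (\<lambda>(t, z). f' t z) (fst p, exp (\<mu> * fst p) *\<^sub>R snd p))"
      by (rule continuous_on_compose2[OF contf']) (auto intro!: continuous_intros)
    then show ?thesis by (simp add: F'_def case_prod_unfold)
  qed
  have contG: "continuous_on ({0..T} \<times> UNIV \<times> {0..1}) (\<lambda>(t, z, \<epsilon>). G t z \<epsilon>)"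
  proof -
    have "continuous_on ({0..T} \<times> UNIV \<times> {0..1}) (\<lambda>p. (\<lambda>(t, z, \<epsilon>). g t z \<epsilon>) (fst p, exp (\<mu> * fst p) *\<^sub>R fst (snd p), snd (snd p)))"
      by (rule continuous_on_compose2[OF contg]) (auto intro!: continuous_intros)
    then have "continuous_on ({0..T} \<times> UNIV \<times> {0..1}) (\<lambda>p. exp (- \<mu> * fst p) *\<^sub>R g (fst p) (exp (\<mu> * fst p) *\<^sub>R fst (snd p)) (snd (snd p)))"
      by (intro continuous_intros) simp
    then show ?thesis by (simp add: G_def case_prod_unfold)
  qed
  have derF: "(F t has_derivative F' t z) (at z)" if t: "t \<in> {0..T}" for t z
  proof -
    have "((\<lambda>z. exp (\<mu> * t) *\<^sub>R z) has_derivative (\<lambda>h. exp (\<mu> * t) *\<^sub>R h)) (at z)"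
      by (auto intro!: derivative_eq_intros)
    from has_derivative_scaleR_right[OF has_derivative_compose[OF this der[OF t]], of "exp (- \<mu> * t)"]
    have "((\<lambda>z. F t z) has_derivative (\<lambda>h. exp (- \<mu> * t) *\<^sub>R f' t (exp (\<mu> * t) *\<^sub>R z) (exp (\<mu> * t) *\<^sub>R h))) (at z)"
      by (simp add: F_def)
    moreover have "(\<lambda>h. exp (- \<mu> * t) *\<^sub>R f' t (exp (\<mu> * t) *\<^sub>R z) (exp (\<mu> * t) *\<^sub>R h)) = F' t z"
      by (auto simp: F'_def blinfun.scaleR_right fun_eq_iff simp flip: exp_add)
    ultimately show ?thesis by simp
  qed
  have lipF: "norm (F' t z - F' t w) \<le> (L * exp (\<mu> * T)) * norm (z - w)" if t: "t \<in> {0..T}" for t z w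
  proof -
    have "norm (F' t z - F' t w) \<le> L * norm (exp (\<mu> * t) *\<^sub>R z - exp (\<mu> * t) *\<^sub>R w)"
      unfolding F'_def by (rule lip[OF t])
    also have "norm (exp (\<mu> * t) *\<^sub>R z - exp (\<mu> * t) *\<^sub>R w) = exp (\<mu> * t) * norm (z - w)"
      by (simp flip: scaleR_diff_right)
    also have "L * (exp (\<mu> * t) * norm (z - w)) \<le> L * (exp (\<mu> * T) * norm (z - w))"
      using t \<mu>(1) L by (intro mult_left_mono mult_right_mono) auto
    finally show ?thesis by (simp add: mult.assoc)
  qed
  have lipG: "norm (G t z \<epsilon> - G t w \<epsilon>) \<le> LG * norm (z - w)" if t: "t \<in> {0..T}" "\<epsilon> \<in> {0..1}" for t z w \<epsilon>
  proof -
    have "norm (G t z \<epsilon> - G t w \<epsilon>) = exp (- \<mu> * t) * norm (g t (exp (\<mu> * t) *\<^sub>R z) \<epsilon> - g t (exp (\<mu> * t) *\<^sub>R w) \<epsilon>)"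
      by (simp add: G_def flip: scaleR_diff_right)
    also have "\<dots> \<le> exp (- \<mu> * t) * (LG * norm (exp (\<mu> * t) *\<^sub>R z - exp (\<mu> * t) *\<^sub>R w))"
      by (intro mult_left_mono lipg t) simp
    also have "norm (exp (\<mu> * t) *\<^sub>R z - exp (\<mu> * t) *\<^sub>R w) = exp (\<mu> * t) * norm (z - w)"
      by (simp flip: scaleR_diff_right)
    also have "exp (- \<mu> * t) * (LG * (exp (\<mu> * t) * norm (z - w))) = LG * norm (z - w)"
      by (simp add: exp_minus field_simps)
    finally show ?thesis .
  qed

  \<comment> \<open>Reformulation in the space of bounded continuous functions\<close>
  have L': "0 \<le> L * exp (\<mu> * T)" using L by simp
  from superposition_C1[OF T0 L' contF contF' derF lipF]
  obtain N :: "(real \<Rightarrow>\<^sub>C 'a) \<Rightarrow> (real \<Rightarrow>\<^sub>C 'a)" and N' :: "(real \<Rightarrow>\<^sub>C 'a) \<Rightarrow> (real \<Rightarrow>\<^sub>C 'a) \<Rightarrow>\<^sub>L (real \<Rightarrow>\<^sub>C 'a)"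
  where N: "\<And>u t. apply_bcontfun (N u) t = F (clip T t) (u (clip T t))"
    and N': "\<And>u v t. apply_bcontfun (N' u v) t = F' (clip T t) (u (clip T t)) (v (clip T t))"
    and Nder: "\<And>u. (N has_derivative N' u) (at u)"
    and N'lip: "\<And>u v. norm (N' u - N' v) \<le> (L * exp (\<mu> * T)) * norm (u - v)"
    and N'bd: "\<And>u B. (\<And>t. t \<in> {0..T} \<Longrightarrow> norm (F' t (apply_bcontfun u t)) \<le> B) \<Longrightarrow> norm (N' u) \<le> B"
    by blast
  from superposition_lipschitz[OF T0 LG contG lipG]
  obtain Gn :: "real \<Rightarrow> (real \<Rightarrow>\<^sub>C 'a) \<Rightarrow> (real \<Rightarrow>\<^sub>C 'a)"
  where Gn: "\<And>\<epsilon> u t. \<epsilon> \<in> {0..1} \<Longrightarrow> apply_bcontfun (Gn \<epsilon> u) t = G (clip T t) (u (clip T t)) \<epsilon>"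
    and Gnlip: "\<And>\<epsilon> u v. \<epsilon> \<in> {0..1} \<Longrightarrow> norm (Gn \<epsilon> u - Gn \<epsilon> v) \<le> LG * norm (u - v)"
    and Gncont: "\<And>u. continuous_on {0..1} (\<lambda>\<epsilon>. Gn \<epsilon> u)"
    by blast
  define uh where "uh \<xi> = Bcontfun (\<lambda>t. (\<lambda>t. exp (- \<mu> * t) *\<^sub>R U t \<xi>) (clip T t))" for \<xi>
  have uh: "apply_bcontfun (uh \<xi>) t = exp (- \<mu> * clip T t) *\<^sub>R U (clip T t) \<xi>" for \<xi> t
    unfolding uh_def by (subst Bcontfun_clip_apply[OF T0]) (auto intro!: continuous_intros U)
  have uh_bl: "bounded_linear uh"
  proof (rule bounded_linear_intro)
    show "norm (uh \<xi>) \<le> norm \<xi> * M" for \<xi>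
    proof (rule norm_bound)
      fix t
      have ct: "clip T t \<in> {0..T}" by (rule clip_in[OF T0])
      have "norm (U (clip T t) \<xi>) \<le> M * norm \<xi>"
        using norm_blinfun[of "U (clip T t)" \<xi>] mult_right_mono[OF U(2)[OF ct], of "norm \<xi>"] by simp
      moreover have "exp (- \<mu> * clip T t) * norm (U (clip T t) \<xi>) \<le> 1 * norm (U (clip T t) \<xi>)"
        using ct \<mu>(1) by (intro mult_right_mono) auto
      ultimately show "norm (apply_bcontfun (uh \<xi>) t) \<le> norm \<xi> * M" by (simp add: uh mult.commute)
    qed
  qed (auto intro!: bcontfun_eqI simp: uh blinfun.add_right blinfun.scaleR_right scaleR_add_right)
  define Uh where "Uh = Blinfun uh"
  have Uh: "apply_bcontfun (Uh \<xi>) t = exp (- \<mu> * clip T t) *\<^sub>R U (clip T t) \<xi>" for \<xi> t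
    by (simp add: Uh_def bounded_linear_Blinfun_apply[OF uh_bl] uh)
  have ev_bl: "bounded_linear (\<lambda>u :: real \<Rightarrow>\<^sub>C 'a. exp (\<mu> * T) *\<^sub>R apply_bcontfun u T)"
  proof (rule bounded_linear_intro)
    show "norm (exp (\<mu> * T) *\<^sub>R apply_bcontfun u T) \<le> norm u * exp (\<mu> * T)" for u :: "real \<Rightarrow>\<^sub>C 'a"
      using norm_bounded[of u T] by simp
  qed (auto simp: scaleR_add_right)
  define ev where "ev = Blinfun (\<lambda>u :: real \<Rightarrow>\<^sub>C 'a. exp (\<mu> * T) *\<^sub>R apply_bcontfun u T)"
  have ev: "ev u = exp (\<mu> * T) *\<^sub>R apply_bcontfun u T" for u
    by (simp add: ev_def bounded_linear_Blinfun_apply[OF ev_bl])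
  define u0 where "u0 = Bcontfun (\<lambda>t. (\<lambda>t. exp (- \<mu> * t) *\<^sub>R x0 t) (clip T t))"
  have u0: "apply_bcontfun u0 t = exp (- \<mu> * clip T t) *\<^sub>R x0 (clip T t)" for t
    unfolding u0_def by (subst Bcontfun_clip_apply[OF T0]) (auto intro!: continuous_intros x0_cont)
  have Kw: "exp (\<mu> * t) *\<^sub>R Km (t - s) v = K (t - s) (exp (\<mu> * s) *\<^sub>R v)" for t s v
    by (simp add: Km_def scaleR_blinfun.rep_eq blinfun.scaleR_right algebra_simps flip: exp_add)
  \<comment> \<open>Multiplication by \<open>exp (\<mu> * t)\<close> turns the weighted convolution
    back into the one with \<open>K\<close>, applied to the unweighted function.\<close>
  have transfer: "((\<lambda>s. K (t - s) (exp (\<mu> * s) *\<^sub>R w s)) has_integral exp (\<mu> * t) *\<^sub>R apply_bcontfun (V w) t) {0..t}"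
    if t: "t \<in> {0..T}" for w :: "real \<Rightarrow>\<^sub>C 'a" and t
  proof -
    have "(\<lambda>s. Km (t - s) (apply_bcontfun w s)) integrable_on {0..t}"
      by (rule convolution_integrable(1)[OF contKm Km \<beta> c _ t]) auto
    then have "((\<lambda>s. Km (t - s) (apply_bcontfun w s)) has_integral apply_bcontfun (V w) t) {0..t}"
      by (simp add: V(1) clip_id[OF t] integrable_integral)
    from has_integral_cmul[OF this, of "exp (\<mu> * t)"] show ?thesis by (simp add: Kw)
  qed
  have u0_eq: "u0 = Uh \<xi>0 + V (N u0)"
  proof (rule bcontfun_eqI)
    fix t
    let ?t = "clip T t"
    have t: "?t \<in> {0..T}" by (rule clip_in[OF T0])
    have "((\<lambda>s. K (?t - s) (exp (\<mu> * s) *\<^sub>R N u0 s)) has_integral (x0 ?t - U ?t \<xi>0)) {0..?t}"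
    proof (rule has_integral_eq[rotated])
      show "((\<lambda>s. K (?t - s) (f s (x0 s))) has_integral (x0 ?t - U ?t \<xi>0)) {0..?t}"
        using x0 t by (simp add: kernel_solution_def)
      fix s assume "s \<in> {0..?t}"
      then have s: "clip T s = s" using t by (intro clip_id) auto
      show "K (?t - s) (f s (x0 s)) = K (?t - s) (exp (\<mu> * s) *\<^sub>R N u0 s)"
        by (simp add: N u0 s F_def flip: exp_add)
    qed
    from has_integral_unique[OF this transfer[OF t, of "N u0"]]
    have "x0 ?t - U ?t \<xi>0 = exp (\<mu> * ?t) *\<^sub>R apply_bcontfun (V (N u0)) ?t" .
    then have "exp (- \<mu> * ?t) *\<^sub>R (x0 ?t - U ?t \<xi>0) = apply_bcontfun (V (N u0)) ?t"
      by (simp flip: exp_add)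
    moreover have "apply_bcontfun (V (N u0)) ?t = apply_bcontfun (V (N u0)) t"
      by (simp add: V(1) clip_id[OF t])
    ultimately have "exp (- \<mu> * ?t) *\<^sub>R x0 ?t = exp (- \<mu> * ?t) *\<^sub>R U ?t \<xi>0 + apply_bcontfun (V (N u0)) t"
      unfolding scaleR_diff_right diff_eq_eq by (simp only: add.commute)
    then show "apply_bcontfun u0 t = apply_bcontfun (Uh \<xi>0 + V (N u0)) t"
      by (simp add: u0 Uh)
  qed
  \<comment> \<open>A weighted distance of at most \<open>exp (- \<mu> * T)\<close> from
    \<open>u0\<close> means an unweighted distance of at most 1 from \<open>x0\<close> on
    \<open>{0..T}\<close>, so the tube bound applies.\<close>
  have N'B: "norm (N' u) \<le> B" if "u \<in> cball u0 (exp (- \<mu> * T))" for u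
  proof (rule N'bd)
    fix t assume t: "t \<in> {0..T}"
    have e: "exp (\<mu> * t) *\<^sub>R apply_bcontfun u0 t = x0 t"
      by (simp add: u0 clip_id[OF t] flip: exp_add)
    have "exp (\<mu> * t) *\<^sub>R apply_bcontfun u t - x0 t = exp (\<mu> * t) *\<^sub>R apply_bcontfun (u - u0) t"
      unfolding e[symmetric] by (simp add: scaleR_diff_right)
    then have "norm (exp (\<mu> * t) *\<^sub>R apply_bcontfun u t - x0 t) = exp (\<mu> * t) * norm (apply_bcontfun (u - u0) t)"
      by simp
    also have "\<dots> \<le> exp (\<mu> * T) * exp (- \<mu> * T)"
    proof (rule mult_mono)
      show "exp (\<mu> * t) \<le> exp (\<mu> * T)" using t \<mu>(1) by simp
      have "norm (u - u0) \<le> exp (- \<mu> * T)" using that by (simp add: dist_norm norm_minus_commute)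
      then show "norm (apply_bcontfun (u - u0) t) \<le> exp (- \<mu> * T)" using norm_bounded[of "u - u0" t] by linarith
    qed auto
    also have "\<dots> = 1" by (simp flip: exp_add)
    finally show "norm (F' t (apply_bcontfun u t)) \<le> B" unfolding F'_def by (rule B[OF t])
  qed
  have \<rho>0: "exp (- \<mu> * T) > 0" by simp
  obtain \<rho> e0 \<Lambda> u y and P' :: "'a \<Rightarrow> 'a \<Rightarrow>\<^sub>L 'a" where fam: "\<rho> > 0" "0 < e0" "e0 \<le> 1"
    "\<And>\<xi>. \<xi> \<in> ball \<xi>0 \<rho> \<Longrightarrow> u \<xi> = Uh \<xi> + V (N (u \<xi>))"
    "\<And>\<xi>. \<xi> \<in> ball \<xi>0 \<rho> \<Longrightarrow> ((\<lambda>\<xi>. ev (u \<xi>)) has_derivative P' \<xi>) (at \<xi>)"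
    "continuous_on (ball \<xi>0 \<rho>) P'"
    "\<And>\<epsilon> \<xi>. \<epsilon> \<in> {0..e0} \<Longrightarrow> \<xi> \<in> ball \<xi>0 \<rho> \<Longrightarrow>
       u \<xi> + \<epsilon> *\<^sub>R y \<epsilon> \<xi> = Uh \<xi> + V (N (u \<xi> + \<epsilon> *\<^sub>R y \<epsilon> \<xi>) + \<epsilon> *\<^sub>R Gn \<epsilon> (u \<xi> + \<epsilon> *\<^sub>R y \<epsilon> \<xi>))"
    "\<And>\<xi>. \<xi> \<in> ball \<xi>0 \<rho> \<Longrightarrow> y 0 \<xi> = V (N' (u \<xi>) (y 0 \<xi>) + Gn 0 (u \<xi>))"
    "continuous_on ({0..e0} \<times> ball \<xi>0 \<rho>) (\<lambda>(\<epsilon>, \<xi>). ev (y \<epsilon> \<xi>))"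
    "\<And>\<epsilon> \<xi> \<xi>'. \<epsilon> \<in> {0..e0} \<Longrightarrow> \<xi> \<in> ball \<xi>0 \<rho> \<Longrightarrow> \<xi>' \<in> ball \<xi>0 \<rho> \<Longrightarrow>
       norm (ev (y \<epsilon> \<xi>) - ev (y \<epsilon> \<xi>')) \<le> \<Lambda> * norm (\<xi> - \<xi>')"
  proof (rule perturbed_solution_family[where Uh = Uh and V = V and N = N and N' = N' and G = Gn and ev = ev
        and ?u0.0 = u0 and ?\<xi>0.0 = \<xi>0, OF \<rho>0 L' LG Nder N'lip N'B small Gnlip Gncont u0_eq], goal_cases)
    case 3
    show ?case by (rule 3(1)) (fact 3(2-))+
  qed

  \<comment> \<open>Return to the unweighted equations\<close>
  have solves: "kernel_solution K (\<lambda>t. U t \<xi>) (\<lambda>s z. f s z + \<epsilon> *\<^sub>R g s z \<epsilon>) T (\<lambda>t. exp (\<mu> * t) *\<^sub>R apply_bcontfun w t)"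
    if \<epsilon>: "\<epsilon> \<in> {0..1}" and w: "w = Uh \<xi> + V (N w + \<epsilon> *\<^sub>R Gn \<epsilon> w)" for w \<epsilon> \<xi>
    unfolding kernel_solution_def
  proof (intro conjI ballI)
    show "continuous_on {0..T} (\<lambda>t. exp (\<mu> * t) *\<^sub>R apply_bcontfun w t)" by (intro continuous_intros) auto
    fix t assume t: "t \<in> {0..T}"
    have "apply_bcontfun w t = apply_bcontfun (Uh \<xi> + V (N w + \<epsilon> *\<^sub>R Gn \<epsilon> w)) t"
      by (rule arg_cong[OF w])
    then have "exp (\<mu> * t) *\<^sub>R apply_bcontfun w t - U t \<xi> = exp (\<mu> * t) *\<^sub>R apply_bcontfun (V (N w + \<epsilon> *\<^sub>R Gn \<epsilon> w)) t"
      by (simp add: Uh clip_id[OF t] scaleR_add_right flip: exp_add)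
    moreover have "((\<lambda>s. K (t - s) (f s (exp (\<mu> * s) *\<^sub>R apply_bcontfun w s) + \<epsilon> *\<^sub>R g s (exp (\<mu> * s) *\<^sub>R apply_bcontfun w s) \<epsilon>))
       has_integral exp (\<mu> * t) *\<^sub>R apply_bcontfun (V (N w + \<epsilon> *\<^sub>R Gn \<epsilon> w)) t) {0..t}"
    proof (rule has_integral_eq[rotated, OF transfer[OF t]])
      fix s assume "s \<in> {0..t}"
      then have s: "clip T s = s" using t by (intro clip_id) auto
      have "exp (\<mu> * s) *\<^sub>R (N w + \<epsilon> *\<^sub>R Gn \<epsilon> w) s
          = f s (exp (\<mu> * s) *\<^sub>R apply_bcontfun w s) + \<epsilon> *\<^sub>R g s (exp (\<mu> * s) *\<^sub>R apply_bcontfun w s) \<epsilon>"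
        by (simp add: N Gn[OF \<epsilon>] s F_def G_def scaleR_add_right mult.commute[of "exp _" \<epsilon>] exp_minus)
      then show "K (t - s) (exp (\<mu> * s) *\<^sub>R (N w + \<epsilon> *\<^sub>R Gn \<epsilon> w) s)
          = K (t - s) (f s (exp (\<mu> * s) *\<^sub>R apply_bcontfun w s) + \<epsilon> *\<^sub>R g s (exp (\<mu> * s) *\<^sub>R apply_bcontfun w s) \<epsilon>)"
        by simp
    qed
    ultimately show "((\<lambda>s. K (t - s) (f s (exp (\<mu> * s) *\<^sub>R apply_bcontfun w s) + \<epsilon> *\<^sub>R g s (exp (\<mu> * s) *\<^sub>R apply_bcontfun w s) \<epsilon>))
       has_integral exp (\<mu> * t) *\<^sub>R apply_bcontfun w t - U t \<xi>) {0..t}" by simp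
  qed
  define X where "X \<xi> t = exp (\<mu> * t) *\<^sub>R apply_bcontfun (u \<xi>) t" for \<xi> t
  have evX: "ev (u \<xi>) = X \<xi> T" for \<xi> by (simp add: ev X_def)
  show ?thesis
  proof (rule that[of \<rho> e0 X P' "\<lambda>\<epsilon> \<xi>. ev (y \<epsilon> \<xi>)" \<Lambda>, OF fam(1-3) _ _ fam(6) _ _ fam(9,10)])
    show "kernel_solution K (\<lambda>t. U t \<xi>) f T (X \<xi>)" if "\<xi> \<in> ball \<xi>0 \<rho>" for \<xi>
      using solves[of 0 "u \<xi>" \<xi>] fam(4)[OF that] by (simp add: X_def[abs_def])
    show "((\<lambda>\<xi>. X \<xi> T) has_derivative P' \<xi>) (at \<xi>)" if "\<xi> \<in> ball \<xi>0 \<rho>" for \<xi>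
      using fam(5)[OF that] by (simp add: evX)
    show "\<exists>x. kernel_solution K (\<lambda>t. U t \<xi>) (\<lambda>s z. f s z + \<epsilon> *\<^sub>R g s z \<epsilon>) T x \<and> x T = X \<xi> T + \<epsilon> *\<^sub>R ev (y \<epsilon> \<xi>)"
      if "\<epsilon> \<in> {0..e0}" "\<xi> \<in> ball \<xi>0 \<rho>" for \<epsilon> \<xi>
      using solves[OF _ fam(7)[OF that]] that(1) fam(3)
      by (intro exI[of _ "\<lambda>t. exp (\<mu> * t) *\<^sub>R apply_bcontfun (u \<xi> + \<epsilon> *\<^sub>R y \<epsilon> \<xi>) t"])
         (auto simp: X_def ev scaleR_add_right)
    show "\<exists>z. kernel_solution K (\<lambda>t. 0) (\<lambda>s z. f' s (X \<xi> s) z + g s (X \<xi> s) 0) T z \<and> z T = ev (y 0 \<xi>)"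
      if \<xi>: "\<xi> \<in> ball \<xi>0 \<rho>" for \<xi>
    proof (intro exI[of _ "\<lambda>t. exp (\<mu> * t) *\<^sub>R apply_bcontfun (y 0 \<xi>) t"] conjI)
      show "exp (\<mu> * T) *\<^sub>R apply_bcontfun (y 0 \<xi>) T = ev (y 0 \<xi>)" by (simp add: ev)
      show "kernel_solution K (\<lambda>t. 0) (\<lambda>s z. f' s (X \<xi> s) z + g s (X \<xi> s) 0) T (\<lambda>t. exp (\<mu> * t) *\<^sub>R apply_bcontfun (y 0 \<xi>) t)"
        unfolding kernel_solution_def
      proof (intro conjI ballI)
        show "continuous_on {0..T} (\<lambda>t. exp (\<mu> * t) *\<^sub>R apply_bcontfun (y 0 \<xi>) t)" by (intro continuous_intros) auto
        fix t assume t: "t \<in> {0..T}"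
        have "((\<lambda>s. K (t - s) (f' s (X \<xi> s) (exp (\<mu> * s) *\<^sub>R apply_bcontfun (y 0 \<xi>) s) + g s (X \<xi> s) 0))
            has_integral exp (\<mu> * t) *\<^sub>R apply_bcontfun (V (N' (u \<xi>) (y 0 \<xi>) + Gn 0 (u \<xi>))) t) {0..t}"
        proof (rule has_integral_eq[rotated, OF transfer[OF t]])
          fix s assume "s \<in> {0..t}"
          then have s: "clip T s = s" using t by (intro clip_id) auto
          have "exp (\<mu> * s) *\<^sub>R (N' (u \<xi>) (y 0 \<xi>) + Gn 0 (u \<xi>)) s
              = f' s (X \<xi> s) (exp (\<mu> * s) *\<^sub>R apply_bcontfun (y 0 \<xi>) s) + g s (X \<xi> s) 0"
            by (simp add: N' Gn s F'_def G_def X_def scaleR_add_right blinfun.scaleR_right flip: exp_add)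
          then show "K (t - s) (exp (\<mu> * s) *\<^sub>R (N' (u \<xi>) (y 0 \<xi>) + Gn 0 (u \<xi>)) s)
              = K (t - s) (f' s (X \<xi> s) (exp (\<mu> * s) *\<^sub>R apply_bcontfun (y 0 \<xi>) s) + g s (X \<xi> s) 0)"
            by simp
        qed
        then show "((\<lambda>s. K (t - s) (f' s (X \<xi> s) (exp (\<mu> * s) *\<^sub>R apply_bcontfun (y 0 \<xi>) s) + g s (X \<xi> s) 0))
            has_integral exp (\<mu> * t) *\<^sub>R apply_bcontfun (y 0 \<xi>) t - 0) {0..t}"
          using fam(8)[OF \<xi>] by simp
      qed
    qed
  qed
qed

section \<open>Persistence of zeros of nonzero degree\<close>

lemma to_coords_in_nsphere:
  fixes v :: "real ^ 'k::finite"
  assumes "norm v = 1"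
  shows "to_coords v \<in> topspace (nsphere (CARD('k) - 1))"
proof -
  have set: "{..CARD('k) - 1} = {..<CARD('k)}"
    using lessThan_Suc_atMost[of "CARD('k) - 1"] zero_less_card_finite[where 'a='k]
    by (metis Suc_diff_1)
  have "(\<Sum>i<CARD('k). (to_coords v i)\<^sup>2) = (\<Sum>j\<in>UNIV. (to_coords v (to_nat_on (UNIV :: 'k set) j))\<^sup>2)"
    using sum.reindex_bij_betw[OF to_nat_on_finite[of "UNIV :: 'k set"], of "\<lambda>i. (to_coords v i)\<^sup>2"] by simp
  also have "\<dots> = (\<Sum>j\<in>UNIV. (v $ j)\<^sup>2)"
  proof (rule sum.cong)
    fix j :: 'k
    have "to_nat_on (UNIV :: 'k set) j < CARD('k)"
      using to_nat_on_finite[of "UNIV :: 'k set"] by (auto simp: bij_betw_def)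
    then show "(to_coords v (to_nat_on (UNIV :: 'k set) j))\<^sup>2 = (v $ j)\<^sup>2"
      by (simp add: to_coords_def)
  qed simp
  also have "\<dots> = 1"
    using assms by (simp add: norm_vec_def L2_set_def)
  finally have "(\<Sum>i\<le>CARD('k) - 1. (to_coords v i)\<^sup>2) = 1" unfolding set .
  moreover have "to_coords v i = 0" if "i > CARD('k) - 1" for i
    using that by (simp add: to_coords_def)
  ultimately show ?thesis by (auto simp: nsphere)
qed

lemma continuous_map_to_coords:
  fixes F :: "'x \<Rightarrow> real ^ 'k::finite"
  assumes "continuous_map X euclidean F" and "\<And>x. x \<in> topspace X \<Longrightarrow> norm (F x) = 1"
  shows "continuous_map X (nsphere (CARD('k) - 1)) (\<lambda>x. to_coords (F x))"
proof -
  have "continuous_map X (powertop_real UNIV) (\<lambda>x. to_coords (F x))"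
    unfolding continuous_map_componentwise_UNIV
  proof
    fix i
    show "continuous_map X euclideanreal (\<lambda>x. to_coords (F x) i)"
    proof (cases "i < CARD('k)")
      case True
      have "continuous_map X euclideanreal ((\<lambda>v. v $ from_nat_into UNIV i) \<circ> F)"
        by (rule continuous_map_compose[OF assms(1)]) (simp add: continuous_intros)
      then show ?thesis using True by (simp add: to_coords_def comp_def)
    qed (simp add: to_coords_def)
  qed
  moreover have "(\<lambda>x. to_coords (F x)) \<in> topspace X \<rightarrow> topspace (nsphere (CARD('k) - 1))"
    using to_coords_in_nsphere assms(2) by blast
  ultimately show ?thesis
    unfolding nsphere by (auto simp: continuous_map_in_subtopology)
qed

lemma continuous_map_of_coords:
  "continuous_map (nsphere n) euclidean (of_coords :: _ \<Rightarrow> real ^ 'k::finite)"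
  unfolding continuous_map_atin
proof
  fix x assume x: "x \<in> topspace (nsphere n)"
  have "((of_coords :: _ \<Rightarrow> real ^ 'k) \<longlongrightarrow> of_coords x) (atin (nsphere n) x)"
  proof (rule vec_tendstoI)
    fix j :: 'k
    have "limitin euclideanreal (\<lambda>y. y (to_nat_on UNIV j)) (x (to_nat_on (UNIV :: 'k set) j)) (atin (nsphere n) x)"
      using continuous_map_nsphere_projection x unfolding continuous_map_atin by blast
    then show "((\<lambda>y. (of_coords y :: real ^ 'k) $ j) \<longlongrightarrow> of_coords x $ j) (atin (nsphere n) x)"
      by (simp add: of_coords_def)
  qed
  then show "limitin euclidean (of_coords :: _ \<Rightarrow> real ^ 'k) (of_coords x) (atin (nsphere n) x)"
    by simp
qed

text \<open>Normalisation by \<open>sgn\<close> is continuous away from 0, so a homotopy through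
  maps without zeros descends to self-maps of the sphere.\<close>

lemma sphere_homotopy:
  fixes H :: "real \<Rightarrow> real ^ 'k::finite \<Rightarrow> real ^ 'k"
  assumes cont: "continuous_on ({0..1} \<times> sphere 0 1) (\<lambda>(t, u). H t u)"
    and nz: "\<And>t u. t \<in> {0..1} \<Longrightarrow> u \<in> sphere 0 1 \<Longrightarrow> H t u \<noteq> 0"
  shows "homotopic_with (\<lambda>x. True) (nsphere (CARD('k) - 1)) (nsphere (CARD('k) - 1))
           (\<lambda>x. to_coords (sgn (H 0 (of_coords x)))) (\<lambda>x. to_coords (sgn (H 1 (of_coords x))))"
proof -
  let ?n = "CARD('k) - 1"
  let ?P = "prod_topology (top_of_set {0..1 :: real}) (nsphere ?n)"
  let ?h = "\<lambda>z. (\<lambda>(t, u). H t u) (fst z, of_coords (snd z))"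
  have fst: "continuous_map ?P euclideanreal fst"
    using continuous_map_fst continuous_map_in_subtopology by blast
  have snd: "continuous_map ?P euclidean (\<lambda>z. of_coords (snd z) :: real ^ 'k)"
    using continuous_map_compose[OF continuous_map_snd continuous_map_of_coords] by (simp add: comp_def)
  have range: "(fst z, of_coords (snd z) :: real ^ 'k) \<in> {0..1} \<times> sphere 0 1" if "z \<in> topspace ?P" for z
    using that norm_of_coords[of "snd z", where 'k = 'k] by auto
  have "continuous_map ?P euclidean (\<lambda>z. (fst z, of_coords (snd z) :: real ^ 'k))"
    unfolding continuous_map_atin
  proof
    fix z assume z: "z \<in> topspace ?P"
    have "(fst \<longlongrightarrow> fst z) (atin ?P z)"
      "((\<lambda>z. of_coords (snd z) :: real ^ 'k) \<longlongrightarrow> of_coords (snd z)) (atin ?P z)"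
      using fst[unfolded continuous_map_atin, rule_format, OF z] snd[unfolded continuous_map_atin, rule_format, OF z]
      by (simp_all only: limitin_canonical_iff)
    then show "limitin euclidean (\<lambda>z. (fst z, of_coords (snd z) :: real ^ 'k)) (fst z, of_coords (snd z)) (atin ?P z)"
      unfolding limitin_canonical_iff by (rule tendsto_Pair)
  qed
  then have "continuous_map ?P (top_of_set ({0..1} \<times> sphere 0 1)) (\<lambda>z. (fst z, of_coords (snd z) :: real ^ 'k))"
    using range by (auto simp: continuous_map_in_subtopology)
  moreover have "continuous_map (top_of_set ({0..1} \<times> sphere 0 1)) euclidean (\<lambda>(t, u). sgn (H t u))"
  proof -
    have "continuous_on ({0..1} \<times> sphere 0 1) (\<lambda>p. sgn ((\<lambda>(t, u). H t u) p))"
      by (rule continuous_on_sgn[OF cont]) (use nz in auto)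
    then show ?thesis by (simp add: case_prod_unfold)
  qed
  ultimately have "continuous_map ?P euclidean ((\<lambda>(t, u). sgn (H t u)) \<circ> (\<lambda>z. (fst z, of_coords (snd z) :: real ^ 'k)))"
    by (rule continuous_map_compose)
  then have "continuous_map ?P (nsphere ?n)
      (\<lambda>z. to_coords (((\<lambda>(t, u). sgn (H t u)) \<circ> (\<lambda>z. (fst z, of_coords (snd z) :: real ^ 'k))) z))"
    by (rule continuous_map_to_coords) (use range nz in \<open>auto simp: norm_sgn\<close>)
  then show ?thesis
    unfolding homotopic_with_def by (intro exI[of _ "\<lambda>z. to_coords (((\<lambda>(t, u). sgn (H t u)) \<circ> (\<lambda>z. (fst z, of_coords (snd z) :: real ^ 'k))) z)"]) simp
qed

text \<open>If \<open>N \<epsilon>\<close> had no zero in the ball, shrinking the radius would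
  deform its boundary map to the constant direction of \<open>N \<epsilon> a\<close>, so its degree
  would be 0. For small \<open>\<epsilon>\<close>, however, it is homotopic to the boundary map of
  \<open>F\<close>.\<close>

theorem nonzero_degree_persistent_zero:
  fixes N :: "real \<Rightarrow> real ^ 'k::finite \<Rightarrow> real ^ 'k"
  assumes r: "r > 0" and e: "e > 0"
    and cont: "continuous_on ({0..e} \<times> cball a r) (\<lambda>(\<epsilon>, h). N \<epsilon> h)"
    and F: "\<And>h. h \<in> cball a r \<Longrightarrow> N 0 h = F h"
    and nz: "\<And>h. h \<in> sphere a r \<Longrightarrow> F h \<noteq> 0"
    and deg: "brouwer_degree_ball F a r \<noteq> 0"
  obtains e' where "e' > 0" "e' \<le> e" "\<And>\<epsilon>. \<epsilon> \<in> {0..e'} \<Longrightarrow> \<exists>h\<in>cball a r. N \<epsilon> h = 0"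
proof -
  have "\<exists>e'>0. e' \<le> e \<and> (\<forall>\<epsilon>\<in>{0..e'}. \<forall>h\<in>sphere a r. N \<epsilon> h \<noteq> 0)"
  proof -
    have subs: "{0..e} \<times> sphere a r \<subseteq> {0..e} \<times> cball a r" by auto
    \<comment> \<open>The zeros over the sphere form a compact set. Its projection to the parameter
      axis is compact and misses 0, hence misses an interval around 0.\<close>
    define Z where "Z = {p \<in> {0..e} \<times> sphere a r. (\<lambda>(\<epsilon>, h). N \<epsilon> h) p = 0}"
    have "closed Z"
      unfolding Z_def
      by (rule continuous_closed_preimage_constant[OF continuous_on_subset[OF cont subs]])
         (simp add: closed_Times)
    moreover have "compact ({0..e} \<times> sphere a r)" by (intro compact_Times) auto
    moreover have "Z \<inter> ({0..e} \<times> sphere a r) = Z" by (auto simp: Z_def)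
    ultimately have "compact Z" using closed_Int_compact by metis
    then have "compact (fst ` Z)" by (intro compact_continuous_image continuous_intros)
    then have "open (- fst ` Z)" using compact_imp_closed open_Compl by blast
    moreover have "0 \<in> - fst ` Z" using F nz by (force simp: Z_def)
    ultimately obtain d where d: "d > 0" "ball 0 d \<subseteq> - fst ` Z"
      by (meson openE)
    have "\<forall>\<epsilon>\<in>{0..min e (d/2)}. \<forall>h\<in>sphere a r. N \<epsilon> h \<noteq> 0"
    proof (intro ballI notI)
      fix \<epsilon> h assume "\<epsilon> \<in> {0..min e (d/2)}" "h \<in> sphere a r" "N \<epsilon> h = 0"
      then have "(\<epsilon>, h) \<in> Z" "\<epsilon> \<in> ball 0 d" using d(1) by (auto simp: Z_def)
      then show False using d(2) by force
    qed
    then show ?thesis using e d(1) by (intro exI[of _ "min e (d/2)"]) auto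
  qed
  then obtain e' where e': "e' > 0" "e' \<le> e" "\<And>\<epsilon> h. \<epsilon> \<in> {0..e'} \<Longrightarrow> h \<in> sphere a r \<Longrightarrow> N \<epsilon> h \<noteq> 0"
    by blast
  show ?thesis
  proof (rule that[OF e'(1,2)], rule ccontr)
    fix \<epsilon> assume \<epsilon>: "\<epsilon> \<in> {0..e'}" and "\<not> (\<exists>h\<in>cball a r. N \<epsilon> h = 0)"
    then have no: "N \<epsilon> h \<noteq> 0" if "h \<in> cball a r" for h using that by blast
    let ?n = "CARD('k) - 1"
    have in1: "t * \<epsilon> \<in> {0..e'}" "a + r *\<^sub>R u \<in> sphere a r" "a + (t * r) *\<^sub>R u \<in> cball a r"
      if "t \<in> {0..1}" "u \<in> sphere 0 1" for t and u :: "real ^ 'k"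
    proof -
      have "t * \<epsilon> \<le> \<epsilon>" "t * r \<le> r" using that(1) \<epsilon> r by (simp_all add: mult_left_le_one_le)
      then show "t * \<epsilon> \<in> {0..e'}" "a + (t * r) *\<^sub>R u \<in> cball a r" "a + r *\<^sub>R u \<in> sphere a r"
        using that \<epsilon> r by (auto simp: dist_norm)
    qed
    have sub: "{0..e'} \<subseteq> {0..e}" "sphere a r \<subseteq> cball a r" using e'(2) by auto
    have \<epsilon>e: "\<epsilon> \<in> {0..e}" using \<epsilon> sub by blast
    have h1: "homotopic_with (\<lambda>x. True) (nsphere ?n) (nsphere ?n)
       (\<lambda>x. to_coords (sgn (N (0 * \<epsilon>) (a + r *\<^sub>R of_coords x)))) (\<lambda>x. to_coords (sgn (N (1 * \<epsilon>) (a + r *\<^sub>R of_coords x))))"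
    proof (rule sphere_homotopy[of "\<lambda>t u. N (t * \<epsilon>) (a + r *\<^sub>R u)"])
      have "continuous_on ({0..1} \<times> sphere 0 1) (\<lambda>z. (\<lambda>(\<epsilon>, h). N \<epsilon> h) (fst z * \<epsilon>, a + r *\<^sub>R snd z))"
      proof (rule continuous_on_compose2[OF cont])
        show "(\<lambda>z. (fst z * \<epsilon>, a + r *\<^sub>R snd z)) ` ({0..1} \<times> sphere 0 1) \<subseteq> {0..e} \<times> cball a r"
        proof (rule image_subsetI)
          fix z :: "real \<times> (real ^ 'k)" assume "z \<in> {0..1} \<times> sphere 0 1"
          then have "fst z \<in> {0..1}" "snd z \<in> sphere 0 1" by (auto simp: mem_Times_iff)
          from in1(1,2)[OF this] sub
          show "(fst z * \<epsilon>, a + r *\<^sub>R snd z) \<in> {0..e} \<times> cball a r" by blast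
        qed
      qed (intro continuous_intros)
      then show "continuous_on ({0..1} \<times> sphere 0 1) (\<lambda>(t, u). N (t * \<epsilon>) (a + r *\<^sub>R u))"
        by (simp add: case_prod_unfold)
      show "N (t * \<epsilon>) (a + r *\<^sub>R u) \<noteq> 0" if "t \<in> {0..1}" "u \<in> sphere 0 1" for t u
        using in1(1,2)[OF that] by (rule e'(3))
    qed
    have h2: "homotopic_with (\<lambda>x. True) (nsphere ?n) (nsphere ?n)
       (\<lambda>x. to_coords (sgn (N \<epsilon> (a + (0 * r) *\<^sub>R of_coords x)))) (\<lambda>x. to_coords (sgn (N \<epsilon> (a + (1 * r) *\<^sub>R of_coords x))))"
    proof (rule sphere_homotopy[of "\<lambda>t u. N \<epsilon> (a + (t * r) *\<^sub>R u)"])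
      have "continuous_on ({0..1} \<times> sphere 0 1) (\<lambda>z. (\<lambda>(\<epsilon>, h). N \<epsilon> h) (\<epsilon>, a + (fst z * r) *\<^sub>R snd z))"
      proof (rule continuous_on_compose2[OF cont])
        show "(\<lambda>z. (\<epsilon>, a + (fst z * r) *\<^sub>R snd z)) ` ({0..1} \<times> sphere 0 1) \<subseteq> {0..e} \<times> cball a r"
        proof (rule image_subsetI)
          fix z :: "real \<times> (real ^ 'k)" assume "z \<in> {0..1} \<times> sphere 0 1"
          then have "fst z \<in> {0..1}" "snd z \<in> sphere 0 1" by (auto simp: mem_Times_iff)
          from in1(3)[OF this] \<epsilon>e
          show "(\<epsilon>, a + (fst z * r) *\<^sub>R snd z) \<in> {0..e} \<times> cball a r" by blast
        qed
      qed (intro continuous_intros)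
      then show "continuous_on ({0..1} \<times> sphere 0 1) (\<lambda>(t, u). N \<epsilon> (a + (t * r) *\<^sub>R u))"
        by (simp add: case_prod_unfold)
      show "N \<epsilon> (a + (t * r) *\<^sub>R u) \<noteq> 0" if "t \<in> {0..1}" "u \<in> sphere 0 1" for t u
        using in1(3)[OF that] by (rule no)
    qed
    have "homotopic_with (\<lambda>x. True) (nsphere ?n) (nsphere ?n)
       (\<lambda>x. to_coords (sgn (N 0 (a + r *\<^sub>R of_coords x)))) (\<lambda>x. to_coords (sgn (N \<epsilon> a)))"
      using homotopic_with_trans[OF h1[unfolded mult_1] homotopic_with_symD[OF h2[unfolded mult_1]]] by simp
    then have "Brouwer_degree2 ?n (\<lambda>x. to_coords (sgn (N 0 (a + r *\<^sub>R of_coords x)))) = 0"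
      by (rule Brouwer_degree2_nullhomotopic)
    moreover have "Brouwer_degree2 ?n (\<lambda>x. to_coords (sgn (N 0 (a + r *\<^sub>R of_coords x))))
        = brouwer_degree_ball F a r"
      unfolding brouwer_degree_ball_def
      by (rule Brouwer_degree2_eq) (use r in \<open>simp add: F dist_norm norm_of_coords\<close>)
    ultimately show False using deg by simp
  qed
qed

text \<open>\<open>zero_index\<close> is a definite description. Were the degree 0 on all small
  balls, the description would denote 0; so a nonzero index yields arbitrarily small balls of
  nonzero degree, without comparing the degrees on different balls.\<close>

lemma frequently_nonzero_degree:
  assumes "zero_index a F \<noteq> 0" "\<delta> > 0"
  shows "\<exists>r. 0 < r \<and> r < \<delta> \<and> brouwer_degree_ball F a r \<noteq> 0"
proof (rule ccontr)
  assume "\<not> ?thesis"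
  then have ev: "\<forall>\<^sub>F r in at_right 0. brouwer_degree_ball F a r = 0"
    using assms(2) by (auto simp: eventually_at_right_field)
  have "zero_index a F = 0"
    unfolding zero_index_def
  proof (rule the_equality)
    fix d assume "\<forall>\<^sub>F r in at_right 0. brouwer_degree_ball F a r = d"
    with ev have "\<forall>\<^sub>F r in at_right (0::real). d = 0"
      by eventually_elim simp
    then show "d = 0" by simp
  qed (rule ev)
  then show False using assms(1) by simp
qed

section \<open>Uniform boundedness and norming functionals\<close>

text \<open>Stated for seminorms, because it is applied to integrals of
  \<open>t powr (\<alpha> - 1) * norm (U t x)\<close> as well as to operator norms. The closed sets
  \<open>E n\<close> exhaust the space, so by Baire one of them has interior points, and symmetry
  about \<open>x0\<close> moves the bound to a ball around 0.\<close>

lemma uniform_boundedness: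
  fixes p :: "'i \<Rightarrow> 'a::banach \<Rightarrow> real"
  assumes sub: "\<And>i x y. p i (x + y) \<le> p i x + p i y"
    and hom: "\<And>i c x. p i (c *\<^sub>R x) = \<bar>c\<bar> * p i x"
    and bd: "\<And>i x. p i x \<le> C i * norm x"
    and pt: "\<And>x. \<exists>B. \<forall>i. p i x \<le> B"
  obtains K where "K > 0" "\<And>i x. p i x \<le> K * norm x"
proof -
  define E where "E n = {x. \<forall>i. p i x \<le> real n}" for n :: nat
  have "closed {x. p i x \<le> real n}" for i n
  proof -
    have "(\<bar>C i\<bar>)-lipschitz_on UNIV (p i)"
    proof (rule lipschitz_onI)
      fix x y
      have "p i x - p i y \<le> p i (x - y)" "p i y - p i x \<le> p i (y - x)"
        using sub[of i "x - y" y] sub[of i "y - x" x] by simp_all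
      moreover have "C i * norm (x - y) \<le> \<bar>C i\<bar> * norm (x - y)"
        by (rule mult_right_mono) auto
      ultimately show "dist (p i x) (p i y) \<le> \<bar>C i\<bar> * dist x y"
        using bd[of i "x - y"] bd[of i "y - x"] by (simp add: dist_norm norm_minus_commute abs_le_iff)
    qed simp
    then have "continuous_on UNIV (p i)" by (rule lipschitz_on_continuous_on)
    then show ?thesis by (intro closed_Collect_le continuous_on_const) auto
  qed
  then have cl: "closed (E n)" for n unfolding E_def by (intro closed_Collect_all) auto
  have un: "\<Union> (range E) = UNIV"
  proof -
    have "\<exists>n. x \<in> E n" for x
    proof -
      obtain B where "\<forall>i. p i x \<le> B" using pt by blast
      moreover obtain n where "B \<le> real n" using real_arch_simple by blast
      ultimately show ?thesis unfolding E_def using order_trans by blast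
    qed
    then show ?thesis by auto
  qed
  have "\<exists>n. interior (E n) \<noteq> {}"
  proof (rule ccontr)
    assume "\<not> ?thesis"
    then have "Met_TC.mtopology interior_of \<Union> (range E) = {}"
      using cl by (intro Met_TC.metric_Baire_category_alt) (auto simp: complete_UNIV)
    then show False by (simp add: un)
  qed
  then obtain n x0 where "x0 \<in> interior (E n)" by blast
  then obtain e where e: "e > 0" "ball x0 e \<subseteq> E n" using mem_interior by blast
  have small: "p i z \<le> real n" if "norm z < e" for i z
  proof -
    have "x0 + z \<in> E n" "x0 - z \<in> E n" using e(2) that by (auto simp: dist_norm subset_iff)
    then have "p i (x0 + z) \<le> real n" "p i (x0 - z) \<le> real n" by (auto simp: E_def)
    moreover have "p i ((-1) *\<^sub>R (x0 - z)) = p i (x0 - z)" by (simp only: hom)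
    moreover have "2 * p i z = p i (2 *\<^sub>R z)" by (simp add: hom)
    moreover have "2 *\<^sub>R z = (x0 + z) + (-1) *\<^sub>R (x0 - z)" by (simp add: scaleR_2)
    ultimately show ?thesis using sub[of i "x0 + z" "(-1) *\<^sub>R (x0 - z)"] by simp
  qed
  \<comment> \<open>Taking \<open>real n + 1\<close> instead of \<open>real n\<close> keeps the
    constant positive when \<open>n = 0\<close>.\<close>
  have "p i x \<le> 2 * (real n + 1) / e * norm x" for i x
  proof (cases "x = 0")
    case True
    then show ?thesis using hom[of i 0 x] by simp
  next
    case False
    have "p i ((e / (2 * norm x)) *\<^sub>R x) \<le> real n"
      using False e(1) by (intro small) (simp add: field_simps)
    then have "e / (2 * norm x) * p i x \<le> real n + 1"
      using False e(1) by (simp add: hom)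
    then show ?thesis using False e(1) by (simp add: field_simps)
  qed
  then show ?thesis by (intro that[of "2 * (real n + 1) / e"]) (use e(1) in auto)
qed

lemma uniform_boundedness_blinfun:
  fixes B :: "'i \<Rightarrow> 'a::banach \<Rightarrow>\<^sub>L 'b::real_normed_vector"
  assumes "\<And>x. \<exists>C. \<forall>i. norm (B i x) \<le> C"
  obtains K where "K > 0" "\<And>i. norm (B i) \<le> K"
proof -
  obtain K where K: "K > 0" "\<And>i x. norm (B i x) \<le> K * norm x"
  proof (rule uniform_boundedness[of "\<lambda>i x. norm (B i x)" "\<lambda>i. norm (B i)"])
    show "\<exists>C. \<forall>i. norm (B i x) \<le> C" for x by (rule assms)
  qed (auto simp: blinfun.add_right blinfun.scaleR_right norm_triangle_ineq norm_blinfun)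
  then show ?thesis by (intro that[of K]) (auto intro: norm_blinfun_bound)
qed

text \<open>Homogeneity is required as an inequality only, which is convenient to verify for the
  infima below; equality follows, see \<open>sublinearD\<close>.\<close>

definition sublinear :: "('a::real_vector \<Rightarrow> real) \<Rightarrow> bool" where
  "sublinear p \<longleftrightarrow> (\<forall>x y. p (x + y) \<le> p x + p y) \<and> (\<forall>t x. 0 \<le> t \<longrightarrow> p (t *\<^sub>R x) \<le> t * p x)"

lemma sublinearD:
  assumes "sublinear p"
  shows "p (x + y) \<le> p x + p y" "0 \<le> t \<Longrightarrow> p (t *\<^sub>R x) = t * p x" "- p (- x) \<le> p x" "p 0 = 0"
proof -
  have *: "p (x + y) \<le> p x + p y" "0 \<le> t \<Longrightarrow> p (t *\<^sub>R x) \<le> t * p x" for x y t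
    using assms by (auto simp: sublinear_def)
  show 0: "p 0 = 0" using *(1)[of 0 0] *(2)[of 0 0] by simp
  show "p (x + y) \<le> p x + p y" by (rule *)
  show "- p (- x) \<le> p x" using *(1)[of x "- x"] 0 by simp
  show "p (t *\<^sub>R x) = t * p x" if "0 \<le> t"
  proof (cases "t = 0")
    case False
    then have "t * p (inverse t *\<^sub>R (t *\<^sub>R x)) \<le> p (t *\<^sub>R x)"
      using *(2)[of "inverse t" "t *\<^sub>R x"] that by (simp add: field_simps)
    then show ?thesis using *(2)[OF that, of x] False by simp
  qed (simp add: 0)
qed

text \<open>If \<open>p\<close> is minimal then \<open>q = p\<close>, and the third claim reads
  \<open>p v + p x \<le> p (v + x)\<close>, the half of additivity that sublinearity leaves
  open.\<close>

lemma sublinear_shift: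
  fixes p :: "'a::real_vector \<Rightarrow> real" and x :: 'a
  assumes p: "sublinear p"
  defines "q \<equiv> \<lambda>v. INF t\<in>{0..}. p (v + t *\<^sub>R x) - t * p x"
  shows "sublinear q" "q v \<le> p v" "q v \<le> p (v + x) - p x"
proof -
  have q_eq: "q v = (INF t\<in>{0..}. p (v + t *\<^sub>R x) - t * p x)" for v
    by (simp add: q_def)
  have bdd: "bdd_below ((\<lambda>t. p (v + t *\<^sub>R x) - t * p x) ` {0..})" for v
  proof (rule bdd_belowI2)
    fix t :: real assume "t \<in> {0..}"
    then show "- p (- v) \<le> p (v + t *\<^sub>R x) - t * p x"
      using sublinearD(1)[OF p, of "v + t *\<^sub>R x" "- v"] sublinearD(2)[OF p, of t x] by simp
  qed
  have low: "q v \<le> p (v + t *\<^sub>R x) - t * p x" if "0 \<le> t" for v t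
    unfolding q_eq using bdd that by (intro cINF_lower) auto
  show "q v \<le> p v" "q v \<le> p (v + x) - p x" using low[of 0 v] low[of 1 v] by simp_all
  have sub: "q (u + v) \<le> q u + q v" for u v
  proof -
    have "q (u + v) - (p (v + s *\<^sub>R x) - s * p x) \<le> q u" if s: "0 \<le> s" for s
      unfolding q_eq[of u]
    proof (rule cINF_greatest)
      fix t :: real assume t: "t \<in> {0..}"
      have "q (u + v) \<le> p (u + v + (t + s) *\<^sub>R x) - (t + s) * p x" using s t by (intro low) auto
      also have "p (u + v + (t + s) *\<^sub>R x) \<le> p (u + t *\<^sub>R x) + p (v + s *\<^sub>R x)"
        using sublinearD(1)[OF p, of "u + t *\<^sub>R x" "v + s *\<^sub>R x"] by (simp add: algebra_simps)
      finally have "q (u + v) - (p (v + s *\<^sub>R x) - s * p x) \<le> p (u + t *\<^sub>R x) - t * p x"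
        by (simp add: algebra_simps)
      then show "q (u + v) - (p (v + s *\<^sub>R x) - s * p x) \<le> p (u + t *\<^sub>R x) - t * p x" .
    qed auto
    then have "q (u + v) - q u \<le> p (v + s *\<^sub>R x) - s * p x" if "s \<in> {0..}" for s
      using that by (simp add: algebra_simps)
    then have "q (u + v) - q u \<le> q v"
      unfolding q_eq[of v] by (intro cINF_greatest) auto
    then show ?thesis by simp
  qed
  have "q (s *\<^sub>R v) \<le> s * q v" if s: "0 \<le> s" for s v
  proof (cases "s = 0")
    case True
    then show ?thesis using low[of 0 0] sublinearD(4)[OF p] by simp
  next
    case False
    have "q (s *\<^sub>R v) / s \<le> q v"
      unfolding q_eq[of v]
    proof (rule cINF_greatest)
      fix t :: real assume t: "t \<in> {0..}"
      have "q (s *\<^sub>R v) \<le> p (s *\<^sub>R v + (s * t) *\<^sub>R x) - (s * t) * p x" using s t by (intro low) auto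
      also have "s *\<^sub>R v + (s * t) *\<^sub>R x = s *\<^sub>R (v + t *\<^sub>R x)" by (simp add: algebra_simps)
      also have "p (s *\<^sub>R (v + t *\<^sub>R x)) = s * p (v + t *\<^sub>R x)" by (rule sublinearD(2)[OF p s])
      finally show "q (s *\<^sub>R v) / s \<le> p (v + t *\<^sub>R x) - t * p x"
        using s False by (simp add: field_simps)
    qed auto
    then show ?thesis using s False by (simp add: field_simps)
  qed
  with sub show "sublinear q" by (simp add: sublinear_def)
qed

text \<open>A minimal sublinear functional is linear, which gives the Hahn--Banach theorem.\<close>

lemma minimal_sublinear:
  fixes p :: "'a::real_vector \<Rightarrow> real"
  assumes p: "sublinear p"
  obtains m where "linear m" "\<And>v. m v \<le> p v"
proof -
  define A where "A = {q. sublinear q \<and> q \<le> p}"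
  have "\<exists>m\<in>A. \<forall>q\<in>A. q \<le> m \<longrightarrow> q = m"
  proof (rule predicate_Zorn[where P = "\<lambda>a b. b \<le> a", simplified])
    show "partial_order_on A (relation_of (\<lambda>a b. b \<le> a) A)"
      by (rule partial_order_on_relation_ofI) auto
    fix C assume C: "C \<in> Chains (relation_of (\<lambda>a b. b \<le> a) A)"
    have CA: "C \<subseteq> A" and tot: "\<And>a b. a \<in> C \<Longrightarrow> b \<in> C \<Longrightarrow> a \<le> b \<or> b \<le> a"
      using C by (auto simp: Chains_def relation_of_def)
    show "\<exists>u\<in>A. \<forall>a\<in>C. u \<le> a"
    proof (cases "C = {}")
      case True
      then show ?thesis using p by (auto simp: A_def)
    next
      case False
      define u where "u v = (INF a\<in>C. a v)" for v
      have bdd: "bdd_below ((\<lambda>a. a v) ` C)" for v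
      proof (rule bdd_belowI2)
        fix a assume "a \<in> C"
        then have "sublinear a" "a (- v) \<le> p (- v)" using CA by (auto simp: A_def le_fun_def)
        then show "- p (- v) \<le> a v" using sublinearD(3)[of a v] by linarith
      qed
      have low: "u v \<le> a v" if "a \<in> C" for a v
        unfolding u_def using bdd that by (intro cINF_lower)
      \<comment> \<open>In a chain one of \<open>a\<close> and \<open>b\<close> is the smaller one;
        its subadditivity bounds the infimum.\<close>
      have mix: "u (v + w) \<le> a v + b w" if "a \<in> C" "b \<in> C" for a b v w
      proof -
        have *: "sublinear a" "sublinear b" using that CA by (auto simp: A_def)
        consider "a \<le> b" | "b \<le> a" using tot \<open>a \<in> C\<close> \<open>b \<in> C\<close> by blast
        then show ?thesis
        proof cases
          case 1
          then show ?thesis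
            using low[OF that(1), of "v + w"] sublinearD(1)[OF *(1), of v w] le_funD[OF 1, of w] by linarith
        next
          case 2
          then show ?thesis
            using low[OF that(2), of "v + w"] sublinearD(1)[OF *(2), of v w] le_funD[OF 2, of v] by linarith
        qed
      qed
      have "u (v + w) \<le> u v + u w" for v w
      proof -
        have "u (v + w) - b w \<le> u v" if "b \<in> C" for b
          unfolding u_def[of v] using mix[OF _ that, of _ v w] False by (intro cINF_greatest) (auto simp: algebra_simps)
        then have "u (v + w) - u v \<le> u w"
          unfolding u_def[of w] using False by (intro cINF_greatest) (auto simp: algebra_simps)
        then show ?thesis by simp
      qed
      moreover have "u (t *\<^sub>R v) \<le> t * u v" if t: "0 \<le> t" for t v
      proof (cases "t = 0")
        case True
        obtain a where "a \<in> C" using False by blast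
        then show ?thesis using low[of a 0] True sublinearD(4)[of a] CA by (auto simp: A_def)
      next
        case tn: False
        have "u (t *\<^sub>R v) / t \<le> u v"
          unfolding u_def[of v]
        proof (rule cINF_greatest[OF False])
          fix a assume a: "a \<in> C"
          then have "a (t *\<^sub>R v) = t * a v" using sublinearD(2)[of a] t CA by (auto simp: A_def)
          then show "u (t *\<^sub>R v) / t \<le> a v" using low[OF a, of "t *\<^sub>R v"] t tn by (simp add: field_simps)
        qed
        then show ?thesis using t tn by (simp add: field_simps)
      qed
      ultimately have "sublinear u" by (simp add: sublinear_def)
      moreover obtain a where "a \<in> C" using False by blast
      then have "u \<le> p" using low[of a] CA by (auto simp: A_def le_fun_def intro: order_trans)
      ultimately show ?thesis using low by (intro bexI[of _ u]) (auto simp: A_def le_fun_def)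
    qed
  qed
  then obtain m where m: "sublinear m" "m \<le> p" and min: "\<And>q. sublinear q \<Longrightarrow> q \<le> m \<Longrightarrow> q = m"
    unfolding A_def by (auto intro: order_trans)
  have add: "m (v + x) = m v + m x" for v x
  proof -
    have "(\<lambda>v. INF t\<in>{0..}. m (v + t *\<^sub>R x) - t * m x) = m"
      using sublinear_shift(1,2)[OF m(1), where x = x] by (intro min) (auto simp: le_fun_def)
    then have "m v \<le> m (v + x) - m x"
      using sublinear_shift(3)[OF m(1), of v x] by (metis (no_types, lifting))
    then show ?thesis using sublinearD(1)[OF m(1), of v x] by linarith
  qed
  have neg: "m (- v) = - m v" for v
    using add[of v "- v"] sublinearD(4)[OF m(1)] by simp
  have "m (t *\<^sub>R v) = t * m v" for t v
  proof (cases "0 \<le> t")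
    case False
    then have "m ((- t) *\<^sub>R (- v)) = (- t) * m (- v)" by (intro sublinearD(2)[OF m(1)]) auto
    then show ?thesis by (simp add: neg)
  qed (rule sublinearD(2)[OF m(1)])
  then have "linear m" using add by (intro linearI) auto
  then show ?thesis using m(2) by (intro that[of m]) (auto simp: le_fun_def)
qed

text \<open>The norm shifted along \<open>x\<close> is at most \<open>- norm x\<close> at
  \<open>- x\<close>, so a linear functional below it is at least \<open>norm x\<close> at
  \<open>x\<close>. Being below the norm as well, it has exactly this value.\<close>

lemma norming_functional:
  fixes x :: "'a::real_normed_vector"
  obtains \<phi> :: "'a \<Rightarrow>\<^sub>L real" where "norm \<phi> \<le> 1" "\<phi> x = norm x"
proof -
  have n: "sublinear (norm :: 'a \<Rightarrow> real)" by (auto simp: sublinear_def norm_triangle_ineq)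
  obtain m where m: "linear m" "\<And>v. m v \<le> (INF t\<in>{0..}. norm (v + t *\<^sub>R x) - t * norm x)"
    using minimal_sublinear[OF sublinear_shift(1)[OF n, of x]] by blast
  have le: "m v \<le> norm v" for v using m(2)[of v] sublinear_shift(2)[OF n, where v = v and x = x] by linarith
  have abs: "norm (m v) \<le> norm v * 1" for v
    using le[of v] le[of "- v"] linear_neg[OF m(1), of v] by auto
  have bl: "bounded_linear m"
    by (rule bounded_linear_intro[where K = 1]) (use m(1) abs in \<open>auto simp: linear_add linear_scale\<close>)
  have "m (- x) \<le> - norm x" using m(2)[of "- x"] sublinear_shift(3)[OF n, where v = "- x" and x = x] by simp
  then have "m x = norm x" using le[of x] linear_neg[OF m(1), of x] by simp
  then show ?thesis
    using bl abs by (intro that[of "Blinfun m"]) (auto simp: bounded_linear_Blinfun_apply intro!: norm_blinfun_bound)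
qed

section \<open>Decay and smoothing of semigroups\<close>

text \<open>A sequence approaching \<open>a\<close> with unbounded norms would still converge
  pointwise, contradicting uniform boundedness. This serves both the semigroup near 0 and its
  extension to the sector.\<close>

lemma blinfun_bounded_near:
  fixes B :: "'p::metric_space \<Rightarrow> 'a::banach \<Rightarrow>\<^sub>L 'b::real_normed_vector"
  assumes lim: "\<And>v. ((\<lambda>z. B z v) \<longlongrightarrow> l v) (at a within S)"
  obtains \<delta> K where "\<delta> > 0" "K > 0" "\<And>z. z \<in> S \<Longrightarrow> z \<noteq> a \<Longrightarrow> dist z a < \<delta> \<Longrightarrow> norm (B z) \<le> K"
proof -
  have "\<exists>n. \<forall>z. z \<in> S \<longrightarrow> z \<noteq> a \<longrightarrow> dist z a < inverse (real (Suc n)) \<longrightarrow> norm (B z) \<le> real (Suc n)"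
  proof (rule ccontr)
    assume "\<not> ?thesis"
    then obtain z where z: "\<And>n. z n \<in> S" "\<And>n. z n \<noteq> a" "\<And>n. dist (z n) a < inverse (real (Suc n))"
      "\<And>n. norm (B (z n)) > real (Suc n)"
      by (metis not_le)
    have "(\<lambda>n. dist (z n) a) \<longlonglongrightarrow> 0"
      by (rule tendsto_sandwich[OF _ _ tendsto_const LIMSEQ_inverse_real_of_nat])
         (use z(3) in \<open>auto simp: less_imp_le intro!: always_eventually\<close>)
    then have "z \<longlonglongrightarrow> a" using tendsto_dist_iff by blast
    then have "filterlim z (at a within S) sequentially"
      using z by (auto simp: filterlim_at intro!: always_eventually)
    then have "(\<lambda>n. B (z n) v) \<longlonglongrightarrow> l v" for v
      using filterlim_compose[OF lim] by blast
    then have bd: "\<exists>C. \<forall>n. norm (B (z n) v) \<le> C" for v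
      using convergent_imp_Bseq[of "\<lambda>n. B (z n) v"] unfolding convergent_def Bseq_def by blast
    obtain K where "\<And>n. norm (B (z n)) \<le> K"
      by (rule uniform_boundedness_blinfun[of "\<lambda>n. B (z n)", OF bd]) blast
    moreover obtain n where "K \<le> real n" using real_arch_simple by blast
    ultimately show False using z(4)[of n] by (smt (verit) of_nat_Suc)
  qed
  then obtain n where "\<And>z. z \<in> S \<Longrightarrow> z \<noteq> a \<Longrightarrow> dist z a < inverse (real (Suc n)) \<Longrightarrow> norm (B z) \<le> real (Suc n)"
    by blast
  then show ?thesis by (intro that[of "inverse (real (Suc n))" "real (Suc n)"]) auto
qed

lemma c0_semigroupD:
  assumes "c0_semigroup U"
  shows "U 0 = id_blinfun" "0 \<le> s \<Longrightarrow> 0 \<le> t \<Longrightarrow> U (s + t) x = U s (U t x)"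
    "((\<lambda>t. U t x) \<longlongrightarrow> x) (at_right 0)"
  using assms by (auto simp: c0_semigroup_def)

lemma c0_norm_mult:
  fixes U :: "real \<Rightarrow> 'a::real_normed_vector \<Rightarrow>\<^sub>L 'a"
  assumes "c0_semigroup U" "0 \<le> s" "0 \<le> t"
  shows "norm (U (s + t)) \<le> norm (U s) * norm (U t)"
  using assms norm_blinfun_compose[of "U s" "U t"] by (simp add: c0_semigroup_def)

lemma c0_norm_power:
  fixes U :: "real \<Rightarrow> 'a::real_normed_vector \<Rightarrow>\<^sub>L 'a"
  assumes U: "c0_semigroup U" and s: "0 \<le> s" and K: "norm (U s) \<le> K"
  shows "0 < n \<Longrightarrow> norm (U (real n * s)) \<le> K ^ n"
proof (induction n)
  case (Suc n)
  show ?case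
  proof (cases "n = 0")
    case False
    then have IH: "norm (U (real n * s)) \<le> K ^ n" using Suc by simp
    have "norm (U (s + real n * s)) \<le> norm (U s) * norm (U (real n * s))"
      by (rule c0_norm_mult[OF U s]) (use s in simp)
    also have "\<dots> \<le> K * K ^ n"
      using K IH norm_ge_zero order_trans by (intro mult_mono) blast+
    finally show ?thesis by (simp add: algebra_simps)
  qed (use K in simp)
qed simp

text \<open>Uniform boundedness controls the norm near 0, and every \<open>t\<close> up to
  \<open>b\<close> is a fixed number of such small steps.\<close>

lemma c0_bounded:
  fixes U :: "real \<Rightarrow> 'a::banach \<Rightarrow>\<^sub>L 'a"
  assumes U: "c0_semigroup U"
  obtains M where "M \<ge> 1" "\<And>t. t \<in> {0..b} \<Longrightarrow> norm (U t) \<le> M"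
proof -
  obtain \<delta> K where \<delta>: "\<delta> > 0" "K > 0" "\<And>z. z \<in> {0<..} \<Longrightarrow> z \<noteq> 0 \<Longrightarrow> dist z 0 < \<delta> \<Longrightarrow> norm (U z) \<le> K"
    by (rule blinfun_bounded_near[of U "\<lambda>v. v" 0 "{0<..}"]) (auto intro: c0_semigroupD(3)[OF U])
  define K' where "K' = max 1 K"
  have K': "norm (U s) \<le> K'" if "0 \<le> s" "s < \<delta>" for s
    using \<delta>(3)[of s] that norm_blinfun_id_le[where 'a='a] by (cases "s = 0") (auto simp: K'_def c0_semigroupD(1)[OF U])
  obtain n where n: "b / \<delta> < real n" using reals_Archimedean2 by blast
  have "norm (U t) \<le> K' ^ Suc n" if t: "t \<in> {0..b}" for t
  proof -
    have "b / real (Suc n) < \<delta>" using n \<delta>(1) by (simp add: field_simps)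
    moreover have "t / real (Suc n) \<le> b / real (Suc n)" using t by (intro divide_right_mono) auto
    ultimately have "norm (U (t / real (Suc n))) \<le> K'" using t by (intro K') auto
    then have "norm (U (real (Suc n) * (t / real (Suc n)))) \<le> K' ^ Suc n"
      using t by (intro c0_norm_power[OF U]) auto
    then show ?thesis by simp
  qed
  moreover have "1 \<le> K' ^ Suc n" by (rule one_le_power) (simp add: K'_def)
  ultimately show ?thesis using that by blast
qed

lemma c0_continuous:
  fixes U :: "real \<Rightarrow> 'a::banach \<Rightarrow>\<^sub>L 'a"
  assumes U: "c0_semigroup U"
  shows "continuous_on {0..} (\<lambda>t. U t x)"
  unfolding continuous_on_iff
proof (intro ballI allI impI)
  fix t e :: real assume t: "t \<in> {0..}" and e: "e > 0"
  obtain M where M: "M \<ge> 1" "\<And>s. s \<in> {0..t+1} \<Longrightarrow> norm (U s) \<le> M" using c0_bounded[OF U] by blast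
  have "\<forall>\<^sub>F h in at_right 0. dist (U h x) x < e / M"
    using c0_semigroupD(3)[OF U, of x] e M(1) by (intro tendstoD) auto
  then obtain d where d: "d > 0" "\<And>h. 0 < h \<Longrightarrow> h < d \<Longrightarrow> dist (U h x) x < e / M"
    unfolding eventually_at_right_field by auto
  have key: "dist (U b x) (U a x) < e" if "0 \<le> a" "a \<le> b" "b \<le> t + 1" "b - a < d" for a b
  proof (cases "a = b")
    case False
    have "U b x - U a x = U a (U (b - a) x - x)"
      using c0_semigroupD(2)[OF U, of a "b - a" x] that by (simp add: blinfun.diff_right)
    also have "norm \<dots> \<le> norm (U a) * norm (U (b - a) x - x)" by (rule norm_blinfun)
    also have "\<dots> \<le> M * norm (U (b - a) x - x)" using that by (intro mult_right_mono M) auto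
    also have "\<dots> < M * (e / M)"
      using d(2)[of "b - a"] that False M(1) by (intro mult_strict_left_mono) (auto simp: dist_norm)
    finally show ?thesis using M(1) by (simp add: dist_norm)
  qed (use e in auto)
  show "\<exists>d>0. \<forall>x'\<in>{0..}. dist x' t < d \<longrightarrow> dist (U x' x) (U t x) < e"
  proof (intro exI[of _ "min d 1"] conjI ballI impI)
    fix s assume "s \<in> {0..}" "dist s t < min d 1"
    then show "dist (U s x) (U t x) < e"
      using key[of s t] key[of t s] t by (cases "s \<le> t") (auto simp: dist_real_def dist_commute)
  qed (use d in auto)
qed

text \<open>The sector is invariant under positive scaling, so a disc around 1 suffices. Radii
  proportional to \<open>t\<close> are what turns Cauchy's inequality into a bound of order
  \<open>1 / t\<close>.\<close>

lemma sector_contains_cones: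
  assumes "\<theta> > 0"
  obtains \<kappa> where "0 < \<kappa>" "\<kappa> < 1" "\<And>t. t > 0 \<Longrightarrow> cball (complex_of_real t) (\<kappa> * t) \<subseteq> sector \<theta>"
proof -
  have "isCont Arg 1" by (rule continuous_at_Arg) (simp add: complex_nonpos_Reals_iff)
  then obtain d where d: "d > 0" "\<And>z. dist z 1 < d \<Longrightarrow> dist (Arg z) (Arg 1) < \<theta>"
    using assms by (metis continuous_at_eps_delta dist_commute)
  define \<kappa> where "\<kappa> = min (d / 2) (1 / 2)"
  have \<kappa>: "0 < \<kappa>" "\<kappa> < 1" "\<kappa> < d" using d by (auto simp: \<kappa>_def)
  have "w \<in> sector \<theta>" if t: "t > 0" and w: "w \<in> cball (complex_of_real t) (\<kappa> * t)" for w t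
  proof -
    define z where "z = w / of_real t"
    have wz: "w = of_real t * z" using t by (simp add: z_def)
    have "dist w (of_real t) = t * dist z 1"
    proof -
      have "w - of_real t = of_real t * (z - 1)" by (simp add: wz algebra_simps)
      then show ?thesis using t by (simp add: dist_norm norm_mult)
    qed
    then have z: "dist z 1 \<le> \<kappa>" using w t by (simp add: dist_commute field_simps)
    then have "\<bar>Arg z\<bar> < \<theta>" using d(2)[of z] \<kappa> by (simp add: dist_real_def)
    moreover have "z \<noteq> 0" using z \<kappa> by auto
    ultimately show ?thesis using t by (simp add: sector_def wz)
  qed
  then show ?thesis using \<kappa> by (intro that[of \<kappa>]) auto
qed

text \<open>A functional norming \<open>D t x\<close>, extended complex linearly to the
  complexification, turns the orbit into a scalar holomorphic function, to which Cauchy's inequality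
  applies on a circle of radius \<open>\<kappa> * t\<close>.\<close>

lemma analytic_semigroup_derivative:
  fixes U :: "real \<Rightarrow> 'a::banach \<Rightarrow>\<^sub>L 'a"
  assumes "analytic_semigroup U"
  obtains D :: "real \<Rightarrow> 'a \<Rightarrow> 'a" and \<delta> C where "\<delta> > 0" "C > 0"
    "\<And>t x. t > 0 \<Longrightarrow> ((\<lambda>s. U s x) has_vector_derivative D t x) (at t)"
    "\<And>t x. 0 < t \<Longrightarrow> t < \<delta> \<Longrightarrow> norm (D t x) \<le> C / t * norm x"
proof -
  obtain \<theta> W where \<theta>: "0 < \<theta>" and W: "holomorphic_semigroup_on_sector \<theta> W"
    and WU: "\<And>t x y. t > 0 \<Longrightarrow> blinfun_apply (W (complex_of_real t)) (x, y) = (U t x, U t y)"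
    using assms unfolding analytic_semigroup_def by blast
  define d where "d z v = (SOME e. ((\<lambda>w. W w v) has_derivative (\<lambda>c. complex_scale c e)) (at z))" for z v
  have d: "((\<lambda>w. W w v) has_derivative (\<lambda>c. complex_scale c (d z v))) (at z)" if "z \<in> sector \<theta>" for v z
    unfolding d_def by (rule someI_ex) (use W that in \<open>unfold holomorphic_semigroup_on_sector_def, blast\<close>)
  have lim: "((\<lambda>z. W z v) \<longlongrightarrow> v) (at 0 within sector \<theta>)" for v
    using W unfolding holomorphic_semigroup_on_sector_def by blast
  obtain \<delta> K where \<delta>: "\<delta> > 0" "K > 0" "\<And>z. z \<in> sector \<theta> \<Longrightarrow> z \<noteq> 0 \<Longrightarrow> dist z 0 < \<delta> \<Longrightarrow> norm (W z) \<le> K"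
    by (rule blinfun_bounded_near[OF lim]) blast
  obtain \<kappa> where \<kappa>: "0 < \<kappa>" "\<kappa> < 1" "\<And>t. t > 0 \<Longrightarrow> cball (complex_of_real t) (\<kappa> * t) \<subseteq> sector \<theta>"
    using sector_contains_cones[OF \<theta>] by blast
  have insec: "complex_of_real t \<in> sector \<theta>" if "t > 0" for t
    using \<kappa>(3)[OF that] \<kappa>(1) that by (auto simp: subset_iff)
  define D where "D t x = fst (d (complex_of_real t) (x, 0))" for t x
  have der: "((\<lambda>s. U s x) has_vector_derivative D t x) (at t)" if t: "t > 0" for t x
  proof -
    let ?d = "d (complex_of_real t) (x, 0)"
    have "((\<lambda>s. W (complex_of_real s) (x, 0)) has_derivative (\<lambda>h. complex_scale (complex_of_real h) ?d)) (at t)"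
      using has_derivative_compose[OF bounded_linear_imp_has_derivative[OF bounded_linear_of_real] d[OF insec[OF t], of "(x, 0)"]]
      by simp
    then have "((\<lambda>s. fst (W (complex_of_real s) (x, 0))) has_derivative (\<lambda>h. fst (complex_scale (complex_of_real h) ?d))) (at t)"
      by (rule has_derivative_fst)
    then have "((\<lambda>s. fst (W (complex_of_real s) (x, 0))) has_vector_derivative D t x) (at t)"
      by (simp add: has_vector_derivative_def complex_scale_def D_def)
    then show ?thesis
      by (rule has_vector_derivative_transform_within_open[of _ _ _ "{0<..}"]) (use t WU in auto)
  qed
  \<comment> \<open>The conditions \<open>t < \<delta> / 2\<close> and \<open>\<kappa> < 1\<close>
    keep the circle inside the disc of radius \<open>\<delta>\<close> where \<open>W\<close> is
    bounded.\<close>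
  have bound: "norm (D t x) \<le> (2 * K / \<kappa>) / t * norm x" if t: "0 < t" "t < \<delta> / 2" for t x
  proof -
    obtain \<phi> :: "'a \<Rightarrow>\<^sub>L real" where \<phi>: "norm \<phi> \<le> 1" "\<phi> (D t x) = norm (D t x)"
      by (rule norming_functional)
    define \<psi> where "\<psi> v = Complex (\<phi> (fst v)) (\<phi> (snd v))" for v
    have \<psi>_bl: "bounded_linear \<psi>"
    proof -
      have "bounded_linear (\<lambda>v. of_real (\<phi> (fst v)) + \<i> * of_real (\<phi> (snd v)))"
        by (intro bounded_linear_add bounded_linear_const_mult bounded_linear_compose[OF bounded_linear_of_real]
            bounded_linear_compose[OF blinfun.bounded_linear_right] bounded_linear_fst bounded_linear_snd)
      moreover have "\<psi> = (\<lambda>v. of_real (\<phi> (fst v)) + \<i> * of_real (\<phi> (snd v)))"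
        by (auto simp: \<psi>_def complex_eq_iff fun_eq_iff)
      ultimately show ?thesis by simp
    qed
    have \<psi>_scale: "\<psi> (complex_scale c v) = \<psi> v * c" for c v
      by (auto simp: \<psi>_def complex_scale_def complex_eq_iff blinfun.add_right blinfun.diff_right blinfun.scaleR_right)
    have \<psi>_norm: "cmod (\<psi> v) \<le> 2 * norm v" for v
    proof -
      have "\<bar>\<phi> u\<bar> \<le> norm u" for u
        using norm_blinfun[of \<phi> u] mult_right_mono[OF \<phi>(1), of "norm u"] by simp
      then have "cmod (\<psi> v) \<le> norm (fst v) + norm (snd v)"
        using cmod_le[of "\<psi> v"] by (smt (verit) \<psi>_def complex.sel)
      then show ?thesis using norm_fst_le[of "fst v" "snd v"] norm_snd_le[of "snd v" "fst v"] by simp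
    qed
    define G where "G z = \<psi> (W z (x, 0))" for z
    have Gder: "(G has_field_derivative \<psi> (d z (x, 0))) (at z)" if "z \<in> sector \<theta>" for z
      unfolding has_field_derivative_def G_def
      using bounded_linear.has_derivative[OF \<psi>_bl d[OF that, of "(x, 0)"]] by (simp add: \<psi>_scale)
    have "cmod ((deriv ^^ 1) G (of_real t)) \<le> fact 1 * (2 * (K * norm x)) / (\<kappa> * t) ^ 1"
    proof (rule Cauchy_inequality)
      have sub: "cball (complex_of_real t) (\<kappa> * t) \<subseteq> sector \<theta>" using \<kappa>(3) t by blast
      have *: "G holomorphic_on cball (complex_of_real t) (\<kappa> * t)"
        using Gder sub by (meson DERIV_subset UNIV_I field_differentiable_def holomorphic_on_def subset_iff has_field_derivative_at_within)
      show "G holomorphic_on ball (complex_of_real t) (\<kappa> * t)"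
        using * ball_subset_cball holomorphic_on_subset by blast
      show "continuous_on (cball (complex_of_real t) (\<kappa> * t)) G"
        using * by (rule holomorphic_on_imp_continuous_on)
      show "0 < \<kappa> * t" using \<kappa> t by simp
      fix z assume z: "norm (complex_of_real t - z) = \<kappa> * t"
      then have zs: "z \<in> sector \<theta>" using sub by (auto simp: dist_norm)
      have "cmod z \<le> t + \<kappa> * t"
        using norm_triangle_sub[of z "complex_of_real t"] z t by (simp add: norm_minus_commute)
      also have "\<dots> < \<delta>" using mult_strict_right_mono[OF \<kappa>(2) t(1)] t(2) by simp
      finally have "norm (W z) \<le> K" using \<delta>(3)[OF zs] zs by (auto simp: sector_def)
      then have "norm (W z (x, 0)) \<le> K * norm x"
        using norm_blinfun[of "W z" "(x, 0)"] mult_right_mono[of "norm (W z)" K "norm x"] by (simp add: norm_Pair)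
      then show "cmod (G z) \<le> 2 * (K * norm x)" using \<psi>_norm[of "W z (x, 0)"] by (simp add: G_def)
    qed
    moreover have "deriv G (of_real t) = \<psi> (d (of_real t) (x, 0))"
      by (rule DERIV_imp_deriv[OF Gder[OF insec[OF t(1)]]])
    moreover have "Re (\<psi> (d (of_real t) (x, 0))) = norm (D t x)" using \<phi>(2) by (simp add: \<psi>_def D_def)
    ultimately have "norm (D t x) \<le> (2 * (K * norm x)) / (\<kappa> * t)"
      using abs_Re_le_cmod[of "\<psi> (d (of_real t) (x, 0))"] by simp
    then show ?thesis by (simp add: algebra_simps)
  qed
  show ?thesis
    by (rule that[of "\<delta> / 2" "2 * K / \<kappa>" D]) (use \<delta> \<kappa> der bound in auto)
qed

text \<open>
  Uniform boundedness turns the pointwise integrability into \<open>\<parallel>U t\<parallel> \<le> c t\<^sup>-\<^sup>\<alpha> sup {\<parallel>U s\<parallel> | s \<le> t}\<close>. So \<open>U\<close> is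
  bounded and \<open>\<parallel>U t\<parallel> \<le> c' t\<^sup>-\<^sup>\<alpha>\<close>; powers of this bound give any polynomial decay.
\<close>

lemma c0_decay:
  fixes U :: "real \<Rightarrow> 'a::banach \<Rightarrow>\<^sub>L 'a"
  assumes U: "c0_semigroup U" and \<alpha>: "0 < \<alpha>" "\<alpha> < 1"
    and fin: "\<And>x. (\<lambda>t. norm (t powr (\<alpha> - 1) *\<^sub>R U t x)) integrable_on {0..}"
  obtains C where "C > 0" "\<And>t. 0 \<le> t \<Longrightarrow> norm (U t) \<le> C / (1 + t)\<^sup>2"
proof -
  define f where "f x t = t powr (\<alpha> - 1) * norm (U t x)" for x t
  have f_int: "f x integrable_on {0..}" for x using fin[of x] by (simp add: f_def[abs_def])
  have f_int': "f x integrable_on {0..b}" for x b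
    by (rule integrable_on_subinterval[OF f_int]) auto
  have pw: "((\<lambda>t. t powr (\<alpha> - 1)) has_integral b powr \<alpha> / \<alpha>) {0..b}" if "0 \<le> b" for b
    using has_integral_powr_from_0[of "\<alpha> - 1" b] \<alpha> that by simp
  \<comment> \<open>Truncation gives seminorms that are continuous for each \<open>n\<close>; the
    assumption \<open>fin\<close> bounds them for each \<open>x\<close>, so uniform boundedness
    applies.\<close>
  define p where "p n x = integral {0..real n} (f x)" for n x
  have "\<forall>n. \<exists>M\<ge>1. \<forall>t\<in>{0..real n}. norm (U t) \<le> M" using c0_bounded[OF U] by metis
  then obtain M where M: "\<And>n t. t \<in> {0..real n} \<Longrightarrow> norm (U t) \<le> M n" by metis
  obtain C0 where C0: "C0 > 0" "\<And>n x. p n x \<le> C0 * norm x"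
  proof (rule uniform_boundedness[of p "\<lambda>n. M n * (real n powr \<alpha> / \<alpha>)"])
    fix n x y
    have "p n (x + y) \<le> integral {0..real n} (\<lambda>t. f x t + f y t)"
      unfolding p_def
    proof (rule integral_le[OF f_int' integrable_add[OF f_int' f_int']])
      fix t
      show "f (x + y) t \<le> f x t + f y t"
        unfolding f_def blinfun.add_right distrib_left[symmetric] by (intro mult_left_mono norm_triangle_ineq) simp
    qed
    then show "p n (x + y) \<le> p n x + p n y"
      using f_int' by (simp add: p_def Henstock_Kurzweil_Integration.integral_add)
  next
    fix n and c :: real and x
    have "f (c *\<^sub>R x) = (\<lambda>t. \<bar>c\<bar> * f x t)" by (auto simp: f_def blinfun.scaleR_right fun_eq_iff)
    then show "p n (c *\<^sub>R x) = \<bar>c\<bar> * p n x" by (simp add: p_def)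
  next
    fix n x
    have "p n x \<le> integral {0..real n} (\<lambda>t. (M n * norm x) * t powr (\<alpha> - 1))"
      unfolding p_def
    proof (rule integral_le[OF f_int'])
      show "(\<lambda>t. M n * norm x * t powr (\<alpha> - 1)) integrable_on {0..real n}"
        using has_integral_mult_right[OF pw[of "real n"], of "M n * norm x"] by auto
      fix t assume "t \<in> {0..real n}"
      then have "norm (U t x) \<le> M n * norm x"
        using norm_blinfun[of "U t" x] mult_right_mono[OF M, of t n "norm x"] by simp
      then have "norm (U t x) * t powr (\<alpha> - 1) \<le> M n * norm x * t powr (\<alpha> - 1)"
        by (intro mult_right_mono) auto
      then show "f x t \<le> M n * norm x * t powr (\<alpha> - 1)"
        by (simp add: f_def mult.commute)
    qed
    also have "\<dots> = (M n * norm x) * (real n powr \<alpha> / \<alpha>)"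
      by (rule integral_unique[OF has_integral_mult_right[OF pw]]) simp
    also have "\<dots> = M n * (real n powr \<alpha> / \<alpha>) * norm x" by simp
    finally show "p n x \<le> M n * (real n powr \<alpha> / \<alpha>) * norm x" .
  next
    fix x
    have "p n x \<le> integral {0..} (f x)" for n
      unfolding p_def by (rule integral_subset_le[OF _ f_int' f_int]) (auto simp: f_def)
    then show "\<exists>B. \<forall>n. p n x \<le> B" by blast
  qed blast
  \<comment> \<open>For \<open>s \<le> t\<close> one has
    \<open>norm (U t x) \<le> m * norm (U s x)\<close>. Integration against
    \<open>s powr (\<alpha> - 1)\<close> over \<open>{0..t}\<close> brings in the uniformly bounded
    integrals.\<close>
  have key: "norm (U t) \<le> \<alpha> * C0 * m * t powr (- \<alpha>)" if t: "t > 0" and m: "\<And>s. s \<in> {0..t} \<Longrightarrow> norm (U s) \<le> m" for t m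
  proof (rule norm_blinfun_bound)
    have m0: "0 \<le> m" using order_trans[OF norm_ge_zero m[of 0]] t by simp
    then show "0 \<le> \<alpha> * C0 * m * t powr (- \<alpha>)" using \<alpha> C0 by simp
    fix x
    obtain n where n: "t \<le> real n" using real_arch_simple by blast
    have "norm (U t x) * (t powr \<alpha> / \<alpha>) = integral {0..t} (\<lambda>s. norm (U t x) * s powr (\<alpha> - 1))"
      by (rule integral_unique[OF has_integral_mult_right[OF pw], symmetric]) (use t in simp)
    also have "\<dots> \<le> integral {0..t} (\<lambda>s. m * f x s)"
    proof (rule integral_le)
      show "(\<lambda>s. norm (U t x) * s powr (\<alpha> - 1)) integrable_on {0..t}"
        using has_integral_mult_right[OF pw[of t], of "norm (U t x)"] t by auto
      show "(\<lambda>s. m * f x s) integrable_on {0..t}" using integrable_on_cmult_left[OF f_int', of m] by simp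
      fix s assume s: "s \<in> {0..t}"
      have "norm (U t x) = norm (U (t - s) (U s x))" using c0_semigroupD(2)[OF U, of "t - s" s x] s by simp
      also have "\<dots> \<le> norm (U (t - s)) * norm (U s x)" by (rule norm_blinfun)
      also have "\<dots> \<le> m * norm (U s x)" using s by (intro mult_right_mono m) auto
      finally show "norm (U t x) * s powr (\<alpha> - 1) \<le> m * f x s"
        using mult_right_mono[of "norm (U t x)" "m * norm (U s x)" "s powr (\<alpha> - 1)"] by (simp add: f_def algebra_simps)
    qed
    also have "\<dots> = m * integral {0..t} (f x)" by simp
    also have "\<dots> \<le> m * p n x"
      unfolding p_def using m0 n by (intro mult_left_mono integral_subset_le f_int') (auto simp: f_def)
    also have "\<dots> \<le> m * (C0 * norm x)" using m0 C0 by (intro mult_left_mono) auto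
    finally have *: "norm (U t x) * (t powr \<alpha> / \<alpha>) \<le> m * (C0 * norm x)" .
    have "norm (U t x) = norm (U t x) * (t powr \<alpha> / \<alpha>) * (\<alpha> * t powr (- \<alpha>))"
      using t \<alpha> by (simp add: powr_minus field_simps)
    also have "\<dots> \<le> m * (C0 * norm x) * (\<alpha> * t powr (- \<alpha>))" using \<alpha> by (intro mult_right_mono *) auto
    finally show "norm (U t x) \<le> \<alpha> * C0 * m * t powr (- \<alpha>) * norm x" by (simp add: algebra_simps)
  qed
  \<comment> \<open>From \<open>t0\<close> on, \<open>key\<close> bounds the norm by half of the
    supremum \<open>m\<close>, so the supremum is governed by the interval
    \<open>{0..t0}\<close>.\<close>
  define t0 where "t0 = max 1 ((2 * \<alpha> * C0) powr (1 / \<alpha>))"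
  have t0: "t0 \<ge> 1" by (simp add: t0_def)
  have half: "\<alpha> * C0 * s powr (- \<alpha>) \<le> 1 / 2" if "s \<ge> t0" for s
  proof -
    have "2 * \<alpha> * C0 = ((2 * \<alpha> * C0) powr (1 / \<alpha>)) powr \<alpha>" using \<alpha> C0 by (simp add: powr_powr)
    also have "\<dots> \<le> s powr \<alpha>" using that \<alpha> by (intro powr_mono2) (auto simp: t0_def)
    finally have "\<alpha> * C0 \<le> s powr \<alpha> / 2" by simp
    then have "\<alpha> * C0 * s powr (- \<alpha>) \<le> s powr \<alpha> / 2 * s powr (- \<alpha>)" by (intro mult_right_mono) auto
    also have "\<dots> = 1 / 2" using that t0 by (simp add: powr_minus)
    finally show ?thesis .
  qed
  obtain m0 where m0: "m0 \<ge> 1" "\<And>t. t \<in> {0..t0} \<Longrightarrow> norm (U t) \<le> m0" using c0_bounded[OF U] by blast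
  have unif: "norm (U t) \<le> m0" if t: "0 \<le> t" for t
  proof -
    define m where "m = (SUP s\<in>{0..t}. norm (U s))"
    have "bdd_above ((\<lambda>s. norm (U s)) ` {0..t})"
      using c0_bounded[OF U, of t] by (meson bdd_aboveI2)
    then have up: "norm (U s) \<le> m" if "s \<in> {0..t}" for s unfolding m_def using that by (intro cSUP_upper)
    have mpos: "0 \<le> m" using order_trans[OF norm_ge_zero up[of 0]] t by simp
    have "m \<le> max m0 (m / 2)"
      unfolding m_def
    proof (rule cSUP_least)
      fix s assume s: "s \<in> {0..t}"
      have "norm (U s) \<le> max m0 (m / 2)"
      proof (cases "s \<le> t0")
        case True
        then show ?thesis using m0(2)[of s] s by auto
      next
        case False
        have "norm (U s) \<le> \<alpha> * C0 * m * s powr (- \<alpha>)" using False s t0 by (intro key up) auto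
        also have "\<dots> = (\<alpha> * C0 * s powr (- \<alpha>)) * m" by simp
        also have "\<dots> \<le> 1 / 2 * m" using False mpos by (intro mult_right_mono half) auto
        finally show ?thesis by simp
      qed
      then show "norm (U s) \<le> max m0 ((SUP s\<in>{0..t}. norm (U s)) / 2)" by (simp add: m_def)
    qed (use t in auto)
    then have "m \<le> m0" using mpos m0(1) by (auto simp: max_def split: if_splits)
    then show ?thesis using up[of t] t by auto
  qed
  define D where "D = \<alpha> * C0 * m0"
  have D0: "D \<ge> 0" using \<alpha> C0 m0 by (simp add: D_def)
  have Dbound: "norm (U t) \<le> D * t powr (- \<alpha>)" if "t > 0" for t
    using key[OF that unif] by (simp add: D_def)
  \<comment> \<open>Since \<open>n \<ge> 2 / \<alpha>\<close>, the \<open>n\<close>-th power of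
    \<open>D * (t / real n) powr (- \<alpha>)\<close> decays at least like
    \<open>1 / t\<^sup>2\<close>.\<close>
  define n where "n = nat \<lceil>2 / \<alpha>\<rceil>"
  have n: "2 / \<alpha> \<le> real n" by (simp add: n_def real_nat_ceiling_ge)
  have n0: "n > 0" using \<alpha> by (simp add: n_def)
  have n\<alpha>: "2 \<le> \<alpha> * real n" using n \<alpha> by (simp add: field_simps)
  define E where "E = (D * real n powr \<alpha>) ^ n"
  have E0: "E \<ge> 0" using D0 by (simp add: E_def)
  have big: "norm (U t) \<le> E / t\<^sup>2" if t: "t \<ge> 1" for t
  proof -
    have "norm (U (real n * (t / real n))) \<le> (D * (t / real n) powr (- \<alpha>)) ^ n"
      using t n0 by (intro c0_norm_power[OF U] Dbound) auto
    also have "real n * (t / real n) = t" using n0 by simp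
    also have "(t / real n) powr (- \<alpha>) = real n powr \<alpha> * t powr (- \<alpha>)"
      using t by (simp add: powr_divide powr_minus field_simps)
    also have "(D * (real n powr \<alpha> * t powr (- \<alpha>))) ^ n = E * (t powr (- \<alpha>)) ^ n"
      by (simp add: E_def power_mult_distrib)
    also have "(t powr (- \<alpha>)) ^ n = t powr (- (\<alpha> * real n))" using t by (simp add: powr_power mult.commute)
    also have "E * t powr (- (\<alpha> * real n)) \<le> E * t powr (- 2)"
      using t n\<alpha> E0 by (intro mult_left_mono powr_mono) auto
    also have "t powr (- 2) = 1 / t\<^sup>2" using t by (simp add: powr_minus_divide)
    finally show ?thesis by simp
  qed
  show ?thesis
  proof (rule that[of "4 * (m0 + E)"])
    fix t :: real assume t: "0 \<le> t"
    have pos: "(1 + t)\<^sup>2 > 0" using t by simp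
    show "norm (U t) \<le> 4 * (m0 + E) / (1 + t)\<^sup>2"
    proof (cases "t \<ge> 1")
      case True
      have "(1 + t)\<^sup>2 \<le> (2 * t)\<^sup>2" using True by (intro power_mono) auto
      then have "E / t\<^sup>2 \<le> 4 * E / (1 + t)\<^sup>2"
        using True E0 pos by (simp add: field_simps power_mult_distrib mult_left_mono)
      also have "\<dots> \<le> 4 * (m0 + E) / (1 + t)\<^sup>2" using m0 pos by (intro divide_right_mono) auto
      finally show ?thesis using big[OF True] by linarith
    next
      case False
      have "(1 + t)\<^sup>2 \<le> 2\<^sup>2" using False t by (intro power_mono) auto
      then have "m0 * (1 + t)\<^sup>2 \<le> m0 * 4" using m0 by (intro mult_left_mono) auto
      then have "m0 \<le> 4 * m0 / (1 + t)\<^sup>2" using pos by (simp add: field_simps)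
      also have "\<dots> \<le> 4 * (m0 + E) / (1 + t)\<^sup>2" using E0 pos by (intro divide_right_mono) auto
      finally show ?thesis using unif[OF t] by linarith
    qed
  qed (use m0 E0 in auto)
qed

text \<open>Close to 0 Cauchy's inequality applies; later \<open>D u x = U (u - a) (D a x)\<close>
  inherits the decay of \<open>U\<close>. In the integral for the preimage the rate
  \<open>1 / t\<close> is used near 0 and \<open>1 / t\<^sup>2\<close> at infinity.\<close>

lemma analytic_derivative_bounds:
  fixes U :: "real \<Rightarrow> 'a::banach \<Rightarrow>\<^sub>L 'a"
  assumes U: "c0_semigroup U" and an: "analytic_semigroup U"
    and dec: "C > 0" "\<And>t. 0 \<le> t \<Longrightarrow> norm (U t) \<le> C / (1 + t)\<^sup>2"
  obtains D :: "real \<Rightarrow> 'a \<Rightarrow> 'a" and B where "B > 0"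
    "\<And>t x. t > 0 \<Longrightarrow> ((\<lambda>s. U s x) has_vector_derivative D t x) (at t)"
    "\<And>t s x. t > 0 \<Longrightarrow> s \<ge> 0 \<Longrightarrow> D (t + s) x = U s (D t x)"
    "\<And>t x. t > 0 \<Longrightarrow> norm (D t x) \<le> B / t * norm x"
    "\<And>t x. t > 0 \<Longrightarrow> norm (D t x) \<le> B / t\<^sup>2 * norm x"
proof -
  obtain D :: "real \<Rightarrow> 'a \<Rightarrow> 'a" and \<delta> C1 where \<delta>: "\<delta> > 0" "C1 > 0"
    and der: "\<And>t x. t > 0 \<Longrightarrow> ((\<lambda>s. U s x) has_vector_derivative D t x) (at t)"
    and near: "\<And>t x. 0 < t \<Longrightarrow> t < \<delta> \<Longrightarrow> norm (D t x) \<le> C1 / t * norm x"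
    using analytic_semigroup_derivative[OF an] by metis
  have semi: "D (t + s) x = U s (D t x)" if "t > 0" "s \<ge> 0" for t s x
  proof -
    have "((\<lambda>r. r - s) has_derivative (\<lambda>h. h)) (at (t + s))" by (auto intro!: derivative_eq_intros)
    moreover have "((\<lambda>r. U r x) has_derivative (\<lambda>h. h *\<^sub>R D t x)) (at (t + s - s))"
      using der[OF that(1), of x] by (simp add: has_vector_derivative_def)
    ultimately have "((\<lambda>r. U (r - s) x) has_derivative (\<lambda>h. h *\<^sub>R D t x)) (at (t + s))"
      by (rule has_derivative_compose)
    then have "((\<lambda>r. U s (U (r - s) x)) has_derivative (\<lambda>h. U s (h *\<^sub>R D t x))) (at (t + s))"
      by (rule bounded_linear.has_derivative[OF blinfun.bounded_linear_right])
    then have "((\<lambda>r. U s (U (r - s) x)) has_vector_derivative U s (D t x)) (at (t + s))"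
      by (simp add: has_vector_derivative_def blinfun.scaleR_right)
    then have "((\<lambda>r. U r x) has_vector_derivative U s (D t x)) (at (t + s))"
    proof (rule has_vector_derivative_transform_within_open[of _ _ _ "{s<..}"])
      fix r assume "r \<in> {s<..}"
      then show "U s (U (r - s) x) = U r x" using c0_semigroupD(2)[OF U, of s "r - s" x] that by simp
    qed (use that in auto)
    then show ?thesis using der[of "t + s" x] that vector_derivative_unique_at by (metis add_pos_nonneg)
  qed
  \<comment> \<open>\<open>a \<le> 1 / 2\<close> gives \<open>u \<le> 1 + (u - a)\<close>, and
    \<open>t\<^sup>2 \<le> t\<close> for \<open>0 < t < a\<close>.\<close>
  define a where "a = min (\<delta> / 2) (1 / 2)"
  have a: "0 < a" "a < \<delta>" "a \<le> 1 / 2" using \<delta> by (auto simp: a_def)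
  define B1 where "B1 = C * (C1 / a)"
  have B1: "B1 > 0" using dec(1) \<delta>(2) a by (simp add: B1_def)
  have far: "norm (D u x) \<le> B1 / u\<^sup>2 * norm x" if "u \<ge> a" for u x
  proof -
    have "D u x = U (u - a) (D a x)" using semi[of a "u - a" x] a that by simp
    also have "norm \<dots> \<le> norm (U (u - a)) * norm (D a x)" by (rule norm_blinfun)
    also have "\<dots> \<le> C / (1 + (u - a))\<^sup>2 * (C1 / a * norm x)"
      using that a dec by (intro mult_mono near) auto
    also have "\<dots> = B1 / (1 + (u - a))\<^sup>2 * norm x" by (simp add: B1_def ac_simps)
    also have "\<dots> \<le> B1 / u\<^sup>2 * norm x"
      using that a B1 by (intro mult_right_mono divide_left_mono power_mono mult_pos_pos) auto
    finally show ?thesis .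
  qed
  define B where "B = C1 + B1 + B1 / a"
  have B: "B > 0" "C1 \<le> B" "B1 \<le> B" "B1 / a \<le> B" using \<delta>(2) B1 a by (auto simp: B_def add_pos_pos)
  show ?thesis
  proof (rule that[of B D])
    fix t x assume t: "(t::real) > 0"
    show "norm (D t x) \<le> B / t * norm x"
    proof (cases "t < a")
      case True
      have "norm (D t x) \<le> C1 / t * norm x" using True t a by (intro near) auto
      also have "\<dots> \<le> B / t * norm x" using t B by (intro mult_right_mono divide_right_mono) auto
      finally show ?thesis .
    next
      case False
      have "norm (D t x) \<le> B1 / t\<^sup>2 * norm x" using False by (intro far) auto
      also have "B1 / t\<^sup>2 = B1 / t / t" by (simp add: power2_eq_square)
      also have "B1 / t / t * norm x \<le> B1 / a / t * norm x"
        using False t a B1 by (intro mult_right_mono divide_right_mono divide_left_mono) auto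
      also have "\<dots> \<le> B / t * norm x" using t B by (intro mult_right_mono divide_right_mono) auto
      finally show ?thesis .
    qed
    show "norm (D t x) \<le> B / t\<^sup>2 * norm x"
    proof (cases "t < a")
      case True
      have "norm (D t x) \<le> C1 / t * norm x" using True t a by (intro near) auto
      also have "\<dots> \<le> C1 / t\<^sup>2 * norm x"
        using True t a \<delta>(2) by (intro mult_right_mono divide_left_mono) (auto simp: power2_eq_square mult_left_le)
      also have "\<dots> \<le> B / t\<^sup>2 * norm x" using t B by (intro mult_right_mono divide_right_mono) auto
      finally show ?thesis .
    next
      case False
      have "norm (D t x) \<le> B1 / t\<^sup>2 * norm x" using False by (intro far) auto
      also have "\<dots> \<le> B / t\<^sup>2 * norm x" using t B by (intro mult_right_mono divide_right_mono) auto
      finally show ?thesis .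
    qed
  qed (use B der semi in auto)
qed

text \<open>
  The preimage is \<open>- \<integral> s\<^sup>-\<^sup>\<alpha> U' (t + s) x ds / \<Gamma> (1 - \<alpha>)\<close>. That it is one is checked after applying a
  continuous functional, where Fubini's theorem for the Lebesgue integral is available.
\<close>

lemma smoothing_preimage:
  fixes U :: "real \<Rightarrow> 'a::banach \<Rightarrow>\<^sub>L 'a" and D :: "real \<Rightarrow> 'a \<Rightarrow> 'a"
  assumes U: "c0_semigroup U" and \<alpha>: "0 < \<alpha>" "\<alpha> < 1"
    and fin: "\<And>x. (\<lambda>t. t powr (\<alpha> - 1) *\<^sub>R U t x) integrable_on {0..}"
      "\<And>x. (\<lambda>t. norm (t powr (\<alpha> - 1) *\<^sub>R U t x)) integrable_on {0..}"
    and bl: "bounded_linear (neg_frac_power U \<alpha>)"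
    and dec: "C > 0" "\<And>t. 0 \<le> t \<Longrightarrow> norm (U t) \<le> C / (1 + t)\<^sup>2"
    and B: "B > 0"
    and der: "\<And>t x. t > 0 \<Longrightarrow> ((\<lambda>s. U s x) has_vector_derivative D t x) (at t)"
    and semi: "\<And>t s x. t > 0 \<Longrightarrow> s \<ge> 0 \<Longrightarrow> D (t + s) x = U s (D t x)"
    and D1: "\<And>t x. t > 0 \<Longrightarrow> norm (D t x) \<le> B / t * norm x"
    and D2: "\<And>t x. t > 0 \<Longrightarrow> norm (D t x) \<le> B / t\<^sup>2 * norm x"
    and t: "t > 0" and \<beta>_def: "\<beta> = (1 + \<alpha>) / 2"
  shows "\<exists>y. neg_frac_power U \<alpha> y = U t x \<and>
           norm y \<le> \<bar>1 / Gamma (1 - \<alpha>)\<bar> * (B * norm x * (t powr (- \<beta>) / (1 - \<beta>) + 1))"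
proof -
  let ?A = "neg_frac_power U \<alpha>"
  have \<beta>: "0 < \<beta>" "\<beta> < 1" using \<alpha> by (auto simp: \<beta>_def)

  \<comment> \<open>Convergence of the integral for the preimage\<close>
  define G where "G s = U s (D t x)" for s
  have G_D: "G s = D (t + s) x" if "0 \<le> s" for s using semi[OF t that] by (simp add: G_def)
  have G_cont: "continuous_on {0..} G" unfolding G_def by (rule c0_continuous[OF U])
  define h where "h s = s powr (- \<alpha>) *\<^sub>R G s" for s
  have h_cont: "continuous_on {0<..} h"
    unfolding h_def by (intro continuous_intros continuous_on_subset[OF G_cont]) auto
  \<comment> \<open>Splitting \<open>1 / (t + s)\<close> into the powers \<open>\<beta>\<close> of
    \<open>t\<close> and \<open>1 - \<beta>\<close> of \<open>s\<close> leaves the exponent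
    \<open>- \<alpha> - (1 - \<beta>) = - \<beta>\<close> in \<open>s\<close>. The choice of
    \<open>\<beta>\<close> halfway between \<open>\<alpha>\<close> and 1 thus gives the same
    integrable singularity in both variables.\<close>
  have h1: "norm (h s) \<le> B * norm x * t powr (- \<beta>) * s powr (- \<beta>)" if s: "s \<in> {0<..1}" for s
  proof -
    have ts: "(t + s) powr (- \<beta>) \<le> t powr (- \<beta>)" "(t + s) powr (- (1 - \<beta>)) \<le> s powr (- (1 - \<beta>))"
      using s t \<beta> by (intro powr_mono2'; simp)+
    have "1 / (t + s) = (t + s) powr (- \<beta> + - (1 - \<beta>))" using s t by (simp add: powr_minus_divide)
    also have "\<dots> = (t + s) powr (- \<beta>) * (t + s) powr (- (1 - \<beta>))" by (rule powr_add)
    also have "\<dots> \<le> t powr (- \<beta>) * s powr (- (1 - \<beta>))" using ts by (intro mult_mono) auto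
    finally have inv: "1 / (t + s) \<le> t powr (- \<beta>) * s powr (- (1 - \<beta>))" .
    have "norm (h s) = s powr (- \<alpha>) * norm (D (t + s) x)" using s by (simp add: h_def G_D)
    also have "\<dots> \<le> s powr (- \<alpha>) * (B / (t + s) * norm x)" using s t by (intro mult_left_mono D1) auto
    also have "\<dots> = s powr (- \<alpha>) * B * norm x * (1 / (t + s))" by simp
    also have "\<dots> \<le> s powr (- \<alpha>) * B * norm x * (t powr (- \<beta>) * s powr (- (1 - \<beta>)))"
      using B by (intro mult_left_mono inv) auto
    also have "\<dots> = B * norm x * t powr (- \<beta>) * (s powr (- \<alpha>) * s powr (- (1 - \<beta>)))" by (simp add: algebra_simps)
    also have "s powr (- \<alpha>) * s powr (- (1 - \<beta>)) = s powr (- \<alpha> + - (1 - \<beta>))" by (simp only: powr_add)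
    also have "- \<alpha> + - (1 - \<beta>) = - \<beta>" by (simp add: \<beta>_def field_simps)
    finally show ?thesis .
  qed
  have h2: "norm (h s) \<le> B * norm x * (1 / s\<^sup>2)" if s: "1 \<le> s" for s
  proof -
    have "norm (h s) = s powr (- \<alpha>) * norm (D (t + s) x)" using s by (simp add: h_def G_D)
    also have "\<dots> \<le> 1 * (B / (t + s)\<^sup>2 * norm x)"
      using s t \<alpha> powr_mono[of "- \<alpha>" 0 s] by (intro mult_mono D2) auto
    also have "\<dots> \<le> B / s\<^sup>2 * norm x"
      using s t B by (auto intro!: mult_right_mono divide_left_mono power_mono)
    finally show ?thesis by simp
  qed
  have c1: "continuous_on {0<..1} h" by (rule continuous_on_subset[OF h_cont]) auto
  have h_int1: "h integrable_on {0..1}" "norm (integral {0..1} h) \<le> B * norm x * t powr (- \<beta>) * (1 / (1 - \<beta>))"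
    using integrable_singular_at_0[OF c1 _ \<beta>(2) _ h1] B by simp_all
  have h_int2: "h integrable_on {a..b}" if "1 \<le> a" for a b
    using that by (intro integrable_continuous_interval continuous_on_subset[OF h_cont]) auto
  have tail: "norm (integral {a..b} h) \<le> B * norm x * (1 / a - 1 / b)" if ab: "1 \<le> a" "a \<le> b" for a b
  proof -
    have "((\<lambda>s. 1 / s\<^sup>2) has_integral (- 1 / b - - 1 / a)) {a..b}"
    proof (rule fundamental_theorem_of_calculus[OF ab(2)])
      fix s assume "s \<in> {a..b}"
      then have "((\<lambda>s. - 1 / s) has_real_derivative 1 / s\<^sup>2) (at s within {a..b})"
        using ab by (auto intro!: derivative_eq_intros simp: power2_eq_square)
      then show "((\<lambda>s. - 1 / s) has_vector_derivative 1 / s\<^sup>2) (at s within {a..b})"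
        by (simp add: has_real_derivative_iff_has_vector_derivative)
    qed
    from has_integral_mult_right[OF this, of "B * norm x"]
    have *: "((\<lambda>s. B * norm x * (1 / s\<^sup>2)) has_integral B * norm x * (1 / a - 1 / b)) {a..b}" by simp
    have "norm (integral {a..b} h) \<le> integral {a..b} (\<lambda>s. B * norm x * (1 / s\<^sup>2))"
      using ab * by (intro integral_norm_bound_integral h_int2 h2) auto
    then show ?thesis using integral_unique[OF *] by simp
  qed
  have h_int: "h integrable_on {0..b}" if "0 \<le> b" for b
  proof (cases "b \<le> 1")
    case True
    show ?thesis by (rule integrable_on_subinterval[OF h_int1(1)]) (use True in auto)
  next
    case False
    then show ?thesis using Henstock_Kurzweil_Integration.integrable_combine[OF _ _ h_int1(1) h_int2[of 1 b]] by simp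
  qed
  \<comment> \<open>The half-line integral is taken as a limit of truncations, since on bounded
    intervals the bounded operator \<open>?A\<close> and the functional can be moved inside.\<close>
  define z where "z n = integral {0..real n} h" for n
  have z_diff: "norm (z n - z m) \<le> B * norm x * (1 / real m - 1 / real n)" if "1 \<le> m" "m \<le> n" for m n
  proof -
    have "integral {0..real m} h + integral {real m..real n} h = integral {0..real n} h"
      using that by (intro Henstock_Kurzweil_Integration.integral_combine h_int) auto
    then have "z n - z m = integral {real m..real n} h" by (simp add: z_def algebra_simps)
    then show ?thesis using tail[of "real m" "real n"] that by simp
  qed
  have "Cauchy z"
  proof (rule CauchyI)
    fix e :: real assume e: "e > 0"
    obtain n0 where n0: "B * norm x / e < real n0" using reals_Archimedean2 by blast
    have small: "norm (z n - z m) < e" if "Suc n0 \<le> m" "m \<le> n" for m n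
    proof -
      have "norm (z n - z m) \<le> B * norm x * (1 / real m - 1 / real n)" using that by (intro z_diff) auto
      also have "\<dots> \<le> B * norm x * (1 / real m)" using B by (intro mult_left_mono) auto
      also have "\<dots> < e"
      proof -
        have "B * norm x / e < real m" using n0 that by linarith
        then show ?thesis using e that by (simp add: field_simps)
      qed
      finally show ?thesis .
    qed
    show "\<exists>M. \<forall>m\<ge>M. \<forall>n\<ge>M. norm (z m - z n) < e"
    proof (intro exI[of _ "Suc n0"] allI impI)
      fix m n assume "Suc n0 \<le> m" "Suc n0 \<le> n"
      then show "norm (z m - z n) < e"
        using small[of m n] small[of n m] by (cases "m \<le> n") (auto simp: norm_minus_commute)
    qed
  qed
  then obtain Z where Z: "z \<longlonglongrightarrow> Z" using Cauchy_convergent convergent_def by blast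
  have z_bound: "norm (z n) \<le> B * norm x * (t powr (- \<beta>) / (1 - \<beta>) + 1)" if "1 \<le> n" for n
  proof -
    have "B * norm x * (1 / real 1 - 1 / real n) \<le> B * norm x * 1" using B by (intro mult_left_mono) auto
    then have "norm (z n - z 1) \<le> B * norm x" using z_diff[of 1 n] that by simp
    moreover have "norm (z 1) \<le> B * norm x * (t powr (- \<beta>) / (1 - \<beta>))" using h_int1(2) by (simp add: z_def)
    ultimately show ?thesis using norm_triangle_sub[of "z n" "z 1"] by (simp add: distrib_left)
  qed
  have Z_bound: "norm Z \<le> B * norm x * (t powr (- \<beta>) / (1 - \<beta>) + 1)"
    by (rule LIMSEQ_le_const2[OF tendsto_norm[OF Z]]) (use z_bound in blast)
  define Y where "Y = (- 1 / Gamma (1 - \<alpha>)) *\<^sub>R Z"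

  \<comment> \<open>Identification of the preimage by a norming functional\<close>
  have "?A Y = U t x"
  proof (rule ccontr)
    assume "?A Y \<noteq> U t x"
    obtain \<phi> :: "'a \<Rightarrow>\<^sub>L real" where \<phi>: "norm \<phi> \<le> 1" "\<phi> (?A Y - U t x) = norm (?A Y - U t x)"
      by (rule norming_functional)
    have \<phi>_le: "\<bar>\<phi> v\<bar> \<le> norm v" for v
      using norm_blinfun[of \<phi> v] mult_right_mono[OF \<phi>(1), of "norm v"] by simp
    \<comment> \<open>Scalar form of the derivative, cut off to \<open>u \<ge> 0\<close> so that it
      is Borel measurable on the line.\<close>
    define g where "g u = indicator {0..} u * \<phi> (D (t + u) x)" for u :: real
    have gG: "g u = \<phi> (G u)" if "0 \<le> u" for u using that by (simp add: g_def G_D)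
    have "g = (\<lambda>u. indicator {0..} u *\<^sub>R \<phi> (G u))" by (auto simp: g_def G_D indicator_def fun_eq_iff)
    moreover have "(\<lambda>u. indicator {0..} u *\<^sub>R \<phi> (G u)) \<in> borel_measurable borel"
      by (rule borel_measurable_continuous_on_indicator) (auto intro!: continuous_intros G_cont)
    ultimately have gm [measurable]: "g \<in> borel_measurable borel" by simp
    have g_int: "set_integrable lborel {0..} g"
    proof -
      have "has_bochner_integral lborel (\<lambda>u. indicator {t..} u * u powr (- 2)) (- (t powr (- 2 + 1)) / (- 2 + 1))"
        by (rule has_bochner_integral_nonneg_HK) (use has_integral_powr_to_inf[of "- 2" t] t in auto)
      then have "integrable lborel (\<lambda>u. indicator {t..} u * u powr (- 2))" by (simp add: has_bochner_integral_iff)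
      from lborel_integrable_real_affine[OF this, of 1 t]
      have I: "integrable lborel (\<lambda>u. (B * norm x) * (indicator {t..} (t + u) * (t + u) powr (- 2)))" by simp
      have bnd: "norm (indicator {0..} u *\<^sub>R g u) \<le> norm ((B * norm x) * (indicator {t..} (t + u) * (t + u) powr (- 2)))" for u
      proof (cases "0 \<le> u")
        case True
        have "\<bar>g u\<bar> \<le> norm (D (t + u) x)" using \<phi>_le True by (simp add: g_def)
        also have "\<dots> \<le> B / (t + u)\<^sup>2 * norm x" using True t by (intro D2) auto
        also have "\<dots> = B * norm x * (t + u) powr (- 2)" using True t by (simp add: powr_minus_divide)
        finally show ?thesis using True B by (simp add: abs_mult)
      qed simp
      show ?thesis
        unfolding set_integrable_def
      proof (rule Bochner_Integration.integrable_bound[OF I])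
        show "AE u in lborel. norm (indicator {0..} u *\<^sub>R g u) \<le> norm ((B * norm x) * (indicator {t..} (t + u) * (t + u) powr (- 2)))"
          by (intro always_eventually allI bnd)
      qed measurable
    qed
    have g_int': "set_integrable lborel {0<..} g" by (rule set_integrable_subset[OF g_int]) auto
    define \<Psi> where "\<Psi> s = (LBINT r:{0<..}. r powr (\<alpha> - 1) * g (s + r))" for s
    note weyl = weyl_integral_composition[OF \<alpha> g_int' gm, folded \<Psi>_def]
    \<comment> \<open>Because \<open>U r (G s) = G (r + s)\<close>, the Gamma-integral of
      \<open>?A (G s)\<close> seen through \<open>\<phi>\<close> is the Weyl integral
      \<open>\<Psi> s\<close>. Domination by \<open>norm (w r)\<close>, integrable by assumption,
      passes from the Henstock-Kurzweil to the Lebesgue integral.\<close>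
    have \<phi>A: "\<phi> (?A (G s)) = (1 / Gamma \<alpha>) * \<Psi> s" if s: "0 \<le> s" for s
    proof -
      define w where "w r = r powr (\<alpha> - 1) *\<^sub>R U r (G s)" for r
      have wg: "\<phi> (w r) = r powr (\<alpha> - 1) * g (s + r)" if "0 \<le> r" for r
        using s that c0_semigroupD(2)[OF U that s, of "D t x"]
        by (simp add: w_def gG blinfun.scaleR_right add.commute) (simp add: G_def)
      have w0: "w 0 = 0" using \<alpha> by (simp add: w_def)
      have w_cont: "continuous_on {0<..} w"
        unfolding w_def by (intro continuous_intros continuous_on_subset[OF c0_continuous[OF U]]) auto
      have "(\<lambda>r. indicator {0<..} r *\<^sub>R norm (w r)) \<in> borel_measurable borel"
        by (rule borel_measurable_continuous_on_indicator) (auto intro!: continuous_intros w_cont)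
      then have m1: "(\<lambda>r. indicator {0<..} r * norm (w r)) \<in> borel_measurable borel" by simp
      have "((\<lambda>r. indicator {0<..} r * norm (w r)) has_integral integral {0..} (\<lambda>r. norm (w r))) {0..}"
        using integrable_integral[OF fin(2)[of "G s"]] unfolding w_def[symmetric]
        by (rule has_integral_eq[rotated]) (use w0 in \<open>auto simp: indicator_def\<close>)
      then have "has_bochner_integral lborel (\<lambda>r. indicator {0..} r * (indicator {0<..} r * norm (w r))) (integral {0..} (\<lambda>r. norm (w r)))"
        by (intro has_bochner_integral_nonneg_HK m1) auto
      then have "integrable lborel (\<lambda>r. indicator {0..} r * (indicator {0<..} r * norm (w r)))"
        by (simp add: has_bochner_integral_iff)
      then have "set_integrable lborel {0..} (\<lambda>r. r powr (\<alpha> - 1) * g (s + r))"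
        unfolding set_integrable_def
      proof (rule Bochner_Integration.integrable_bound)
        show "AE r in lborel. norm (indicator {0..} r *\<^sub>R (r powr (\<alpha> - 1) * g (s + r)))
              \<le> norm (indicator {0..} r * (indicator {0<..} r * norm (w r)))"
        proof (intro always_eventually allI)
          fix r :: real
          show "norm (indicator {0..} r *\<^sub>R (r powr (\<alpha> - 1) * g (s + r)))
              \<le> norm (indicator {0..} r * (indicator {0<..} r * norm (w r)))"
          proof (cases "0 < r")
            case True
            then show ?thesis using wg[of r] \<phi>_le[of "w r"] by simp
          qed (use \<alpha> in \<open>auto simp: indicator_def\<close>)
        qed
      qed measurable
      note si = set_borel_integral_eq_integral[OF this]
      have "\<phi> (?A (G s)) = (1 / Gamma \<alpha>) * \<phi> (integral {0..} w)"
        using \<alpha> by (simp add: neg_frac_power_def w_def[abs_def] blinfun.scaleR_right)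
      also have "\<phi> (integral {0..} w) = integral {0..} (\<lambda>r. \<phi> (w r))"
        using fin(1)[of "G s"] by (simp add: integral_blinfun_apply w_def[abs_def])
      also have "\<dots> = integral {0..} (\<lambda>r. r powr (\<alpha> - 1) * g (s + r))"
        by (rule Henstock_Kurzweil_Integration.integral_cong) (simp add: wg)
      also have "\<dots> = (LBINT r:{0..}. r powr (\<alpha> - 1) * g (s + r))" by (rule si(2)[symmetric])
      also have "\<dots> = \<Psi> s"
        unfolding \<Psi>_def set_lebesgue_integral_def
        by (rule Bochner_Integration.integral_cong) (use \<alpha> in \<open>auto simp: indicator_def\<close>)
      finally show ?thesis .
    qed
    define L where "L = (LBINT u:{0<..}. g u)"
    \<comment> \<open>Inserting \<open>\<phi>A\<close> under the integral over
      \<open>{0..real n}\<close> and letting \<open>n\<close> grow produces the composed Weyl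
      integral, which \<open>weyl\<close> reduces to the plain integral \<open>L\<close>.\<close>
    have "(\<lambda>n. \<phi> (?A (z n))) \<longlonglongrightarrow> (1 / Gamma \<alpha>) * (Gamma (1 - \<alpha>) * Gamma \<alpha> * L)"
    proof -
      have w1: "set_integrable lborel {0..} (\<lambda>s. s powr (- \<alpha>) * \<Psi> s)"
        "(LBINT s:{0..}. s powr (- \<alpha>) * \<Psi> s) = (LBINT s:{0<..}. s powr (- \<alpha>) * \<Psi> s)"
      proof -
        have eq: "(\<lambda>s. indicator {0..} s *\<^sub>R (s powr (- \<alpha>) * \<Psi> s)) = (\<lambda>s. indicator {0<..} s *\<^sub>R (s powr (- \<alpha>) * \<Psi> s))"
          using \<alpha> by (auto simp: indicator_def fun_eq_iff)
        show "set_integrable lborel {0..} (\<lambda>s. s powr (- \<alpha>) * \<Psi> s)"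
          using weyl(1) unfolding set_integrable_def eq by simp
        show "(LBINT s:{0..}. s powr (- \<alpha>) * \<Psi> s) = (LBINT s:{0<..}. s powr (- \<alpha>) * \<Psi> s)"
          unfolding set_lebesgue_integral_def eq ..
      qed
      have "((\<lambda>b. LBINT s:{0..b}. s powr (- \<alpha>) * \<Psi> s) \<longlongrightarrow> (LBINT s:{0..}. s powr (- \<alpha>) * \<Psi> s)) at_top"
        by (rule tendsto_set_lebesgue_integral_at_top[OF _ w1(1)]) auto
      from filterlim_compose[OF this filterlim_real_sequentially]
      have "(\<lambda>n. LBINT s:{0..real n}. s powr (- \<alpha>) * \<Psi> s) \<longlonglongrightarrow> Gamma (1 - \<alpha>) * Gamma \<alpha> * L"
        unfolding w1(2) weyl(2) L_def .
      then have "(\<lambda>n. (1 / Gamma \<alpha>) * (LBINT s:{0..real n}. s powr (- \<alpha>) * \<Psi> s)) \<longlonglongrightarrow> (1 / Gamma \<alpha>) * (Gamma (1 - \<alpha>) * Gamma \<alpha> * L)"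
        by (rule tendsto_mult_left)
      moreover have "\<phi> (?A (z n)) = (1 / Gamma \<alpha>) * (LBINT s:{0..real n}. s powr (- \<alpha>) * \<Psi> s)" for n
      proof -
        have bl\<phi>: "bounded_linear (\<lambda>v. \<phi> (?A v))"
          by (rule bounded_linear_compose[OF blinfun.bounded_linear_right bl])
        have "\<phi> (?A (z n)) = integral {0..real n} (\<lambda>s. \<phi> (?A (h s)))"
          using integral_linear[OF h_int bl\<phi>, of "real n"] by (simp add: z_def comp_def)
        also have "\<dots> = integral {0..real n} (\<lambda>s. (1 / Gamma \<alpha>) * (s powr (- \<alpha>) * \<Psi> s))"
          by (rule Henstock_Kurzweil_Integration.integral_cong)
             (simp add: h_def linear_scale[OF bounded_linear.linear[OF bl]] blinfun.scaleR_right \<phi>A)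
        also have "\<dots> = (1 / Gamma \<alpha>) * integral {0..real n} (\<lambda>s. s powr (- \<alpha>) * \<Psi> s)" by (rule integral_mult_right)
        also have "integral {0..real n} (\<lambda>s. s powr (- \<alpha>) * \<Psi> s) = (LBINT s:{0..real n}. s powr (- \<alpha>) * \<Psi> s)"
          by (rule set_borel_integral_eq_integral(2)[symmetric]) (rule set_integrable_subset[OF w1(1)], auto)
        finally show ?thesis .
      qed
      ultimately show ?thesis by simp
    qed
    moreover have "(\<lambda>n. \<phi> (?A (z n))) \<longlonglongrightarrow> \<phi> (?A Z)"
      by (rule bounded_linear.tendsto[OF bounded_linear_compose[OF blinfun.bounded_linear_right bl] Z])
    ultimately have "\<phi> (?A Z) = (1 / Gamma \<alpha>) * (Gamma (1 - \<alpha>) * Gamma \<alpha> * L)"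
      using LIMSEQ_unique by blast
    moreover have Gam: "Gamma \<alpha> > 0" "Gamma (1 - \<alpha>) > 0" using \<alpha> by (auto intro: Gamma_real_pos)
    ultimately have AZ: "\<phi> (?A Z) = Gamma (1 - \<alpha>) * L" by simp
    have "\<phi> (?A Y) = - L"
      using AZ Gam by (simp add: Y_def linear_scale[OF bounded_linear.linear[OF bl]] linear_neg[OF bounded_linear.linear[OF bl]] blinfun.scaleR_right blinfun.minus_right)
    \<comment> \<open>\<open>g\<close> is the derivative of \<open>\<phi> (U (t + u) x)\<close>,
      which tends to 0 by the decay of \<open>U\<close>. This is the origin of the minus sign in
      \<open>Y\<close>.\<close>
    moreover have "L = - \<phi> (U t x)"
    proof -
      have L0: "L = (LBINT u:{0..}. g u)"
      proof -
        have "AE u in lborel. indicator {0<..} u *\<^sub>R g u = indicator {0..} u *\<^sub>R g u"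
          using AE_lborel_singleton[of "0::real"] by (rule AE_mp) (auto simp: indicator_def)
        then show ?thesis unfolding L_def set_lebesgue_integral_def by (intro integral_cong_AE) auto
      qed
      have "((\<lambda>b. LBINT u:{0..b}. g u) \<longlongrightarrow> (LBINT u:{0..}. g u)) at_top"
        by (rule tendsto_set_lebesgue_integral_at_top[OF _ g_int]) auto
      from filterlim_compose[OF this filterlim_real_sequentially]
      have lim1: "(\<lambda>n. LBINT u:{0..real n}. g u) \<longlonglongrightarrow> L" unfolding L0 .
      have "(LBINT u:{0..real n}. g u) = \<phi> (U (t + real n) x) - \<phi> (U t x)" for n
      proof -
        have "(g has_integral (\<phi> (U (t + real n) x) - \<phi> (U (t + 0) x))) {0..real n}"
        proof (rule fundamental_theorem_of_calculus)
          fix u assume u: "u \<in> {0..real n}"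
          have "((\<lambda>u. t + u) has_derivative (\<lambda>h. h)) (at u)" by (auto intro!: derivative_eq_intros)
          moreover have "((\<lambda>r. U r x) has_derivative (\<lambda>h. h *\<^sub>R D (t + u) x)) (at (t + u))"
            using der[of "t + u" x] u t by (simp add: has_vector_derivative_def)
          ultimately have "((\<lambda>u. U (t + u) x) has_derivative (\<lambda>h. h *\<^sub>R D (t + u) x)) (at u)"
            by (rule has_derivative_compose)
          then have "((\<lambda>u. \<phi> (U (t + u) x)) has_derivative (\<lambda>h. \<phi> (h *\<^sub>R D (t + u) x))) (at u)"
            by (rule bounded_linear.has_derivative[OF blinfun.bounded_linear_right])
          then have "((\<lambda>u. \<phi> (U (t + u) x)) has_vector_derivative g u) (at u)"
            using u by (simp add: has_vector_derivative_def blinfun.scaleR_right g_def)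
          then show "((\<lambda>u. \<phi> (U (t + u) x)) has_vector_derivative g u) (at u within {0..real n})"
            by (rule has_vector_derivative_at_within)
        qed simp
        then have "integral {0..real n} g = \<phi> (U (t + real n) x) - \<phi> (U t x)" by (simp add: integral_unique)
        moreover have "(LBINT u:{0..real n}. g u) = integral {0..real n} g"
          by (rule set_borel_integral_eq_integral(2)) (rule set_integrable_subset[OF g_int], auto)
        ultimately show ?thesis by simp
      qed
      with lim1 have lim2: "(\<lambda>n. \<phi> (U (t + real n) x) - \<phi> (U t x)) \<longlonglongrightarrow> L" by simp
      have "(\<lambda>n. C * norm x * (1 / real n)) \<longlonglongrightarrow> C * norm x * 0"
        by (intro tendsto_intros lim_1_over_n)
      then have lim0: "(\<lambda>n. C * norm x * (1 / real n)) \<longlonglongrightarrow> 0" by simp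
      have "(\<lambda>n. \<phi> (U (t + real n) x)) \<longlonglongrightarrow> 0"
      proof (rule Lim_null_comparison[OF _ lim0])
        show "\<forall>\<^sub>F n in sequentially. norm (\<phi> (U (t + real n) x)) \<le> C * norm x * (1 / real n)"
        proof (rule eventually_sequentiallyI[of 1])
          fix n :: nat assume n: "1 \<le> n"
          have "norm (\<phi> (U (t + real n) x)) \<le> norm (U (t + real n)) * norm x"
            using \<phi>_le[of "U (t + real n) x"] norm_blinfun[of "U (t + real n)" x] by simp
          also have "\<dots> \<le> C / (1 + (t + real n))\<^sup>2 * norm x" using t by (intro mult_right_mono dec) auto
          also have "\<dots> \<le> C / real n * norm x"
          proof (intro mult_right_mono divide_left_mono)
            have "real n \<le> 1 * (1 + (t + real n))" using t by simp
            also have "\<dots> \<le> (1 + (t + real n)) * (1 + (t + real n))" using t by (intro mult_right_mono) auto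
            finally show "real n \<le> (1 + (t + real n))\<^sup>2" by (simp add: power2_eq_square)
          qed (use dec n t in auto)
          finally show "norm (\<phi> (U (t + real n) x)) \<le> C * norm x * (1 / real n)" by simp
        qed
      qed
      then have "(\<lambda>n. \<phi> (U (t + real n) x) - \<phi> (U t x)) \<longlonglongrightarrow> 0 - \<phi> (U t x)"
        by (intro tendsto_intros)
      then show ?thesis using LIMSEQ_unique[OF lim2] by simp
    qed
    ultimately have "\<phi> (?A Y - U t x) = 0" by (simp add: blinfun.diff_right)
    then show False using \<phi>(2) \<open>?A Y \<noteq> U t x\<close> by simp
  qed
  moreover have "norm Y \<le> \<bar>1 / Gamma (1 - \<alpha>)\<bar> * (B * norm x * (t powr (- \<beta>) / (1 - \<beta>) + 1))"
  proof -
    have "norm Y = \<bar>1 / Gamma (1 - \<alpha>)\<bar> * norm Z" by (simp add: Y_def)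
    then show ?thesis using mult_left_mono[OF Z_bound abs_ge_zero[of "1 / Gamma (1 - \<alpha>)"]] by (simp only:)
  qed
  ultimately show ?thesis by (intro exI[of _ Y] conjI)
qed

text \<open>The preimages give the norm bound. Linearity and the law
  \<open>q (a + s) x = U s (q a x)\<close> hold because \<open>neg_frac_power\<close> is injective
  and sends both sides to the same vector; strong continuity follows from that law.\<close>

theorem smoothing_kernel:
  fixes U :: "real \<Rightarrow> 'a::banach \<Rightarrow>\<^sub>L 'a"
  assumes U: "c0_semigroup U" and an: "analytic_semigroup U" and \<alpha>: "0 < \<alpha>" "\<alpha> < 1"
    and frac: "frac_powers_defined U \<alpha>" and bl: "bounded_linear (neg_frac_power U \<alpha>)" and T: "T > 0"
  obtains K :: "real \<Rightarrow> 'a \<Rightarrow>\<^sub>L 'a" and c \<beta> where "0 \<le> \<beta>" "\<beta> < 1" "0 \<le> c"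
    "\<And>t. t \<in> {0<..T} \<Longrightarrow> norm (K t) \<le> c * t powr (- \<beta>)"
    "\<And>x. continuous_on {0<..T} (\<lambda>t. K t x)"
    "\<And>t x. 0 < t \<Longrightarrow> frac_power U \<alpha> (U t x) = K t x"
proof -
  let ?A = "neg_frac_power U \<alpha>"
  have fin: "\<And>x. (\<lambda>t. t powr (\<alpha> - 1) *\<^sub>R U t x) integrable_on {0..}"
    "\<And>x. (\<lambda>t. norm (t powr (\<alpha> - 1) *\<^sub>R U t x)) integrable_on {0..}" and inj: "inj ?A"
    using frac by (auto simp: frac_powers_defined_def)
  obtain C where C: "C > 0" "\<And>t. 0 \<le> t \<Longrightarrow> norm (U t) \<le> C / (1 + t)\<^sup>2"
    using c0_decay[OF U \<alpha> fin(2)] by blast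
  obtain D :: "real \<Rightarrow> 'a \<Rightarrow> 'a" and B where D: "B > 0"
    "\<And>t x. t > 0 \<Longrightarrow> ((\<lambda>s. U s x) has_vector_derivative D t x) (at t)"
    "\<And>t s x. t > 0 \<Longrightarrow> s \<ge> 0 \<Longrightarrow> D (t + s) x = U s (D t x)"
    "\<And>t x. t > 0 \<Longrightarrow> norm (D t x) \<le> B / t * norm x"
    "\<And>t x. t > 0 \<Longrightarrow> norm (D t x) \<le> B / t\<^sup>2 * norm x"
  proof (rule analytic_derivative_bounds[OF U an C], goal_cases)
    case 2
    show ?case by (rule 2(1)) (fact 2(2-))+
  qed
  define \<beta> where "\<beta> = (1 + \<alpha>) / 2"
  have \<beta>: "0 < \<beta>" "\<beta> < 1" using \<alpha> by (auto simp: \<beta>_def)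
  define k where "k t = \<bar>1 / Gamma (1 - \<alpha>)\<bar> * (B * (t powr (- \<beta>) / (1 - \<beta>) + 1))" for t
  have k0: "0 \<le> k t" for t using D(1) \<beta> by (simp add: k_def)
  have pre: "\<exists>y. ?A y = U t x \<and> norm y \<le> k t * norm x" if "t > 0" for t x
    using smoothing_preimage[OF U \<alpha> fin bl C D that \<beta>_def, of x] by (simp add: k_def algebra_simps)
  define q where "q t x = frac_power U \<alpha> (U t x)" for t x
  have q: "?A (q t x) = U t x" "norm (q t x) \<le> k t * norm x" if t: "t > 0" for t x
  proof -
    obtain y where y: "?A y = U t x" "norm y \<le> k t * norm x" using pre[OF t] by blast
    have "q t x = y" unfolding q_def frac_power_def y(1)[symmetric] by (rule inv_into_f_f[OF inj UNIV_I])
    then show "?A (q t x) = U t x" "norm (q t x) \<le> k t * norm x" using y by auto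
  qed
  have A_lin: "linear ?A" using bl by (rule bounded_linear.linear)
  have q_bl: "bounded_linear (q t)" if t: "t > 0" for t
  proof (rule bounded_linear_intro)
    fix x y and r :: real
    show "q t (x + y) = q t x + q t y"
      by (rule injD[OF inj]) (simp add: q[OF t] linear_add[OF A_lin] blinfun.add_right)
    show "q t (r *\<^sub>R x) = r *\<^sub>R q t x"
      by (rule injD[OF inj]) (simp add: q[OF t] linear_scale[OF A_lin] blinfun.scaleR_right)
    show "norm (q t x) \<le> norm x * k t" using q(2)[OF t] by (simp add: mult.commute)
  qed
  have A_U: "?A (U s x) = U s (?A x)" if s: "0 \<le> s" for s x
  proof -
    have "integral {0..} (\<lambda>r. r powr (\<alpha> - 1) *\<^sub>R U r (U s x)) = integral {0..} (\<lambda>r. U s (r powr (\<alpha> - 1) *\<^sub>R U r x))"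
    proof (rule Henstock_Kurzweil_Integration.integral_cong)
      fix r :: real assume "r \<in> {0..}"
      then show "r powr (\<alpha> - 1) *\<^sub>R U r (U s x) = U s (r powr (\<alpha> - 1) *\<^sub>R U r x)"
        using c0_semigroupD(2)[OF U _ s, of r x] c0_semigroupD(2)[OF U s, of r x]
        by (simp add: blinfun.scaleR_right add.commute)
    qed
    also have "\<dots> = U s (integral {0..} (\<lambda>r. r powr (\<alpha> - 1) *\<^sub>R U r x))"
      by (rule integral_blinfun_apply[OF fin(1)])
    finally show ?thesis using \<alpha> by (simp add: neg_frac_power_def blinfun.scaleR_right)
  qed
  have q_semi: "q (a + s) x = U s (q a x)" if "a > 0" "s \<ge> 0" for a s x
  proof (rule injD[OF inj])
    show "?A (q (a + s) x) = ?A (U s (q a x))"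
      using q(1)[of "a + s" x] q(1)[OF that(1), of x] A_U[OF that(2)] c0_semigroupD(2)[OF U that(2), of a x] that
      by (simp add: add.commute)
  qed
  have q_cont: "continuous_on {0<..T} (\<lambda>t. q t x)" for x
    unfolding continuous_on_eq_continuous_within
  proof
    fix t assume t: "t \<in> {0<..T}"
    have "continuous_on {t/2..} (\<lambda>s. U (s - t/2) (q (t/2) x))"
      by (rule continuous_on_compose2[OF c0_continuous[OF U]]) (auto intro!: continuous_intros)
    then have "continuous_on {t/2..} (\<lambda>s. q s x)"
    proof (rule continuous_on_eq)
      fix s assume s: "s \<in> {t/2..}"
      have "t/2 + (s - t/2) = s" by simp
      then show "U (s - t/2) (q (t/2) x) = q s x" using q_semi[of "t/2" "s - t/2" x] t s by simp
    qed
    then have "continuous_on {t/2<..} (\<lambda>s. q s x)" by (rule continuous_on_subset) auto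
    then have "isCont (\<lambda>s. q s x) t" using t by (simp add: continuous_on_eq_continuous_at)
    then show "continuous (at t within {0<..T}) (\<lambda>s. q s x)"
      by (rule continuous_at_imp_continuous_at_within)
  qed
  define K where "K t = Blinfun (q t)" for t
  have K: "blinfun_apply (K t) x = q t x" if "t > 0" for t x
    using q_bl[OF that] by (simp add: K_def bounded_linear_Blinfun_apply)
  \<comment> \<open>The constant summand of \<open>k\<close> is absorbed through
    \<open>1 \<le> T powr \<beta> * t powr (- \<beta>)\<close> on \<open>{0<..T}\<close>.\<close>
  define c where "c = \<bar>1 / Gamma (1 - \<alpha>)\<bar> * (B * (1 / (1 - \<beta>) + T powr \<beta>))"
  have kc: "k t \<le> c * t powr (- \<beta>)" if t: "t \<in> {0<..T}" for t
  proof -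
    have "1 = t powr \<beta> * t powr (- \<beta>)" using t by (simp add: powr_minus)
    also have "\<dots> \<le> T powr \<beta> * t powr (- \<beta>)" using t \<beta> by (intro mult_right_mono powr_mono2) auto
    finally have "t powr (- \<beta>) / (1 - \<beta>) + 1 \<le> (1 / (1 - \<beta>) + T powr \<beta>) * t powr (- \<beta>)"
      by (simp add: algebra_simps)
    then have "k t \<le> \<bar>1 / Gamma (1 - \<alpha>)\<bar> * (B * ((1 / (1 - \<beta>) + T powr \<beta>) * t powr (- \<beta>)))"
      unfolding k_def using D(1) by (intro mult_left_mono) auto
    then show ?thesis by (simp add: c_def mult.assoc)
  qed
  show ?thesis
  proof (rule that[of \<beta> c K])
    show "norm (K t) \<le> c * t powr (- \<beta>)" if t: "t \<in> {0<..T}" for t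
    proof (rule norm_blinfun_bound)
      show "0 \<le> c * t powr (- \<beta>)" by (rule order_trans[OF k0 kc[OF t]])
      fix x
      show "norm (K t x) \<le> c * t powr (- \<beta>) * norm x"
        using q(2)[of t x] mult_right_mono[OF kc[OF t], of "norm x"] K[of t x] t by simp
    qed
    show "continuous_on {0<..T} (\<lambda>t. K t x)" for x
      by (rule continuous_on_eq[OF q_cont]) (simp add: K)
    show "0 \<le> c" using D(1) \<beta> by (simp add: c_def)
  qed (use \<beta> K in \<open>auto simp: q_def\<close>)
qed

section \<open>The perturbed Poincare map and its fixed points\<close>

text \<open>The selected \<open>x \<epsilon>\<close> comes within \<open>\<epsilon>\<close> of the
  infimum of \<open>d\<close> over the admissible elements, so a single selection works for every
  \<open>\<delta>\<close> at once.\<close>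

lemma eventually_selection:
  fixes P :: "real \<Rightarrow> 'x \<Rightarrow> bool" and d :: "'x \<Rightarrow> real"
  assumes ev: "\<And>\<delta>. \<delta> > 0 \<Longrightarrow> \<forall>\<^sub>F \<epsilon> in at_right 0. \<exists>x. P \<epsilon> x \<and> d x < \<delta>" and pos: "\<And>x. 0 \<le> d x"
  obtains x where "\<forall>\<^sub>F \<epsilon> in at_right 0. P \<epsilon> (x \<epsilon>)" "((\<lambda>\<epsilon>. d (x \<epsilon>)) \<longlongrightarrow> 0) (at_right 0)"
proof -
  define m where "m \<epsilon> = Inf (d ` {x. P \<epsilon> x})" for \<epsilon>
  define x where "x \<epsilon> = (SOME x. P \<epsilon> x \<and> d x < m \<epsilon> + \<epsilon>)" for \<epsilon>
  have bdd: "bdd_below (d ` {x. P \<epsilon> x})" for \<epsilon> using pos by (intro bdd_belowI2) auto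
  have x: "P \<epsilon> (x \<epsilon>) \<and> d (x \<epsilon>) < m \<epsilon> + \<epsilon>" if "0 < \<epsilon>" "P \<epsilon> y" for \<epsilon> y
    unfolding x_def
  proof (rule someI_ex)
    have "m \<epsilon> < m \<epsilon> + \<epsilon>" using that by simp
    then show "\<exists>x. P \<epsilon> x \<and> d x < m \<epsilon> + \<epsilon>"
      unfolding m_def using cInf_lessD[of "d ` {x. P \<epsilon> x}"] that(2) by blast
  qed
  have gt: "\<forall>\<^sub>F \<epsilon> in at_right (0::real). 0 < \<epsilon>" by (simp add: eventually_at_right_less)
  show ?thesis
  proof
    show "\<forall>\<^sub>F \<epsilon> in at_right 0. P \<epsilon> (x \<epsilon>)"
      using ev[OF zero_less_one] gt by eventually_elim (use x in blast)
    show "((\<lambda>\<epsilon>. d (x \<epsilon>)) \<longlongrightarrow> 0) (at_right 0)"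
    proof (rule tendstoI)
      fix \<delta> :: real assume "\<delta> > 0"
      then have h: "\<delta> / 2 > 0" by simp
      have "\<forall>\<^sub>F \<epsilon> in at_right (0::real). \<epsilon> < \<delta> / 2" by (rule eventually_mono[OF eventually_at_right_real[OF h]]) simp
      with ev[OF h] gt show "\<forall>\<^sub>F \<epsilon> in at_right 0. dist (d (x \<epsilon>)) 0 < \<delta>"
      proof eventually_elim
        case (elim \<epsilon>)
        then obtain y where y: "P \<epsilon> y" "d y < \<delta> / 2" by blast
        have "m \<epsilon> \<le> d y" unfolding m_def using y(1) bdd by (intro cINF_lower) auto
        then show ?case using x[OF elim(2) y(1)] y(2) elim(3) pos[of "x \<epsilon>"] by (simp add: dist_real_def)
      qed
    qed
  qed
qed

text \<open>Common interface of the two cases. In the contractive one the kernel is \<open>U\<close>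
  itself away from 0, with \<open>\<beta> = 0\<close> and \<open>c = 1\<close>.\<close>

lemma semigroup_kernel:
  fixes U :: "real \<Rightarrow> 'a::banach \<Rightarrow>\<^sub>L 'a"
  assumes T: "0 < T" and cases: "analytic_compact_case U \<alpha> f g \<or> contractive_case U \<alpha> f g"
  obtains K :: "real \<Rightarrow> 'a \<Rightarrow>\<^sub>L 'a" and c \<beta> M where
    "\<And>x. continuous_on {0..T} (\<lambda>t. U t x)" "\<And>t. t \<in> {0..T} \<Longrightarrow> norm (U t) \<le> M"
    "\<And>z. continuous_on {0<..T} (\<lambda>s. K s z)" "\<And>s. s \<in> {0..T} \<Longrightarrow> norm (K s) \<le> c * s powr (- \<beta>)"
    "0 \<le> \<beta>" "\<beta> < 1" "0 \<le> c" "\<And>t x. 0 < t \<Longrightarrow> frac_power U \<alpha> (U t x) = K t x"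
    "bounded_linear (neg_frac_power U \<alpha>)" "U 0 = id_blinfun"
    "regular_pair (\<lambda>t z. f t (neg_frac_power U \<alpha> z)) (\<lambda>t z \<epsilon>. g t (neg_frac_power U \<alpha> z) \<epsilon>)"
proof -
  have U: "c0_semigroup U" using cases by (auto simp: analytic_compact_case_def contractive_case_def)
  have Uc: "continuous_on {0..T} (\<lambda>t. U t x)" for x
    by (rule continuous_on_subset[OF c0_continuous[OF U]]) auto
  obtain M where M: "\<And>t. t \<in> {0..T} \<Longrightarrow> norm (U t) \<le> M" using c0_bounded[OF U] by blast
  from cases show ?thesis
  proof
    assume a: "analytic_compact_case U \<alpha> f g"
    then have \<alpha>: "0 < \<alpha>" "\<alpha> < 1" and bl: "bounded_linear (neg_frac_power U \<alpha>)"
      and reg: "regular_pair (\<lambda>t z. f t (neg_frac_power U \<alpha> z)) (\<lambda>t z \<epsilon>. g t (neg_frac_power U \<alpha> z) \<epsilon>)"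
      and an: "analytic_semigroup U" and fr: "frac_powers_defined U \<alpha>"
      by (auto simp: analytic_compact_case_def)
    obtain K :: "real \<Rightarrow> 'a \<Rightarrow>\<^sub>L 'a" and c \<beta> where K: "0 \<le> \<beta>" "\<beta> < 1" "0 \<le> c"
      "\<And>t. t \<in> {0<..T} \<Longrightarrow> norm (K t) \<le> c * t powr (- \<beta>)"
      "\<And>x. continuous_on {0<..T} (\<lambda>t. K t x)"
      "\<And>t x. 0 < t \<Longrightarrow> frac_power U \<alpha> (U t x) = K t x"
    proof (rule smoothing_kernel[OF U an \<alpha> fr bl T], goal_cases)
      case 1
      show ?case by (rule 1(1)) (fact 1(2-))+
    qed
    \<comment> \<open>Since \<open>0 powr _ = 0\<close>, the bound on \<open>{0..T}\<close> forces
      the kernel to vanish at 0; integrals do not see this value.\<close>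
    define K' where "K' t = (if t = 0 then 0 else K t)" for t
    show ?thesis
    proof (rule that[of M K' c \<beta>, OF Uc M _ _ K(1-3) _ bl c0_semigroupD(1)[OF U] reg])
      show "continuous_on {0<..T} (\<lambda>s. K' s z)" for z
        by (rule continuous_on_eq[OF K(5)]) (simp add: K'_def)
      show "norm (K' s) \<le> c * s powr (- \<beta>)" if "s \<in> {0..T}" for s
        using K(4)[of s] that by (cases "s = 0") (auto simp: K'_def)
      show "frac_power U \<alpha> (U t x) = K' t x" if "0 < t" for t x using K(6)[OF that] that by (simp add: K'_def)
    qed
  next
    assume a: "contractive_case U \<alpha> f g"
    then obtain \<gamma> where \<gamma>: "\<gamma> > 0" "\<And>t. t \<ge> 0 \<Longrightarrow> norm (U t) \<le> exp (- \<gamma> * t)"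
      by (auto simp: contractive_case_def)
    have \<alpha>: "\<alpha> = 0" and reg: "regular_pair f g" using a by (auto simp: contractive_case_def)
    have id: "neg_frac_power U \<alpha> = (\<lambda>x. x)" by (simp add: neg_frac_power_def \<alpha> fun_eq_iff)
    have fid: "frac_power U \<alpha> x = x" for x
      unfolding frac_power_def id by (rule inv_into_f_eq) auto
    define K' where "K' t = (if t = 0 then 0 else U t)" for t
    show ?thesis
    proof (rule that[of M K' 1 0, OF Uc M _ _ _ _ _ _ _ c0_semigroupD(1)[OF U]])
      show "continuous_on {0<..T} (\<lambda>s. K' s z)" for z
        by (rule continuous_on_eq[OF continuous_on_subset[OF Uc]]) (auto simp: K'_def)
      show "norm (K' s) \<le> 1 * s powr (- 0)" if "s \<in> {0..T}" for s
        using \<gamma>(2)[of s] that order_trans[of "norm (U s)" "exp (- \<gamma> * s)" 1] \<gamma>(1)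
        by (cases "s = 0") (auto simp: K'_def)
      show "frac_power U \<alpha> (U t x) = K' t x" if "0 < t" for t x using that by (simp add: K'_def fid)
      show "bounded_linear (neg_frac_power U \<alpha>)" unfolding id by (rule bounded_linear_ident)
      show "regular_pair (\<lambda>t z. f t (neg_frac_power U \<alpha> z)) (\<lambda>t z \<epsilon>. g t (neg_frac_power U \<alpha> z) \<epsilon>)"
        unfolding id by (rule reg)
    qed auto
  qed
qed

text \<open>At \<open>s = t\<close> the integrands may differ, because \<open>frac_power\<close> is
  then applied to a vector possibly outside its domain. A single point does not affect the
  integral.\<close>

lemma has_integral_convolution_cong:
  fixes t :: real and K :: "real \<Rightarrow> 'a::real_normed_vector \<Rightarrow>\<^sub>L 'b::real_normed_vector"
  assumes "\<And>t x. 0 < t \<Longrightarrow> q (U t x) = blinfun_apply (K t) x"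
  shows "((\<lambda>s. q (U (t - s) (w s))) has_integral i) {0..t} \<longleftrightarrow> ((\<lambda>s. K (t - s) (w s)) has_integral i) {0..t}"
  by (rule has_integral_spike_finite_eq[of "{t}"]) (use assms in auto)

lemma mild_solution_iff_kernel_solution:
  fixes U K :: "real \<Rightarrow> 'a::banach \<Rightarrow>\<^sub>L 'a"
  assumes "\<And>t x. 0 < t \<Longrightarrow> frac_power U \<alpha> (U t x) = K t x"
  shows "mild_solution U \<alpha> f g \<epsilon> \<xi> d x \<longleftrightarrow> kernel_solution K (\<lambda>t. U t \<xi>)
    (\<lambda>s z. f s (neg_frac_power U \<alpha> z) + \<epsilon> *\<^sub>R g s (neg_frac_power U \<alpha> z) \<epsilon>) d x"
  unfolding mild_solution_def kernel_solution_def
  by (simp add: has_integral_convolution_cong[where q = "frac_power U \<alpha>" and U = "\<lambda>t x. U t x", OF assms])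

lemma kernel_solution_at_0:
  fixes K :: "real \<Rightarrow> 'a::real_normed_vector \<Rightarrow>\<^sub>L 'b::real_normed_vector"
  assumes "kernel_solution K \<phi> r d x" "0 \<le> d"
  shows "x 0 = \<phi> 0"
proof -
  have all: "\<forall>t\<in>{0..d}. ((\<lambda>s. K (t - s) (r s (x s))) has_integral (x t - \<phi> t)) {0..t}"
    using assms(1) by (simp add: kernel_solution_def)
  have "((\<lambda>s. K (0 - s) (r s (x s))) has_integral (x 0 - \<phi> 0)) {0..0}"
    by (rule bspec[OF all]) (use assms(2) in simp)
  moreover have "((\<lambda>s. K (0 - s) (r s (x s))) has_integral 0) {0..0}"
    using has_integral_refl(1)[of _ "0::real"] by simp
  ultimately have "x 0 - \<phi> 0 = 0" by (rule has_integral_unique)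
  then show ?thesis by simp
qed

text \<open>\<open>f\<close> need not be globally Lipschitz, since \<open>f'\<close> may grow with
  \<open>z\<close>. Along two continuous curves a bound exists by compactness, and uniqueness of
  solutions asks for no more.\<close>

lemma lipschitz_along_curves:
  fixes f :: "real \<Rightarrow> 'a::real_normed_vector \<Rightarrow> 'b::real_normed_vector" and f' :: "real \<Rightarrow> 'a \<Rightarrow> 'a \<Rightarrow>\<^sub>L 'b"
  assumes contf': "continuous_on ({0..d} \<times> UNIV) (\<lambda>(t, z). f' t z)"
    and der: "\<And>t z. t \<in> {0..d} \<Longrightarrow> (f t has_derivative f' t z) (at z)"
    and lip: "\<And>t z w. t \<in> {0..d} \<Longrightarrow> norm (f' t z - f' t w) \<le> L * norm (z - w)" and L: "0 \<le> L"
    and x: "continuous_on {0..d} x" and y: "continuous_on {0..d} y"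
  obtains B where "0 \<le> B" "\<And>s. s \<in> {0..d} \<Longrightarrow> norm (f s (x s) - f s (y s)) \<le> B * norm (x s - y s)"
proof -
  have "continuous_on {0..d} (\<lambda>t. (\<lambda>(t, z). f' t z) (t, x t))"
    by (rule continuous_on_compose2[OF contf']) (auto intro!: continuous_intros x)
  then have "continuous_on {0..d} (\<lambda>t. norm (f' t (x t)) + L * norm (x t - y t))"
    by (intro continuous_intros x y) simp
  then have "bounded ((\<lambda>t. norm (f' t (x t)) + L * norm (x t - y t)) ` {0..d})"
    by (intro compact_imp_bounded compact_continuous_image) auto
  then obtain B where B: "\<And>t. t \<in> {0..d} \<Longrightarrow> norm (norm (f' t (x t)) + L * norm (x t - y t)) \<le> B"
    by (meson bounded_iff image_eqI)
  have "norm (f s (x s) - f s (y s)) \<le> max B 0 * norm (x s - y s)" if s: "s \<in> {0..d}" for s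
  proof -
    have "norm (f s (x s) - f s (y s) - (0 :: 'a \<Rightarrow>\<^sub>L 'b) (x s - y s)) \<le> max B 0 * norm (x s - y s)"
    proof (rule derivative_near_linear_bound[where B = "cball (x s) (norm (x s - y s))" and P' = "f' s"])
      fix z assume "z \<in> cball (x s) (norm (x s - y s))"
      then have "L * norm (z - x s) \<le> L * norm (x s - y s)"
        using L by (intro mult_left_mono) (auto simp: dist_norm norm_minus_commute)
      then have "norm (f' s z) \<le> norm (f' s (x s)) + L * norm (x s - y s)"
        using lip[OF s, of z "x s"] norm_triangle_sub[of "f' s z" "f' s (x s)"] by linarith
      then show "norm (f' s z - 0) \<le> max B 0" using B[OF s] by simp
    qed (use der[OF s] in \<open>auto simp: dist_norm intro: has_derivative_at_withinI\<close>)
    then show ?thesis by (simp add: zero_blinfun.rep_eq)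
  qed
  then show ?thesis by (intro that[of "max B 0"]) auto
qed

lemma regular_pairD:
  assumes "regular_pair F G"
  shows "(F t has_derivative D2 F t z) (at z)" "continuous_on UNIV (\<lambda>(t, z). D2 F t z)"
    "\<exists>L\<ge>0. \<forall>t z w. norm (D2 F t z - D2 F t w) \<le> L * norm (z - w)"
    "continuous_on (UNIV \<times> UNIV \<times> {0..1}) (\<lambda>(t, z, \<epsilon>). G t z \<epsilon>)"
    "\<exists>L\<ge>0. \<forall>t. \<forall>\<epsilon>\<in>{0..1}. \<forall>z w. norm (G t z \<epsilon> - G t w \<epsilon>) \<le> L * norm (z - w)"
proof -
  have "(F t has_derivative frechet_derivative (F t) (at z)) (at z)"
    using assms by (simp add: regular_pair_def frechet_derivative_works)
  then show "(F t has_derivative D2 F t z) (at z)"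
    by (simp add: D2_def bounded_linear_Blinfun_apply has_derivative_bounded_linear)
  show "continuous_on UNIV (\<lambda>(t, z). D2 F t z)" "continuous_on (UNIV \<times> UNIV \<times> {0..1}) (\<lambda>(t, z, \<epsilon>). G t z \<epsilon>)"
    using assms by (simp_all add: regular_pair_def)
  obtain L where L: "\<And>t. L-lipschitz_on UNIV (D2 F t)" using assms by (auto simp: regular_pair_def)
  then show "\<exists>L\<ge>0. \<forall>t z w. norm (D2 F t z - D2 F t w) \<le> L * norm (z - w)"
    using lipschitz_on_nonneg[OF L] by (auto simp: lipschitz_on_def dist_norm)
  obtain L' where L': "\<And>t \<epsilon>. \<epsilon> \<in> {0..1} \<Longrightarrow> L'-lipschitz_on UNIV (\<lambda>z. G t z \<epsilon>)"
    using assms unfolding regular_pair_def by blast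
  then have "0 \<le> L'" using lipschitz_on_nonneg[OF L'[of 0]] by auto
  then show "\<exists>L\<ge>0. \<forall>t. \<forall>\<epsilon>\<in>{0..1}. \<forall>z w. norm (G t z \<epsilon> - G t w \<epsilon>) \<le> L * norm (z - w)"
    using L' unfolding lipschitz_on_def dist_norm by blast
qed

text \<open>Uniqueness of kernel solutions evaluates the definite descriptions \<open>sol\<close>
  and \<open>eta\<close>, which turns the family of \<open>solution_family\<close> into a statement
  on the Poincare map.\<close>

theorem poincare_family:
  fixes U :: "real \<Rightarrow> 'a::banach \<Rightarrow>\<^sub>L 'a" and f :: "real \<Rightarrow> 'a \<Rightarrow> 'a" and g :: "real \<Rightarrow> 'a \<Rightarrow> real \<Rightarrow> 'a"
  assumes T: "0 < T" and C1: "C1_on (\<lambda>(t, x). f t x) UNIV"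
    and cases: "analytic_compact_case U \<alpha> f g \<or> contractive_case U \<alpha> f g"
    and ex: "sol_exists U \<alpha> f g 0 \<xi>0 T"
  obtains \<rho> e0 \<Lambda> R and P' :: "'a \<Rightarrow> 'a \<Rightarrow>\<^sub>L 'a" where "\<rho> > 0" "0 < e0"
    "\<And>\<xi>. \<xi> \<in> ball \<xi>0 \<rho> \<Longrightarrow> (poincare U \<alpha> f g T 0 has_derivative P' \<xi>) (at \<xi>)"
    "continuous_on (ball \<xi>0 \<rho>) P'"
    "\<And>\<epsilon> \<xi>. \<epsilon> \<in> {0..e0} \<Longrightarrow> \<xi> \<in> ball \<xi>0 \<rho> \<Longrightarrow>
       \<exists>x. mild_solution U \<alpha> f g \<epsilon> \<xi> T x \<and> x 0 = \<xi> \<and> x T = poincare U \<alpha> f g T 0 \<xi> + \<epsilon> *\<^sub>R R \<epsilon> \<xi>"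
    "\<And>\<xi>. \<xi> \<in> ball \<xi>0 \<rho> \<Longrightarrow> eta U \<alpha> f g T \<xi> = R 0 \<xi>"
    "continuous_on ({0..e0} \<times> ball \<xi>0 \<rho>) (\<lambda>(\<epsilon>, \<xi>). R \<epsilon> \<xi>)"
    "\<And>\<epsilon> \<xi> \<xi>'. \<epsilon> \<in> {0..e0} \<Longrightarrow> \<xi> \<in> ball \<xi>0 \<rho> \<Longrightarrow> \<xi>' \<in> ball \<xi>0 \<rho> \<Longrightarrow>
       norm (R \<epsilon> \<xi> - R \<epsilon> \<xi>') \<le> \<Lambda> * norm (\<xi> - \<xi>')"
proof -
  let ?A = "neg_frac_power U \<alpha>"
  obtain K :: "real \<Rightarrow> 'a \<Rightarrow>\<^sub>L 'a" and c \<beta> M where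
    U: "\<And>x. continuous_on {0..T} (\<lambda>t. U t x)" "\<And>t. t \<in> {0..T} \<Longrightarrow> norm (U t) \<le> M"
    and contK: "\<And>z. continuous_on {0<..T} (\<lambda>s. K s z)" and K: "\<And>s. s \<in> {0..T} \<Longrightarrow> norm (K s) \<le> c * s powr (- \<beta>)"
    and \<beta>: "0 \<le> \<beta>" "\<beta> < 1" and c: "0 \<le> c" and fK: "\<And>t x. 0 < t \<Longrightarrow> frac_power U \<alpha> (U t x) = K t x"
    and A: "bounded_linear ?A" and U0: "U 0 = id_blinfun"
    and reg: "regular_pair (\<lambda>t z. f t (?A z)) (\<lambda>t z \<epsilon>. g t (?A z) \<epsilon>)"
  proof (rule semigroup_kernel[OF T cases], goal_cases)
    case 1
    show ?case by (rule 1(1)) (fact 1(2-))+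
  qed
  define fh where "fh t z = f t (?A z)" for t z
  define gh where "gh t z \<epsilon> = g t (?A z) \<epsilon>" for t z \<epsilon>
  note reg' = regular_pairD[OF reg[folded fh_def gh_def]]
  have fh_eta: "(\<lambda>t z. f t (?A z)) = fh" by (simp add: fh_def fun_eq_iff)
  define f' where "f' = D2 fh"
  have der: "(fh t has_derivative f' t z) (at z)" for t z using reg'(1)[of t z] by (simp add: f'_def)
  have contf': "continuous_on (S \<times> UNIV) (\<lambda>(t, z). f' t z)" for S
    using continuous_on_subset[OF reg'(2)] by (simp add: f'_def)
  obtain L where L: "0 \<le> L" and lip: "\<And>t z w. norm (f' t z - f' t w) \<le> L * norm (z - w)"
    using reg'(3) by (auto simp: f'_def)
  have contg: "continuous_on ({0..T} \<times> UNIV \<times> {0..1}) (\<lambda>(t, z, \<epsilon>). gh t z \<epsilon>)"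
    by (rule continuous_on_subset[OF reg'(4)]) auto
  obtain LG where LG: "0 \<le> LG" and lipg: "\<And>t z w \<epsilon>. \<epsilon> \<in> {0..1} \<Longrightarrow> norm (gh t z \<epsilon> - gh t w \<epsilon>) \<le> LG * norm (z - w)"
    using reg'(5) by blast
  have contf: "continuous_on ({0..T} \<times> UNIV) (\<lambda>(t, z). fh t z)"
  proof -
    obtain F' where "\<And>x. ((\<lambda>(t, x). f t x) has_derivative blinfun_apply (F' x)) (at x)"
      using C1 by (auto simp: C1_on_def)
    then have "continuous_on UNIV (\<lambda>(t, x). f t x)"
      by (meson continuous_at_imp_continuous_on has_derivative_continuous)
    then have "continuous_on ({0..T} \<times> UNIV) (\<lambda>p. (\<lambda>(t, x). f t x) (fst p, ?A (snd p)))"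
      by (rule continuous_on_compose2) (auto intro!: continuous_intros bounded_linear.continuous_on[OF A])
    then show ?thesis by (simp add: fh_def case_prod_unfold)
  qed
  have mild: "mild_solution U \<alpha> f g \<epsilon> \<xi> d x \<longleftrightarrow> kernel_solution K (\<lambda>t. U t \<xi>) (\<lambda>s z. fh s z + \<epsilon> *\<^sub>R gh s z \<epsilon>) d x"
    for \<epsilon> \<xi> d x
    using mild_solution_iff_kernel_solution[of U \<alpha> K, OF fK] by (simp add: fh_def gh_def)
  have mild0: "mild_solution U \<alpha> f g 0 \<xi> d x \<longleftrightarrow> kernel_solution K (\<lambda>t. U t \<xi>) fh d x" for \<xi> d x
    by (simp add: mild)
  have sol: "sol U \<alpha> f g 0 \<xi> t = x t" if x: "kernel_solution K (\<lambda>t. U t \<xi>) fh T x" and t: "t \<in> {0..T}" for \<xi> x t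
    unfolding sol_def mild0
  proof (rule the_equality)
    have xt: "kernel_solution K (\<lambda>t. U t \<xi>) fh t x" by (rule kernel_solution_mono[OF x]) (use t in auto)
    then show "\<exists>y. kernel_solution K (\<lambda>t. U t \<xi>) fh t y \<and> y t = x t" by blast
    fix v assume "\<exists>y. kernel_solution K (\<lambda>t. U t \<xi>) fh t y \<and> y t = v"
    then obtain y where y: "kernel_solution K (\<lambda>t. U t \<xi>) fh t y" "y t = v" by blast
    have "continuous_on {0..t} x" "continuous_on {0..t} y" using xt y(1) by (simp_all add: kernel_solution_def)
    from this obtain B where B: "0 \<le> B" "\<And>s. s \<in> {0..t} \<Longrightarrow> norm (fh s (x s) - fh s (y s)) \<le> B * norm (x s - y s)"
    proof (rule lipschitz_along_curves[OF contf' der lip L], goal_cases)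
      case 1
      show ?case by (rule 1(1)) (fact 1(2-))+
    qed
    have "x t = y t"
      by (rule kernel_solution_unique[OF K \<beta> c t xt y(1) B]) (use t in auto)
    then show "v = x t" using y(2) by simp
  qed
  obtain x0 where x0: "kernel_solution K (\<lambda>t. U t \<xi>0) fh T x0"
    using ex by (auto simp: sol_exists_def mild0)
  obtain \<rho> e0 \<Lambda> X R and P' :: "'a \<Rightarrow> 'a \<Rightarrow>\<^sub>L 'a" where fam: "\<rho> > 0" "0 < e0" "e0 \<le> 1"
    "\<And>\<xi>. \<xi> \<in> ball \<xi>0 \<rho> \<Longrightarrow> kernel_solution K (\<lambda>t. U t \<xi>) fh T (X \<xi>)"
    "\<And>\<xi>. \<xi> \<in> ball \<xi>0 \<rho> \<Longrightarrow> ((\<lambda>\<xi>. X \<xi> T) has_derivative P' \<xi>) (at \<xi>)"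
    "continuous_on (ball \<xi>0 \<rho>) P'"
    "\<And>\<epsilon> \<xi>. \<epsilon> \<in> {0..e0} \<Longrightarrow> \<xi> \<in> ball \<xi>0 \<rho> \<Longrightarrow>
       \<exists>x. kernel_solution K (\<lambda>t. U t \<xi>) (\<lambda>s z. fh s z + \<epsilon> *\<^sub>R gh s z \<epsilon>) T x \<and> x T = X \<xi> T + \<epsilon> *\<^sub>R R \<epsilon> \<xi>"
    "\<And>\<xi>. \<xi> \<in> ball \<xi>0 \<rho> \<Longrightarrow>
       \<exists>y. kernel_solution K (\<lambda>t. 0) (\<lambda>s z. f' s (X \<xi> s) z + gh s (X \<xi> s) 0) T y \<and> y T = R 0 \<xi>"
    "continuous_on ({0..e0} \<times> ball \<xi>0 \<rho>) (\<lambda>(\<epsilon>, \<xi>). R \<epsilon> \<xi>)"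
    "\<And>\<epsilon> \<xi> \<xi>'. \<epsilon> \<in> {0..e0} \<Longrightarrow> \<xi> \<in> ball \<xi>0 \<rho> \<Longrightarrow> \<xi>' \<in> ball \<xi>0 \<rho> \<Longrightarrow>
       norm (R \<epsilon> \<xi> - R \<epsilon> \<xi>') \<le> \<Lambda> * norm (\<xi> - \<xi>')"
  proof (rule solution_family[OF T L LG U contK K \<beta> c contf contf' der lip contg lipg x0], goal_cases)
    case 4
    show ?case by (rule 4(1)) (fact 4(2-))+
  qed
  have solX: "sol U \<alpha> f g 0 \<xi> t = X \<xi> t" if "\<xi> \<in> ball \<xi>0 \<rho>" "t \<in> {0..T}" for \<xi> t
    by (rule sol[OF fam(4)[OF that(1)] that(2)])
  have P0: "poincare U \<alpha> f g T 0 \<xi> = X \<xi> T" if "\<xi> \<in> ball \<xi>0 \<rho>" for \<xi>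
    unfolding poincare_def by (rule solX[OF that]) (use T in auto)
  have eta: "eta U \<alpha> f g T \<xi> = R 0 \<xi>" if \<xi>: "\<xi> \<in> ball \<xi>0 \<rho>" for \<xi>
  proof -
    let ?r = "\<lambda>s z. f' s (X \<xi> s) z + gh s (X \<xi> s) 0"
    have iff: "continuous_on {0..T} y \<and>
        (\<forall>t\<in>{0..T}.
           ((\<lambda>s. frac_power U \<alpha> (U (t - s)
                   (D2 (\<lambda>r z. f r (neg_frac_power U \<alpha> z)) s (sol U \<alpha> f g 0 \<xi> s) (y s)
                    + g s (neg_frac_power U \<alpha> (sol U \<alpha> f g 0 \<xi> s)) 0)))
             has_integral y t) {0..t}) \<longleftrightarrow> kernel_solution K (\<lambda>t. 0) ?r T y" for y
    proof -
      have "((\<lambda>s. frac_power U \<alpha> (U (t - s)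
                   (D2 (\<lambda>r z. f r (neg_frac_power U \<alpha> z)) s (sol U \<alpha> f g 0 \<xi> s) (y s)
                    + g s (neg_frac_power U \<alpha> (sol U \<alpha> f g 0 \<xi> s)) 0)))
             has_integral y t) {0..t} \<longleftrightarrow> ((\<lambda>s. K (t - s) (?r s (y s))) has_integral (y t - 0)) {0..t}"
        if t: "t \<in> {0..T}" for t
      proof -
        have "((\<lambda>s. frac_power U \<alpha> (U (t - s)
                   (D2 (\<lambda>r z. f r (neg_frac_power U \<alpha> z)) s (sol U \<alpha> f g 0 \<xi> s) (y s)
                    + g s (neg_frac_power U \<alpha> (sol U \<alpha> f g 0 \<xi> s)) 0)))
             has_integral y t) {0..t} \<longleftrightarrow> ((\<lambda>s. frac_power U \<alpha> (U (t - s) (?r s (y s)))) has_integral y t) {0..t}"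
          by (rule has_integral_cong) (use t solX[OF \<xi>] in \<open>auto simp: fh_eta f'_def gh_def\<close>)
        also have "\<dots> \<longleftrightarrow> ((\<lambda>s. K (t - s) (?r s (y s))) has_integral y t) {0..t}"
          by (rule has_integral_convolution_cong[where q = "frac_power U \<alpha>" and U = "\<lambda>t x. U t x", OF fK])
        finally show ?thesis by simp
      qed
      then show ?thesis by (auto simp: kernel_solution_def)
    qed
    obtain y where y: "kernel_solution K (\<lambda>t. 0) ?r T y" "y T = R 0 \<xi>" using fam(8)[OF \<xi>] by blast
    have Xc: "continuous_on {0..T} (X \<xi>)" using fam(4)[OF \<xi>] by (simp add: kernel_solution_def)
    have "continuous_on {0..T} (\<lambda>t. (\<lambda>(t, z). f' t z) (t, X \<xi> t))"
      by (rule continuous_on_compose2[OF contf'[of "{0..T}"]]) (auto intro!: continuous_intros Xc)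
    then have "continuous_on {0..T} (\<lambda>t. f' t (X \<xi> t))" by simp
    then have "bounded ((\<lambda>t. f' t (X \<xi> t)) ` {0..T})" by (intro compact_imp_bounded compact_continuous_image) auto
    then obtain B where B: "\<And>t. t \<in> {0..T} \<Longrightarrow> norm (f' t (X \<xi> t)) \<le> B" by (meson bounded_iff image_eqI)
    have B0: "0 \<le> B" using order_trans[OF norm_ge_zero B[of 0]] T by simp
    have uniq: "z T = y T" if z: "kernel_solution K (\<lambda>t. 0) ?r T z" for z
    proof (rule kernel_solution_unique[OF K \<beta> c _ z y(1) B0])
      fix s assume "s \<in> {0..T}"
      then have "norm (f' s (X \<xi> s)) * norm (z s - y s) \<le> B * norm (z s - y s)" by (intro mult_right_mono B) auto
      then show "norm (?r s (z s) - ?r s (y s)) \<le> B * norm (z s - y s)"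
        using norm_blinfun[of "f' s (X \<xi> s)" "z s - y s"] by (simp add: blinfun.diff_right)
    qed (use T in auto)
    show ?thesis
      unfolding eta_def conj_assoc[symmetric] iff
    proof (rule the_equality)
      show "\<exists>z. kernel_solution K (\<lambda>t. 0) ?r T z \<and> z T = R 0 \<xi>" using y by blast
      fix v assume "\<exists>z. kernel_solution K (\<lambda>t. 0) ?r T z \<and> z T = v"
      then obtain z where z: "kernel_solution K (\<lambda>t. 0) ?r T z" "z T = v" by blast
      show "v = R 0 \<xi>" using uniq[OF z(1)] unfolding z(2) y(2) .
    qed
  qed
  show ?thesis
  proof (rule that[OF fam(1,2) _ fam(6) _ eta fam(9,10)])
    show "(poincare U \<alpha> f g T 0 has_derivative P' \<xi>) (at \<xi>)" if "\<xi> \<in> ball \<xi>0 \<rho>" for \<xi>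
      by (rule has_derivative_transform_within_open[OF fam(5)[OF that] open_ball that]) (simp add: P0)
    show "\<exists>x. mild_solution U \<alpha> f g \<epsilon> \<xi> T x \<and> x 0 = \<xi> \<and> x T = poincare U \<alpha> f g T 0 \<xi> + \<epsilon> *\<^sub>R R \<epsilon> \<xi>"
      if e: "\<epsilon> \<in> {0..e0}" "\<xi> \<in> ball \<xi>0 \<rho>" for \<epsilon> \<xi>
    proof -
      obtain x where x: "kernel_solution K (\<lambda>t. U t \<xi>) (\<lambda>s z. fh s z + \<epsilon> *\<^sub>R gh s z \<epsilon>) T x" "x T = X \<xi> T + \<epsilon> *\<^sub>R R \<epsilon> \<xi>"
        using fam(7)[OF e] by blast
      have "x 0 = \<xi>" using kernel_solution_at_0[OF x(1)] T U0 by simp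
      then show ?thesis using x P0[OF e(2)] by (auto simp: mild)
    qed
  qed
qed

text \<open>Full dimension of the range forces the images of the basis vectors to be distinct and
  independent, hence \<open>F\<close> to be injective. The constant is the minimum of
  \<open>norm (F v)\<close> on the compact unit sphere.\<close>

lemma linear_full_rank_bounded_below:
  fixes F :: "(real ^ 'k::finite) \<Rightarrow>\<^sub>L 'a::real_normed_vector"
  assumes "dim (range F) = CARD('k)"
  obtains c where "c > 0" "\<And>v. c * norm v \<le> norm (F v)"
proof -
  have lin: "linear F" by (rule bounded_linear.linear[OF blinfun.bounded_linear_right])
  let ?B = "Basis :: (real ^ 'k) set"
  have card: "card ?B = CARD('k)" using DIM_cart[where 'a = real and 'b = 'k] by simp
  have range: "range F = span (F ` ?B)"
    using linear_span_image[OF lin, of ?B] by simp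
  have fin: "finite (F ` ?B)" by simp
  have small: "CARD('k) \<le> card W" if "finite W" "range F \<subseteq> span W" for W
    using real_vector.dim_le_card[OF that(2,1)] assms by simp
  have c1: "card (F ` ?B) = card ?B"
    using small[OF fin] range card card_image_le[of ?B F] by simp
  then have injB: "inj_on F ?B" by (intro eq_card_imp_inj_on) auto
  have indep: "independent (F ` ?B)"
  proof
    assume "dependent (F ` ?B)"
    then obtain b where b: "b \<in> F ` ?B" "b \<in> span (F ` ?B - {b})" by (auto simp: real_vector.dependent_def)
    have "span (F ` ?B) = span (F ` ?B - {b})"
      using span_redundant[OF b(2)] b(1) by (simp add: insert_absorb)
    then have "CARD('k) \<le> card (F ` ?B - {b})" using range by (intro small) auto
    then show False using card_Diff1_less[OF fin b(1)] c1 card by linarith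
  qed
  have "inj_on F (span ?B)"
    using linear_inj_on_span_iff_independent_image[OF lin indep] injB by simp
  then have inj: "F v = 0 \<Longrightarrow> v = 0" for v
    using linear_0[OF lin] by (auto simp: inj_on_def)
  have "compact (sphere (0 :: real ^ 'k) 1)" by simp
  moreover have "sphere (0 :: real ^ 'k) 1 \<noteq> {}" by simp
  moreover have "continuous_on (sphere 0 1) (\<lambda>v. norm (F v))" by (intro continuous_intros)
  ultimately have "\<exists>u\<in>sphere 0 1. \<forall>v\<in>sphere 0 1. norm (F u) \<le> norm (F v)"
    by (rule continuous_attains_inf)
  then obtain u where u: "u \<in> sphere 0 1" "\<And>v. v \<in> sphere 0 1 \<Longrightarrow> norm (F u) \<le> norm (F v)"
    by blast
  show ?thesis
  proof (rule that[of "norm (F u)"])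
    have "u \<noteq> 0" using u(1) by auto
    then show "norm (F u) > 0" using inj by auto
    fix v
    show "norm (F u) * norm v \<le> norm (F v)"
    proof (cases "v = 0")
      case False
      have "norm (F u) \<le> norm (F (v /\<^sub>R norm v))" using False by (intro u(2)) simp
      then show ?thesis using False by (simp add: blinfun.scaleR_right field_simps)
    qed simp
  qed
qed

lemma linear_continuous_at_0_bounded:
  fixes j :: "'a::real_normed_vector \<Rightarrow> 'b::real_normed_vector"
  assumes lin: "linear j" and cont: "isCont j 0"
  shows "bounded_linear j"
proof -
  obtain d where d: "d > 0" "\<And>v. dist v 0 < d \<Longrightarrow> dist (j v) (j 0) < 1"
    using cont by (metis continuous_at_eps_delta zero_less_one dist_commute)
  have "norm (j v) \<le> norm v * (2 / d)" for v
  proof (cases "v = 0")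
    case False
    have "norm (j ((d / (2 * norm v)) *\<^sub>R v)) < 1"
      using d(2)[of "(d / (2 * norm v)) *\<^sub>R v"] d(1) False linear_0[OF lin] by simp
    then have "d / (2 * norm v) * norm (j v) < 1"
      using d(1) by (simp add: linear_scale[OF lin])
    then show ?thesis using False d(1) by (simp add: field_simps)
  qed (simp add: linear_0[OF lin])
  then show ?thesis by (intro bounded_linear_intro[where K = "2 / d"]) (auto simp: linear_add[OF lin] linear_scale[OF lin])
qed

lemma direct_sum_projectors:
  assumes ds: "direct_sum_decomposition X Y"
    and p1: "projector_onto_along p1 X Y" and p2: "projector_onto_along p2 Y X"
  shows "p1 v + p2 v = v" "p1 v \<in> X" "p2 v \<in> Y" "p1 (p1 v) = p1 v" "p2 (p2 v) = p2 v"
    "p1 (p2 v) = 0" "p2 (p1 v) = 0" "y \<in> Y \<Longrightarrow> p2 y = y"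
proof -
  have sub: "0 \<in> X" "0 \<in> Y" using ds subspace_0 by (auto simp: direct_sum_decomposition_def)
  obtain x z where v: "x \<in> X" "z \<in> Y" "v = x + z" using ds unfolding direct_sum_decomposition_def by blast
  have P: "p1 (a + b) = a" "p2 (b + a) = b" if "a \<in> X" "b \<in> Y" for a b
    using p1 p2 that by (auto simp: projector_onto_along_def)
  have e1: "p1 v = x" using P(1)[OF v(1,2)] v(3) by simp
  have e2: "p2 v = z" using P(2)[OF v(1,2)] v(3) by (simp add: add.commute)
  show "p1 v + p2 v = v" "p1 v \<in> X" "p2 v \<in> Y" using v e1 e2 by auto
  show "p1 (p1 v) = p1 v" "p2 (p1 v) = 0" using P[OF v(1) sub(2)] e1 by simp_all
  show "p2 (p2 v) = p2 v" "p1 (p2 v) = 0" using P[OF sub(1) v(2)] e2 by simp_all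
  show "p2 y = y" if "y \<in> Y" using P(2)[OF sub(1) that] by simp
qed

text \<open>\<open>J\<close> is the inverse on \<open>Y\<close> applied to the component in
  \<open>Y\<close>, plus the component in \<open>X\<close>. The hypothesis provides a continuous
  inverse map; its linearity comes from that of \<open>q\<close>, and boundedness from continuity at
  0.\<close>

lemma invertible_operator_inverse:
  fixes q :: "'a::real_normed_vector \<Rightarrow> 'a" and p1 p2 :: "'a \<Rightarrow>\<^sub>L 'a"
  assumes inv: "invertible_operator_on q Y" and lin: "linear q"
    and ds: "direct_sum_decomposition X Y"
    and p1: "projector_onto_along p1 X Y" and p2: "projector_onto_along p2 Y X"
    and q2: "\<And>v. q (p2 v) = q v"
  obtains J :: "'a \<Rightarrow>\<^sub>L 'a" where "\<And>v. J (q v + p1 v) = v" "\<And>v. J v = 0 \<Longrightarrow> v = 0"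
proof -
  note P = direct_sum_projectors[OF ds p1 p2]
  have bij: "bij_betw q Y Y" and cont: "continuous_on Y (inv_into Y q)"
    using inv by (auto simp: invertible_operator_on_def)
  have Y: "subspace Y" using ds by (simp add: direct_sum_decomposition_def)
  have inj: "inj_on q Y" and im: "q ` Y = Y" using bij by (auto simp: bij_betw_def)
  let ?i = "inv_into Y q"
  have i: "?i y \<in> Y" "q (?i y) = y" if "y \<in> Y" for y
    using that im by (auto intro: inv_into_into f_inv_into_f)
  have iq: "?i (q y) = y" if "y \<in> Y" for y using inv_into_f_f[OF inj that] .
  have qY: "q v \<in> Y" for v using im P(3)[of v] q2[of v] by (metis image_eqI)
  define j where "j v = ?i (p2 v) + p1 v" for v
  have i_add: "?i (x + y) = ?i x + ?i y" if "x \<in> Y" "y \<in> Y" for x y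
  proof -
    have "?i (q (?i x + ?i y)) = ?i x + ?i y" using i that Y by (intro iq subspace_add) auto
    then show ?thesis using i(2) that by (simp add: linear_add[OF lin])
  qed
  have i_scale: "?i (r *\<^sub>R x) = r *\<^sub>R ?i x" if "x \<in> Y" for x r
  proof -
    have "?i (q (r *\<^sub>R ?i x)) = r *\<^sub>R ?i x" using i that Y by (intro iq subspace_scale) auto
    then show ?thesis using i(2) that by (simp add: linear_scale[OF lin])
  qed
  have j_lin: "linear j"
    by (rule linearI) (simp_all add: j_def blinfun.add_right blinfun.scaleR_right i_add i_scale P(3) scaleR_add_right)
  have "continuous_on UNIV (\<lambda>v. ?i (p2 v))"
    by (rule continuous_on_compose2[OF cont]) (auto intro!: continuous_intros P(3))
  then have "continuous_on UNIV j" unfolding j_def by (intro continuous_intros)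
  then have j_bl: "bounded_linear j"
    using linear_continuous_at_0_bounded[OF j_lin] by (simp add: continuous_on_eq_continuous_at)
  show ?thesis
  proof (rule that[of "Blinfun j"])
    fix v
    have "p2 (q v + p1 v) = q v" using P(7,8) qY by (simp add: blinfun.add_right)
    moreover have "p1 (q v) = 0" using P(6)[of "q v"] P(8)[OF qY[of v]] by simp
    then have "p1 (q v + p1 v) = p1 v" using P(4) by (simp add: blinfun.add_right)
    ultimately have "j (q v + p1 v) = ?i (q (p2 v)) + p1 v" by (simp add: j_def q2)
    also have "\<dots> = v" using iq[OF P(3)] P(1)[of v] by (simp add: add.commute)
    finally show "Blinfun j (q v + p1 v) = v" by (simp add: bounded_linear_Blinfun_apply[OF j_bl])
  next
    fix v assume "Blinfun j v = 0"
    then have jv: "j v = 0" by (simp add: bounded_linear_Blinfun_apply[OF j_bl])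
    have "?i (p2 v) \<in> Y" using i P(3) by blast
    then have "p1 (?i (p2 v)) = 0" using P(6)[of "?i (p2 v)"] P(8) by metis
    then have "p1 v = p1 (j v)" using P(4) by (simp add: j_def blinfun.add_right)
    then have p1v: "p1 v = 0" using jv by (simp add: blinfun.zero_right)
    then have "?i (p2 v) = 0" using jv by (simp add: j_def)
    then have "p2 v = q 0" using i(2)[OF P(3)[of v]] by simp
    then show "v = 0" using p1v P(1)[of v] linear_0[OF lin] by simp
  qed
qed

theorem theorem4p2:
  fixes A :: "'a::banach \<Rightarrow> 'a" and DA :: "'a set"
    and U :: "real \<Rightarrow> 'a \<Rightarrow>\<^sub>L 'a"
    and f :: "real \<Rightarrow> 'a \<Rightarrow> 'a" and g :: "real \<Rightarrow> 'a \<Rightarrow> real \<Rightarrow> 'a"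
    and T \<alpha> :: real and \<xi>0 :: 'a
    and V :: "(real ^ 'k::finite) set" and S :: "real ^ 'k \<Rightarrow> 'a" and h0 :: "real ^ 'k"
    and E2 :: "real ^ 'k \<Rightarrow> 'a set" and \<pi>1 \<pi>2 :: "real ^ 'k \<Rightarrow> 'a \<Rightarrow>\<^sub>L 'a"
  assumes "T > 0"
    and "infinitesimal_generator U DA A"
    and "C1_on (\<lambda>(t, x). f t x) UNIV"
    and "continuous_on (UNIV \<times> UNIV \<times> {0..1}) (\<lambda>(t, x, \<epsilon>). g t x \<epsilon>)"
    and "\<And>t x. f (t + T) x = f t x"
    and "\<And>t x \<epsilon>. \<epsilon> \<in> {0..1} \<Longrightarrow> g (t + T) x \<epsilon> = g t x \<epsilon>"
    and "analytic_compact_case U \<alpha> f g \<or> contractive_case U \<alpha> f g"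
    and "sol_exists U \<alpha> f g 0 \<xi>0 T"
    and "open V" and "h0 \<in> V" and "C1_on S V" and "S h0 = \<xi>0"
    and "\<And>h. h \<in> V \<Longrightarrow> sol_exists U \<alpha> f g 0 (S h) T \<and> poincare U \<alpha> f g T 0 (S h) = S h"
    and "dim (tangent_space S h0) = CARD('k)"
    and "\<And>h. h \<in> V \<Longrightarrow> direct_sum_decomposition (tangent_space S h) (E2 h)"
    and "\<And>h. h \<in> V \<Longrightarrow> projector_onto_along (\<pi>1 h) (tangent_space S h) (E2 h)"
    and "\<And>h. h \<in> V \<Longrightarrow> projector_onto_along (\<pi>2 h) (E2 h) (tangent_space S h)"
    and "continuous_on V \<pi>1" and "continuous_on V \<pi>2"
    and "invertible_operator_on
           (\<lambda>v. \<pi>2 h0 (poincare_deriv_minus_id U \<alpha> f g T \<xi>0 (\<pi>2 h0 v))) (E2 h0)"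
    and "isolated_zero h0 (bifurcation_map U \<alpha> f g T S E2 \<pi>1 \<pi>2)"
    and "zero_index h0 (bifurcation_map U \<alpha> f g T S E2 \<pi>1 \<pi>2) \<noteq> 0"
  shows "\<exists>x :: real \<Rightarrow> real \<Rightarrow> 'a.
           (\<forall>\<^sub>F \<epsilon> in at_right 0.
              mild_solution U \<alpha> f g \<epsilon> (x \<epsilon> 0) T (x \<epsilon>) \<and> x \<epsilon> T = x \<epsilon> 0) \<and>
           ((\<lambda>\<epsilon>. x \<epsilon> 0) \<longlongrightarrow> \<xi>0) (at_right 0)"
proof -
  let ?P0 = "poincare U \<alpha> f g T 0"
  let ?M = "bifurcation_map U \<alpha> f g T S E2 \<pi>1 \<pi>2"
  obtain \<rho> e0 \<Lambda> R and P' :: "'a \<Rightarrow> 'a \<Rightarrow>\<^sub>L 'a" where \<rho>: "\<rho> > 0" and e0: "0 < e0"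
    and der: "\<And>\<xi>. \<xi> \<in> ball \<xi>0 \<rho> \<Longrightarrow> (?P0 has_derivative P' \<xi>) (at \<xi>)"
    and contP': "continuous_on (ball \<xi>0 \<rho>) P'"
    and pert: "\<And>\<epsilon> \<xi>. \<epsilon> \<in> {0..e0} \<Longrightarrow> \<xi> \<in> ball \<xi>0 \<rho> \<Longrightarrow>
       \<exists>x. mild_solution U \<alpha> f g \<epsilon> \<xi> T x \<and> x 0 = \<xi> \<and> x T = ?P0 \<xi> + \<epsilon> *\<^sub>R R \<epsilon> \<xi>"
    and eta: "\<And>\<xi>. \<xi> \<in> ball \<xi>0 \<rho> \<Longrightarrow> eta U \<alpha> f g T \<xi> = R 0 \<xi>"
    and contR: "continuous_on ({0..e0} \<times> ball \<xi>0 \<rho>) (\<lambda>(\<epsilon>, \<xi>). R \<epsilon> \<xi>)"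
    and lipR: "\<And>\<epsilon> \<xi> \<xi>'. \<epsilon> \<in> {0..e0} \<Longrightarrow> \<xi> \<in> ball \<xi>0 \<rho> \<Longrightarrow> \<xi>' \<in> ball \<xi>0 \<rho> \<Longrightarrow>
       norm (R \<epsilon> \<xi> - R \<epsilon> \<xi>') \<le> \<Lambda> * norm (\<xi> - \<xi>')"
  proof (rule poincare_family[OF assms(1,3,7,8)], goal_cases)
    case 1
    show ?case by (rule 1(1)) (fact 1(2-))+
  qed
  have pd: "poincare_deriv_minus_id U \<alpha> f g T \<xi> v = P' \<xi> v - v" if "\<xi> \<in> ball \<xi>0 \<rho>" for \<xi> v
    using frechet_derivative_at[OF der[OF that]] by (simp add: poincare_deriv_minus_id_def)
  obtain S' where contS'_pointwise: "continuous_on V (\<lambda>h. blinfun_apply (S' h))"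
    and derS: "\<And>h. h \<in> V \<Longrightarrow> (S has_derivative blinfun_apply (S' h)) (at h)"
    using assms(11) unfolding C1_on_def by blast
  \<comment> \<open>\<open>C1_on\<close> only provides pointwise continuity of the derivative, since \<open>S'\<close> is coerced to a function
      there. On a finite-dimensional space this is continuity in the operator norm.\<close>
  have contS': "continuous_on V S'"
    by (rule continuous_on_blinfun_componentwise)
      (rule continuous_on_product_then_coordinatewise[OF contS'_pointwise])
  have fS: "frechet_derivative S (at h) = S' h" if "h \<in> V" for h
    using frechet_derivative_at[OF derS[OF that]] by simp
  have tan: "tangent_space S h = range (S' h)" if "h \<in> V" for h
    using fS[OF that] by (simp add: tangent_space_def)
  have contS: "continuous_on V S"
    by (meson continuous_at_imp_continuous_on derS has_derivative_continuous)
  \<comment> \<open>\<open>V\<close> is shrunk so that \<open>S\<close> stays in the ball where the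
    expansion of the perturbed Poincare map is available.\<close>
  define W where "W = V \<inter> S -` ball \<xi>0 \<rho>"
  have W: "open W" "h0 \<in> W" "W \<subseteq> V"
    using continuous_open_preimage[OF contS assms(9) open_ball] assms(10,12) \<rho> by (auto simp: W_def)
  have SW: "S h \<in> ball \<xi>0 \<rho>" if "h \<in> W" for h using that by (auto simp: W_def)
  have h0V: "h0 \<in> V" by (rule assms(10))
  note proj = direct_sum_projectors[OF assms(15,16,17)]
  obtain c where c: "c > 0" "\<And>v. c * norm v \<le> norm (S' h0 v)"
    using linear_full_rank_bounded_below[of "S' h0"] assms(14) tan[OF h0V] by auto
  let ?q = "\<lambda>v. \<pi>2 h0 (P' \<xi>0 (\<pi>2 h0 v) - \<pi>2 h0 v)"
  have qeq: "(\<lambda>v. \<pi>2 h0 (poincare_deriv_minus_id U \<alpha> f g T \<xi>0 (\<pi>2 h0 v))) = ?q"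
    using pd[of \<xi>0] \<rho> by (simp add: fun_eq_iff)
  have q_lin: "linear ?q"
    by (rule linearI) (simp_all add: blinfun.add_right blinfun.scaleR_right blinfun.diff_right scaleR_diff_right)
  obtain J :: "'a \<Rightarrow>\<^sub>L 'a" where J: "\<And>v. J (?q v + \<pi>1 h0 v) = v" "\<And>v. J v = 0 \<Longrightarrow> v = 0"
  proof (rule invertible_operator_inverse[OF assms(20)[unfolded qeq] q_lin assms(15-17)[OF h0V]], goal_cases)
    case 1
    show ?case by (simp add: proj(5)[OF h0V h0V h0V])
  next
    case 2
    show ?case by (rule 2(1)) (fact 2(2-))+
  qed
  have fixS: "?P0 (S h) = S h" if "h \<in> W" for h using assms(13) that W(3) by blast
  have p_sum: "\<pi>1 h v + \<pi>2 h v = v" and p_idem: "\<pi>1 h (\<pi>1 h v) = \<pi>1 h v" and p_range: "\<pi>1 h v \<in> range (S' h)"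
    if "h \<in> W" for h v
  proof -
    have h: "h \<in> V" using that W(3) by blast
    show "\<pi>1 h v + \<pi>2 h v = v" "\<pi>1 h (\<pi>1 h v) = \<pi>1 h v" "\<pi>1 h v \<in> range (S' h)"
      using proj(1,2,4)[OF h h h] tan[OF h] by simp_all
  qed
  note contW = continuous_on_subset[OF contS W(3)] continuous_on_subset[OF contS' W(3)]
    continuous_on_subset[OF assms(18) W(3)] continuous_on_subset[OF assms(19) W(3)]
  obtain r0 e1 C N w where r0: "r0 > 0" and e1: "e1 > 0" "e1 \<le> e0" and sub: "cball h0 r0 \<subseteq> W"
    and contN: "continuous_on ({0..e1} \<times> cball h0 r0) (\<lambda>(\<epsilon>, h). N \<epsilon> h)"
    and w1: "\<And>h. h \<in> cball h0 r0 \<Longrightarrow> \<pi>1 h (w h) = 0"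
    and w2: "\<And>h. h \<in> cball h0 r0 \<Longrightarrow> \<pi>2 h (P' (S h) (w h) - w h + R 0 (S h)) = 0"
    and N0: "\<And>h. h \<in> cball h0 r0 \<Longrightarrow> S' h (N 0 h) = \<pi>1 h (P' (S h) (w h) - w h + R 0 (S h))"
    and inj2: "\<And>h v. h \<in> cball h0 r0 \<Longrightarrow> \<pi>1 h v = 0 \<Longrightarrow> \<pi>2 h (P' (S h) v - v) = 0 \<Longrightarrow> v = 0"
    and injS: "\<And>h v. h \<in> cball h0 r0 \<Longrightarrow> S' h v = 0 \<Longrightarrow> v = 0"
    and zero: "\<And>\<epsilon> h. \<epsilon> \<in> {0<..e1} \<Longrightarrow> h \<in> cball h0 r0 \<Longrightarrow> N \<epsilon> h = 0 \<Longrightarrow>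
         \<exists>x\<in>ball \<xi>0 \<rho>. ?P0 x + \<epsilon> *\<^sub>R R \<epsilon> x = x \<and> norm (x - S h) \<le> \<epsilon> * C"
  proof (rule lyapunov_schmidt[where S' = S', OF \<rho> e0 c(1) der contP' contR lipR W(1,2) contW(1,2) assms(12) fixS c(2)
        p_sum p_idem p_range contW(3,4) J], goal_cases)
    case 10
    show ?case by (rule 10(1)) (fact 10(2-))+
  qed
  \<comment> \<open>The element \<open>w h\<close> solves
    \<open>\<pi>2 h (Q (w h)) = - \<pi>2 h (R 0 (S h))\<close>, whereas the bifurcation function
    inverts the compressed operator on \<open>\<pi>2 h (R 0 (S h))\<close> itself. The preimage is
    therefore \<open>- w h\<close>, and the signs match.\<close>
  have M_eq: "N 0 h = ?M h" if h: "h \<in> cball h0 r0" for h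
  proof -
    have hW: "h \<in> W" and hV: "h \<in> V" using h sub W(3) by blast+
    note pr = proj[OF hV hV hV]
    define Q where "Q v = P' (S h) v - v" for v
    have pdQ: "poincare_deriv_minus_id U \<alpha> f g T (S h) = Q"
      using pd[OF SW[OF hW]] by (simp add: Q_def fun_eq_iff)
    let ?qh = "\<lambda>v. \<pi>2 h (Q (\<pi>2 h v))"
    have Q_diff: "Q (a - b) = Q a - Q b" for a b by (simp add: Q_def blinfun.diff_right)
    have p1E: "\<pi>1 h v = 0" if "v \<in> E2 h" for v
      using pr(6)[of v] pr(8)[OF that] by simp
    \<comment> \<open>\<open>inv_into\<close> is evaluated through the explicit preimage
      \<open>- w h\<close>; injectivity on \<open>E2 h\<close> makes it the only one.\<close>
    have inj: "inj_on ?qh (E2 h)"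
    proof (rule inj_onI)
      fix a b assume ab: "a \<in> E2 h" "b \<in> E2 h" "?qh a = ?qh b"
      have "\<pi>2 h (Q (a - b)) = 0"
        using ab(3) unfolding pr(8)[OF ab(1)] pr(8)[OF ab(2)] by (simp add: Q_diff blinfun.diff_right)
      then have q0: "\<pi>2 h (P' (S h) (a - b) - (a - b)) = 0" unfolding Q_def .
      have p0: "\<pi>1 h (a - b) = 0" using p1E ab by (simp add: blinfun.diff_right)
      have "a - b = 0" by (rule inj2[OF h p0 q0])
      then show "a = b" by simp
    qed
    have w_fix: "\<pi>2 h (w h) = w h" using pr(1)[of "w h"] w1[OF h] by simp
    have wE: "- w h \<in> E2 h" using pr(3)[of "- w h"] w_fix by (simp add: blinfun.minus_right)
    have Qm: "Q (- w h) = - Q (w h)" by (simp add: Q_def blinfun.minus_right)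
    have "\<pi>2 h (Q (w h) + R 0 (S h)) = 0" using w2[OF h] by (simp add: Q_def)
    then have "- \<pi>2 h (Q (w h)) = \<pi>2 h (R 0 (S h))"
      unfolding blinfun.add_right by (rule minus_unique)
    then have "?qh (- w h) = \<pi>2 h (R 0 (S h))"
      unfolding pr(8)[OF wE] unfolding Qm blinfun.minus_right .
    then have "inv_into (E2 h) ?qh (\<pi>2 h (R 0 (S h))) = - w h"
      using inv_into_f_eq[OF inj wE] by simp
    then have "?M h = inv_into UNIV (S' h) (\<pi>1 h (R 0 (S h) - Q (- w h)))"
      by (simp add: bifurcation_map_def Let_def pdQ eta[OF SW[OF hW]] fS[OF hV])
    also have "\<pi>1 h (R 0 (S h) - Q (- w h)) = S' h (N 0 h)"
      unfolding N0[OF h] Qm by (simp add: Q_def algebra_simps)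
    also have "inv_into UNIV (S' h) (S' h (N 0 h)) = N 0 h"
    proof (rule inv_into_f_f)
      show "inj (S' h)"
      proof (rule injI)
        fix a b assume "S' h a = S' h b"
        then have "S' h (a - b) = 0" by (simp add: blinfun.diff_right)
        then show "a = b" using injS[OF h] by fastforce
      qed
    qed simp
    finally show ?thesis by simp
  qed
  have main: "\<forall>\<^sub>F \<epsilon> in at_right 0. \<exists>x. (mild_solution U \<alpha> f g \<epsilon> (x 0) T x \<and> x T = x 0) \<and> norm (x 0 - \<xi>0) < \<delta>"
    if \<delta>: "\<delta> > 0" for \<delta>
  proof -
    have "\<forall>\<^sub>F h in at h0. ?M h \<noteq> 0" using assms(21) by (simp add: isolated_zero_def)
    then obtain d1 where d1: "d1 > 0" "\<And>h. h \<noteq> h0 \<Longrightarrow> dist h h0 < d1 \<Longrightarrow> ?M h \<noteq> 0"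
      unfolding eventually_at by auto
    have "isCont S h0" using contS assms(9) h0V continuous_on_eq_continuous_at by blast
    then obtain d2 where d2: "d2 > 0" "\<And>h. dist h h0 < d2 \<Longrightarrow> dist (S h) (S h0) < \<delta> / 2"
      using \<delta> by (metis continuous_at_eps_delta dist_commute half_gt_zero)
    \<comment> \<open>Radii below \<open>d\<close> keep the ball in the domain of \<open>N\<close>,
      free of zeros of the bifurcation function other than \<open>h0\<close>, and small enough for
      \<open>S\<close> to stay within \<open>\<delta> / 2\<close> of \<open>\<xi>0\<close>.\<close>
    define d where "d = min r0 (min d1 d2)"
    have d: "d > 0" using r0 d1 d2 by (simp add: d_def)
    obtain r where r: "0 < r" "r < d" and deg: "brouwer_degree_ball ?M h0 r \<noteq> 0"
      using frequently_nonzero_degree[OF assms(22) d] by blast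
    have rsub: "cball h0 r \<subseteq> cball h0 r0" using r by (auto simp: d_def)
    have cN: "continuous_on ({0..e1} \<times> cball h0 r) (\<lambda>(\<epsilon>, h). N \<epsilon> h)"
      by (rule continuous_on_subset[OF contN]) (use rsub in auto)
    obtain e' where e': "e' > 0" "e' \<le> e1" "\<And>\<epsilon>. \<epsilon> \<in> {0..e'} \<Longrightarrow> \<exists>h\<in>cball h0 r. N \<epsilon> h = 0"
    proof (rule nonzero_degree_persistent_zero[OF r(1) e1(1) cN _ _ deg])
      show "N 0 h = ?M h" if "h \<in> cball h0 r" for h using M_eq that rsub by blast
      show "?M h \<noteq> 0" if "h \<in> sphere h0 r" for h
        using that r by (intro d1(2)) (auto simp: d_def dist_commute)
    qed blast
    \<comment> \<open>Makes \<open>\<epsilon> * C < \<delta> / 2\<close>, the share of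
      \<open>\<delta>\<close> left for the distance between the fixed point and \<open>S h\<close>;
      the summand 1 avoids division by 0.\<close>
    define e2 where "e2 = min e' (\<delta> / (2 * (\<bar>C\<bar> + 1)))"
    have e2: "e2 > 0" using e'(1) \<delta> by (simp add: e2_def add_nonneg_pos)
    have "\<exists>x. (mild_solution U \<alpha> f g \<epsilon> (x 0) T x \<and> x T = x 0) \<and> norm (x 0 - \<xi>0) < \<delta>"
      if \<epsilon>: "0 < \<epsilon>" "\<epsilon> < e2" for \<epsilon>
    proof -
      have \<epsilon>': "\<epsilon> \<in> {0..e'}" "\<epsilon> \<in> {0<..e1}" "\<epsilon> \<in> {0..e0}" using \<epsilon> e'(2) e1(2) by (auto simp: e2_def)
      obtain h where h: "h \<in> cball h0 r" "N \<epsilon> h = 0" using e'(3)[OF \<epsilon>'(1)] by blast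
      obtain \<xi> where \<xi>: "\<xi> \<in> ball \<xi>0 \<rho>" "?P0 \<xi> + \<epsilon> *\<^sub>R R \<epsilon> \<xi> = \<xi>" "norm (\<xi> - S h) \<le> \<epsilon> * C"
        using zero[OF \<epsilon>'(2) _ h(2)] h(1) rsub by blast
      obtain x where x: "mild_solution U \<alpha> f g \<epsilon> \<xi> T x" "x 0 = \<xi>" "x T = ?P0 \<xi> + \<epsilon> *\<^sub>R R \<epsilon> \<xi>"
        using pert[OF \<epsilon>'(3) \<xi>(1)] by blast
      have "\<epsilon> * C \<le> \<epsilon> * (\<bar>C\<bar> + 1)" using \<epsilon>(1) by (intro mult_left_mono) auto
      also have "\<dots> < \<delta> / 2"
      proof -
        have "\<epsilon> < \<delta> / (2 * (\<bar>C\<bar> + 1))" using \<epsilon>(2) by (simp add: e2_def)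
        then have "\<epsilon> * (2 * (\<bar>C\<bar> + 1)) < \<delta>" by (subst (asm) pos_less_divide_eq) (auto simp: add_nonneg_pos)
        then show ?thesis by (simp add: algebra_simps)
      qed
      finally have "norm (\<xi> - S h) < \<delta> / 2" using \<xi>(3) by linarith
      moreover have "norm (S h - \<xi>0) < \<delta> / 2"
      proof -
        have "dist h h0 < d2" using h(1) r by (simp add: d_def dist_commute)
        then show ?thesis using d2(2) assms(12) by (simp add: dist_norm)
      qed
      ultimately have "norm (\<xi> - \<xi>0) < \<delta>"
        using norm_triangle_ineq[of "\<xi> - S h" "S h - \<xi>0"] by simp
      then show ?thesis using x \<xi>(2) by (intro exI[of _ x]) simp
    qed
    then show ?thesis using e2 by (auto simp: eventually_at_right_field)
  qed
  show ?thesis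
  proof (rule eventually_selection[of "\<lambda>\<epsilon> x. mild_solution U \<alpha> f g \<epsilon> (x 0) T x \<and> x T = x 0"
        "\<lambda>x. norm (x 0 - \<xi>0)", OF main], goal_cases)
    case (3 x)
    then show ?case by (intro exI[of _ x]) (simp add: tendsto_norm_zero_iff LIM_zero_iff)
  qed simp_all
qed

end
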